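(* Let $\phi:\Sigma\to\mathbb{S}^3$ (resp. $\phi:\Sigma\to\mathbb{H}^3$) be an immersed oriented surface in the round unit sphere (resp. in hyperbolic space of curvature $-1$), with unit normal $N$, mean curvature $H$ (half the trace of the shape operator) and Gauss curvature $K$ (intrinsic curvature of the induced metric). Let $\Phi=\phi\wedge N$ be its Gauss map into the space of oriented geodesics $\mathbb{L}(\mathbb{S}^3)$ (resp. $\mathbb{L}(\mathbb{H}^3)$), assumed to be an immersion with non-degenerate induced metric $\Phi^*G'$. Then $\Phi$ is Hamiltonian minimal with respect to the Kähler, locally conformally flat structure $(G',\mathbb{J}')$ if and only if $\phi$ is a critical point of the functional $$\mathcal{W}'(\phi)=\int_\Sigma\sqrt{H^2-K+1}\;dA\qquad\Big(\text{resp. } \mathcal{W}'(\phi)=\int_\Sigma\sqrt{H^2-K-1}\;dA\Big),$$ where $dA$ is the area element of the induced metric.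
   Context: Ambient model: for $0\le p\le 4$ let $\langle\cdot,\cdot\rangle_p=-\sum_{i=1}^p dx_i^2+\sum_{i=p+1}^{4}dx_i^2$ on $\mathbb{R}^4$ and $\mathbb{S}^3_{p,1}=\{x:\langle x,x\rangle_p=1\}$. Then $\mathbb{S}^3=\mathbb{S}^3_{0,1}$, and $\mathbb{H}^3$ is a connected component of $\mathbb{S}^3_{3,1}$, whose induced metric is minus the hyperbolic metric. Put $p=0$, $\epsilon=1$ in the spherical case and $p=3$, $\epsilon=-1$ in the hyperbolic case. The shape operator is $A=-dN$. Space of oriented geodesics: it is the set of $x\wedge y\in\Lambda^2(\mathbb{R}^4)$ with $x$ in $\mathbb{S}^3$ (resp. $\mathbb{H}^3$), $y$ tangent at $x$ and $\langle y,y\rangle_p=\epsilon$. Let $G$ be the metric induced by $\langle\langle x_1\wedge y_1,x_2\wedge y_2\rangle\rangle=\langle x_1,x_2\rangle_p\langle y_1,y_2\rangle_p-\langle x_1,y_2\rangle_p\langle x_2,y_1\rangle_p$. Tangent vectors at $x\wedge y$ (with $\langle x,x\rangle_p=1$, $\langle y,y\rangle_p=\epsilon$, $\langle x,y\rangle_p=0$) are $x\wedge X+y\wedge Y$ with $X,Y$ in the orthogonal plane $(x\wedge y)^\perp$. Let $\mathbb{J}(x\wedge X+y\wedge Y)=y\wedge X-\epsilon\,x\wedge Y$ and $\Omega(\cdot,\cdot)=\epsilon G(\mathbb{J}\cdot,\cdot)$, a symplectic form. The plane $(x\wedge y)^\perp$ (with definite metric here) is oriented so that positively oriented bases $(e_1,e_2)$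 make $(x,y,e_1,e_2)$ positively oriented; let $J'$ be rotation by $+\pi/2$ in it: $J'e_1=e_2$, $J'e_2=-e_1$ for positively oriented orthonormal $(e_1,e_2)$. Define $\mathbb{J}'(x\wedge X+y\wedge Y)=x\wedge J'X+y\wedge J'Y$ and $G'(\cdot,\cdot)=\Omega(\cdot,\mathbb{J}'\cdot)=-\epsilon G(\cdot,\mathbb{J}\circ\mathbb{J}'\cdot)$. Then $(G',\mathbb{J}',\Omega)$ is a Kähler structure with $G'$ of neutral signature and locally conformally flat. Gauss map: $\Phi=\phi\wedge N$, with $N$ the unit normal viewed in $\mathbb{R}^4$; it is Lagrangian for $\Omega$ when it is an immersion. Hamiltonian minimality: a compactly supported variation $(\Phi_t)$ of a Lagrangian immersion $\Phi$ with non-degenerate $\Phi^*G'$ is Hamiltonian if the normal component (for $G'$) of $\partial_t\Phi_t|_{t=0}$ equals $\mathbb{J}'\,d\Phi(\nabla u)$ for some compactly supported $u\in C^\infty(\Sigma)$, with $\nabla$ the gradient of $\Phi^*G'$. $\Phi$ is Hamiltonian minimal if $\frac{d}{dt}\big|_{t=0}\mathrm{Vol}(\Phi_t)=0$ for every Hamiltonian variation, where $\mathrm{Vol}$ is the area for $|\det\Phi_t^*G'|^{1/2}$ (computed on a compact set containing the support of the variation). Equivalently $\operatorname{div}(\mathbb{J}'\vec H)=0$, with $\vec H$ the mean curvature vector of $\Phi$. Critical point: $\phi$ is a critical point of $\mathcal{W}'$ if its first variation at $\phi$ vanishes along every compactly supported smooth variation of $\phi$ through immersions (integrals taken over a compact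 set containing the support). *)

theory Defs
  imports "HOL-Analysis.Analysis"
begin

section \<open>Smooth maps and oriented smooth surfaces\<close>

fun Ck_on :: "nat \<Rightarrow> 'b::euclidean_space set \<Rightarrow> ('b \<Rightarrow> 'v::euclidean_space) \<Rightarrow> bool" where
  "Ck_on 0 S f \<longleftrightarrow> continuous_on S f"
| "Ck_on (Suc k) S f \<longleftrightarrow> (\<forall>x\<in>S. f differentiable (at x)) \<and>
     (\<forall>v. Ck_on k S (\<lambda>x. frechet_derivative f (at x) v))"

text \<open>Only used for open sets \<open>S\<close>, where it means \<open>C\<^sup>\<infinity>\<close>.\<close>

definition smooth_on :: "'b::euclidean_space set \<Rightarrow> ('b \<Rightarrow> 'v::euclidean_space) \<Rightarrow> bool" where
  "smooth_on S f \<longleftrightarrow> (\<forall>k. Ck_on k S f)"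

text \<open>A chart is a pair of its domain and its coordinate map; the values of the
  coordinate map outside the domain are irrelevant.\<close>

type_synonym 'a chart = "'a set \<times> ('a \<Rightarrow> real^2)"

definition chart_dom :: "'a chart \<Rightarrow> 'a set" where
  "chart_dom c = fst c"

definition chart_img :: "'a chart \<Rightarrow> (real^2) set" where
  "chart_img c = snd c ` fst c"

definition chart_inv :: "'a chart \<Rightarrow> real^2 \<Rightarrow> 'a" where
  "chart_inv c = inv_into (fst c) (snd c)"

text \<open>The local expression of a map on the surface; meaningful on \<open>chart_img c\<close>.\<close>

definition loc :: "'a chart \<Rightarrow> ('a \<Rightarrow> 'v) \<Rightarrow> real^2 \<Rightarrow> 'v" where
  "loc c f = f \<circ> chart_inv c"

abbreviation D :: "('b::real_normed_vector \<Rightarrow> 'v::real_normed_vector) \<Rightarrow> 'b \<Rightarrow> 'b \<Rightarrow> 'v" where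
  "D f z \<equiv> frechet_derivative f (at z)"

text \<open>The surface is the whole type (Hausdorff and second countable by its type class), with an
  oriented smooth atlas that need not be maximal. Connectedness is not required.\<close>

definition oriented_surface :: "'a::{t2_space,second_countable_topology} chart set \<Rightarrow> bool" where
  "oriented_surface A \<longleftrightarrow>
     (\<forall>c\<in>A. open (chart_dom c) \<and> open (chart_img c) \<and>
        homeomorphism (chart_dom c) (chart_img c) (snd c) (chart_inv c)) \<and>
     (\<Union>c\<in>A. chart_dom c) = UNIV \<and>
     (\<forall>c\<in>A. \<forall>d\<in>A. smooth_on (snd c ` (chart_dom c \<inter> chart_dom d)) (loc c (snd d)) \<and>
        (\<forall>z \<in> snd c ` (chart_dom c \<inter> chart_dom d). det (matrix (D (loc c (snd d)) z)) > 0))"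

definition smooth_map :: "'a chart set \<Rightarrow> ('a \<Rightarrow> 'v::euclidean_space) \<Rightarrow> bool" where
  "smooth_map A f \<longleftrightarrow> (\<forall>c\<in>A. smooth_on (chart_img c) (loc c f))"

text \<open>Immersions into a submanifold \<open>M\<close> of a Euclidean space. For the embedded submanifolds
  below, smoothness into \<open>M\<close> and into the surrounding space coincide.\<close>

definition immersion :: "'a chart set \<Rightarrow> 'v::euclidean_space set \<Rightarrow> ('a \<Rightarrow> 'v) \<Rightarrow> bool" where
  "immersion A M f \<longleftrightarrow> range f \<subseteq> M \<and> smooth_map A f \<and>
     (\<forall>c\<in>A. \<forall>z\<in>chart_img c. inj (D (loc c f) z))"

text \<open>\<open>ft\<close> is a smooth variation of \<open>f\<close> through immersions, supported in the compact set \<open>C\<close>.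
  Only parameters near \<open>0\<close> matter.\<close>

definition variation ::
  "'a::topological_space chart set \<Rightarrow> 'v::euclidean_space set \<Rightarrow> ('a \<Rightarrow> 'v) \<Rightarrow>
     (real \<Rightarrow> 'a \<Rightarrow> 'v) \<Rightarrow> 'a set \<Rightarrow> bool" where
  "variation A M f ft C \<longleftrightarrow> compact C \<and> ft 0 = f \<and>
     (\<exists>\<delta>>0.
        (\<forall>c\<in>A. smooth_on ({-\<delta><..<\<delta>} \<times> chart_img c) (\<lambda>(t, z). loc c (ft t) z)) \<and>
        (\<forall>t\<in>{-\<delta><..<\<delta>}. immersion A M (ft t) \<and> (\<forall>q. q \<notin> C \<longrightarrow> ft t q = f q)))"

text \<open>The Borel measure on the surface which in every chart \<open>c\<close> has density \<open>\<rho> c\<close> with respect to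
  Lebesgue measure. It exists and is unique if the \<open>\<rho> c\<close> are continuous, nonnegative and transform
  by the Jacobians of the coordinate changes.\<close>

definition density_measure ::
  "'a::topological_space chart set \<Rightarrow> ('a chart \<Rightarrow> real^2 \<Rightarrow> real) \<Rightarrow> 'a measure" where
  "density_measure A \<rho> = (THE \<mu>. sets \<mu> = sets borel \<and>
     (\<forall>c\<in>A. \<forall>B\<in>sets borel. B \<subseteq> chart_dom c \<longrightarrow>
        emeasure \<mu> B = (\<integral>\<^sup>+z\<in>snd c ` B. ennreal (\<rho> c z) \<partial>lborel)))"


section \<open>Intrinsic curvature of a metric in coordinates\<close>

definition partial :: "2 \<Rightarrow> (real^2 \<Rightarrow> real) \<Rightarrow> real^2 \<Rightarrow> real" where
  "partial i f z = D f z (axis i 1)"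

text \<open>\<open>christoffel g k i j\<close> is \<open>\<Gamma>\<^sup>k\<^sub>i\<^sub>j\<close>.\<close>

definition christoffel :: "(real^2 \<Rightarrow> real^2^2) \<Rightarrow> 2 \<Rightarrow> 2 \<Rightarrow> 2 \<Rightarrow> real^2 \<Rightarrow> real" where
  "christoffel g k i j z = (1/2) * (\<Sum>l\<in>UNIV. matrix_inv (g z) $ k $ l *
     (partial i (\<lambda>y. g y $ j $ l) z + partial j (\<lambda>y. g y $ i $ l) z - partial l (\<lambda>y. g y $ i $ j) z))"

text \<open>\<open>R(\<partial>\<^sub>i, \<partial>\<^sub>j) \<partial>\<^sub>k\<close> is the sum over \<open>l\<close> of \<open>riemann g l k i j\<close> times \<open>\<partial>\<^sub>l\<close>, where
  \<open>R(X,Y) = [\<nabla>\<^sub>X, \<nabla>\<^sub>Y] - \<nabla>\<^bsub>[X,Y]\<^esub>\<close>.\<close>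

definition riemann :: "(real^2 \<Rightarrow> real^2^2) \<Rightarrow> 2 \<Rightarrow> 2 \<Rightarrow> 2 \<Rightarrow> 2 \<Rightarrow> real^2 \<Rightarrow> real" where
  "riemann g l k i j z =
     partial i (christoffel g l j k) z - partial j (christoffel g l i k) z +
     (\<Sum>m\<in>UNIV. christoffel g l i m z * christoffel g m j k z
               - christoffel g l j m z * christoffel g m i k z)"

text \<open>\<open>g(R(\<partial>\<^sub>1,\<partial>\<^sub>2)\<partial>\<^sub>2, \<partial>\<^sub>1) / det g\<close>, which is \<open>1\<close> for the round unit sphere.\<close>

definition gauss_curvature_metric :: "(real^2 \<Rightarrow> real^2^2) \<Rightarrow> real^2 \<Rightarrow> real" where
  "gauss_curvature_metric g z = (\<Sum>l\<in>UNIV. g z $ 1 $ l * riemann g l 2 1 2 z) / det (g z)"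


section \<open>The sphere and hyperbolic space\<close>

text \<open>Coordinates on \<open>\<real>\<^sup>4\<close> are indexed by the numeral type \<open>4\<close>, in which \<open>4 = 0\<close>;
  the signs are distributed over the indices \<open>1, 2, 3, 4\<close> in this order.\<close>

definition pform :: "nat \<Rightarrow> real^4 \<Rightarrow> real^4 \<Rightarrow> real" where
  "pform p x y = - (\<Sum>i=1..p. x $ of_nat i * y $ of_nat i) + (\<Sum>i=p+1..4. x $ of_nat i * y $ of_nat i)"

datatype geometry = Spherical | Hyperbolic

fun idx :: "geometry \<Rightarrow> nat" where
  "idx Spherical = 0"
| "idx Hyperbolic = 3"

fun eps :: "geometry \<Rightarrow> real" where
  "eps Spherical = 1"
| "eps Hyperbolic = -1"

abbreviation ip :: "geometry \<Rightarrow> real^4 \<Rightarrow> real^4 \<Rightarrow> real" where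
  "ip s \<equiv> pform (idx s)"

fun ambient :: "geometry \<Rightarrow> (real^4) set" where
  "ambient Spherical = {x. pform 0 x x = 1}"
| "ambient Hyperbolic = {x. pform 3 x x = 1 \<and> x $ 4 > 0}"


section \<open>The space of oriented geodesics\<close>

text \<open>\<open>\<Lambda>\<^sup>2(\<real>\<^sup>4)\<close> is realised as the skew-symmetric matrices.\<close>

definition wedge :: "real^4 \<Rightarrow> real^4 \<Rightarrow> real^4^4" (infixl \<open>\<and>\<and>\<close> 75) where
  "x \<and>\<and> y = (\<chi> i j. x $ i * y $ j - y $ i * x $ j)"

text \<open>The form \<open>\<langle>\<langle>\<cdot>,\<cdot>\<rangle>\<rangle>\<close>, extended bilinearly from decomposable bivectors;
  \<open>\<langle>e\<^sub>i,e\<^sub>i\<rangle>\<close> is the sign of the \<open>i\<close>-th coordinate. See \<open>G_wedge\<close>.\<close>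

definition G :: "geometry \<Rightarrow> real^4^4 \<Rightarrow> real^4^4 \<Rightarrow> real" where
  "G s a b = (1/2) * (\<Sum>i\<in>UNIV. \<Sum>j\<in>UNIV.
     ip s (axis i 1) (axis i 1) * ip s (axis j 1) (axis j 1) * (a $ i $ j) * (b $ i $ j))"

lemma pform_0: "pform 0 x y = x$1 * y$1 + x$2 * y$2 + x$3 * y$3 + x$4 * y$4"
proof -
  have s: "{Suc 0..4} = {1, 2, 3, 4::nat}" by auto
  show ?thesis by (simp add: pform_def s)
qed

lemma pform_3: "pform 3 x y = - (x$1 * y$1 + x$2 * y$2 + x$3 * y$3) + x$4 * y$4"
proof -
  have s: "{Suc 0..3} = {1, 2, 3::nat}" "{4..4} = {4::nat}" by auto
  show ?thesis by (simp add: pform_def s)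
qed

lemma G_wedge:
  "G s (x1 \<and>\<and> y1) (x2 \<and>\<and> y2) = ip s x1 x2 * ip s y1 y2 - ip s x1 y2 * ip s x2 y1"
  by (cases s) (simp_all add: G_def wedge_def sum_4 pform_0 pform_3 axis_def algebra_simps)

definition geodesic_frame :: "geometry \<Rightarrow> real^4 \<Rightarrow> real^4 \<Rightarrow> bool" where
  "geodesic_frame s x y \<longleftrightarrow> x \<in> ambient s \<and> ip s x y = 0 \<and> ip s y y = eps s"

definition geodesics :: "geometry \<Rightarrow> (real^4^4) set" where
  "geodesics s = {x \<and>\<and> y | x y. geodesic_frame s x y}"

definition orth_plane :: "geometry \<Rightarrow> real^4 \<Rightarrow> real^4 \<Rightarrow> (real^4) set" where
  "orth_plane s x y = {X. ip s x X = 0 \<and> ip s y X = 0}"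

text \<open>The form restricted to \<open>orth_plane s x y\<close> is definite of sign \<open>eps s\<close>.\<close>

definition oriented_orthonormal ::
  "geometry \<Rightarrow> real^4 \<Rightarrow> real^4 \<Rightarrow> real^4 \<Rightarrow> real^4 \<Rightarrow> bool" where
  "oriented_orthonormal s x y e1 e2 \<longleftrightarrow> e1 \<in> orth_plane s x y \<and> e2 \<in> orth_plane s x y \<and>
     ip s e1 e1 = eps s \<and> ip s e2 e2 = eps s \<and> ip s e1 e2 = 0 \<and>
     det (vector [x, y, e1, e2] :: real^4^4) > 0"

definition rot :: "geometry \<Rightarrow> real^4 \<Rightarrow> real^4 \<Rightarrow> real^4 \<Rightarrow> real^4" where
  "rot s x y X = (THE Z. \<exists>e1 e2 a b. oriented_orthonormal s x y e1 e2 \<and>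
     X = a *\<^sub>R e1 + b *\<^sub>R e2 \<and> Z = a *\<^sub>R e2 - b *\<^sub>R e1)"

text \<open>The structures below are defined for tangent vectors \<open>v\<close> of \<open>geodesics s\<close> at \<open>g\<close>, through any
  representation \<open>g = x \<and>\<and> y\<close> and \<open>v = x \<and>\<and> X + y \<and>\<and> Y\<close>; the results do not depend on the
  representation. They are meaningless for vectors that are not tangent.\<close>

definition tangent_repr ::
  "geometry \<Rightarrow> real^4^4 \<Rightarrow> real^4^4 \<Rightarrow> real^4 \<Rightarrow> real^4 \<Rightarrow> real^4 \<Rightarrow> real^4 \<Rightarrow> bool" where
  "tangent_repr s g v x y X Y \<longleftrightarrow> geodesic_frame s x y \<and> g = x \<and>\<and> y \<and>
     X \<in> orth_plane s x y \<and> Y \<in> orth_plane s x y \<and> v = x \<and>\<and> X + y \<and>\<and> Y"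

definition JJ :: "geometry \<Rightarrow> real^4^4 \<Rightarrow> real^4^4 \<Rightarrow> real^4^4" where
  "JJ s g v = (THE w. \<exists>x y X Y. tangent_repr s g v x y X Y \<and> w = y \<and>\<and> X - eps s *\<^sub>R (x \<and>\<and> Y))"

definition JJ' :: "geometry \<Rightarrow> real^4^4 \<Rightarrow> real^4^4 \<Rightarrow> real^4^4" where
  "JJ' s g v = (THE w. \<exists>x y X Y. tangent_repr s g v x y X Y \<and>
     w = x \<and>\<and> rot s x y X + y \<and>\<and> rot s x y Y)"

definition Omega :: "geometry \<Rightarrow> real^4^4 \<Rightarrow> real^4^4 \<Rightarrow> real^4^4 \<Rightarrow> real" where
  "Omega s g v w = eps s * G s (JJ s g v) w"

definition G' :: "geometry \<Rightarrow> real^4^4 \<Rightarrow> real^4^4 \<Rightarrow> real^4^4 \<Rightarrow> real" where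
  "G' s g v w = Omega s g v (JJ' s g w)"


section \<open>Geometry of an immersed surface\<close>

text \<open>The form induced by \<open>ip s\<close> on the ambient space is \<open>eps s\<close> times the spherical or hyperbolic
  metric, hence the factor \<open>eps s\<close>.\<close>

definition first_form :: "geometry \<Rightarrow> (real^2 \<Rightarrow> real^4) \<Rightarrow> real^2 \<Rightarrow> real^2^2" where
  "first_form s F z = (\<chi> i j. eps s * ip s (D F z (axis i 1)) (D F z (axis j 1)))"

text \<open>The unit normal determined by the orientations: \<open>(d\<phi> e\<^sub>1, d\<phi> e\<^sub>2, N)\<close> is a positive basis of the
  tangent space of the ambient space at \<open>\<phi>\<close> (oriented so that a basis \<open>b\<close> is positive iff \<open>(\<phi>, b)\<close>
  is positive in \<open>\<real>\<^sup>4\<close>) whenever \<open>(e\<^sub>1, e\<^sub>2)\<close> is positive on the surface. The opposite convention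
  amounts to reversing the orientation of the surface.\<close>

definition unit_normal :: "geometry \<Rightarrow> 'a chart set \<Rightarrow> ('a \<Rightarrow> real^4) \<Rightarrow> 'a \<Rightarrow> real^4" where
  "unit_normal s A \<phi> q = (THE \<nu>. ip s \<nu> \<nu> = eps s \<and> ip s \<nu> (\<phi> q) = 0 \<and>
     (\<forall>c\<in>A. q \<in> chart_dom c \<longrightarrow>
        (\<forall>v. ip s \<nu> (D (loc c \<phi>) (snd c q) v) = 0) \<and>
        det (vector [\<phi> q, D (loc c \<phi>) (snd c q) (axis 1 1), D (loc c \<phi>) (snd c q) (axis 2 1), \<nu>]
               :: real^4^4) > 0))"

text \<open>\<open>-dN = d\<phi> \<circ> S\<close>, with \<open>F\<close> and \<open>N\<close> local expressions of the immersion and its normal.\<close>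

definition shape_operator ::
  "(real^2 \<Rightarrow> real^4) \<Rightarrow> (real^2 \<Rightarrow> real^4) \<Rightarrow> real^2 \<Rightarrow> real^2 \<Rightarrow> real^2" where
  "shape_operator F N z = (THE S. linear S \<and> (\<forall>v. - D N z v = D F z (S v)))"

text \<open>In the next two definitions the value does not depend on the chart.\<close>

definition mean_curvature :: "geometry \<Rightarrow> 'a chart set \<Rightarrow> ('a \<Rightarrow> real^4) \<Rightarrow> 'a \<Rightarrow> real" where
  "mean_curvature s A \<phi> q = (THE h. \<forall>c\<in>A. q \<in> chart_dom c \<longrightarrow>
     h = trace (matrix (shape_operator (loc c \<phi>) (loc c (unit_normal s A \<phi>)) (snd c q))) / 2)"

definition gauss_curvature :: "geometry \<Rightarrow> 'a chart set \<Rightarrow> ('a \<Rightarrow> real^4) \<Rightarrow> 'a \<Rightarrow> real" where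
  "gauss_curvature s A \<phi> q = (THE k. \<forall>c\<in>A. q \<in> chart_dom c \<longrightarrow>
     k = gauss_curvature_metric (first_form s (loc c \<phi>)) (snd c q))"

definition area :: "geometry \<Rightarrow> 'a::topological_space chart set \<Rightarrow> ('a \<Rightarrow> real^4) \<Rightarrow> 'a measure" where
  "area s A \<phi> = density_measure A (\<lambda>c z. sqrt (det (first_form s (loc c \<phi>) z)))"

definition W' :: "geometry \<Rightarrow> 'a::topological_space chart set \<Rightarrow> 'a set \<Rightarrow> ('a \<Rightarrow> real^4) \<Rightarrow> real" where
  "W' s A C \<phi> =
     (LINT q:C|area s A \<phi>. sqrt ((mean_curvature s A \<phi> q)\<^sup>2 - gauss_curvature s A \<phi> q + eps s))"

definition critical_W' :: "geometry \<Rightarrow> 'a::topological_space chart set \<Rightarrow> ('a \<Rightarrow> real^4) \<Rightarrow> bool" where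
  "critical_W' s A \<phi> \<longleftrightarrow> (\<forall>\<phi>t C. variation A (ambient s) \<phi> \<phi>t C \<longrightarrow>
     ((\<lambda>t. W' s A C (\<phi>t t)) has_real_derivative 0) (at 0))"


section \<open>Gauss map and Hamiltonian minimality\<close>

definition gauss_map :: "geometry \<Rightarrow> 'a chart set \<Rightarrow> ('a \<Rightarrow> real^4) \<Rightarrow> 'a \<Rightarrow> real^4^4" where
  "gauss_map s A \<phi> q = \<phi> q \<and>\<and> unit_normal s A \<phi> q"

text \<open>The pullback of \<open>G'\<close> under a local expression \<open>F\<close> of a map into \<open>geodesics s\<close>.\<close>

definition pullback_G' ::
  "geometry \<Rightarrow> (real^2 \<Rightarrow> real^4^4) \<Rightarrow> real^2 \<Rightarrow> real^2 \<Rightarrow> real^2 \<Rightarrow> real" where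
  "pullback_G' s F z v w = G' s (F z) (D F z v) (D F z w)"

definition nondegenerate :: "geometry \<Rightarrow> 'a chart set \<Rightarrow> ('a \<Rightarrow> real^4^4) \<Rightarrow> bool" where
  "nondegenerate s A \<Phi> \<longleftrightarrow> (\<forall>c\<in>A. \<forall>z\<in>chart_img c. \<forall>v.
     v \<noteq> 0 \<longrightarrow> (\<exists>w. pullback_G' s (loc c \<Phi>) z v w \<noteq> 0))"

definition lagrangian :: "geometry \<Rightarrow> 'a chart set \<Rightarrow> ('a \<Rightarrow> real^4^4) \<Rightarrow> bool" where
  "lagrangian s A \<Phi> \<longleftrightarrow> (\<forall>c\<in>A. \<forall>z\<in>chart_img c. \<forall>v w.
     Omega s (loc c \<Phi> z) (D (loc c \<Phi>) z v) (D (loc c \<Phi>) z w) = 0)"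

definition Vol :: "geometry \<Rightarrow> 'a::topological_space chart set \<Rightarrow> 'a set \<Rightarrow> ('a \<Rightarrow> real^4^4) \<Rightarrow> real" where
  "Vol s A C \<Phi> = measure (density_measure A (\<lambda>c z.
     sqrt \<bar>det (\<chi> i j. pullback_G' s (loc c \<Phi>) z (axis i 1) (axis j 1) :: real^2^2)\<bar>)) C"

definition gradient :: "geometry \<Rightarrow> (real^2 \<Rightarrow> real^4^4) \<Rightarrow> (real^2 \<Rightarrow> real) \<Rightarrow> real^2 \<Rightarrow> real^2" where
  "gradient s F u z = (THE a. \<forall>w. pullback_G' s F z a w = D u z w)"

definition normal_part :: "geometry \<Rightarrow> (real^2 \<Rightarrow> real^4^4) \<Rightarrow> real^2 \<Rightarrow> real^4^4 \<Rightarrow> real^4^4" where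
  "normal_part s F z v = (THE n. (\<exists>a. v = D F z a + n) \<and> (\<forall>b. G' s (F z) n (D F z b) = 0))"

definition hamiltonian_field ::
  "geometry \<Rightarrow> 'a::topological_space chart set \<Rightarrow> ('a \<Rightarrow> real^4^4) \<Rightarrow> ('a \<Rightarrow> real^4^4) \<Rightarrow> bool" where
  "hamiltonian_field s A \<Phi> V \<longleftrightarrow>
     (\<exists>u :: 'a \<Rightarrow> real. smooth_map A u \<and> (\<exists>K. compact K \<and> (\<forall>q. q \<notin> K \<longrightarrow> u q = 0)) \<and>
        (\<forall>c\<in>A. \<forall>z\<in>chart_img c. normal_part s (loc c \<Phi>) z (loc c V z) =
           JJ' s (loc c \<Phi> z) (D (loc c \<Phi>) z (gradient s (loc c \<Phi>) (loc c u) z))))"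

definition hamiltonian_minimal ::
  "geometry \<Rightarrow> 'a::topological_space chart set \<Rightarrow> ('a \<Rightarrow> real^4^4) \<Rightarrow> bool" where
  "hamiltonian_minimal s A \<Phi> \<longleftrightarrow>
     immersion A (geodesics s) \<Phi> \<and> lagrangian s A \<Phi> \<and> nondegenerate s A \<Phi> \<and>
     (\<forall>\<Phi>t C. variation A (geodesics s) \<Phi> \<Phi>t C \<longrightarrow>
        hamiltonian_field s A \<Phi> (\<lambda>q. vector_derivative (\<lambda>t. \<Phi>t t q) (at 0)) \<longrightarrow>
        ((\<lambda>t. Vol s A C (\<Phi>t t)) has_real_derivative 0) (at 0))"

end

theory Submission
  imports Defs
begin

text \<open>On bivectors tangent to the space of oriented geodesics, \<open>G'(v, w)\<close> is \<open>\<epsilon>\<close> times the constant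
  form \<open>v \<and> w\<close> on \<open>\<Lambda>\<^sup>2(\<real>\<^sup>4)\<close>. For the Gauss map \<open>\<Phi> = \<phi> \<and> N\<close> this gives
  \<open>det \<Phi>\<^sup>*G' = - (k\<^sub>1 - k\<^sub>2)\<^sup>2 det I\<close>, which by the Gauss equation is \<open>- 4 (H\<^sup>2 - K + \<epsilon>) det I\<close>. Hence the volume of
  \<open>\<Phi>\<close> is twice \<open>\<W>'(\<phi>)\<close>.

  If \<open>\<phi>\<^sub>t\<close> is a variation of \<open>\<phi>\<close>, the velocity \<open>V\<close> of its Gauss maps satisfies \<open>\<Omega>(V, d\<Phi>) = - du\<close> with
  \<open>u = - \<langle>\<partial>\<^sub>t\<phi>\<^sub>t, N\<rangle>\<close>, which says precisely that its normal part is \<open>\<J>' d\<Phi>(\<nabla>u)\<close>. So a Hamiltonian minimal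
  Gauss map forces \<open>\<phi>\<close> to be critical. Conversely, let \<open>\<Psi>\<^sub>t\<close> be a Hamiltonian variation of \<open>\<Phi>\<close> with velocity \<open>V\<close>
  and potential \<open>u\<close>. Choosing the tangential part of \<open>\<partial>\<^sub>t\<phi>\<^sub>t\<close> suitably, one gets a variation \<open>\<phi>\<^sub>t\<close> of \<open>\<phi>\<close> whose
  Gauss maps have exactly the velocity \<open>V\<close>; then the volumes of \<open>\<Psi>\<^sub>t\<close> and of the Gauss maps of \<open>\<phi>\<^sub>t\<close> differ by
  \<open>O(t\<^sup>2)\<close>. In this way neither the first variation formula nor the divergence theorem is needed.\<close>

section \<open>Smooth maps\<close>

text \<open>Since \<open>plk\<close> is a constant form, the density of a map into the space of
  geodesics is \<open>sqrt \<bar>p\<bar>\<close> with \<open>p\<close> a polynomial in its first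
  derivatives; the base point has dropped out. Hence equal initial maps and velocities give equal
  \<open>p\<close> up to order \<open>t^2\<close>. Non-degeneracy keeps \<open>p\<close> away from
  0, where the square root is not Lipschitz, and compactness makes the constants uniform. A tangent
  vector \<open>V = \<phi> \<and> X + N \<and> Y\<close> along the Gauss map is fixed by
  \<open>Y\<close> and by the pairings \<open>\<Omega>(V, d\<Phi>)\<close>, because
  \<open>d\<phi>\<close> spans the plane containing \<open>X\<close>. For the Gauss maps of a family
  \<open>\<phi>t\<close>, \<open>Y\<close> is minus the tangential velocity of
  \<open>\<phi>t\<close>, and \<open>\<Omega>(V, d\<Phi>)\<close> comes from the normal velocity. A
  Hamiltonian \<open>V\<close> prescribes exactly these two parts, so it can be realised by moving
  \<open>\<phi>\<close>. Much of the remaining work is forced by definite descriptions: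
  \<open>JJ'\<close>, \<open>unit_normal\<close>, both curvatures and \<open>density_measure\<close>
  denote the intended objects only once existence, uniqueness and independence of the frame or chart
  are proved.\<close>

lemma Ck_on_cong:
  assumes "open S" "\<And>x. x \<in> S \<Longrightarrow> f x = g x" "Ck_on k S f"
  shows "Ck_on k S g"
  using assms(2,3)
proof (induction k arbitrary: f g)
  case 0
  then show ?case using continuous_on_cong by force
next
  case (Suc k)
  have d: "f differentiable (at x)" if "x \<in> S" for x using Suc.prems that by auto
  have "g differentiable (at x)" if "x \<in> S" for x
    using d[OF that] Suc.prems(1) that assms(1) unfolding differentiable_def
    by (meson has_derivative_transform_within_open)
  moreover have "D f x = D g x" if "x \<in> S" for x
    using frechet_derivative_transform_within_open[OF d[OF that] assms(1) that Suc.prems(1)] .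
  ultimately show ?case using Suc.IH[of "\<lambda>x. D f x v" "\<lambda>x. D g x v" for v] Suc.prems(2) by simp
qed

lemma Ck_on_subset: "Ck_on k S f \<Longrightarrow> T \<subseteq> S \<Longrightarrow> Ck_on k T f"
  by (induction k arbitrary: f) (auto intro: continuous_on_subset)

lemma Ck_on_imp_continuous: "Ck_on k S f \<Longrightarrow> continuous_on S f"
  by (cases k) (auto simp: continuous_on_eq_continuous_at
      intro!: continuous_at_imp_continuous_on differentiable_imp_continuous_within)

lemma Ck_on_SucD: "Ck_on (Suc k) S f \<Longrightarrow> Ck_on k S f"
  by (induction k arbitrary: f) (use Ck_on_imp_continuous[of "Suc 0"] in auto)

lemma Ck_on_const: "Ck_on k S (\<lambda>x. c)"
  by (induction k arbitrary: c) auto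

lemma D_bounded_linear: "bounded_linear f \<Longrightarrow> D f x = f"
  by (metis bounded_linear_imp_has_derivative frechet_derivative_at)

lemma Ck_on_linear:
  assumes "bounded_linear f" shows "Ck_on k S f"
  by (cases k) (auto simp: D_bounded_linear[OF assms] Ck_on_const
      linear_continuous_on[OF assms] bounded_linear_imp_differentiable[OF assms])

lemma has_derivative_D: "f differentiable (at x) \<Longrightarrow> (f has_derivative D f x) (at x)"
  by (simp add: frechet_derivative_works)

lemma D_add:
  assumes "f differentiable (at x)" "g differentiable (at x)"
  shows "D (\<lambda>x. f x + g x) x v = D f x v + D g x v"
  by (rule fun_cong[OF frechet_derivative_at[OF
          has_derivative_add[OF has_derivative_D[OF assms(1)] has_derivative_D[OF assms(2)]], symmetric]])

lemma Ck_on_add: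
  assumes "open S" shows "Ck_on k S f \<Longrightarrow> Ck_on k S g \<Longrightarrow> Ck_on k S (\<lambda>x. f x + g x)"
proof (induction k arbitrary: f g)
  case 0
  then show ?case by (auto intro: continuous_intros)
next
  case (Suc k)
  have "Ck_on k S (\<lambda>x. D (\<lambda>x. f x + g x) x v)" for v
    by (rule Ck_on_cong[OF assms _ Suc.IH[of "\<lambda>x. D f x v" "\<lambda>x. D g x v"]])
      (use Suc.prems in \<open>auto simp: D_add\<close>)
  with Suc.prems show ?case by (auto intro: differentiable_add)
qed

lemma D_bilinear:
  assumes "bounded_bilinear p" "f differentiable (at x)" "g differentiable (at x)"
  shows "D (\<lambda>x. p (f x) (g x)) x v = p (f x) (D g x v) + p (D f x v) (g x)"
  by (rule fun_cong[OF frechet_derivative_at[OF bounded_bilinear.FDERIV[OF assms(1)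
        has_derivative_D[OF assms(2)] has_derivative_D[OF assms(3)]], symmetric]])

lemma differentiable_bilinear:
  assumes "bounded_bilinear p" "f differentiable (at x)" "g differentiable (at x)"
  shows "(\<lambda>x. p (f x) (g x)) differentiable (at x)"
  using bounded_bilinear.FDERIV[OF assms(1)
        has_derivative_D[OF assms(2)] has_derivative_D[OF assms(3)]] differentiable_def by blast

lemma Ck_on_bilinear:
  assumes "open S" "bounded_bilinear p"
  shows "Ck_on k S f \<Longrightarrow> Ck_on k S g \<Longrightarrow> Ck_on k S (\<lambda>x. p (f x) (g x))"
proof (induction k arbitrary: f g)
  case 0
  then show ?case using bounded_bilinear.continuous_on[OF assms(2)] by auto
next
  case (Suc k)
  have "Ck_on k S (\<lambda>x. D (\<lambda>x. p (f x) (g x)) x v)" for v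
    by (rule Ck_on_cong[OF assms(1) _ Ck_on_add[OF assms(1)
            Suc.IH[of f "\<lambda>x. D g x v"] Suc.IH[of "\<lambda>x. D f x v" g]]])
      (use Suc.prems Ck_on_SucD[of k S f] Ck_on_SucD[of k S g] in \<open>auto simp: D_bilinear[OF assms(2)]\<close>)
  with Suc.prems show ?case by (auto intro: differentiable_bilinear[OF assms(2)])
qed

lemma Ck_on_sum:
  assumes "open S" "\<And>i. i \<in> I \<Longrightarrow> Ck_on k S (f i)"
  shows "Ck_on k S (\<lambda>x. \<Sum>i\<in>I. f i x)"
  using assms(2) by (induction I rule: infinite_finite_induct) (auto intro: Ck_on_const Ck_on_add[OF assms(1)])

lemma D_chain:
  assumes "g differentiable (at (f x))" "f differentiable (at x)"
  shows "D (\<lambda>x. g (f x)) x v = D g (f x) (D f x v)"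
  using frechet_derivative_compose[OF assms(2,1)] by (simp add: o_def)

lemma linear_D: "f differentiable (at x) \<Longrightarrow> linear (D f x)"
  by (rule linear_frechet_derivative)

lemma linear_expand: 
  fixes L :: "'a::euclidean_space \<Rightarrow> 'b::real_vector"
  assumes "linear L" shows "L v = (\<Sum>b\<in>Basis. (v \<bullet> b) *\<^sub>R L b)"
  by (subst euclidean_representation[of v, symmetric])
    (simp only: linear_sum[OF assms] linear_cmul[OF assms])

text \<open>In the chain rule the direction \<open>D f x v\<close> varies with \<open>x\<close>, so
  the induction hypothesis does not apply directly. Expanding that direction in the basis leaves the
  maps \<open>\<lambda>x. D g (f x) b\<close> with \<open>b\<close> fixed, to which it does
  apply.\<close>

lemma Ck_on_compose:
  assumes "open S" "open T" "f ` S \<subseteq> T"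
  shows "Ck_on k T g \<Longrightarrow> Ck_on k S f \<Longrightarrow> Ck_on k S (\<lambda>x. g (f x))"
proof (induction k arbitrary: g)
  case 0
  then show ?case using assms(3) continuous_on_compose2 by fastforce
next
  case (Suc k)
  have dg: "g differentiable (at (f x))" and df: "f differentiable (at x)" if "x \<in> S" for x
    using Suc.prems that assms(3) by auto
  have D_eq: "(\<Sum>b\<in>Basis. (D f x v \<bullet> b) *\<^sub>R D g (f x) b) = D (\<lambda>x. g (f x)) x v" if "x \<in> S" for x v
  proof -
    have "D (\<lambda>x. g (f x)) x v = D g (f x) (D f x v)"
      by (rule D_chain[of g f x v, OF dg[OF that] df[OF that]])
    also have "\<dots> = (\<Sum>b\<in>Basis. (D f x v \<bullet> b) *\<^sub>R D g (f x) b)"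
      by (rule linear_expand[of "D g (f x)" "D f x v", OF linear_D[of g "f x", OF dg[OF that]]])
    finally show ?thesis by simp
  qed
  have "Ck_on k S (\<lambda>x. D g (f x) b)" for b
    by (rule Suc.IH) (use Suc.prems Ck_on_SucD[OF Suc.prems(2)] in auto)
  then have "Ck_on k S (\<lambda>x. \<Sum>b\<in>Basis. (D f x v \<bullet> b) *\<^sub>R D g (f x) b)" for v
    using Suc.prems(2) by (intro Ck_on_sum assms(1) Ck_on_bilinear[OF assms(1) bounded_bilinear_scaleR]
          Ck_on_bilinear[OF assms(1) bounded_bilinear_inner] Ck_on_const) auto
  from Ck_on_cong[OF assms(1) D_eq this]
  have "Ck_on k S (\<lambda>x. D (\<lambda>x. g (f x)) x v)" for v .
  moreover have "(\<lambda>x. g (f x)) differentiable (at x)" if "x \<in> S" for x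
    using differentiable_chain_at[of f x g, unfolded o_def] df[OF that] dg[OF that] by blast
  ultimately show ?case by simp
qed

lemma smooth_on_cong:
  "open S \<Longrightarrow> (\<And>x. x \<in> S \<Longrightarrow> f x = g x) \<Longrightarrow> smooth_on S f \<Longrightarrow> smooth_on S g"
  unfolding smooth_on_def using Ck_on_cong by blast

lemma smooth_on_subset: "smooth_on S f \<Longrightarrow> T \<subseteq> S \<Longrightarrow> smooth_on T f"
  unfolding smooth_on_def using Ck_on_subset by blast

lemma smooth_on_imp_continuous: "smooth_on S f \<Longrightarrow> continuous_on S f"
  unfolding smooth_on_def using Ck_on_imp_continuous by blast

lemma smooth_on_differentiable: "smooth_on S f \<Longrightarrow> x \<in> S \<Longrightarrow> f differentiable (at x)"
  unfolding smooth_on_def using Ck_on.simps(2) by blast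

lemma smooth_on_D: "smooth_on S f \<Longrightarrow> smooth_on S (\<lambda>x. D f x v)"
  unfolding smooth_on_def using Ck_on.simps(2) by blast

lemma smooth_on_const: "smooth_on S (\<lambda>x. c)"
  unfolding smooth_on_def using Ck_on_const by blast

lemma smooth_on_linear: "bounded_linear f \<Longrightarrow> smooth_on S f"
  unfolding smooth_on_def using Ck_on_linear by blast

lemma smooth_on_add: "open S \<Longrightarrow> smooth_on S f \<Longrightarrow> smooth_on S g \<Longrightarrow> smooth_on S (\<lambda>x. f x + g x)"
  unfolding smooth_on_def by (intro allI Ck_on_add) auto

lemma smooth_on_bilinear:
  "open S \<Longrightarrow> bounded_bilinear p \<Longrightarrow> smooth_on S f \<Longrightarrow> smooth_on S g \<Longrightarrow> smooth_on S (\<lambda>x. p (f x) (g x))"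
  unfolding smooth_on_def by (intro allI Ck_on_bilinear[of S p _ f g]) auto

lemma smooth_on_sum:
  "open S \<Longrightarrow> (\<And>i. i \<in> I \<Longrightarrow> smooth_on S (f i)) \<Longrightarrow> smooth_on S (\<lambda>x. \<Sum>i\<in>I. f i x)"
  unfolding smooth_on_def by (intro allI Ck_on_sum) auto

lemma smooth_on_compose:
  "open S \<Longrightarrow> open T \<Longrightarrow> f ` S \<subseteq> T \<Longrightarrow> smooth_on T g \<Longrightarrow> smooth_on S f \<Longrightarrow> smooth_on S (\<lambda>x. g (f x))"
  unfolding smooth_on_def by (intro allI Ck_on_compose[of S T f _ g]) auto

lemma smooth_on_linear_compose:
  assumes "bounded_linear g" "open S" "smooth_on S f" shows "smooth_on S (\<lambda>x. g (f x))"
  by (rule smooth_on_compose[of S UNIV f g]) (use assms smooth_on_linear in auto)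

lemma smooth_on_mult:
  fixes f g :: "'a::euclidean_space \<Rightarrow> real"
  shows "open S \<Longrightarrow> smooth_on S f \<Longrightarrow> smooth_on S g \<Longrightarrow> smooth_on S (\<lambda>x. f x * g x)"
  by (rule smooth_on_bilinear[OF _ bounded_bilinear_mult])

lemma smooth_on_scaleR: "open S \<Longrightarrow> smooth_on S f \<Longrightarrow> smooth_on S g \<Longrightarrow> smooth_on S (\<lambda>x. f x *\<^sub>R g x)"
  by (rule smooth_on_bilinear[OF _ bounded_bilinear_scaleR])

lemma smooth_on_minus: "open S \<Longrightarrow> smooth_on S f \<Longrightarrow> smooth_on S (\<lambda>x. - f x)"
  by (rule smooth_on_linear_compose[OF bounded_linear_minus[OF bounded_linear_ident]])

lemma smooth_on_diff: "open S \<Longrightarrow> smooth_on S f \<Longrightarrow> smooth_on S g \<Longrightarrow> smooth_on S (\<lambda>x. f x - g x)"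
  using smooth_on_add[of S f "\<lambda>x. - g x"] smooth_on_minus[of S g] by simp

lemma smooth_on_nth:
  fixes f :: "'a::euclidean_space \<Rightarrow> 'b::euclidean_space ^ 'n"
  shows "open S \<Longrightarrow> smooth_on S f \<Longrightarrow> smooth_on S (\<lambda>x. f x $ i)"
  by (rule smooth_on_linear_compose[OF bounded_linear_vec_nth])

lemma smooth_on_vec:
  fixes f :: "'n::finite \<Rightarrow> 'a::euclidean_space \<Rightarrow> 'b::euclidean_space"
  assumes "open S" "\<And>i. smooth_on S (f i)"
  shows "smooth_on S (\<lambda>x. \<chi> i. f i x)"
proof -
  have *: "(\<chi> i. f i x) = (\<Sum>i\<in>UNIV. axis i (f i x))" for x
    by (simp add: vec_eq_iff axis_def sum_component)
  have "bounded_linear (\<lambda>y::'b. axis i y)" for i :: 'n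
    by (rule linear_conv_bounded_linear[THEN iffD1]) (auto intro!: linearI simp: vec_eq_iff axis_def)
  then show ?thesis unfolding * by (intro smooth_on_sum assms(1) smooth_on_linear_compose[OF _ assms(1) assms(2)])
qed

text \<open>The derivative of \<open>inverse\<close> is a polynomial in \<open>inverse\<close>
  itself, so the induction on \<open>k\<close> closes.\<close>

lemma smooth_on_inverse_real: "smooth_on (- {0::real}) inverse"
proof -
  have o: "open (- {0::real})" by auto
  have "Ck_on k (- {0::real}) inverse" for k
  proof (induction k)
    case 0
    show ?case by (auto intro!: continuous_intros)
  next
    case (Suc k)
    have d: "(inverse has_derivative (\<lambda>h. - (inverse x * h * inverse x))) (at x)" if "x \<noteq> 0" for x :: real
      by (rule has_derivative_inverse'[OF that])
    have "Ck_on k (- {0}) (\<lambda>x::real. D inverse x v)" for v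
    proof (rule Ck_on_cong[OF o])
      show "(inverse x * inverse x) * (- v) = D inverse x v" if "x \<in> - {0}" for x :: real
        using that frechet_derivative_at[OF d[of x], symmetric] by simp
      show "Ck_on k (- {0}) (\<lambda>x::real. inverse x * inverse x * (- v))"
        by (intro Ck_on_bilinear[OF o bounded_bilinear_mult] Suc Ck_on_const)
    qed
    moreover have "inverse differentiable (at x)" if "x \<in> - {0}" for x :: real
      using d[of x] that by (auto intro: differentiableI)
    ultimately show ?case by simp
  qed
  then show ?thesis by (simp add: smooth_on_def)
qed

text \<open>The derivative involves only \<open>inverse\<close> composed with the function under
  induction, whose values are non-zero for positive arguments.\<close>

lemma smooth_on_sqrt_real: "smooth_on {0<..} sqrt"
proof -
  have "Ck_on k {0<..} sqrt" for k
  proof (induction k)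
    case 0
    show ?case by (auto intro!: continuous_intros)
  next
    case (Suc k)
    have d: "(sqrt has_derivative (*) (inverse (sqrt x) / 2)) (at x)" if "x > 0" for x :: real
      using DERIV_real_sqrt[OF that] unfolding has_field_derivative_def by (simp add: mult.commute)
    have "Ck_on k {0<..} (\<lambda>x::real. D sqrt x v)" for v
    proof (rule Ck_on_cong[OF open_greaterThan])
      show "inverse (sqrt x) * (v / 2) = D sqrt x v" if "x \<in> {0<..}" for x :: real
        using that frechet_derivative_at[OF d[of x], symmetric] by simp
      show "Ck_on k {0<..} (\<lambda>x::real. inverse (sqrt x) * (v / 2))"
        by (intro Ck_on_bilinear[OF open_greaterThan bounded_bilinear_mult] Ck_on_const
            Ck_on_compose[OF open_greaterThan _ _ _ Suc, of "- {0}"])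
          (use smooth_on_inverse_real in \<open>auto simp: smooth_on_def\<close>)
    qed
    moreover have "sqrt differentiable (at x)" if "x \<in> {0<..}" for x :: real
      using d[of x] that by (auto intro: differentiableI)
    ultimately show ?case by simp
  qed
  then show ?thesis by (simp add: smooth_on_def)
qed

lemma smooth_on_inverse:
  "open S \<Longrightarrow> smooth_on S f \<Longrightarrow> (\<And>x. x \<in> S \<Longrightarrow> f x \<noteq> 0) \<Longrightarrow> smooth_on S (\<lambda>x. inverse (f x :: real))"
  by (rule smooth_on_compose[OF _ _ _ smooth_on_inverse_real]) auto

lemma smooth_on_divide:
  "open S \<Longrightarrow> smooth_on S f \<Longrightarrow> smooth_on S g \<Longrightarrow> (\<And>x. x \<in> S \<Longrightarrow> g x \<noteq> 0) \<Longrightarrow> smooth_on S (\<lambda>x. f x / g x :: real)"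
  unfolding divide_inverse by (intro smooth_on_mult smooth_on_inverse)

lemma smooth_on_sqrt:
  "open S \<Longrightarrow> smooth_on S f \<Longrightarrow> (\<And>x. x \<in> S \<Longrightarrow> f x > 0) \<Longrightarrow> smooth_on S (\<lambda>x. sqrt (f x))"
  by (rule smooth_on_compose[OF _ _ _ smooth_on_sqrt_real]) auto


section \<open>Mean values, symmetry of second derivatives, quadratic remainders\<close>

lemma D_linear_compose:
  assumes "bounded_linear g" "f differentiable (at x)"
  shows "D (\<lambda>x. g (f x)) x v = g (D f x v)"
  by (rule fun_cong[OF frechet_derivative_at[OF bounded_linear.has_derivative[OF assms(1)
          has_derivative_D[OF assms(2)]], symmetric]])

lemma D_cong:
  assumes "f differentiable (at x)" "open S" "x \<in> S" "\<And>y. y \<in> S \<Longrightarrow> f y = g y"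
  shows "D g x = D f x" "g differentiable (at x)"
  using frechet_derivative_transform_within_open[OF assms]
    has_derivative_transform_within_open[OF has_derivative_D[OF assms(1)] assms(2-4)]
  by (auto intro: differentiableI)

lemma mvt_line:
  fixes f :: "'a::euclidean_space \<Rightarrow> real"
  assumes "\<And>\<tau>. 0 \<le> \<tau> \<Longrightarrow> \<tau> \<le> 1 \<Longrightarrow> f differentiable (at (x + \<tau> *\<^sub>R v))"
  obtains \<tau> where "0 \<le> \<tau>" "\<tau> \<le> 1" "f (x + v) - f x = D f (x + \<tau> *\<^sub>R v) v"
proof -
  have "\<exists>\<tau>\<in>{0..1}. f (x + 1 *\<^sub>R v) - f (x + 0 *\<^sub>R v) = D f (x + \<tau> *\<^sub>R v) ((1 - 0) *\<^sub>R v)"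
  proof (rule mvt_very_simple)
    fix \<tau> :: real assume t: "0 \<le> \<tau>" "\<tau> \<le> 1"
    have a: "((\<lambda>\<tau>. x + \<tau> *\<^sub>R v) has_derivative (\<lambda>h. h *\<^sub>R v)) (at \<tau> within {0..1})"
      by (auto intro!: derivative_eq_intros)
    show "((\<lambda>\<tau>. f (x + \<tau> *\<^sub>R v)) has_derivative (\<lambda>h. D f (x + \<tau> *\<^sub>R v) (h *\<^sub>R v))) (at \<tau> within {0..1})"
      by (rule has_derivative_compose[OF a has_derivative_D[OF assms[OF t]]])
  qed simp
  then show ?thesis using that by auto
qed

text \<open>The second difference of \<open>f\<close> over the parallelogram spanned by
  \<open>h v\<close> and \<open>h w\<close> is symmetric in \<open>v\<close> and \<open>w\<close>,
  and two mean value steps write it as \<open>h^2\<close> times either iterated derivative at a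
  nearby point. As \<open>h\<close> tends to 0, continuity gives equality at
  \<open>x\<close>.\<close>

lemma D_commute_real:
  fixes f :: "'a::euclidean_space \<Rightarrow> real"
  assumes "open S" "smooth_on S f" "x \<in> S"
  shows "D (\<lambda>y. D f y v) x w = D (\<lambda>y. D f y w) x v"
proof -
  obtain r where r: "r > 0" "ball x r \<subseteq> S" using assms(1,3) openE by blast
  \<comment> \<open>The summand 1 makes \<open>h * N\<close> strictly larger than the reach of the
    parallelogram, also when \<open>v = w = 0\<close>.\<close>
  define N where "N = norm v + norm w + 1"
  have N: "N > 0" unfolding N_def by (smt (verit) norm_ge_zero)
  have key: "\<exists>p\<in>ball x (h * N). f (x + h *\<^sub>R v + h *\<^sub>R w) - f (x + h *\<^sub>R v) - f (x + h *\<^sub>R w) + f x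
        = h\<^sup>2 * D (\<lambda>y. D f y v) p w"
    if h: "h > 0" "h * N < r" and N': "N = norm v + norm w + 1" for h v w
  proof -
    have near: "x + (s * h) *\<^sub>R v + (t * h) *\<^sub>R w \<in> ball x (h * N)"
      if "0 \<le> s" "s \<le> 1" "0 \<le> t" "t \<le> 1" for s t
    proof -
      have "norm ((s * h) *\<^sub>R v + (t * h) *\<^sub>R w) \<le> s * h * norm v + t * h * norm w"
        using norm_triangle_ineq[of "(s * h) *\<^sub>R v" "(t * h) *\<^sub>R w"] that h by simp
      also have "\<dots> \<le> h * norm v + h * norm w"
        using that h by (intro add_mono mult_right_mono) (auto simp: mult_left_le_one_le)
      also have "\<dots> < h * N" using h N' by (simp add: algebra_simps)
      finally have "norm ((s * h) *\<^sub>R v + (t * h) *\<^sub>R w) < h * N" .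
      moreover have "x + (s * h) *\<^sub>R v + (t * h) *\<^sub>R w - x = (s * h) *\<^sub>R v + (t * h) *\<^sub>R w" by simp
      ultimately show ?thesis unfolding mem_ball by (metis dist_commute dist_norm)
    qed
    have sub: "ball x (h * N) \<subseteq> S" using r(2) h(2) by (meson less_eq_real_def subset_ball subset_trans)
    have inS: "x + (s * h) *\<^sub>R v + (t * h) *\<^sub>R w \<in> S" if "0 \<le> s" "s \<le> 1" "0 \<le> t" "t \<le> 1" for s t
      using near[OF that] sub by blast
    have df: "f differentiable (at y)" if "y \<in> S" for y using smooth_on_differentiable[OF assms(2) that] .
    \<comment> \<open>First difference in direction \<open>w\<close>. The mean value theorem is
      applied to it along \<open>v\<close>, and then to \<open>\<lambda>y. D f y v\<close> along
      \<open>w\<close>.\<close>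
    define F where "F = (\<lambda>y. f (y + h *\<^sub>R w) - f y)"
    have dF: "F differentiable (at y)" "D F y u = D f (y + h *\<^sub>R w) u - D f y u"
      if "y \<in> S" "y + h *\<^sub>R w \<in> S" for y u
    proof -
      have "((\<lambda>y. f (y + h *\<^sub>R w)) has_derivative D f (y + h *\<^sub>R w)) (at y)"
        by (rule has_derivative_compose[of "\<lambda>y. y + h *\<^sub>R w" "\<lambda>y. y" y UNIV f, OF _ has_derivative_D[OF df[OF that(2)]]])
           (auto intro!: derivative_eq_intros)
      from has_derivative_diff[OF this has_derivative_D[OF df[OF that(1)]]]
      have "(F has_derivative (\<lambda>u. D f (y + h *\<^sub>R w) u - D f y u)) (at y)" unfolding F_def .
      then show "F differentiable (at y)" "D F y u = D f (y + h *\<^sub>R w) u - D f y u"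
        by (auto intro: differentiableI simp flip: frechet_derivative_at)
    qed
    obtain s where s: "0 \<le> s" "s \<le> 1" "F (x + h *\<^sub>R v) - F x = D F (x + s *\<^sub>R (h *\<^sub>R v)) (h *\<^sub>R v)"
    proof (rule mvt_line[of F x "h *\<^sub>R v"])
      fix s :: real assume "0 \<le> s" "s \<le> 1"
      then show "F differentiable (at (x + s *\<^sub>R (h *\<^sub>R v)))"
        using inS[of s 0] inS[of s 1] by (intro dF) auto
    qed (use that in auto)
    define y where "y = x + (s * h) *\<^sub>R v"
    define K where "K = (\<lambda>y. D f y v)"
    have y: "y \<in> S" "y + h *\<^sub>R w \<in> S" using inS[of s 0] inS[of s 1] s by (auto simp: y_def)
    have "F (x + h *\<^sub>R v) - F x = h * (K (y + h *\<^sub>R w) - K y)"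
    proof -
      have "F (x + h *\<^sub>R v) - F x = D F y (h *\<^sub>R v)" using s(3) by (simp add: y_def)
      also have "\<dots> = h * D f (y + h *\<^sub>R w) v - h * D f y v"
        using dF(2)[OF y, of "h *\<^sub>R v"] linear_cmul[OF linear_D[OF df[OF y(1)]], of h v]
          linear_cmul[OF linear_D[OF df[OF y(2)]], of h v] by simp
      finally show ?thesis by (simp add: K_def right_diff_distrib)
    qed
    moreover obtain t where t: "0 \<le> t" "t \<le> 1" "K (y + h *\<^sub>R w) - K y = D K (y + t *\<^sub>R (h *\<^sub>R w)) (h *\<^sub>R w)"
    proof (rule mvt_line[of K y "h *\<^sub>R w"])
      fix t :: real assume "0 \<le> t" "t \<le> 1"
      then show "K differentiable (at (y + t *\<^sub>R (h *\<^sub>R w)))"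
        using inS[of s t] s unfolding K_def
        by (intro smooth_on_differentiable[OF smooth_on_D[OF assms(2)]]) (auto simp: y_def)
    qed (use that in auto)
    moreover have p: "y + t *\<^sub>R (h *\<^sub>R w) \<in> ball x (h * N)"
      using near[OF s(1,2) t(1,2)] by (simp add: y_def)
    moreover have "D K (y + t *\<^sub>R (h *\<^sub>R w)) (h *\<^sub>R w) = h * D K (y + t *\<^sub>R (h *\<^sub>R w)) w"
      using linear_cmul[OF linear_D[OF smooth_on_differentiable[OF smooth_on_D[OF assms(2)]]]] p sub
      unfolding K_def by fastforce
    ultimately have "F (x + h *\<^sub>R v) - F x = h\<^sup>2 * D K (y + t *\<^sub>R (h *\<^sub>R w)) w"
      by (simp add: power2_eq_square)
    then show ?thesis using p unfolding F_def K_def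
      by (intro bexI[of _ "y + t *\<^sub>R (h *\<^sub>R w)"]) (simp_all add: algebra_simps)
  qed
  \<comment> \<open>A positive null sequence; the factor 2 makes \<open>a n * N < r\<close> strict
    already at \<open>n = 0\<close>.\<close>
  define a where "a = (\<lambda>n::nat. r / (2 * N * (real n + 1)))"
  have a: "a n > 0" "a n * N < r" for n
  proof -
    show "a n > 0" using r N by (simp add: a_def)
    have "a n * N = r / (2 * (real n + 1))" using N by (simp add: a_def)
    also have "\<dots> < r" using r(1) by (simp add: field_simps add_pos_nonneg)
    finally show "a n * N < r" .
  qed
  have aN: "(\<lambda>n. a n * N) \<longlonglongrightarrow> 0"
  proof -
    have "(\<lambda>n. (r/2) * inverse (real (Suc n))) \<longlonglongrightarrow> (r/2) * 0"
      by (intro tendsto_mult LIMSEQ_inverse_real_of_nat tendsto_const)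
    moreover have "(\<lambda>n. a n * N) = (\<lambda>n. (r/2) * inverse (real (Suc n)))"
      using N by (auto simp: a_def fun_eq_iff divide_simps)
    ultimately show ?thesis by simp
  qed
  have "\<exists>z. fst z \<in> ball x (a n * N) \<and> snd z \<in> ball x (a n * N) \<and>
      D (\<lambda>y. D f y v) (fst z) w = D (\<lambda>y. D f y w) (snd z) v" for n
  proof -
    obtain p where p: "p \<in> ball x (a n * N)"
      "f (x + a n *\<^sub>R v + a n *\<^sub>R w) - f (x + a n *\<^sub>R v) - f (x + a n *\<^sub>R w) + f x = (a n)\<^sup>2 * D (\<lambda>y. D f y v) p w"
      using key[of "a n" v w, OF a] N_def by auto
    obtain q where q: "q \<in> ball x (a n * N)"
      "f (x + a n *\<^sub>R w + a n *\<^sub>R v) - f (x + a n *\<^sub>R w) - f (x + a n *\<^sub>R v) + f x = (a n)\<^sup>2 * D (\<lambda>y. D f y w) q v"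
      using key[of "a n" w v, OF a] N_def by auto
    have "(a n)\<^sup>2 * D (\<lambda>y. D f y v) p w = (a n)\<^sup>2 * D (\<lambda>y. D f y w) q v"
      unfolding p(2)[symmetric] q(2)[symmetric] by (simp add: add.commute add.left_commute)
    then have "D (\<lambda>y. D f y v) p w = D (\<lambda>y. D f y w) q v" using a(1)[of n] by simp
    then show ?thesis using p(1) q(1) by (intro exI[of _ "(p, q)"]) auto
  qed
  then obtain z where z: "\<forall>n. fst (z n) \<in> ball x (a n * N) \<and> snd (z n) \<in> ball x (a n * N) \<and>
      D (\<lambda>y. D f y v) (fst (z n)) w = D (\<lambda>y. D f y w) (snd (z n)) v"
    using choice[of "\<lambda>n z. fst z \<in> ball x (a n * N) \<and> snd z \<in> ball x (a n * N) \<and>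
      D (\<lambda>y. D f y v) (fst z) w = D (\<lambda>y. D f y w) (snd z) v"] by blast
  define p q where "p n = fst (z n)" and "q n = snd (z n)" for n
  have pq: "\<And>n. p n \<in> ball x (a n * N)" "\<And>n. q n \<in> ball x (a n * N)"
    "\<And>n. D (\<lambda>y. D f y v) (p n) w = D (\<lambda>y. D f y w) (q n) v"
    using z by (auto simp: p_def q_def)
  have lim: "z \<longlonglongrightarrow> x" if "\<And>n. z n \<in> ball x (a n * N)" for z
  proof (rule metric_tendsto_imp_tendsto[OF aN], rule always_eventually, rule allI)
    fix n show "dist (z n) x \<le> dist (a n * N) 0"
      using that[of n] unfolding mem_ball dist_real_def dist_commute[of x] by simp
  qed
  have cont: "isCont (\<lambda>y. D (\<lambda>y. D f y v) y w) x" for v w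
    using smooth_on_imp_continuous[OF smooth_on_D[OF smooth_on_D[OF assms(2)]]] assms(1,3)
    by (simp add: continuous_on_eq_continuous_at)
  have "(\<lambda>n. D (\<lambda>y. D f y v) (p n) w) \<longlonglongrightarrow> D (\<lambda>y. D f y v) x w"
    by (rule isCont_tendsto_compose[OF cont lim[OF pq(1)]])
  moreover have "(\<lambda>n. D (\<lambda>y. D f y v) (p n) w) \<longlonglongrightarrow> D (\<lambda>y. D f y w) x v"
    unfolding pq(3) by (rule isCont_tendsto_compose[OF cont lim[OF pq(2)]])
  ultimately show ?thesis by (rule LIMSEQ_unique)
qed

lemma D_commute:
  fixes f :: "'a::euclidean_space \<Rightarrow> 'b::euclidean_space"
  assumes "open S" "smooth_on S f" "x \<in> S"
  shows "D (\<lambda>y. D f y v) x w = D (\<lambda>y. D f y w) x v"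
proof (rule euclidean_eqI)
  fix b :: 'b assume "b \<in> Basis"
  have bl: "bounded_linear (\<lambda>y. y \<bullet> b)" by (rule bounded_linear_inner_left)
  have 1: "D (\<lambda>y. f y \<bullet> b) y v = D f y v \<bullet> b" if "y \<in> S" for y v
    by (rule D_linear_compose[OF bl smooth_on_differentiable[OF assms(2) that]])
  have 2: "D (\<lambda>y. D (\<lambda>y. f y \<bullet> b) y v) x w = D (\<lambda>y. D f y v) x w \<bullet> b" for v w
  proof -
    have d: "(\<lambda>y. D f y v) differentiable (at x)"
      by (rule smooth_on_differentiable[OF smooth_on_D[OF assms(2)] assms(3)])
    have "(\<lambda>y. D f y v \<bullet> b) differentiable (at x)"
      using d by (rule differentiable_inner) simp
    then have "D (\<lambda>y. D (\<lambda>y. f y \<bullet> b) y v) x = D (\<lambda>y. D f y v \<bullet> b) x"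
      by (rule D_cong(1)[OF _ assms(1,3)]) (simp add: 1)
    then show ?thesis using D_linear_compose[OF bl d] by simp
  qed
  show "D (\<lambda>y. D f y v) x w \<bullet> b = D (\<lambda>y. D f y w) x v \<bullet> b"
    unfolding 2[symmetric]
    by (rule D_commute_real[OF assms(1) smooth_on_linear_compose[OF bl assms(1,2)] assms(3)])
qed

text \<open>With \<open>k\<close> the second \<open>t\<close>-derivative, two mean value steps in
  \<open>t\<close> give \<open>g (t, z) = t * (\<tau> * t) * k (\<sigma> * \<tau> * t, z)\<close>.
  The bound holds on a neighbourhood of \<open>(0, z0)\<close> in both variables, which is what a
  covering argument needs.\<close>

lemma taylor_quadratic:
  fixes g :: "real \<times> 'b::euclidean_space \<Rightarrow> real"
  assumes "\<delta> > 0" "open U" "smooth_on ({-\<delta><..<\<delta>} \<times> U) g" "z0 \<in> U"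
    and g0: "\<And>z. z \<in> U \<Longrightarrow> g (0, z) = 0" "\<And>z. z \<in> U \<Longrightarrow> D g (0, z) (1, 0) = 0"
  shows "\<exists>M. \<forall>\<^sub>F p in nhds (0, z0). \<bar>g p\<bar> \<le> M * (fst p)\<^sup>2"
proof -
  define S where "S = {-\<delta><..<\<delta>} \<times> U"
  define k where "k = (\<lambda>p. D (\<lambda>q. D g q (1,0)) p (1,0))"
  have oS: "open S" unfolding S_def using assms(2) by (auto intro: open_Times)
  have x0: "(0, z0) \<in> S" using assms by (auto simp: S_def)
  have sm: "smooth_on S g" using assms(3) by (simp add: S_def)
  have "isCont k (0, z0)"
    using smooth_on_imp_continuous[OF smooth_on_D[OF smooth_on_D[OF sm]]] oS x0
    unfolding k_def by (simp add: continuous_on_eq_continuous_at)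
  then have "\<forall>\<^sub>F p in nhds (0, z0). dist (k p) (k (0, z0)) < 1"
    unfolding isCont_def tendsto_iff eventually_at_filter eventually_nhds
    by (metis UNIV_I dist_self zero_less_one)
  moreover have "\<forall>\<^sub>F p in nhds (0, z0). p \<in> S" using oS x0 eventually_nhds_in_open by blast
  ultimately have "\<forall>\<^sub>F p in nhds (0, z0). p \<in> S \<and> dist (k p) (k (0, z0)) < 1" by eventually_elim simp
  then obtain P where P: "open P" "(0, z0) \<in> P" "\<And>p. p \<in> P \<Longrightarrow> p \<in> S \<and> dist (k p) (k (0, z0)) < 1"
    unfolding eventually_nhds by blast
  from open_prod_elim[OF P(1,2)] obtain T Z where TZ: "open T" "open Z" "(0, z0) \<in> T \<times> Z" "T \<times> Z \<subseteq> P" by blast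
  then obtain r where r: "r > 0" "ball 0 r \<subseteq> T" using openE[of T 0] by auto
  \<comment> \<open>On \<open>P\<close> the function \<open>k\<close> differs by less than 1 from
    its value at the centre.\<close>
  define M where "M = \<bar>k (0, z0)\<bar> + 1"
  have bound: "norm (g p) \<le> M * norm ((fst p)\<^sup>2)" if p: "p \<in> ball 0 r \<times> Z" for p
  proof -
    obtain t z where tz: "p = (t, z)" by (cases p)
    have in_P: "(\<tau> * t, z) \<in> P" if "0 \<le> \<tau>" "\<tau> \<le> 1" for \<tau>
    proof -
      have "\<bar>\<tau> * t\<bar> \<le> \<bar>t\<bar>" using that by (simp add: abs_mult mult_left_le_one_le)
      then have "\<tau> * t \<in> ball 0 r" using p tz by auto
      then show ?thesis using p tz r(2) TZ(4) by blast
    qed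
    have in_S: "(\<tau> * t, z) \<in> S" if "0 \<le> \<tau>" "\<tau> \<le> 1" for \<tau> using in_P[OF that] P by blast
    have z: "z \<in> U" using in_S[of 0] by (simp add: S_def)
    have scale: "(t, 0) = t *\<^sub>R (1, 0::'b)" by simp
    obtain \<tau> where \<tau>: "0 \<le> \<tau>" "\<tau> \<le> 1" "g ((0,z) + (t,0)) - g (0,z) = D g ((0,z) + \<tau> *\<^sub>R (t,0)) (t,0)"
      by (rule mvt_line[of g "(0,z)" "(t,0)"])
        (use smooth_on_differentiable[OF sm] in_S in auto)
    then have 1: "g p = t * D g (\<tau> * t, z) (1,0)"
      using linear_cmul[OF linear_D[OF smooth_on_differentiable[OF sm in_S[OF \<tau>(1,2)]]], of t "(1,0)"] g0(1)[OF z]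
      by (simp add: tz)
    define K where "K = (\<lambda>q. D g q (1,0))"
    have smK: "smooth_on S K" unfolding K_def by (rule smooth_on_D[OF sm])
    have mem: "0 \<le> \<sigma> * \<tau>" "\<sigma> * \<tau> \<le> 1" if "0 \<le> \<sigma>" "\<sigma> \<le> 1" for \<sigma>
      using that \<tau> by (auto intro: mult_le_one)
    obtain \<sigma> where \<sigma>: "0 \<le> \<sigma>" "\<sigma> \<le> 1" "K ((0,z) + (\<tau> * t,0)) - K (0,z) = D K ((0,z) + \<sigma> *\<^sub>R (\<tau> * t,0)) (\<tau> * t,0)"
      by (rule mvt_line[of K "(0,z)" "(\<tau> * t,0)"])
        (use smooth_on_differentiable[OF smK] in_S[OF mem] in \<open>auto simp: mult.assoc\<close>)
    have s: "(\<sigma> * \<tau> * t, z) \<in> S" "(\<sigma> * \<tau> * t, z) \<in> P" using in_S in_P mem \<sigma> by auto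
    have 2: "D g (\<tau> * t, z) (1,0) = \<tau> * t * k (\<sigma> * \<tau> * t, z)"
      using \<sigma>(3) g0(2)[OF z] linear_cmul[OF linear_D[OF smooth_on_differentiable[OF smK s(1)]], of "\<tau> * t" "(1,0)"]
      by (simp add: K_def k_def mult.assoc)
    have "\<bar>k (\<sigma> * \<tau> * t, z)\<bar> \<le> M" using P(3)[OF s(2)] unfolding M_def dist_real_def by linarith
    moreover have "g p = t\<^sup>2 * (\<tau> * k (\<sigma> * \<tau> * t, z))" using 1 2 by (simp add: power2_eq_square)
    ultimately have "\<bar>g p\<bar> \<le> t\<^sup>2 * (1 * M)"
      using \<tau>(1,2) by (simp only: abs_mult) (intro mult_mono; simp)
    then show ?thesis by (simp add: tz mult.commute)
  qed
  have "\<forall>\<^sub>F p in nhds (0, z0). p \<in> ball 0 r \<times> Z"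
    using TZ r by (intro eventually_nhds_in_open open_Times) auto
  then have "\<forall>\<^sub>F p in nhds (0, z0). \<bar>g p\<bar> \<le> M * (fst p)\<^sup>2"
    by eventually_elim (use bound in simp)
  then show ?thesis by blast
qed

text \<open>The finitely many local radii have a positive minimum and the local constants a maximum;
  \<open>mono\<close> permits passing to the latter.\<close>

lemma compact_uniform_bound:
  fixes P :: "real \<Rightarrow> real \<Rightarrow> 'a::topological_space \<Rightarrow> bool"
  assumes "compact C"
    and "\<And>q. q \<in> C \<Longrightarrow> \<exists>U \<delta> K. open U \<and> q \<in> U \<and> \<delta> > 0 \<and> (\<forall>t q'. \<bar>t\<bar> < \<delta> \<longrightarrow> q' \<in> U \<longrightarrow> P K t q')"
    and mono: "\<And>K K' t q. K \<le> K' \<Longrightarrow> P K t q \<Longrightarrow> P K' t q"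
  shows "\<exists>\<delta>>0. \<exists>K. \<forall>t q. \<bar>t\<bar> < \<delta> \<longrightarrow> q \<in> C \<longrightarrow> P K t q"
proof -
  obtain U \<delta> K where U: "\<And>q. q \<in> C \<Longrightarrow> open (U q) \<and> q \<in> U q \<and> \<delta> q > 0 \<and> (\<forall>t q'. \<bar>t\<bar> < \<delta> q \<longrightarrow> q' \<in> U q \<longrightarrow> P (K q) t q')"
    using assms(2) by metis
  then obtain F where F: "F \<subseteq> C" "finite F" "C \<subseteq> (\<Union>q\<in>F. U q)"
    using compactE_image[OF assms(1), of C U] by (metis (no_types, lifting) UN_I subsetI)
  \<comment> \<open>The inserted values keep \<open>Min\<close> and \<open>Max\<close> meaningful
    when \<open>F\<close> is empty, as for empty \<open>C\<close>.\<close>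
  define d where "d = Min (insert 1 (\<delta> ` F))"
  define k where "k = Max (insert 0 (K ` F))"
  have "d > 0" unfolding d_def using F U by (subst Min_gr_iff) auto
  moreover have "d \<le> \<delta> q" "K q \<le> k" if "q \<in> F" for q
    unfolding d_def k_def using F(2) that by (auto intro: Min_le Max_ge)
  moreover have "P k t q" if t: "\<bar>t\<bar> < d" and q: "q \<in> C" for t q
  proof -
    obtain p where p: "p \<in> F" "q \<in> U p" using F(3) q by blast
    then have "\<bar>t\<bar> < \<delta> p" "K p \<le> k" using t calculation(2,3)[OF p(1)] by auto
    then show ?thesis using U[of p] F(1) p mono by blast
  qed
  ultimately show ?thesis by blast
qed

section \<open>Bivectors of \<open>\<real>\<^sup>4\<close>\<close>

definition sg :: "geometry \<Rightarrow> 4 \<Rightarrow> real" where "sg s i = ip s (axis i 1) (axis i 1)"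

lemma ip_sum: "ip s x y = (\<Sum>i\<in>UNIV. sg s i * x $ i * y $ i)"
  by (cases s) (simp_all add: sg_def sum_4 pform_0 pform_3 axis_def)

lemma sg_sq: "sg s i * sg s i = 1"
proof -
  have "\<forall>i. sg s i * sg s i = 1"
    unfolding forall_4 by (cases s) (simp_all add: sg_def pform_0 pform_3 axis_def)
  then show ?thesis by blast
qed

lemma eps_sq [simp]: "eps s * eps s = 1" "eps s * (eps s * r) = r" by (cases s; simp)+

lemma eps_mult_eps: "(eps s * x) * (eps s * y) = x * y"
  by (cases s) simp_all

lemma eps_nz [simp]: "eps s \<noteq> 0" by (cases s) auto

lemma bilinear_ip: "bilinear (ip s)"
  by (auto simp: bilinear_def ip_sum sum.distrib[symmetric] sum_distrib_left algebra_simps intro!: linearI sum.cong)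

interpretation ip: bounded_bilinear "ip s" for s
  using bilinear_ip bilinear_conv_bounded_bilinear by blast

interpretation wedge: bounded_bilinear "(\<and>\<and>)"
  unfolding bilinear_conv_bounded_bilinear[symmetric]
  by (auto simp: bilinear_def wedge_def vec_eq_iff algebra_simps intro!: linearI)

lemma ip_commute: "ip s x y = ip s y x"
  by (simp add: ip_sum mult.commute mult.left_commute)

lemma wedge_self [simp]: "x \<and>\<and> x = 0" by (simp add: wedge_def vec_eq_iff)

lemma wedge_commute: "y \<and>\<and> x = - (x \<and>\<and> y)" by (simp add: wedge_def vec_eq_iff)

text \<open>The pairing \<open>v \<and> w\<close> of bivectors, with values in \<open>\<Lambda>\<^sup>4(\<real>\<^sup>4) = \<real>\<close>.\<close>

definition plk :: "real^4^4 \<Rightarrow> real^4^4 \<Rightarrow> real" where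
  "plk a b = a$1$2 * b$3$4 - a$1$3 * b$2$4 + a$1$4 * b$2$3
           + a$3$4 * b$1$2 - a$2$4 * b$1$3 + a$2$3 * b$1$4"

interpretation plk: bounded_bilinear plk
  unfolding bilinear_conv_bounded_bilinear[symmetric]
  by (auto simp: bilinear_def plk_def algebra_simps intro!: linearI)

lemma plk_commute: "plk a b = plk b a" by (simp add: plk_def)

lemma det_4: "det (A::real^4^4) =
    A$1$1 * (A$2$2 * (A$3$3 * A$4$4 - A$3$4 * A$4$3) - A$2$3 * (A$3$2 * A$4$4 - A$3$4 * A$4$2) + A$2$4 * (A$3$2 * A$4$3 - A$3$3 * A$4$2))
  - A$1$2 * (A$2$1 * (A$3$3 * A$4$4 - A$3$4 * A$4$3) - A$2$3 * (A$3$1 * A$4$4 - A$3$4 * A$4$1) + A$2$4 * (A$3$1 * A$4$3 - A$3$3 * A$4$1))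
  + A$1$3 * (A$2$1 * (A$3$2 * A$4$4 - A$3$4 * A$4$2) - A$2$2 * (A$3$1 * A$4$4 - A$3$4 * A$4$1) + A$2$4 * (A$3$1 * A$4$2 - A$3$2 * A$4$1))
  - A$1$4 * (A$2$1 * (A$3$2 * A$4$3 - A$3$3 * A$4$2) - A$2$2 * (A$3$1 * A$4$3 - A$3$3 * A$4$1) + A$2$3 * (A$3$1 * A$4$2 - A$3$2 * A$4$1))"
proof -
  have f1: "finite {2::4, 3, 4}" "1 \<notin> {2::4, 3, 4}" by auto
  have f2: "finite {3::4, 4}" "2 \<notin> {3::4, 4}" by auto
  have f3: "finite {4::4}" "3 \<notin> {4::4}" by auto
  show ?thesis
    unfolding det_def UNIV_4
    unfolding sum_over_permutations_insert[OF f1] sum_over_permutations_insert[OF f2]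
      sum_over_permutations_insert[OF f3] permutes_sing
    by (simp add: sign_swap_id permutation_swap_id permutation_compose sign_compose sign_id swap_id_eq algebra_simps)
qed

lemma vector_4:
  "(vector [a,b,c,d] :: 'a::zero^4) $ 1 = a" "(vector [a,b,c,d] :: 'a^4) $ 2 = b"
  "(vector [a,b,c,d] :: 'a^4) $ 3 = c" "(vector [a,b,c,d] :: 'a^4) $ 4 = d"
  by (simp_all add: vector_def)

lemma plk_det: "plk (a \<and>\<and> b) (c \<and>\<and> d) = det (vector [a, b, c, d])"
  by (simp add: det_4 plk_def wedge_def vector_4 algebra_simps)

text \<open>A cyclic permutation of the last three vectors is even, so the determinant is
  unchanged.\<close>

lemma plk_rot: "plk (x \<and>\<and> a) (b \<and>\<and> n) = plk (x \<and>\<and> n) (a \<and>\<and> b)"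
  by (simp add: plk_def wedge_def algebra_simps)

text \<open>The Gram matrix is \<open>M ** E ** transpose M\<close> with \<open>E\<close> the
  diagonal matrix of the form; in the hyperbolic case three minus signs make \<open>det E\<close>
  negative.\<close>

lemma gram_det:
  "det (\<chi> i j. ip s ((vector [a,b,c,d] :: real^4^4) $ i) ((vector [a,b,c,d] :: real^4^4) $ j) :: real^4^4)
    = eps s * (plk (a \<and>\<and> b) (c \<and>\<and> d))\<^sup>2"
proof -
  define M :: "real^4^4" where "M = vector [a,b,c,d]"
  define E :: "real^4^4" where "E = (\<chi> i j. if i = j then sg s i else 0)"
  have "det E = eps s" 
    by (cases s) (simp_all add: E_def det_4 sg_def pform_0 pform_3 axis_def)
  moreover have "(\<chi> i j. ip s (M $ i) (M $ j)) = M ** E ** transpose M"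
    unfolding vec_eq_iff forall_4
    by (simp add: matrix_matrix_mult_def transpose_def E_def ip_sum sum_4 mult_ac)
  ultimately show ?thesis
    by (simp add: M_def[symmetric] plk_det det_mul power2_eq_square)
qed

text \<open>The Gram matrix is block diagonal: 1 for \<open>x\<close>, the block of \<open>a\<close>
  and \<open>b\<close>, and \<open>ip s r r\<close>.\<close>

lemma gram_orth:
  assumes "ip s x x = 1" "ip s x a = 0" "ip s x b = 0" "ip s x r = 0" "ip s a r = 0" "ip s b r = 0"
  shows "eps s * (plk (x \<and>\<and> a) (b \<and>\<and> r))\<^sup>2 = (ip s a a * ip s b b - (ip s a b)\<^sup>2) * ip s r r"
proof -
  have c: "ip s a x = 0" "ip s b x = 0" "ip s r x = 0" "ip s r a = 0" "ip s r b = 0" "ip s b a = ip s a b"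
    using assms ip_commute by metis+
  show ?thesis unfolding gram_det[symmetric] det_4
    by (simp add: assms c vector_4 power2_eq_square algebra_simps)
qed

text \<open>A non-zero determinant makes the four vectors a basis, and the form is non-degenerate.
  Identities between vectors are proved below by testing the difference against a frame in this
  way.\<close>

lemma plk_nondegenerate:
  assumes "plk (a \<and>\<and> b) (c \<and>\<and> d) \<noteq> 0" "ip s a r = 0" "ip s b r = 0" "ip s c r = 0" "ip s d r = 0"
  shows "r = 0"
proof -
  define M :: "real^4^4" where "M = vector [a,b,c,d]"
  have "invertible M" using assms(1) by (simp add: plk_det M_def invertible_det_nz)
  moreover have "M *v (\<chi> i. sg s i * r $ i) = 0"
  proof -
    have "(M *v (\<chi> i. sg s i * r $ i)) $ j = ip s (M $ j) r" for j
      by (simp add: matrix_vector_mult_def ip_sum mult.commute mult.left_commute)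
    moreover have "ip s (M $ j) r = 0" for j
      using exhaust_4[of j] assms(2-5) by (auto simp: M_def vector_4)
    ultimately show ?thesis by (simp add: vec_eq_iff)
  qed
  ultimately have "(\<chi> i. sg s i * r $ i) = 0"
    using invertible_eq_bij matrix_left_invertible_ker invertible_def by metis
  then show ?thesis using sg_sq[of s] by (simp add: vec_eq_iff) (metis mult_eq_0_iff zero_neq_one)
qed

text \<open>Changing signs of coordinates turns orthogonality for the form into Euclidean
  orthogonality, and three vectors do not span a space of dimension four.\<close>

lemma ex_orthogonal: "\<exists>r. r \<noteq> 0 \<and> ip s a r = 0 \<and> ip s b r = 0 \<and> ip s c r = 0"
proof -
  define E :: "real^4 \<Rightarrow> real^4" where "E x = (\<chi> i. sg s i * x $ i)" for x
  have "dim {E a, E b, E c} \<le> card {E a, E b, E c}" by (rule dim_le_card') simp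
  also have "\<dots> \<le> 3" by (simp add: card_insert_if)
  finally have "dim {E a, E b, E c} < DIM(real^4)" by simp
  then obtain r where r: "r \<noteq> 0" "\<And>y. y \<in> span {E a, E b, E c} \<Longrightarrow> orthogonal r y"
    using orthogonal_to_subspace_exists by blast
  have "E x \<bullet> r = ip s x r" for x by (simp add: E_def inner_vec_def ip_sum)
  then show ?thesis using r(2)[OF span_base, of "E a"] r(2)[OF span_base, of "E b"] r(2)[OF span_base, of "E c"] r(1)
    by (auto simp: orthogonal_def inner_commute)
qed

lemma ambient_ip: "x \<in> ambient s \<Longrightarrow> ip s x x = 1" by (cases s) auto

text \<open>In the hyperbolic case \<open>x\<close> spans the one positive direction, so its
  orthogonal complement is negative definite: for a counterexample \<open>z\<close>, Cauchy-Schwarz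
  on the first three coordinates forces \<open>z $ 4 = 0\<close> and then \<open>z = 0\<close>. The
  square roots that normalise vectors below rest on this.\<close>

lemma ambient_definite:
  assumes "x \<in> ambient s" "ip s x z = 0" "z \<noteq> 0"
  shows "eps s * ip s z z > 0"
proof (cases s)
  case Spherical
  have "ip s z z = z \<bullet> z" using Spherical by (simp add: pform_0 inner_vec_def sum_4)
  then show ?thesis using assms(3) Spherical by simp
next
  case Hyperbolic
  define X Z :: "real^3" where "X = vector [x$1, x$2, x$3]" and "Z = vector [z$1, z$2, z$3]"
  have xx: "(x$4)\<^sup>2 = 1 + X \<bullet> X" and xz: "x$4 * z$4 = X \<bullet> Z" and zz: "ip s z z = (z$4)\<^sup>2 - Z \<bullet> Z"
    using assms Hyperbolic by (auto simp: pform_3 inner_vec_def sum_3 X_def Z_def power2_eq_square)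
  show ?thesis
  proof (rule ccontr)
    assume "\<not> ?thesis"
    then have le: "Z \<bullet> Z \<le> (z$4)\<^sup>2" using zz Hyperbolic by simp
    have "(X \<bullet> Z)\<^sup>2 \<le> (X \<bullet> X) * (Z \<bullet> Z)" by (rule Cauchy_Schwarz_ineq)
    also have "\<dots> \<le> (X \<bullet> X) * (z$4)\<^sup>2" using le by (intro mult_left_mono) auto
    finally have "(x$4)\<^sup>2 * (z$4)\<^sup>2 \<le> (X \<bullet> X) * (z$4)\<^sup>2" by (simp add: xz[symmetric] power_mult_distrib)
    then have "(z$4)\<^sup>2 \<le> 0" unfolding xx by (simp add: algebra_simps)
    then have z4: "z$4 = 0" by simp
    then have "Z = 0" using le by (metis inner_gt_zero_iff not_less power_zero_numeral)
    then have "z = 0" using z4 by (simp add: Z_def vec_eq_iff forall_3 forall_4 vector_3)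
    then show False using assms(3) by simp
  qed
qed

section \<open>The structures on the space of geodesics\<close>

lemma geodesic_frame_ip:
  assumes "geodesic_frame s x y"
  shows "ip s x x = 1" "ip s y y = eps s" "ip s x y = 0" "ip s y x = 0" "x \<in> ambient s"
  using assms ip_commute[of s y x] by (auto simp: geodesic_frame_def ambient_ip)

lemma orth_plane_ip:
  assumes "X \<in> orth_plane s x y"
  shows "ip s x X = 0" "ip s y X = 0" "ip s X x = 0" "ip s X y = 0"
  using assms ip_commute[of s X] by (auto simp: orth_plane_def)

lemma orth_plane_add: "X \<in> orth_plane s x y \<Longrightarrow> Y \<in> orth_plane s x y \<Longrightarrow> X + Y \<in> orth_plane s x y"
  by (simp add: orth_plane_def ip.add_right)

lemma orth_plane_diff: "X \<in> orth_plane s x y \<Longrightarrow> Y \<in> orth_plane s x y \<Longrightarrow> X - Y \<in> orth_plane s x y"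
  by (simp add: orth_plane_def ip.diff_right)

lemma orth_plane_scaleR: "X \<in> orth_plane s x y \<Longrightarrow> c *\<^sub>R X \<in> orth_plane s x y"
  by (simp add: orth_plane_def ip.scaleR_right)

lemma orth_plane_uminus: "X \<in> orth_plane s x y \<Longrightarrow> - X \<in> orth_plane s x y"
  by (simp add: orth_plane_def ip.minus_right)

lemmas orth_plane_intros = orth_plane_add orth_plane_diff orth_plane_scaleR orth_plane_uminus

lemma orth_plane_eqI:
  assumes "geodesic_frame s x y" "Z \<in> orth_plane s x y" "Z' \<in> orth_plane s x y"
    and "\<And>A. A \<in> orth_plane s x y \<Longrightarrow> ip s A Z = ip s A Z'"
  shows "Z = Z'"
proof (rule ccontr)
  assume "Z \<noteq> Z'"
  have m: "Z - Z' \<in> orth_plane s x y" by (intro orth_plane_intros assms)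
  have "eps s * ip s (Z - Z') (Z - Z') > 0"
    using assms(1) \<open>Z \<noteq> Z'\<close> orth_plane_ip[OF m] by (intro ambient_definite[of x]) (auto simp: geodesic_frame_def)
  moreover have "ip s (Z - Z') (Z - Z') = 0"
    using assms(4)[OF m] by (simp add: ip.diff_right)
  ultimately show False by simp
qed

lemma ex_unit_orthogonal:
  assumes "x \<in> ambient s"
  shows "\<exists>e. ip s x e = 0 \<and> ip s b e = 0 \<and> ip s c e = 0 \<and> ip s e e = eps s"
proof -
  obtain r where r: "r \<noteq> 0" "ip s x r = 0" "ip s b r = 0" "ip s c r = 0"
    using ex_orthogonal by blast
  define q where "q = eps s * ip s r r"
  have q: "q > 0" unfolding q_def by (rule ambient_definite[OF assms r(2,1)])
  have "ip s r r = eps s * q" by (simp add: q_def)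
  then have "ip s ((1 / sqrt q) *\<^sub>R r) ((1 / sqrt q) *\<^sub>R r) = eps s"
    using q by (simp add: ip.scaleR_left ip.scaleR_right)
  then show ?thesis using r by (intro exI[of _ "(1 / sqrt q) *\<^sub>R r"]) (simp add: ip.scaleR_right)
qed

text \<open>The Gram determinant of such a frame is \<open>eps s\<close>, which leaves only
  \<open>1\<close> and \<open>-1\<close> for the determinant of the frame itself.\<close>

lemma orthonormal_plk:
  assumes "geodesic_frame s x y" "e1 \<in> orth_plane s x y" "e2 \<in> orth_plane s x y"
    "ip s e1 e1 = eps s" "ip s e2 e2 = eps s" "ip s e1 e2 = 0"
  shows "(plk (x \<and>\<and> y) (e1 \<and>\<and> e2))\<^sup>2 = 1"
proof -
  note f = geodesic_frame_ip[OF assms(1)] orth_plane_ip[OF assms(2)] orth_plane_ip[OF assms(3)]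
  have "eps s * (plk (x \<and>\<and> y) (e1 \<and>\<and> e2))\<^sup>2 = eps s"
    by (subst gram_orth) (simp_all add: f assms)
  then show ?thesis using eps_nz[of s] by simp
qed

lemma oriented_orthonormal_plk:
  assumes "geodesic_frame s x y" "oriented_orthonormal s x y e1 e2"
  shows "plk (x \<and>\<and> y) (e1 \<and>\<and> e2) = 1"
  using orthonormal_plk[OF assms(1), of e1 e2] assms(2)
  by (simp add: oriented_orthonormal_def plk_det power2_eq_1_iff)

lemma ex_oriented_orthonormal:
  assumes "geodesic_frame s x y"
  shows "\<exists>e1 e2. oriented_orthonormal s x y e1 e2"
proof -
  note f = geodesic_frame_ip[OF assms]
  obtain e1 where e1: "ip s x e1 = 0" "ip s y e1 = 0" "ip s e1 e1 = eps s"
    using ex_unit_orthogonal[OF f(5), of y y] by blast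
  obtain e2 where e2: "ip s x e2 = 0" "ip s y e2 = 0" "ip s e1 e2 = 0" "ip s e2 e2 = eps s"
    using ex_unit_orthogonal[OF f(5), of y e1] by blast
  have "(plk (x \<and>\<and> y) (e1 \<and>\<and> e2))\<^sup>2 = 1"
    by (rule orthonormal_plk[OF assms]) (use e1 e2 in \<open>auto simp: orth_plane_def\<close>)
  then consider "plk (x \<and>\<and> y) (e1 \<and>\<and> e2) = 1" | "plk (x \<and>\<and> y) (e1 \<and>\<and> (- e2)) = 1"
    by (auto simp: power2_eq_1_iff wedge.minus_right plk.minus_right)
  then show ?thesis
  proof cases
    case 1
    then have "oriented_orthonormal s x y e1 e2"
      using e1 e2 unfolding oriented_orthonormal_def plk_det[symmetric] by (auto simp: orth_plane_def)
    then show ?thesis by blast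
  next
    case 2
    then have "oriented_orthonormal s x y e1 (- e2)"
      using e1 e2 unfolding oriented_orthonormal_def plk_det[symmetric]
      by (auto simp: orth_plane_def ip.minus_right ip.minus_left)
    then show ?thesis by blast
  qed
qed

lemma frame_expand:
  assumes "geodesic_frame s x y" "oriented_orthonormal s x y e1 e2" "Z \<in> orth_plane s x y"
  obtains a b where "Z = a *\<^sub>R e1 + b *\<^sub>R e2"
proof -
  define a b where "a = eps s * ip s e1 Z" and "b = eps s * ip s e2 Z"
  have o: "e1 \<in> orth_plane s x y" "e2 \<in> orth_plane s x y" "ip s e1 e1 = eps s" "ip s e2 e2 = eps s"
    "ip s e1 e2 = 0" "ip s e2 e1 = 0"
    using assms(2) ip_commute[of s e2 e1] by (auto simp: oriented_orthonormal_def)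
  note f = geodesic_frame_ip[OF assms(1)] orth_plane_ip[OF o(1)] orth_plane_ip[OF o(2)] orth_plane_ip[OF assms(3)]
  have "Z - (a *\<^sub>R e1 + b *\<^sub>R e2) = 0"
    by (rule plk_nondegenerate[of x y e1 e2 s])
      (use oriented_orthonormal_plk[OF assms(1,2)] in
        \<open>simp_all add: f o ip.diff_right ip.add_right ip.scaleR_right a_def b_def\<close>)
  then show ?thesis using that by simp
qed

text \<open>The right-hand side involves the vector \<open>a *\<^sub>R e1 + b *\<^sub>R e2\<close>
  but not the frame in which it is expanded. Together with \<open>orth_plane_eqI\<close> this makes
  \<open>rot\<close> well defined.\<close>

lemma frame_rot:
  assumes "geodesic_frame s x y" "oriented_orthonormal s x y e1 e2" "A \<in> orth_plane s x y"
  shows "ip s A (a *\<^sub>R e2 - b *\<^sub>R e1) = - eps s * plk (x \<and>\<and> y) (A \<and>\<and> (a *\<^sub>R e1 + b *\<^sub>R e2))"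
proof -
  obtain c d where A: "A = c *\<^sub>R e1 + d *\<^sub>R e2" using frame_expand[OF assms] .
  have "e2 \<and>\<and> e1 = - (e1 \<and>\<and> e2)" by (rule wedge_commute)
  then show ?thesis
    using assms(2) oriented_orthonormal_plk[OF assms(1,2)] ip_commute[of s e2 e1]
    by (simp add: A oriented_orthonormal_def ip.add_left ip.add_right ip.diff_right ip.scaleR_left ip.scaleR_right
        wedge.add_left wedge.add_right wedge.scaleR_left wedge.scaleR_right
        plk.add_right plk.diff_right plk.scaleR_right plk.minus_right algebra_simps)
qed

lemma rot_frame:
  assumes "geodesic_frame s x y" "oriented_orthonormal s x y e1 e2"
  shows "rot s x y (a *\<^sub>R e1 + b *\<^sub>R e2) = a *\<^sub>R e2 - b *\<^sub>R e1"
  unfolding rot_def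
proof (rule the_equality)
  show "\<exists>e1' e2' a' b'. oriented_orthonormal s x y e1' e2' \<and>
     a *\<^sub>R e1 + b *\<^sub>R e2 = a' *\<^sub>R e1' + b' *\<^sub>R e2' \<and> a *\<^sub>R e2 - b *\<^sub>R e1 = a' *\<^sub>R e2' - b' *\<^sub>R e1'"
    using assms(2) by blast
next
  fix Z assume "\<exists>e1' e2' a' b'. oriented_orthonormal s x y e1' e2' \<and>
     a *\<^sub>R e1 + b *\<^sub>R e2 = a' *\<^sub>R e1' + b' *\<^sub>R e2' \<and> Z = a' *\<^sub>R e2' - b' *\<^sub>R e1'"
  then obtain e1' e2' a' b' where e: "oriented_orthonormal s x y e1' e2'"
     "a *\<^sub>R e1 + b *\<^sub>R e2 = a' *\<^sub>R e1' + b' *\<^sub>R e2'" "Z = a' *\<^sub>R e2' - b' *\<^sub>R e1'" by blast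
  show "Z = a *\<^sub>R e2 - b *\<^sub>R e1"
  proof (rule orth_plane_eqI[OF assms(1)])
    show "Z \<in> orth_plane s x y" "a *\<^sub>R e2 - b *\<^sub>R e1 \<in> orth_plane s x y"
      using e assms(2) by (auto simp: oriented_orthonormal_def intro!: orth_plane_intros)
    show "ip s A Z = ip s A (a *\<^sub>R e2 - b *\<^sub>R e1)" if "A \<in> orth_plane s x y" for A
      unfolding e(3) frame_rot[OF assms(1) e(1) that] frame_rot[OF assms that] e(2) ..
  qed
qed

lemma
  assumes "geodesic_frame s x y" "X \<in> orth_plane s x y"
  shows rot_orth_plane: "rot s x y X \<in> orth_plane s x y"
    and ip_rot: "A \<in> orth_plane s x y \<Longrightarrow> ip s A (rot s x y X) = - eps s * plk (x \<and>\<and> y) (A \<and>\<and> X)"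
    and rot_rot: "rot s x y (rot s x y X) = - X"
proof -
  obtain e1 e2 where e: "oriented_orthonormal s x y e1 e2" using ex_oriented_orthonormal[OF assms(1)] by blast
  obtain a b where X: "X = a *\<^sub>R e1 + b *\<^sub>R e2" using frame_expand[OF assms(1) e assms(2)] .
  have r: "rot s x y X = a *\<^sub>R e2 - b *\<^sub>R e1" unfolding X by (rule rot_frame[OF assms(1) e])
  show "rot s x y X \<in> orth_plane s x y"
    unfolding r using e by (auto simp: oriented_orthonormal_def intro!: orth_plane_intros)
  show "ip s A (rot s x y X) = - eps s * plk (x \<and>\<and> y) (A \<and>\<and> X)" if "A \<in> orth_plane s x y"
    using frame_rot[OF assms(1) e that, of a b] r X by simp
  have r2: "rot s x y X = (- b) *\<^sub>R e1 + a *\<^sub>R e2" using r by simp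
  show "rot s x y (rot s x y X) = - X"
    unfolding r2 unfolding rot_frame[OF assms(1) e] unfolding X by simp
qed

text \<open>By \<open>ip_rot\<close> and the antisymmetry of the wedge, one rotation moves across
  the form with a change of sign, and \<open>rot_rot\<close> supplies the other sign.\<close>

lemma ip_rot_rot:
  assumes "geodesic_frame s x y" "X \<in> orth_plane s x y" "Y \<in> orth_plane s x y"
  shows "ip s (rot s x y X) (rot s x y Y) = ip s X Y"
proof -
  have "ip s (rot s x y X) (rot s x y Y) = eps s * plk (x \<and>\<and> y) (Y \<and>\<and> rot s x y X)"
    using ip_rot[OF assms(1,3) rot_orth_plane[OF assms(1,2)]] wedge_commute[of Y "rot s x y X"]
    by (simp add: plk.minus_right)
  also have "\<dots> = - ip s Y (rot s x y (rot s x y X))"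
    using ip_rot[OF assms(1) rot_orth_plane[OF assms(1,2)] assms(3)] by simp
  finally show ?thesis using rot_rot[OF assms(1,2)] ip_commute[of s Y X] by (simp add: ip.minus_right)
qed

text \<open>The bivector \<open>g\<close> as an endomorphism, one index being lowered by the form.\<close>

definition contr :: "geometry \<Rightarrow> real^4^4 \<Rightarrow> real^4 \<Rightarrow> real^4" where
  "contr s g z = (\<chi> i. \<Sum>j\<in>UNIV. g $ i $ j * (sg s j * z $ j))"

interpretation contr: bounded_bilinear "contr s" for s
  unfolding bilinear_conv_bounded_bilinear[symmetric]
  by (auto simp: bilinear_def contr_def vec_eq_iff sum.distrib[symmetric] sum_distrib_left algebra_simps
      intro!: linearI sum.cong)

interpretation G: bounded_bilinear "G s" for s
  unfolding bilinear_conv_bounded_bilinear[symmetric]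
  by (auto simp: bilinear_def G_def sum.distrib[symmetric] sum_distrib_left algebra_simps
      intro!: linearI sum.cong)

lemma contr_wedge: "contr s (a \<and>\<and> b) z = ip s b z *\<^sub>R a - ip s a z *\<^sub>R b"
  by (simp add: contr_def wedge_def ip_sum vec_eq_iff sum_distrib_left sum_distrib_right
      sum_subtractf[symmetric] algebra_simps)

lemma contr_eqI:
  assumes "\<And>z. contr s a z = contr s b z" shows "a = b"
proof -
  have "contr s c (axis j 1) $ i = c $ i $ j * sg s j" for c i j
    by (simp add: contr_def axis_def if_distrib cong: if_cong)
  then have "a $ i $ j * sg s j = b $ i $ j * sg s j" for i j using assms by metis
  moreover have "sg s j \<noteq> 0" for j using sg_sq[of s j] by auto
  ultimately show ?thesis by (simp add: vec_eq_iff)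
qed

lemma G_contr: "G s (x \<and>\<and> y) b = (ip s x (contr s b y) - ip s y (contr s b x)) / 2"
  unfolding G_def sg_def[symmetric]
  by (simp add: contr_def wedge_def ip_sum sum_4 field_simps)

lemma G_commute: "G s a b = G s b a"
  by (simp add: G_def mult.commute mult.left_commute)

lemma ip_contr_skew:
  assumes "\<And>i j. V $ i $ j = - V $ j $ i"
  shows "ip s a (contr s V b) = - ip s b (contr s V a)"
proof -
  have "ip s a (contr s V b) = (\<Sum>i\<in>UNIV. \<Sum>j\<in>UNIV. sg s i * a $ i * (V $ i $ j * (sg s j * b $ j)))"
    by (simp add: ip_sum contr_def sum_distrib_left)
  also have "\<dots> = (\<Sum>j\<in>UNIV. \<Sum>i\<in>UNIV. sg s i * a $ i * (V $ i $ j * (sg s j * b $ j)))"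
    by (rule sum.swap)
  also have "\<dots> = (\<Sum>j\<in>UNIV. \<Sum>i\<in>UNIV. - (sg s j * b $ j * (V $ j $ i * (sg s i * a $ i))))"
    by (intro sum.cong refl, subst assms) (simp add: mult_ac)
  also have "\<dots> = - ip s b (contr s V a)"
    by (simp add: ip_sum contr_def sum_distrib_left sum_negf)
  finally show ?thesis .
qed

text \<open>The right-hand side does not involve the representation of \<open>v\<close>, so \<open>JJ\<close> is well defined.\<close>

lemma tangent_repr_JJ:
  assumes "tangent_repr s g v x y X Y"
  shows "contr s (y \<and>\<and> X - eps s *\<^sub>R (x \<and>\<and> Y)) z = contr s v (contr s g z) - contr s g (contr s v z)"
proof -
  have r: "geodesic_frame s x y" "g = x \<and>\<and> y" "X \<in> orth_plane s x y" "Y \<in> orth_plane s x y"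
    "v = x \<and>\<and> X + y \<and>\<and> Y"
    using assms by (auto simp: tangent_repr_def)
  show ?thesis
    unfolding r(2,5)
    by (simp add: contr.add_left contr.diff_left contr.scaleR_left contr_wedge ip.add_right ip.diff_right
        ip.scaleR_right geodesic_frame_ip[OF r(1)] orth_plane_ip[OF r(3)] orth_plane_ip[OF r(4)] algebra_simps)
qed

lemma JJ_repr:
  assumes "tangent_repr s g v x y X Y"
  shows "JJ s g v = y \<and>\<and> X - eps s *\<^sub>R (x \<and>\<and> Y)"
  unfolding JJ_def
  by (rule the_equality, use assms in blast)
    (metis (no_types, lifting) contr_eqI tangent_repr_JJ[OF assms] tangent_repr_JJ)

section \<open>Tangent vectors and changes of frame\<close>

definition tangent :: "geometry \<Rightarrow> real^4^4 \<Rightarrow> real^4^4 \<Rightarrow> bool" where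
  "tangent s g v \<longleftrightarrow> (\<exists>x y X Y. tangent_repr s g v x y X Y)"

text \<open>Contracting \<open>x \<and>\<and> y\<close> with \<open>x\<close> and with
  \<open>y\<close> gives \<open>- y\<close> and \<open>eps s *\<^sub>R x\<close>. The contractions
  depend on the bivector alone, so evaluating them in the other frame expresses \<open>x\<close> and
  \<open>y\<close> through \<open>x2\<close> and \<open>y2\<close>.\<close>

lemma frame_change:
  assumes "geodesic_frame s x y" "geodesic_frame s x2 y2" "x \<and>\<and> y = x2 \<and>\<and> y2"
  shows "x = (eps s * ip s y2 y) *\<^sub>R x2 + (- eps s * ip s x2 y) *\<^sub>R y2"
    and "y = (- ip s y2 x) *\<^sub>R x2 + ip s x2 x *\<^sub>R y2"
proof -
  have "contr s (x \<and>\<and> y) x = contr s (x2 \<and>\<and> y2) x" "contr s (x \<and>\<and> y) y = contr s (x2 \<and>\<and> y2) y"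
    using assms(3) by auto
  then have 1: "- y = ip s y2 x *\<^sub>R x2 - ip s x2 x *\<^sub>R y2" and 2: "eps s *\<^sub>R x = ip s y2 y *\<^sub>R x2 - ip s x2 y *\<^sub>R y2"
    unfolding contr_wedge geodesic_frame_ip[OF assms(1)] by auto
  have "y = - (ip s y2 x *\<^sub>R x2 - ip s x2 x *\<^sub>R y2)" unfolding 1[symmetric] by simp
  then show "y = (- ip s y2 x) *\<^sub>R x2 + ip s x2 x *\<^sub>R y2" by simp
  have "x = eps s *\<^sub>R (eps s *\<^sub>R x)" by simp
  then show "x = (eps s * ip s y2 y) *\<^sub>R x2 + (- eps s * ip s x2 y) *\<^sub>R y2"
    unfolding 2 by (simp add: scaleR_right_diff_distrib)
qed

lemma orth_plane_change:
  assumes "geodesic_frame s x y" "geodesic_frame s x2 y2" "x \<and>\<and> y = x2 \<and>\<and> y2" "X \<in> orth_plane s x2 y2"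
  shows "X \<in> orth_plane s x y"
proof -
  note f = orth_plane_ip[OF assms(4)]
  have "ip s x X = 0"
    by (subst frame_change(1)[OF assms(1-3)]) (simp only: ip.add_left ip.scaleR_left f, simp)
  moreover have "ip s y X = 0"
    by (subst frame_change(2)[OF assms(1-3)]) (simp only: ip.add_left ip.scaleR_left f, simp)
  ultimately show ?thesis by (simp add: orth_plane_def)
qed

text \<open>Any two tangent vectors at the same geodesic can thus be written in one common frame, in
  which the structures are evaluated on pairs. The new components come from bilinearity of the
  wedge.\<close>

lemma tangent_repr_change:
  assumes "tangent s g v" "geodesic_frame s x2 y2" "g = x2 \<and>\<and> y2"
  obtains X2 Y2 where "tangent_repr s g v x2 y2 X2 Y2"
proof -
  obtain x y X Y where r: "geodesic_frame s x y" "g = x \<and>\<and> y" "X \<in> orth_plane s x y" "Y \<in> orth_plane s x y"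
    "v = x \<and>\<and> X + y \<and>\<and> Y"
    using assms by (auto simp: tangent_def tangent_repr_def)
  have e: "x \<and>\<and> y = x2 \<and>\<and> y2" using assms r by simp
  have o: "X \<in> orth_plane s x2 y2" "Y \<in> orth_plane s x2 y2"
    using orth_plane_change[OF assms(2) r(1) e[symmetric]] r(3,4) by auto
  define a b c d where "a = eps s * ip s y2 y" and "b = - eps s * ip s x2 y" and "c = - ip s y2 x" and "d = ip s x2 x"
  have x: "x = a *\<^sub>R x2 + b *\<^sub>R y2" and y: "y = c *\<^sub>R x2 + d *\<^sub>R y2"
    unfolding a_def b_def c_def d_def using frame_change[OF r(1) assms(2) e] by blast+
  have "v = x2 \<and>\<and> (a *\<^sub>R X + c *\<^sub>R Y) + y2 \<and>\<and> (b *\<^sub>R X + d *\<^sub>R Y)"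
    unfolding r(5) x y
    by (simp add: wedge.add_left wedge.add_right wedge.scaleR_left wedge.scaleR_right)
  then have "tangent_repr s g v x2 y2 (a *\<^sub>R X + c *\<^sub>R Y) (b *\<^sub>R X + d *\<^sub>R Y)"
    unfolding tangent_repr_def using assms(2,3) o by (auto intro!: orth_plane_intros)
  then show ?thesis using that by blast
qed

lemma Omega_repr:
  assumes "tangent_repr s g v x y X Y" "tangent_repr s g w x y X' Y'"
  shows "Omega s g v w = ip s X Y' - ip s Y X'"
proof -
  have r: "geodesic_frame s x y" "X \<in> orth_plane s x y" "Y \<in> orth_plane s x y"
    "X' \<in> orth_plane s x y" "Y' \<in> orth_plane s x y" "w = x \<and>\<and> X' + y \<and>\<and> Y'"
    using assms by (auto simp: tangent_repr_def)
  show ?thesis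
    unfolding Omega_def JJ_repr[OF assms(1)] r(6)
    by (simp add: G.add_right G.diff_left G.scaleR_left G_wedge geodesic_frame_ip[OF r(1)]
        orth_plane_ip[OF r(2)] orth_plane_ip[OF r(3)] orth_plane_ip[OF r(4)] orth_plane_ip[OF r(5)] algebra_simps)
qed

lemma plk_repr:
  assumes "tangent_repr s g v x y X Y" "tangent_repr s g w x y X' Y'"
  shows "plk v w = plk (x \<and>\<and> y) (Y \<and>\<and> X') - plk (x \<and>\<and> y) (X \<and>\<and> Y')"
proof -
  have r: "v = x \<and>\<and> X + y \<and>\<and> Y" "w = x \<and>\<and> X' + y \<and>\<and> Y'"
    using assms by (auto simp: tangent_repr_def)
  show ?thesis unfolding r by (simp add: plk_def wedge_def algebra_simps)
qed

lemma tangent_repr_rot: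
  assumes "tangent_repr s g v x y X Y"
  shows "tangent_repr s g (x \<and>\<and> rot s x y X + y \<and>\<and> rot s x y Y) x y (rot s x y X) (rot s x y Y)"
  using assms rot_orth_plane by (auto simp: tangent_repr_def)

text \<open>As \<open>\<Omega>\<close> is non-degenerate, this determines \<open>\<J>' v\<close> independently of the representation of \<open>v\<close>.\<close>

lemma Omega_rot:
  assumes "tangent_repr s g u x y A B" "tangent_repr s g v x y X Y"
  shows "Omega s g u (x \<and>\<and> rot s x y X + y \<and>\<and> rot s x y Y) = eps s * plk u v"
proof -
  have r: "geodesic_frame s x y" "X \<in> orth_plane s x y" "Y \<in> orth_plane s x y"
    "A \<in> orth_plane s x y" "B \<in> orth_plane s x y"
    using assms by (auto simp: tangent_repr_def)
  show ?thesis
    unfolding Omega_repr[OF assms(1) tangent_repr_rot[OF assms(2)]] plk_repr[OF assms]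
      ip_rot[OF r(1,3,4)] ip_rot[OF r(1,2,5)]
    by (simp add: algebra_simps)
qed

lemma JJ'_repr:
  assumes "tangent_repr s g v x y X Y"
  shows "JJ' s g v = x \<and>\<and> rot s x y X + y \<and>\<and> rot s x y Y"
  unfolding JJ'_def
proof (rule the_equality)
  show "\<exists>x' y' X' Y'. tangent_repr s g v x' y' X' Y' \<and>
     x \<and>\<and> rot s x y X + y \<and>\<and> rot s x y Y = x' \<and>\<and> rot s x' y' X' + y' \<and>\<and> rot s x' y' Y'"
    using assms by blast
next
  fix w assume "\<exists>x' y' X' Y'. tangent_repr s g v x' y' X' Y' \<and> w = x' \<and>\<and> rot s x' y' X' + y' \<and>\<and> rot s x' y' Y'"
  then obtain x2 y2 X2 Y2 where 2: "tangent_repr s g v x2 y2 X2 Y2"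
    and w: "w = x2 \<and>\<and> rot s x2 y2 X2 + y2 \<and>\<and> rot s x2 y2 Y2" by blast
  have f: "geodesic_frame s x y" "g = x \<and>\<and> y" "X \<in> orth_plane s x y" "Y \<in> orth_plane s x y"
    and f2: "geodesic_frame s x2 y2" "g = x2 \<and>\<and> y2"
    using assms 2 by (auto simp: tangent_repr_def)
  have "tangent s g w" unfolding w tangent_def using tangent_repr_rot[OF 2] by blast
  then obtain P Q where PQ: "tangent_repr s g w x y P Q" using tangent_repr_change[OF _ f(1,2)] by blast
  have o: "P \<in> orth_plane s x y" "Q \<in> orth_plane s x y" using PQ by (auto simp: tangent_repr_def)
  \<comment> \<open>Both candidates for \<open>JJ' s g v\<close> have the same
    \<open>\<Omega>\<close>-pairing with every tangent vector \<open>u\<close>, namely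
    \<open>eps s * plk u v\<close>, in which no frame occurs. Taking \<open>B = 0\<close> or
    \<open>A = 0\<close> afterwards isolates the two components.\<close>
  have key: "ip s A Q - ip s B P = ip s A (rot s x y Y) - ip s B (rot s x y X)"
    if "A \<in> orth_plane s x y" "B \<in> orth_plane s x y" for A B
  proof -
    define u where "u = x \<and>\<and> A + y \<and>\<and> B"
    have u: "tangent_repr s g u x y A B" using f that by (auto simp: tangent_repr_def u_def)
    then have "tangent s g u" by (auto simp: tangent_def)
    then obtain A2 B2 where u2: "tangent_repr s g u x2 y2 A2 B2" using tangent_repr_change[OF _ f2] by blast
    have "ip s A Q - ip s B P = Omega s g u w" using Omega_repr[OF u PQ] by simp
    also have "\<dots> = eps s * plk u v" unfolding w by (rule Omega_rot[OF u2 2])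
    also have "\<dots> = Omega s g u (x \<and>\<and> rot s x y X + y \<and>\<and> rot s x y Y)" by (rule Omega_rot[OF u assms, symmetric])
    also have "\<dots> = ip s A (rot s x y Y) - ip s B (rot s x y X)"
      by (rule Omega_repr[OF u tangent_repr_rot[OF assms]])
    finally show ?thesis .
  qed
  have z: "0 \<in> orth_plane s x y" by (simp add: orth_plane_def ip.zero_right)
  have "Q = rot s x y Y"
    by (rule orth_plane_eqI[OF f(1) o(2) rot_orth_plane[OF f(1,4)]]) (use key[OF _ z] in \<open>simp add: ip.zero_left\<close>)
  moreover have "P = rot s x y X"
    by (rule orth_plane_eqI[OF f(1) o(1) rot_orth_plane[OF f(1,3)]]) (use key[OF z] in \<open>simp add: ip.zero_left\<close>)
  ultimately show "w = x \<and>\<and> rot s x y X + y \<and>\<and> rot s x y Y"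
    using PQ by (simp add: tangent_repr_def)
qed

lemma tangent_common:
  assumes "tangent s g v" "tangent s g w"
  obtains x y X Y X' Y' where "tangent_repr s g v x y X Y" "tangent_repr s g w x y X' Y'"
proof -
  obtain x y X Y where v: "tangent_repr s g v x y X Y" using assms(1) by (auto simp: tangent_def)
  then obtain X' Y' where "tangent_repr s g w x y X' Y'"
    using tangent_repr_change[OF assms(2), of x y] by (auto simp: tangent_repr_def)
  then show ?thesis using that v by blast
qed

lemma G'_plk: "tangent s g v \<Longrightarrow> tangent s g w \<Longrightarrow> G' s g v w = eps s * plk v w"
  using tangent_common[of s g v w] Omega_rot JJ'_repr unfolding G'_def by metis

lemma tangent_JJ': "tangent s g v \<Longrightarrow> tangent s g (JJ' s g v)"
  using tangent_repr_rot JJ'_repr unfolding tangent_def by metis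

text \<open>Rotation is an isometry of the orthogonal plane, so \<open>JJ'\<close> applied to both
  arguments preserves \<open>Omega\<close>.\<close>

lemma G'_JJ':
  assumes "tangent s g v" "tangent s g w" shows "G' s g (JJ' s g v) w = Omega s g v w"
proof -
  obtain x y X Y X' Y' where r: "tangent_repr s g v x y X Y" "tangent_repr s g w x y X' Y'"
    using tangent_common[OF assms] .
  then have f: "geodesic_frame s x y" "X \<in> orth_plane s x y" "Y \<in> orth_plane s x y"
    "X' \<in> orth_plane s x y" "Y' \<in> orth_plane s x y" by (auto simp: tangent_repr_def)
  show ?thesis
    unfolding G'_def JJ'_repr[OF r(1)] JJ'_repr[OF r(2)] Omega_repr[OF tangent_repr_rot[OF r(1)] tangent_repr_rot[OF r(2)]]
      Omega_repr[OF r] ip_rot_rot[OF f(1,2,5)] ip_rot_rot[OF f(1,3,4)] ..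
qed

lemma Omega_skew: "tangent s g v \<Longrightarrow> tangent s g w \<Longrightarrow> Omega s g v w = - Omega s g w v"
  by (erule (1) tangent_common) (simp add: Omega_repr[of s g] ip_commute)

lemma Omega_JJ':
  assumes "tangent s g v" "tangent s g w" shows "Omega s g (JJ' s g v) w = - G' s g v w"
proof -
  have "Omega s g (JJ' s g v) w = - G' s g w v"
    unfolding G'_def using Omega_skew[OF tangent_JJ'[OF assms(1)] assms(2)] .
  also have "\<dots> = - G' s g v w" using G'_plk assms by (simp add: plk_commute)
  finally show ?thesis .
qed

lemma tangent_add:
  assumes "tangent s g v" "tangent s g w" shows "tangent s g (v + w)"
proof -
  obtain x y X Y X' Y' where r: "tangent_repr s g v x y X Y" "tangent_repr s g w x y X' Y'"
    using tangent_common[OF assms] .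
  then have "tangent_repr s g (v + w) x y (X + X') (Y + Y')"
    by (simp add: tangent_repr_def wedge.add_right orth_plane_add)
  then show ?thesis unfolding tangent_def by blast
qed

lemma tangent_scaleR: "tangent s g v \<Longrightarrow> tangent s g (c *\<^sub>R v)"
  unfolding tangent_def tangent_repr_def
  by (elim exE conjE, intro exI conjI, assumption, assumption, erule orth_plane_scaleR[of _ _ _ _ c],
      erule orth_plane_scaleR[of _ _ _ _ c]) (simp add: wedge.scaleR_right scaleR_right_distrib)

lemma tangent_diff: "tangent s g v \<Longrightarrow> tangent s g w \<Longrightarrow> tangent s g (v - w)"
  using tangent_add[of s g v "(-1) *\<^sub>R w"] tangent_scaleR[of s g w "-1"] by simp

lemma Omega_diff_left:
  assumes "tangent s g u" "tangent s g v" "tangent s g w"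
  shows "Omega s g (u - v) w = Omega s g u w - Omega s g v w"
proof -
  obtain x y X Y X' Y' where r: "tangent_repr s g u x y X Y" "tangent_repr s g v x y X' Y'"
    using tangent_common[OF assms(1,2)] .
  obtain A B where w: "tangent_repr s g w x y A B"
    using tangent_repr_change[OF assms(3), of x y] r(1) by (auto simp: tangent_repr_def)
  have "tangent_repr s g (u - v) x y (X - X') (Y - Y')"
    using r by (auto simp: tangent_repr_def wedge.diff_right intro!: orth_plane_intros)
  then show ?thesis using Omega_repr[OF _ w] r by (simp add: ip.diff_left)
qed

section \<open>Velocities of maps into the space of geodesics\<close>

lemma has_derivative_locally_const:
  assumes "open U" "z \<in> U" "\<And>y. y \<in> U \<Longrightarrow> h y = c" "(h has_derivative h') (at z)"
  shows "h' v = 0"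
proof -
  have "((\<lambda>_. c) has_derivative h') (at z)"
    by (rule has_derivative_transform_within_open[OF assms(4,1,2)]) (rule assms(3))
  then have "h' = (\<lambda>_. 0)" by (rule has_derivative_unique[OF _ has_derivative_const])
  then show ?thesis by simp
qed

text \<open>On the span of \<open>x\<close> and \<open>y\<close> the square of
  \<open>contr s (x \<and>\<and> y)\<close> is \<open>- eps s\<close>, and the orthogonal plane is
  its kernel. Unlike the frame, this polynomial identity is a condition on the bivector alone, so it
  can be differentiated along a map into \<open>geodesics s\<close>.\<close>

lemma geodesic_contr_cube:
  assumes "geodesic_frame s x y"
  shows "contr s (x \<and>\<and> y) (contr s (x \<and>\<and> y) (contr s (x \<and>\<and> y) z)) + eps s *\<^sub>R contr s (x \<and>\<and> y) z = 0"
  by (simp add: contr_wedge ip.diff_right ip.minus_right ip.add_right ip.scaleR_right geodesic_frame_ip[OF assms] algebra_simps)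

text \<open>The map \<open>f\<close> does not come with a differentiable choice of frames, so the
  product rule for the wedge is not at hand. Instead three frame-free identities are differentiated:
  skew symmetry, constant \<open>G\<close>-norm and the cubic identity. They leave the derivative no
  component along \<open>f z\<close> and none in the wedge square of the orthogonal plane, hence
  only tangential ones.\<close>

lemma tangent_deriv:
  fixes f :: "'b::euclidean_space \<Rightarrow> real^4^4"
  assumes "open U" "z \<in> U" "\<And>y. y \<in> U \<Longrightarrow> f y \<in> geodesics s" "f differentiable (at z)"
  shows "tangent s (f z) (D f z v)"
proof -
  define V where "V = D f z v"
  note zero = has_derivative_locally_const[OF assms(1,2)]
  note F = has_derivative_D[OF assms(4)]
  obtain x y where xy: "f z = x \<and>\<and> y" "geodesic_frame s x y"
    using assms(2,3) by (fastforce simp: geodesics_def)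
  note fr = geodesic_frame_ip[OF xy(2)]
  have skew: "V $ i $ j = - V $ j $ i" for i j
  proof -
    have bl: "bounded_linear (\<lambda>g::real^4^4. g $ i $ j + g $ j $ i)"
      by (intro bounded_linear_add bounded_linear_compose[OF bounded_linear_vec_nth] bounded_linear_vec_nth)
    have "f y $ i $ j + f y $ j $ i = 0" if "y \<in> U" for y
      using assms(3)[OF that] by (auto simp: geodesics_def wedge_def)
    from zero[OF this bounded_linear.has_derivative[OF bl F], of v] show ?thesis by (simp add: V_def)
  qed
  \<comment> \<open>Removes the component of \<open>V\<close> along \<open>f z\<close>.\<close>
  have GV: "G s (f z) V = 0"
  proof -
    have "G s (f y) (f y) = eps s" if "y \<in> U" for y
      using assms(3)[OF that] by (auto simp: geodesics_def G_wedge geodesic_frame_ip)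
    from zero[OF this G.FDERIV[OF F F], of v] show ?thesis using G_commute[of s "f z" V] by (simp add: V_def)
  qed
  have orth0: "contr s (f z) Z = 0" if "Z \<in> orth_plane s x y" for Z
    unfolding xy(1) contr_wedge orth_plane_ip[OF that] by simp
  \<comment> \<open>Removes the component in the wedge square of the orthogonal plane. After pairing
    the differentiated cubic identity with \<open>Z'\<close>, every term with
    \<open>contr s (f z)\<close> outermost vanishes, since its values lie in the span of
    \<open>x\<close> and \<open>y\<close>.\<close>
  have orthV: "ip s Z' (contr s V Z) = 0" if Z: "Z \<in> orth_plane s x y" "Z' \<in> orth_plane s x y" for Z Z'
  proof -
    have c: "contr s (f y) (contr s (f y) (contr s (f y) Z)) + eps s *\<^sub>R contr s (f y) Z = 0" if "y \<in> U" for y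
      using assms(3)[OF that] geodesic_contr_cube by (auto simp: geodesics_def)
    have d: "((\<lambda>y. contr s (f y) Z) has_derivative (\<lambda>h. contr s (D f z h) Z)) (at z)"
      using contr.FDERIV[OF F has_derivative_const[of Z]] by (simp add: contr.zero_right)
    have "contr s (f z) (contr s (f z) (contr s V Z) + contr s V (contr s (f z) Z))
        + contr s V (contr s (f z) (contr s (f z) Z)) + eps s *\<^sub>R contr s V Z = 0"
      using zero[OF c has_derivative_add[OF contr.FDERIV[OF F contr.FDERIV[OF F d]]
            has_derivative_scaleR_right[OF d]], of v] by (simp add: V_def)
    then have e: "contr s (f z) (contr s (f z) (contr s V Z)) + eps s *\<^sub>R contr s V Z = 0"
      by (simp add: orth0[OF Z(1)] contr.zero_right)
    have "ip s Z' (contr s (f z) w) = 0" for w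
      unfolding xy(1) contr_wedge by (simp add: ip.diff_right ip.scaleR_right orth_plane_ip[OF Z(2)])
    then have "eps s * ip s Z' (contr s V Z) = 0"
      using arg_cong[OF e, of "ip s Z'"] by (simp add: ip.add_right ip.scaleR_right ip.zero_right)
    then show ?thesis by simp
  qed
  \<comment> \<open>For \<open>V = x \<and>\<and> X + y \<and>\<and> Y\<close> the contractions with
    \<open>x\<close> and \<open>y\<close> are \<open>- X\<close> and
    \<open>- eps s *\<^sub>R Y\<close>; solving for the components gives these candidates.\<close>
  define X Y where "X = - contr s V x" and "Y = - eps s *\<^sub>R contr s V y"
  have xx: "ip s x (contr s V x) = 0" and yy: "ip s y (contr s V y) = 0"
    using ip_contr_skew[OF skew, of s x x] ip_contr_skew[OF skew, of s y y] by auto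
  have xy0: "ip s x (contr s V y) = 0" "ip s y (contr s V x) = 0"
    using GV ip_contr_skew[OF skew, of s y x] unfolding xy(1) G_contr by auto
  have X: "X \<in> orth_plane s x y" and Y: "Y \<in> orth_plane s x y"
    using xx yy xy0 by (auto simp: orth_plane_def X_def Y_def ip.minus_right ip.scaleR_right)
  have cx: "contr s V x = - X" and cy: "contr s V y = - eps s *\<^sub>R Y" by (simp_all add: X_def Y_def)
  obtain e1 e2 where e: "oriented_orthonormal s x y e1 e2" using ex_oriented_orthonormal[OF xy(2)] by blast
  then have e': "e1 \<in> orth_plane s x y" "e2 \<in> orth_plane s x y" by (auto simp: oriented_orthonormal_def)
  have p: "plk (x \<and>\<and> y) (e1 \<and>\<and> e2) \<noteq> 0" using oriented_orthonormal_plk[OF xy(2) e] by simp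
  have "V = x \<and>\<and> X + y \<and>\<and> Y"
  proof (rule contr_eqI)
    fix w
    define R where "R = contr s V w - contr s (x \<and>\<and> X + y \<and>\<and> Y) w"
    have R: "ip s a R = - ip s w (contr s V a) - ip s X w * ip s a x + ip s x w * ip s a X
        - ip s Y w * ip s a y + ip s y w * ip s a Y" for a
      unfolding R_def by (simp add: contr.add_left contr_wedge ip.diff_right ip.add_right ip.scaleR_right
          ip_contr_skew[OF skew, of s a w])
    have "R = 0"
    proof (rule plk_nondegenerate[OF p])
      show "ip s x R = 0" unfolding R cx
        by (simp add: fr orth_plane_ip[OF X] orth_plane_ip[OF Y] ip.minus_right ip_commute[of s w])
      show "ip s y R = 0" unfolding R cy
        by (simp add: fr orth_plane_ip[OF X] orth_plane_ip[OF Y] ip.minus_right ip.scaleR_right ip_commute[of s w])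
      have "ip s a R = 0" if a: "a \<in> orth_plane s x y" for a
      proof -
        define Z where "Z = w - ip s x w *\<^sub>R x - (eps s * ip s y w) *\<^sub>R y"
        have Z: "Z \<in> orth_plane s x y"
          by (simp add: orth_plane_def Z_def ip.diff_right ip.scaleR_right fr)
        have w: "w = ip s x w *\<^sub>R x + (eps s * ip s y w) *\<^sub>R y + Z" by (simp add: Z_def)
        have "ip s w (contr s V a) = - ip s a (contr s V w)" by (rule ip_contr_skew[OF skew])
        also have "contr s V w = ip s x w *\<^sub>R (- X) + (eps s * ip s y w) *\<^sub>R (- eps s *\<^sub>R Y) + contr s V Z"
          by (subst w) (simp only: contr.add_right contr.scaleR_right cx cy)
        finally have "ip s w (contr s V a) = ip s x w * ip s a X + ip s y w * ip s a Y"
          using orthV[OF Z a] by (simp add: ip.add_right ip.scaleR_right ip.minus_right ip.diff_right)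
        then show ?thesis unfolding R by (simp add: orth_plane_ip[OF a])
      qed
      then show "ip s e1 R = 0" "ip s e2 R = 0" using e' by auto
    qed
    then show "contr s V w = contr s (x \<and>\<and> X + y \<and>\<and> Y) w" by (simp add: R_def)
  qed
  then show ?thesis
    using xy X Y unfolding tangent_def tangent_repr_def V_def by blast
qed

section \<open>The unit normal of a tangent plane\<close>

definition cross :: "geometry \<Rightarrow> real^4 \<Rightarrow> real^4 \<Rightarrow> real^4 \<Rightarrow> real^4" where
  "cross s a b c = (\<chi> i. sg s i * plk (a \<and>\<and> b) (c \<and>\<and> axis i 1))"

lemma ip_cross: "ip s (cross s a b c) z = plk (a \<and>\<and> b) (c \<and>\<and> z)"
proof -
  have "ip s (cross s a b c) z = (\<Sum>i\<in>UNIV. (sg s i * sg s i) * plk (a \<and>\<and> b) (c \<and>\<and> axis i 1) * z $ i)"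
    by (simp add: ip_sum cross_def mult.assoc)
  also have "\<dots> = plk (a \<and>\<and> b) (c \<and>\<and> z)"
    unfolding sg_sq by (simp add: sum_4 plk_def wedge_def axis_def algebra_simps)
  finally show ?thesis .
qed

definition gram2 :: "geometry \<Rightarrow> real^4 \<Rightarrow> real^4 \<Rightarrow> real" where
  "gram2 s a b = ip s a a * ip s b b - (ip s a b)\<^sup>2"

text \<open>An explicit formula makes smooth dependence on all arguments visible. The root
  normalises the length by \<open>cross_norm\<close>, and the sign \<open>eps s\<close> makes
  \<open>x\<close>, \<open>a\<close>, \<open>b\<close> and the normal positively oriented in both
  geometries, see \<open>plk_n\<close>.\<close>

definition lnormal :: "geometry \<Rightarrow> real^4 \<Rightarrow> real^4 \<Rightarrow> real^4 \<Rightarrow> real^4" where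
  "lnormal s x a b = (eps s / sqrt (gram2 s a b)) *\<^sub>R cross s x a b"

locale tangent_plane =
  fixes s :: geometry and x a b :: "real^4"
  assumes ambient: "x \<in> ambient s" and orth: "ip s x a = 0" "ip s x b = 0"
    and indep: "\<And>\<alpha> \<beta>. \<alpha> *\<^sub>R a + \<beta> *\<^sub>R b = 0 \<Longrightarrow> \<alpha> = 0 \<and> \<beta> = 0"
begin

lemma ip_rev: "ip s x x = 1" "ip s a x = 0" "ip s b x = 0" "ip s b a = ip s a b"
  using ambient_ip[OF ambient] orth ip_commute by metis+

lemma eps_aa: "eps s * ip s a a > 0"
  using indep[of 1 0] by (intro ambient_definite[OF ambient orth(1)]) auto

text \<open>\<open>w\<close> is the component of \<open>b\<close> orthogonal to \<open>a\<close>,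
  scaled by \<open>ip s a a\<close> to avoid a division. Both \<open>ip s w w\<close> and
  \<open>ip s a a\<close> have the sign \<open>eps s\<close>, and their quotient is the Gram
  determinant.\<close>

lemma gram2_pos: "gram2 s a b > 0"
proof -
  define w where "w = ip s a a *\<^sub>R b - ip s a b *\<^sub>R a"
  have "w \<noteq> 0" using indep[of "- ip s a b" "ip s a a"] eps_aa by (auto simp: w_def)
  then have "eps s * ip s w w > 0"
    by (intro ambient_definite[OF ambient]) (simp_all add: w_def ip.diff_right ip.scaleR_right orth)
  moreover have "ip s w w = ip s a a * gram2 s a b"
    by (simp add: w_def gram2_def ip.diff_left ip.diff_right ip.scaleR_left ip.scaleR_right ip_rev power2_eq_square algebra_simps)
  ultimately show ?thesis using eps_aa by (simp add: mult.assoc[symmetric] zero_less_mult_iff)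
qed

abbreviation "n \<equiv> lnormal s x a b"

text \<open>Putting the cross product \<open>c\<close> itself for \<open>r\<close> in
  \<open>gram_orth\<close> yields the claim multiplied by \<open>ip s c c\<close>, so this number
  must be non-zero. For that an auxiliary \<open>r\<close> orthogonal to \<open>x\<close>,
  \<open>a\<close>, \<open>b\<close> is used: by the same lemma it pairs non-trivially with
  \<open>c\<close>, so \<open>c\<close> is not 0, and definiteness applies.\<close>

lemma cross_norm: "ip s (cross s x a b) (cross s x a b) = eps s * gram2 s a b"
proof -
  define c where "c = cross s x a b"
  have c: "ip s c z = plk (x \<and>\<and> a) (b \<and>\<and> z)" for z by (simp add: c_def ip_cross)
  have co: "ip s x c = 0" "ip s a c = 0" "ip s b c = 0"
    unfolding ip_commute[of s _ c] c by (simp_all add: plk_def wedge_def algebra_simps)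
  obtain r where r: "r \<noteq> 0" "ip s x r = 0" "ip s a r = 0" "ip s b r = 0" using ex_orthogonal by blast
  have "eps s * (ip s c r)\<^sup>2 = gram2 s a b * ip s r r"
    unfolding c gram2_def by (rule gram_orth) (use r orth ip_rev in auto)
  moreover have "ip s r r \<noteq> 0" using ambient_definite[OF ambient r(2,1)] by auto
  ultimately have "ip s c r \<noteq> 0" using gram2_pos by auto
  then have "c \<noteq> 0" by (auto simp: ip.zero_left)
  then have nz: "ip s c c \<noteq> 0" using ambient_definite[OF ambient co(1)] by auto
  have "eps s * (plk (x \<and>\<and> a) (b \<and>\<and> c))\<^sup>2 = gram2 s a b * ip s c c"
    unfolding gram2_def by (rule gram_orth) (use co orth ip_rev in auto)
  then have "eps s * (ip s c c)\<^sup>2 = gram2 s a b * ip s c c" by (simp only: c)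
  then have "eps s * ip s c c = gram2 s a b" using nz by (simp add: power2_eq_square)
  then show ?thesis unfolding c_def by (metis eps_sq(2))
qed

lemma n_ip: "ip s n n = eps s" "ip s x n = 0" "ip s a n = 0" "ip s b n = 0" "ip s n x = 0" "ip s n a = 0" "ip s n b = 0"
proof -
  show "ip s n n = eps s"
    using cross_norm gram2_pos by (simp add: lnormal_def ip.scaleR_left ip.scaleR_right field_simps)
  show "ip s n x = 0" "ip s n a = 0" "ip s n b = 0"
    by (simp_all add: lnormal_def ip.scaleR_left ip_cross) (simp_all add: plk_def wedge_def algebra_simps)
  then show "ip s x n = 0" "ip s a n = 0" "ip s b n = 0" using ip_commute by metis+
qed

lemma plk_n: "plk (x \<and>\<and> a) (b \<and>\<and> n) = sqrt (gram2 s a b)" "plk (x \<and>\<and> n) (a \<and>\<and> b) = sqrt (gram2 s a b)"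
proof -
  have "plk (x \<and>\<and> a) (b \<and>\<and> n) = ip s (cross s x a b) n" by (simp add: ip_cross)
  also have "\<dots> = eps s / sqrt (gram2 s a b) * (eps s * gram2 s a b)"
    unfolding lnormal_def ip.scaleR_right cross_norm by simp
  also have "\<dots> = sqrt (gram2 s a b)" using gram2_pos by (simp add: real_div_sqrt mult.assoc[symmetric])
  finally show "plk (x \<and>\<and> a) (b \<and>\<and> n) = sqrt (gram2 s a b)" .
  then show "plk (x \<and>\<and> n) (a \<and>\<and> b) = sqrt (gram2 s a b)" by (simp add: plk_rot)
qed

lemma n_frame: "geodesic_frame s x n"
  using ambient n_ip by (simp add: geodesic_frame_def)

lemma orth_zero:
  assumes "ip s x r = 0" "ip s a r = 0" "ip s b r = 0" "ip s n r = 0" shows "r = 0"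
  using plk_nondegenerate[of x a b n s r] assms plk_n(1) gram2_pos by simp

lemma orth_plane_span:
  assumes "Z \<in> orth_plane s x n" obtains \<alpha> \<beta> where "Z = \<alpha> *\<^sub>R a + \<beta> *\<^sub>R b"
proof -
  \<comment> \<open>Cramer's rule for the Gram matrix of \<open>a\<close> and
    \<open>b\<close>.\<close>
  define \<alpha> \<beta> where "\<alpha> = (ip s a Z * ip s b b - ip s b Z * ip s a b) / gram2 s a b"
    and "\<beta> = (ip s b Z * ip s a a - ip s a Z * ip s a b) / gram2 s a b"
  have g: "gram2 s a b \<noteq> 0" using gram2_pos by simp
  have "Z - (\<alpha> *\<^sub>R a + \<beta> *\<^sub>R b) = 0"
  proof (rule orth_zero)
    have "\<alpha> * ip s a a + \<beta> * ip s a b = ip s a Z * gram2 s a b / gram2 s a b"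
      unfolding \<alpha>_def \<beta>_def times_divide_eq_left add_divide_distrib[symmetric]
      by (simp add: gram2_def power2_eq_square algebra_simps)
    then show "ip s a (Z - (\<alpha> *\<^sub>R a + \<beta> *\<^sub>R b)) = 0"
      using g by (simp add: ip.diff_right ip.add_right ip.scaleR_right)
    have "\<alpha> * ip s a b + \<beta> * ip s b b = ip s b Z * gram2 s a b / gram2 s a b"
      unfolding \<alpha>_def \<beta>_def times_divide_eq_left add_divide_distrib[symmetric]
      by (simp add: gram2_def power2_eq_square algebra_simps)
    then show "ip s b (Z - (\<alpha> *\<^sub>R a + \<beta> *\<^sub>R b)) = 0"
      using g by (simp add: ip.diff_right ip.add_right ip.scaleR_right ip_rev)
  qed (simp_all add: ip.diff_right ip.add_right ip.scaleR_right orth n_ip orth_plane_ip[OF assms])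
  then show ?thesis using that by simp
qed

lemma tangential_eqI:
  assumes "Z \<in> orth_plane s x n" "Z' \<in> orth_plane s x n" "ip s Z a = ip s Z' a" "ip s Z b = ip s Z' b"
  shows "Z = Z'"
proof -
  have "Z - Z' = 0"
    by (rule orth_zero)
      (use assms ip_commute[of s _ a] ip_commute[of s _ b] in \<open>simp_all add: ip.diff_right orth_plane_ip[OF assms(1)] orth_plane_ip[OF assms(2)]\<close>)
  then show ?thesis by simp
qed

lemma n_unique:
  assumes "ip s v v = eps s" "ip s v x = 0" "ip s v a = 0" "ip s v b = 0" "plk (x \<and>\<and> a) (b \<and>\<and> v) > 0"
  shows "v = n"
proof -
  have rev: "ip s x v = 0" "ip s a v = 0" "ip s b v = 0" using assms(2-4) ip_commute by metis+
  define c where "c = eps s * ip s n v"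
  have "v - c *\<^sub>R n = 0"
    by (rule orth_zero) (simp_all add: rev ip.diff_right ip.scaleR_right n_ip c_def)
  then have v: "v = c *\<^sub>R n" by simp
  have "c * c = 1" using assms(1) unfolding v by (simp add: ip.scaleR_left ip.scaleR_right n_ip)
  moreover have "c > 0" using assms(5) gram2_pos unfolding v
    by (simp add: wedge.scaleR_right plk.scaleR_right plk_n zero_less_mult_iff)
  ultimately have "c = 1" by (simp add: square_eq_1_iff)
  then show ?thesis using v by simp
qed

end

section \<open>Surfaces in coordinates\<close>

lemma vec2_expand: "v = v $ 1 *\<^sub>R axis 1 1 + v $ 2 *\<^sub>R (axis 2 1 :: real^2)"
  by (simp add: vec_eq_iff forall_2 axis_def)

lemma linear_real2:
  fixes L :: "real^2 \<Rightarrow> 'v::real_vector"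
  assumes "linear L"
  shows "L v = v $ 1 *\<^sub>R L (axis 1 1) + v $ 2 *\<^sub>R L (axis 2 1)"
  by (subst vec2_expand[of v]) (simp only: linear_add[OF assms] linear_cmul[OF assms])

lemma matrix_vector_axis_2:
  fixes M :: "real^2^2"
  shows "M *v axis j 1 = M $ 1 $ j *\<^sub>R axis 1 1 + M $ 2 $ j *\<^sub>R axis 2 1"
  by (simp add: vec_eq_iff forall_2 matrix_vector_mult_def axis_def if_distrib cong: if_cong)

lemma matrix_inv_unique:
  fixes A B :: "real^'n^'n"
  assumes "A ** B = mat 1" shows "matrix_inv A = B"
proof -
  have BA: "B ** A = mat 1" using assms matrix_left_right_inverse by blast
  then have "matrix_inv A ** A = mat 1"
    unfolding matrix_inv_def by (rule_tac someI2[of _ B]) (use assms in auto)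
  then have "matrix_inv A ** (A ** B) = B" by (simp add: matrix_mul_assoc)
  then show ?thesis by (simp add: assms)
qed

text \<open>The adjugate written uniformly in the indices: \<open>trace A - A $ i $ i\<close> is the
  other diagonal entry. Smoothness of the Christoffel symbols is read off from this formula,
  \<open>matrix_inv\<close> being given by a choice.\<close>

lemma matrix_inv_2:
  fixes A :: "real^2^2"
  assumes "det A \<noteq> 0"
  shows "matrix_inv A $ i $ j = (if i = j then trace A - A $ i $ i else - A $ i $ j) / det A"
proof -
  have "A ** (\<chi> i j. (if i = j then trace A - A $ i $ i else - A $ i $ j) / det A) = mat 1"
    using assms
    by (simp add: vec_eq_iff forall_2 matrix_matrix_mult_def sum_2 mat_def trace_def det_2 divide_simps)
  from matrix_inv_unique[OF this] show ?thesis by simp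
qed

lemmas smooth_on_ip = smooth_on_bilinear[OF _ ip.bounded_bilinear_axioms]
lemmas smooth_on_wedge = smooth_on_bilinear[OF _ wedge.bounded_bilinear_axioms]
lemmas smooth_on_plk = smooth_on_bilinear[OF _ plk.bounded_bilinear_axioms]
lemmas smooth_on_contr = smooth_on_bilinear[OF _ contr.bounded_bilinear_axioms]

lemma smooth_on_lnormal:
  assumes "open S" "smooth_on S x" "smooth_on S a" "smooth_on S b"
    and "\<And>p. p \<in> S \<Longrightarrow> gram2 s (a p) (b p) > 0"
  shows "smooth_on S (\<lambda>p. lnormal s (x p) (a p) (b p))"
proof -
  have g: "smooth_on S (\<lambda>p. gram2 s (a p) (b p))"
    unfolding gram2_def power2_eq_square by (intro smooth_on_diff smooth_on_mult smooth_on_ip assms(1-4))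
  have "smooth_on S (\<lambda>p. (eps s / sqrt (gram2 s (a p) (b p))) *\<^sub>R
      (\<chi> i. sg s i * plk (x p \<and>\<and> a p) (b p \<and>\<and> axis i 1)))"
    by (intro smooth_on_scaleR smooth_on_divide smooth_on_sqrt smooth_on_const smooth_on_vec smooth_on_mult
        smooth_on_plk smooth_on_wedge assms(1-4) g) (auto dest: assms(5))
  then show ?thesis unfolding lnormal_def cross_def .
qed

definition gnormal :: "geometry \<Rightarrow> (real^2 \<Rightarrow> real^4) \<Rightarrow> real^2 \<Rightarrow> real^4" where
  "gnormal s F z = lnormal s (F z) (D F z (axis 1 1)) (D F z (axis 2 1))"

lemma det_first_form: "det (first_form s F z) = gram2 s (D F z (axis 1 1)) (D F z (axis 2 1))"
proof -
  show ?thesis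
    by (simp add: eps_mult_eps det_2 first_form_def gram2_def power2_eq_square ip_commute[of s "D F z (axis 2 1)" "D F z (axis 1 1)"])
qed

lemma D_ip:
  assumes "f differentiable (at z)" "g differentiable (at z)"
  shows "D (\<lambda>y. ip s (f y) (g y)) z v = ip s (f z) (D g z v) + ip s (D f z v) (g z)"
  by (rule D_bilinear[OF ip.bounded_bilinear_axioms assms])

lemma D_locally_const:
  assumes "open U" "z \<in> U" "\<And>y. y \<in> U \<Longrightarrow> h y = c" "h differentiable (at z)"
  shows "D h z v = 0"
  by (rule has_derivative_locally_const[OF assms(1-3) has_derivative_D[OF assms(4)]])

locale patch =
  fixes s :: geometry and U :: "(real^2) set" and F :: "real^2 \<Rightarrow> real^4"
  assumes open_U: "open U" and smooth_F: "smooth_on U F"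
    and F_ambient: "\<And>z. z \<in> U \<Longrightarrow> F z \<in> ambient s"
    and F_inj: "\<And>z. z \<in> U \<Longrightarrow> inj (D F z)"
begin

abbreviation "N \<equiv> gnormal s F"
abbreviation "\<Phi> \<equiv> \<lambda>z. F z \<and>\<and> N z"

lemma diff_F: "z \<in> U \<Longrightarrow> F differentiable (at z)"
  by (rule smooth_on_differentiable[OF smooth_F])

lemma F_DF: assumes "z \<in> U" shows "ip s (F z) (D F z v) = 0"
proof -
  have "D (\<lambda>y. ip s (F y) (F y)) z v = 0"
    by (rule D_locally_const[OF open_U assms])
      (auto intro: ambient_ip F_ambient differentiable_bilinear[OF ip.bounded_bilinear_axioms] diff_F assms)
  then show ?thesis using D_ip[OF diff_F diff_F, OF assms assms, of s v] ip_commute[of s "F z"] by simp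
qed

lemma tangent_plane: assumes "z \<in> U" shows "tangent_plane s (F z) (D F z (axis 1 1)) (D F z (axis 2 1))"
proof
  show "F z \<in> ambient s" by (rule F_ambient[OF assms])
  show "ip s (F z) (D F z (axis 1 1)) = 0" "ip s (F z) (D F z (axis 2 1)) = 0" by (rule F_DF[OF assms])+
  fix \<alpha> \<beta> :: real assume *: "\<alpha> *\<^sub>R D F z (axis 1 1) + \<beta> *\<^sub>R D F z (axis 2 1) = 0"
  note L = linear_D[OF diff_F[OF assms]]
  have "D F z (\<alpha> *\<^sub>R axis 1 1 + \<beta> *\<^sub>R axis 2 1) = D F z 0"
    using * by (simp add: linear_add[OF L] linear_cmul[OF L] linear_0[OF L])
  then have "\<alpha> *\<^sub>R axis 1 1 + \<beta> *\<^sub>R axis 2 1 = (0 :: real^2)" using F_inj[OF assms] injD by metis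
  then show "\<alpha> = 0 \<and> \<beta> = 0" by (simp add: vec_eq_iff forall_2 axis_def)
qed

lemma gram2_pos: "z \<in> U \<Longrightarrow> gram2 s (D F z (axis 1 1)) (D F z (axis 2 1)) > 0"
  by (rule tangent_plane.gram2_pos[OF tangent_plane])

lemma det_first_form_pos: "z \<in> U \<Longrightarrow> det (first_form s F z) > 0"
  by (simp add: det_first_form gram2_pos)

lemma N_ip: assumes "z \<in> U" shows "ip s (N z) (N z) = eps s" "ip s (F z) (N z) = 0"
  using tangent_plane.n_ip[OF tangent_plane[OF assms]] by (auto simp: gnormal_def)

lemma N_frame: "z \<in> U \<Longrightarrow> geodesic_frame s (F z) (N z)"
  unfolding gnormal_def by (rule tangent_plane.n_frame[OF tangent_plane])

lemma N_DF: assumes "z \<in> U" shows "ip s (N z) (D F z v) = 0"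
  using tangent_plane.n_ip[OF tangent_plane[OF assms]]
  by (subst linear_real2[OF linear_D[OF diff_F[OF assms]]])
    (simp add: gnormal_def ip.add_right ip.scaleR_right)

lemma smooth_N: "smooth_on U N"
  unfolding gnormal_def[abs_def]
  by (rule smooth_on_lnormal[OF open_U smooth_F smooth_on_D[OF smooth_F] smooth_on_D[OF smooth_F] gram2_pos])

lemma diff_N: "z \<in> U \<Longrightarrow> N differentiable (at z)"
  by (rule smooth_on_differentiable[OF smooth_N])

lemma N_DN: assumes "z \<in> U" shows "ip s (N z) (D N z v) = 0"
proof -
  have "D (\<lambda>y. ip s (N y) (N y)) z v = 0"
    by (rule D_locally_const[OF open_U assms])
      (auto intro: N_ip differentiable_bilinear[OF ip.bounded_bilinear_axioms] diff_N assms)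
  then show ?thesis using D_ip[OF diff_N diff_N, OF assms assms, of s v] ip_commute[of s "N z"] by simp
qed

lemma F_DN: assumes "z \<in> U" shows "ip s (F z) (D N z v) = 0"
proof -
  have "D (\<lambda>y. ip s (F y) (N y)) z v = 0"
    by (rule D_locally_const[OF open_U assms])
      (auto intro: N_ip differentiable_bilinear[OF ip.bounded_bilinear_axioms] diff_F diff_N assms)
  then show ?thesis using D_ip[OF diff_F diff_N, OF assms assms, of s v] N_DF[OF assms, of v]
      ip_commute[of s "N z" "D F z v"] by simp
qed

lemma orth_plane_N: assumes "z \<in> U"
  shows "D N z v \<in> orth_plane s (F z) (N z)" "D F z v \<in> orth_plane s (F z) (N z)"
  using F_DN N_DN F_DF N_DF assms by (auto simp: orth_plane_def)

text \<open>The two expressions of the second fundamental form, obtained by differentiating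
  \<open>ip s (N z) (D F z w) = 0\<close>.\<close>

lemma N_DDF: assumes "z \<in> U" shows "ip s (N z) (D (\<lambda>y. D F y w) z v) = - ip s (D N z v) (D F z w)"
proof -
  have d: "(\<lambda>y. D F y w) differentiable (at z)"
    by (rule smooth_on_differentiable[OF smooth_on_D[OF smooth_F] assms])
  have "D (\<lambda>y. ip s (N y) (D F y w)) z v = 0"
    by (rule D_locally_const[OF open_U assms])
      (erule N_DF, rule differentiable_bilinear[OF ip.bounded_bilinear_axioms diff_N[OF assms] d])
  then show ?thesis using D_ip[OF diff_N d, OF assms, of s v] by simp
qed

text \<open>Self-adjointness of the shape operator, inherited from the symmetry of the second
  derivatives of \<open>F\<close>.\<close>

lemma DN_sym: assumes "z \<in> U" shows "ip s (D N z v) (D F z w) = ip s (D N z w) (D F z v)"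
  using N_DDF[OF assms, of v w] N_DDF[OF assms, of w v] D_commute[OF open_U smooth_F assms, of v w] by simp

lemma smooth_\<Phi>: "smooth_on U \<Phi>"
  by (intro smooth_on_wedge open_U smooth_F smooth_N)

lemma D_\<Phi>: assumes "z \<in> U" shows "D \<Phi> z v = F z \<and>\<and> D N z v + N z \<and>\<and> (- D F z v)"
  using D_bilinear[OF wedge.bounded_bilinear_axioms diff_F diff_N, OF assms assms, of v]
    wedge_commute[of "D F z v" "N z"] by (simp add: wedge.minus_right)

lemma \<Phi>_geodesics: "z \<in> U \<Longrightarrow> \<Phi> z \<in> geodesics s"
  using N_frame by (auto simp: geodesics_def)

lemma repr_\<Phi>: assumes "z \<in> U" shows "tangent_repr s (\<Phi> z) (D \<Phi> z v) (F z) (N z) (D N z v) (- D F z v)"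
  unfolding tangent_repr_def
  using N_frame[OF assms] D_\<Phi>[OF assms] orth_plane_N[OF assms] orth_plane_uminus by blast

lemma tangent_\<Phi>: "z \<in> U \<Longrightarrow> tangent s (\<Phi> z) (D \<Phi> z v)"
  unfolding tangent_def using repr_\<Phi> by blast

text \<open>In the frame \<open>(F, N)\<close> the components of \<open>d\<Phi>\<close> are
  \<open>dN\<close> and \<open>- dF\<close>, so this is the self-adjointness of the shape
  operator.\<close>

lemma lagrangian_\<Phi>: assumes "z \<in> U" shows "Omega s (\<Phi> z) (D \<Phi> z v) (D \<Phi> z w) = 0"
  unfolding Omega_repr[OF repr_\<Phi>[OF assms] repr_\<Phi>[OF assms]]
  using DN_sym[OF assms, of v w] ip_commute[of s "D F z v"] by (simp add: ip.minus_right ip.minus_left)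

lemma pullback_\<Phi>: assumes "z \<in> U"
  shows "pullback_G' s \<Phi> z v w = eps s * (plk (F z \<and>\<and> N z) (D N z v \<and>\<and> D F z w) + plk (F z \<and>\<and> N z) (D N z w \<and>\<and> D F z v))"
  unfolding pullback_G'_def G'_plk[OF tangent_\<Phi> tangent_\<Phi>, OF assms assms]
    plk_repr[OF repr_\<Phi> repr_\<Phi>, OF assms assms] wedge_commute[of "- D F z v" "D N z w"]
  by (simp add: wedge.minus_right plk.minus_right)

section \<open>The shape operator and the pulled back metric\<close>

lemma shape_operator_matrix:
  assumes "z \<in> U"
  obtains M :: "real^2^2" where "shape_operator F N z = (\<lambda>v. M *v v)" "\<And>v. - D N z v = D F z (M *v v)"
proof -
  interpret tp: tangent_plane s "F z" "D F z (axis 1 1)" "D F z (axis 2 1)" by (rule tangent_plane[OF assms])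
  have o: "- D N z v \<in> orth_plane s (F z) (lnormal s (F z) (D F z (axis 1 1)) (D F z (axis 2 1)))" for v
    using orth_plane_uminus[OF orth_plane_N(1)[OF assms]] by (simp add: gnormal_def)
  obtain p q where 1: "- D N z (axis 1 1) = p *\<^sub>R D F z (axis 1 1) + q *\<^sub>R D F z (axis 2 1)"
    using tp.orth_plane_span[OF o] .
  obtain r t where 2: "- D N z (axis 2 1) = r *\<^sub>R D F z (axis 1 1) + t *\<^sub>R D F z (axis 2 1)"
    using tp.orth_plane_span[OF o] .
  define M :: "real^2^2" where "M = (\<chi> i j. if i = 1 then (if j = 1 then p else r) else (if j = 1 then q else t))"
  have Mv: "(M *v v) $ 1 = p * v $ 1 + r * v $ 2" "(M *v v) $ 2 = q * v $ 1 + t * v $ 2" for v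
    by (simp_all add: M_def matrix_vector_mult_def sum_2)
  have M: "- D N z v = D F z (M *v v)" for v
  proof -
    have "- D N z v = v $ 1 *\<^sub>R (- D N z (axis 1 1)) + v $ 2 *\<^sub>R (- D N z (axis 2 1))"
      by (subst linear_real2[OF linear_D[OF diff_N[OF assms]]]) simp
    also have "\<dots> = D F z (M *v v)"
      unfolding 1 2 by (subst (3) linear_real2[OF linear_D[OF diff_F[OF assms]]]) (simp add: Mv algebra_simps)
    finally show ?thesis .
  qed
  have "shape_operator F N z = (\<lambda>v. M *v v)"
    unfolding shape_operator_def
  proof (rule the_equality)
    show "linear ((*v) M) \<and> (\<forall>v. - D N z v = D F z (M *v v))"
      using M matrix_vector_mul_linear by blast
    fix S assume "linear S \<and> (\<forall>v. - D N z v = D F z (S v))"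
    then have "D F z (S v) = D F z (M *v v)" for v using M by metis
    then show "S = (*v) M" using F_inj[OF assms] by (auto simp: inj_def fun_eq_iff)
  qed
  then show ?thesis using M that by blast
qed

text \<open>\<open>(trace M)^2 - 4 * det M\<close> is the square of the difference of the principal
  curvatures. No principal frame is introduced: the pullback is computed from the entries of
  \<open>M\<close> in the coordinate basis, and non-negativity comes from completing a
  square.\<close>

lemma
  assumes z: "z \<in> U" and M: "\<And>v. - D N z v = D F z (M *v v)"
  shows det_pullback: "det (\<chi> i j. pullback_G' s \<Phi> z (axis i 1) (axis j 1) :: real^2^2)
      = - (((trace M)\<^sup>2 - 4 * det M) * det (first_form s F z))"
    and trace_det_shape: "0 \<le> (trace M)\<^sup>2 - 4 * det M"
proof -
  interpret tp: tangent_plane s "F z" "D F z (axis 1 1)" "D F z (axis 2 1)" by (rule tangent_plane[OF z])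
  define a b where "a = D F z (axis 1 1)" and "b = D F z (axis 2 1)"
  have Mv: "M *v axis j 1 = M $ 1 $ j *\<^sub>R axis 1 1 + M $ 2 $ j *\<^sub>R axis 2 1" for j
    by (rule matrix_vector_axis_2)
  note L = linear_D[OF diff_F[OF z]]
  have DN: "D N z (axis j 1) = - (M $ 1 $ j *\<^sub>R a + M $ 2 $ j *\<^sub>R b)" for j
  proof -
    have "- D N z (axis j 1) = M $ 1 $ j *\<^sub>R a + M $ 2 $ j *\<^sub>R b"
      unfolding M Mv by (simp add: linear_add[OF L] linear_cmul[OF L] a_def b_def)
    then show ?thesis by (metis minus_minus)
  qed
  have k: "plk (F z \<and>\<and> N z) (a \<and>\<and> b) = sqrt (det (first_form s F z))"
    using tp.plk_n(2) by (simp add: gnormal_def det_first_form a_def b_def)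
  have ba: "b \<and>\<and> a = - (a \<and>\<and> b)" by (rule wedge_commute)
  define K where "K = sqrt (det (first_form s F z))"
  have KK: "K * K = det (first_form s F z)" using det_first_form_pos[OF z] by (simp add: K_def)
  note sm = wedge.add_left wedge.add_right wedge.scaleR_left wedge.scaleR_right wedge.minus_left
    wedge.minus_right plk.add_right plk.minus_right plk.scaleR_right plk.diff_right wedge.diff_left
  \<comment> \<open>Only the off-diagonal entries of \<open>M\<close> and the difference of its
    diagonal entries survive in the pullback: multiples of the identity contribute nothing.\<close>
  have P11: "pullback_G' s \<Phi> z (axis 1 1) (axis 1 1) = eps s * (2 * M $ 2 $ 1 * K)"
    unfolding pullback_\<Phi>[OF z] DN a_def[symmetric] by (simp add: sm ba k K_def)
  have P22: "pullback_G' s \<Phi> z (axis 2 1) (axis 2 1) = eps s * (- 2 * M $ 1 $ 2 * K)"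
    unfolding pullback_\<Phi>[OF z] DN b_def[symmetric] by (simp add: sm ba k K_def)
  have P12: "pullback_G' s \<Phi> z (axis 1 1) (axis 2 1) = eps s * ((M $ 2 $ 2 - M $ 1 $ 1) * K)"
    "pullback_G' s \<Phi> z (axis 2 1) (axis 1 1) = eps s * ((M $ 2 $ 2 - M $ 1 $ 1) * K)"
    unfolding pullback_\<Phi>[OF z] DN a_def[symmetric] b_def[symmetric] by (simp_all add: sm ba k K_def algebra_simps)
  show "det (\<chi> i j. pullback_G' s \<Phi> z (axis i 1) (axis j 1) :: real^2^2)
      = - (((trace M)\<^sup>2 - 4 * det M) * det (first_form s F z))"
    unfolding KK[symmetric]
    by (simp only: det_2 vec_lambda_beta P11 P12 P22 eps_mult_eps trace_def sum_2) (simp add: power2_eq_square algebra_simps)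
  \<comment> \<open>In these coefficients self-adjointness eliminates \<open>M $ 1 $ 2\<close>. The
    discriminant is multiplied by the square of \<open>E\<close>, not divided by \<open>E\<close>,
    and becomes a square plus a non-negative multiple of the Gram determinant.\<close>
  define E f g where "E = ip s a a" and "f = ip s a b" and "g = ip s b b"
  have "ip s (D N z (axis 1 1)) b = ip s (D N z (axis 2 1)) a"
    using DN_sym[OF z] by (simp add: a_def b_def)
  then have sym: "M$1$1 * f + M$2$1 * g = M$1$2 * E + M$2$2 * f"
    unfolding DN by (simp add: ip.minus_left ip.add_left ip.diff_left ip.scaleR_left E_def f_def g_def ip_commute[of s b a])
  have E: "E \<noteq> 0" using tp.eps_aa by (auto simp: E_def a_def)
  have "E\<^sup>2 * ((trace M)\<^sup>2 - 4 * det M) = E\<^sup>2 * (M$1$1 - M$2$2)\<^sup>2 + 4 * M$2$1 * E * (M$1$2 * E)"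
    by (simp add: trace_def sum_2 det_2 power2_eq_square algebra_simps)
  also have "M$1$2 * E = (M$1$1 - M$2$2) * f + M$2$1 * g" using sym by (simp add: algebra_simps)
  also have "E\<^sup>2 * (M$1$1 - M$2$2)\<^sup>2 + 4 * M$2$1 * E * ((M$1$1 - M$2$2) * f + M$2$1 * g)
      = (E * (M$1$1 - M$2$2) + 2 * M$2$1 * f)\<^sup>2 + 4 * (M$2$1)\<^sup>2 * (E * g - f\<^sup>2)"
    by (simp add: power2_eq_square algebra_simps)
  also have "\<dots> \<ge> 0" using tp.gram2_pos by (simp add: gram2_def E_def f_def g_def a_def b_def)
  finally have "0 \<le> E\<^sup>2 * ((trace M)\<^sup>2 - 4 * det M)" .
  then show "0 \<le> (trace M)\<^sup>2 - 4 * det M" using E by (simp add: zero_le_mult_iff)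
qed

end

section \<open>The Gauss equation\<close>

lemma partial_cong:
  assumes "open U" "z \<in> U" "\<And>y. y \<in> U \<Longrightarrow> f y = g y" "g differentiable (at z)"
  shows "partial i f z = partial i g z"
proof -
  have "D f z = D g z"
    by (rule D_cong(1)[OF assms(4,1,2)]) (simp add: assms(3))
  then show ?thesis by (simp add: partial_def)
qed

lemma partial_add:
  "f differentiable (at z) \<Longrightarrow> g differentiable (at z) \<Longrightarrow> partial i (\<lambda>y. f y + g y) z = partial i f z + partial i g z"
  by (simp add: partial_def D_add)

lemma partial_mult:
  "f differentiable (at z) \<Longrightarrow> g differentiable (at z) \<Longrightarrow>
    partial i (\<lambda>y. f y * g y) z = f z * partial i g z + partial i f z * g z"
  unfolding partial_def by (rule D_bilinear[OF bounded_bilinear_mult])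

context patch
begin

definition Fi :: "2 \<Rightarrow> real^2 \<Rightarrow> real^4" where "Fi i = (\<lambda>y. D F y (axis i 1))"
definition Fij :: "2 \<Rightarrow> 2 \<Rightarrow> real^2 \<Rightarrow> real^4" where "Fij i j = (\<lambda>y. D (Fi i) y (axis j 1))"

text \<open>Christoffel symbols of the first kind, encoded as tangential components of second
  derivatives.\<close>

definition christoffel1 :: "2 \<Rightarrow> 2 \<Rightarrow> 2 \<Rightarrow> real^2 \<Rightarrow> real" where
  "christoffel1 l i j y = eps s * ip s (Fij i j y) (Fi l y)"

abbreviation "g \<equiv> first_form s F"
abbreviation "\<Gamma> \<equiv> christoffel (first_form s F)"

lemma smooth_Fi: "smooth_on U (Fi i)" unfolding Fi_def by (rule smooth_on_D[OF smooth_F])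
lemma smooth_Fij: "smooth_on U (Fij i j)" unfolding Fij_def by (rule smooth_on_D[OF smooth_Fi])

lemma diff_Fi: "y \<in> U \<Longrightarrow> Fi i differentiable (at y)" by (rule smooth_on_differentiable[OF smooth_Fi])
lemma diff_Fij: "y \<in> U \<Longrightarrow> Fij i j differentiable (at y)" by (rule smooth_on_differentiable[OF smooth_Fij])

lemma Fij_sym: "y \<in> U \<Longrightarrow> Fij i j y = Fij j i y"
  unfolding Fij_def Fi_def by (rule D_commute[OF open_U smooth_F])

lemma g_nth: "g y $ i $ j = eps s * ip s (Fi i y) (Fi j y)"
  by (simp add: first_form_def Fi_def)

lemma partial_eps_ip:
  assumes "f differentiable (at z)" "h differentiable (at z)"
  shows "partial k (\<lambda>y. eps s * ip s (f y) (h y)) z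
    = eps s * (ip s (f z) (D h z (axis k 1)) + ip s (D f z (axis k 1)) (h z))"
proof -
  have "(\<lambda>y. ip s (f y) (h y)) differentiable (at z)"
    by (rule differentiable_bilinear[OF ip.bounded_bilinear_axioms assms])
  from D_linear_compose[OF bounded_linear_mult_right this, of "eps s" "axis k 1"] D_ip[OF assms, of s "axis k 1"]
  show ?thesis by (simp add: partial_def)
qed

lemma partial_g:
  assumes "y \<in> U"
  shows "partial k (\<lambda>y. g y $ i $ j) y = eps s * (ip s (Fi i y) (Fij j k y) + ip s (Fij i k y) (Fi j y))"
  unfolding g_nth using partial_eps_ip[OF diff_Fi diff_Fi, OF assms assms, of k i j] by (simp add: Fij_def)

text \<open>When the three derivatives of the metric are expanded by the product rule, the symmetry
  of second derivatives cancels all but twice one product.\<close>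

lemma christoffel_eq:
  assumes "y \<in> U"
  shows "\<Gamma> k i j y = (\<Sum>l\<in>UNIV. matrix_inv (g y) $ k $ l * christoffel1 l i j y)"
proof -
  have "partial i (\<lambda>y. g y $ j $ l) y + partial j (\<lambda>y. g y $ i $ l) y - partial l (\<lambda>y. g y $ i $ j) y
      = 2 * christoffel1 l i j y" for l
    unfolding partial_g[OF assms] christoffel1_def
    using Fij_sym[OF assms, of l i] Fij_sym[OF assms, of l j] Fij_sym[OF assms, of j i]
      ip_commute[of s "Fi j y" "Fij i l y"] ip_commute[of s "Fi i y" "Fij j l y"]
    by (simp add: algebra_simps)
  then show ?thesis unfolding christoffel_def by (simp add: sum_distrib_left)
qed

lemma christoffel_lower:
  assumes "y \<in> U"
  shows "(\<Sum>k\<in>UNIV. g y $ m $ k * \<Gamma> k i j y) = christoffel1 m i j y"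
proof -
  have "invertible (g y)" using det_first_form_pos[OF assms] by (simp add: invertible_det_nz)
  then have "g y ** matrix_inv (g y) = mat 1"
    unfolding invertible_def matrix_inv_def by (rule someI2_ex) simp
  then have "(g y ** matrix_inv (g y)) $ m $ l = mat 1 $ m $ l" for l by simp
  then have inv: "g y $ m $ 1 * matrix_inv (g y) $ 1 $ l + g y $ m $ 2 * matrix_inv (g y) $ 2 $ l = (if m = l then 1 else 0)" for l
    by (simp add: matrix_matrix_mult_def mat_def sum_2)
  have "(\<Sum>k\<in>UNIV. g y $ m $ k * \<Gamma> k i j y) = (\<Sum>l\<in>UNIV.
      (g y $ m $ 1 * matrix_inv (g y) $ 1 $ l + g y $ m $ 2 * matrix_inv (g y) $ 2 $ l) * christoffel1 l i j y)"
    unfolding christoffel_eq[OF assms] by (simp add: sum_2 algebra_simps)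
  also have "\<dots> = christoffel1 m i j y" unfolding inv using exhaust_2[of m] by (auto simp: sum_2)
  finally show ?thesis .
qed

lemma smooth_christoffel: "smooth_on U (\<Gamma> k i j)"
proof -
  have sg: "smooth_on U (\<lambda>y. g y $ i $ j)" for i j
    unfolding g_nth by (intro smooth_on_mult smooth_on_const smooth_on_ip open_U smooth_Fi)
  have sc: "smooth_on U (christoffel1 l i j)" for l
    unfolding christoffel1_def by (intro smooth_on_mult smooth_on_const smooth_on_ip open_U smooth_Fi smooth_Fij)
  have sd: "smooth_on U (\<lambda>y. det (g y))"
    unfolding det_2 by (intro smooth_on_diff smooth_on_mult open_U sg)
  have st: "smooth_on U (\<lambda>y. if k = l then trace (g y) - g y $ k $ k else - g y $ k $ l)" for l
    unfolding trace_def by (cases "k = l") (simp_all add: sum_2 smooth_on_diff smooth_on_add smooth_on_minus open_U sg)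
  have "smooth_on U (\<lambda>y. \<Sum>l\<in>UNIV. ((if k = l then trace (g y) - g y $ k $ k else - g y $ k $ l) / det (g y)) * christoffel1 l i j y)"
    by (intro smooth_on_sum smooth_on_mult smooth_on_divide open_U sc sd st) (auto dest: det_first_form_pos)
  then show ?thesis
  proof (rule smooth_on_cong[OF open_U, rotated])
    fix y assume y: "y \<in> U"
    then have nz: "det (g y) \<noteq> 0" using det_first_form_pos by fastforce
    show "(\<Sum>l\<in>UNIV. ((if k = l then trace (g y) - g y $ k $ k else - g y $ k $ l) / det (g y)) * christoffel1 l i j y) = \<Gamma> k i j y"
      unfolding christoffel_eq[OF y] matrix_inv_2[OF nz] ..
  qed
qed

text \<open>The relation with lowered index is differentiated and not \<open>christoffel_eq\<close>,
  so that no derivative of the inverse metric appears.\<close>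

lemma christoffel_lower_deriv:
  assumes "z \<in> U"
  shows "(\<Sum>k\<in>UNIV. g z $ m $ k * partial n (\<Gamma> k i j) z + (christoffel1 m k n z + christoffel1 k m n z) * \<Gamma> k i j z)
    = eps s * (ip s (Fij i j z) (Fij m n z) + ip s (D (Fij i j) z (axis n 1)) (Fi m z))"
proof -
  have dG: "\<Gamma> k i j differentiable (at z)" for k
    by (rule smooth_on_differentiable[OF smooth_christoffel assms])
  have dg: "(\<lambda>y. g y $ m $ k) differentiable (at z)" for k
    unfolding g_nth by (intro differentiable_mult differentiable_const
        differentiable_bilinear[OF ip.bounded_bilinear_axioms] diff_Fi assms)
  have dc: "(\<lambda>y. eps s * ip s (Fij i j y) (Fi m y)) differentiable (at z)"
    by (intro differentiable_mult differentiable_const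
        differentiable_bilinear[OF ip.bounded_bilinear_axioms] diff_Fi diff_Fij assms)
  have pg: "partial n (\<lambda>y. g y $ m $ k) z = christoffel1 m k n z + christoffel1 k m n z" for k
    unfolding partial_g[OF assms] christoffel1_def by (simp add: ip_commute algebra_simps)
  have "partial n (\<lambda>y. g y $ m $ 1 * \<Gamma> 1 i j y + g y $ m $ 2 * \<Gamma> 2 i j y) z
      = partial n (\<lambda>y. eps s * ip s (Fij i j y) (Fi m y)) z"
    by (rule partial_cong[OF open_U assms _ dc])
      (use christoffel_lower in \<open>simp add: sum_2 christoffel1_def\<close>)
  also have "\<dots> = eps s * (ip s (Fij i j z) (Fij m n z) + ip s (D (Fij i j) z (axis n 1)) (Fi m z))"
    unfolding partial_eps_ip[OF diff_Fij diff_Fi, OF assms assms] Fij_def[of m n] ..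
  also have "partial n (\<lambda>y. g y $ m $ 1 * \<Gamma> 1 i j y + g y $ m $ 2 * \<Gamma> 2 i j y) z
      = (\<Sum>k\<in>UNIV. g z $ m $ k * partial n (\<Gamma> k i j) z + (christoffel1 m k n z + christoffel1 k m n z) * \<Gamma> k i j z)"
    by (simp add: partial_add partial_mult differentiable_mult dg dG pg sum_2)
  finally show ?thesis .
qed

text \<open>Lowering the index turns derivatives of Christoffel symbols into third derivatives of
  \<open>F\<close> plus products. The third derivatives cancel in the antisymmetrisation, and the
  rest is quadratic in second derivatives.\<close>

lemma riemann_sum:
  assumes z: "z \<in> U"
  shows "(\<Sum>l\<in>UNIV. g z $ 1 $ l * riemann g l 2 1 2 z)
    = eps s * (ip s (Fij 2 2 z) (Fij 1 1 z) - ip s (Fij 1 2 z) (Fij 1 2 z))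
      - (\<Sum>k\<in>UNIV. christoffel1 k 1 1 z * \<Gamma> k 2 2 z) + (\<Sum>k\<in>UNIV. christoffel1 k 1 2 z * \<Gamma> k 1 2 z)"
proof -
  have third: "D (Fij 2 2) z (axis 1 1) = D (Fij 1 2) z (axis 2 1)"
  proof -
    have "D (Fij 2 2) z (axis 1 1) = D (Fij 2 1) z (axis 2 1)"
      unfolding Fij_def by (rule D_commute[OF open_U smooth_Fi z])
    also have "D (Fij 2 1) z = D (Fij 1 2) z"
      by (rule D_cong(1)[OF diff_Fij[OF z] open_U z]) (rule Fij_sym)
    finally show ?thesis .
  qed
  have sym: "christoffel1 l 2 1 z = christoffel1 l 1 2 z" for l unfolding christoffel1_def Fij_sym[OF z, of 2 1] ..
  note A = christoffel_lower_deriv[OF z, of 1 1 2 2] and B = christoffel_lower_deriv[OF z, of 1 2 1 2]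
  have C: "g z $ 1 $ 1 * \<Gamma> 1 1 m z + g z $ 1 $ 2 * \<Gamma> 2 1 m z = christoffel1 1 1 m z"
    and E: "g z $ 1 $ 1 * \<Gamma> 1 2 m z + g z $ 1 $ 2 * \<Gamma> 2 2 m z = christoffel1 1 2 m z" for m
    using christoffel_lower[OF z] by (simp_all add: sum_2)
  have "(\<Sum>l\<in>UNIV. g z $ 1 $ l * riemann g l 2 1 2 z)
     = (\<Sum>l\<in>UNIV. g z $ 1 $ l * partial 1 (\<Gamma> l 2 2) z) - (\<Sum>l\<in>UNIV. g z $ 1 $ l * partial 2 (\<Gamma> l 1 2) z)
      + (g z $ 1 $ 1 * \<Gamma> 1 1 1 z + g z $ 1 $ 2 * \<Gamma> 2 1 1 z) * \<Gamma> 1 2 2 z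
      + (g z $ 1 $ 1 * \<Gamma> 1 1 2 z + g z $ 1 $ 2 * \<Gamma> 2 1 2 z) * \<Gamma> 2 2 2 z
      - (g z $ 1 $ 1 * \<Gamma> 1 2 1 z + g z $ 1 $ 2 * \<Gamma> 2 2 1 z) * \<Gamma> 1 1 2 z
      - (g z $ 1 $ 1 * \<Gamma> 1 2 2 z + g z $ 1 $ 2 * \<Gamma> 2 2 2 z) * \<Gamma> 2 1 2 z"
    by (simp add: riemann_def sum_2 algebra_simps)
  also have "\<dots> = (\<Sum>l\<in>UNIV. g z $ 1 $ l * partial 1 (\<Gamma> l 2 2) z) - (\<Sum>l\<in>UNIV. g z $ 1 $ l * partial 2 (\<Gamma> l 1 2) z)
      + christoffel1 1 1 1 z * \<Gamma> 1 2 2 z + christoffel1 1 1 2 z * \<Gamma> 2 2 2 z - christoffel1 1 1 2 z * \<Gamma> 1 1 2 z - christoffel1 1 2 2 z * \<Gamma> 2 1 2 z"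
    unfolding C E sym ..
  also have "\<dots> = eps s * (ip s (Fij 2 2 z) (Fij 1 1 z) - ip s (Fij 1 2 z) (Fij 1 2 z))
      - (\<Sum>k\<in>UNIV. christoffel1 k 1 1 z * \<Gamma> k 2 2 z) + (\<Sum>k\<in>UNIV. christoffel1 k 1 2 z * \<Gamma> k 1 2 z)"
    using A B by (simp add: sum_2 sym third algebra_simps)
  finally show ?thesis .
qed

text \<open>The Gauss formula in four-space. Besides tangential and normal parts there is a
  component along the position vector, because \<open>ip s (F z) (Fi i z) = 0\<close> differentiates
  to minus the induced form; it is the source of the ambient curvature in the Gauss
  equation.\<close>

lemma second_derivative_expand:
  assumes z: "z \<in> U"
  shows "Fij i j z = \<Gamma> 1 i j z *\<^sub>R Fi 1 z + \<Gamma> 2 i j z *\<^sub>R Fi 2 z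
    + (eps s * ip s (N z) (Fij i j z)) *\<^sub>R N z - (eps s * g z $ i $ j) *\<^sub>R F z"
proof -
  interpret tp: tangent_plane s "F z" "D F z (axis 1 1)" "D F z (axis 2 1)" by (rule tangent_plane[OF z])
  define R where "R = Fij i j z - (\<Gamma> 1 i j z *\<^sub>R Fi 1 z + \<Gamma> 2 i j z *\<^sub>R Fi 2 z
    + (eps s * ip s (N z) (Fij i j z)) *\<^sub>R N z - (eps s * g z $ i $ j) *\<^sub>R F z)"
  have FN: "ip s (F z) (Fij i j z) = - eps s * g z $ i $ j"
  proof -
    have "D (\<lambda>y. ip s (F y) (Fi i y)) z (axis j 1) = 0"
      by (rule D_locally_const[OF open_U z])
        (simp add: Fi_def F_DF, rule differentiable_bilinear[OF ip.bounded_bilinear_axioms diff_F[OF z] diff_Fi[OF z]])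
    then show ?thesis unfolding D_ip[OF diff_F diff_Fi, OF z z] g_nth
      by (simp add: Fij_def Fi_def ip_commute[of s "D F z (axis j 1)" "D F z (axis i 1)"] mult.assoc[symmetric])
  qed
  have low: "ip s (Fi l z) (\<Gamma> 1 i j z *\<^sub>R Fi 1 z + \<Gamma> 2 i j z *\<^sub>R Fi 2 z) = ip s (Fi l z) (Fij i j z)" for l
  proof -
    have "eps s * ip s (Fi l z) (\<Gamma> 1 i j z *\<^sub>R Fi 1 z + \<Gamma> 2 i j z *\<^sub>R Fi 2 z)
        = g z $ l $ 1 * \<Gamma> 1 i j z + g z $ l $ 2 * \<Gamma> 2 i j z"
      unfolding g_nth by (simp add: ip.add_right ip.scaleR_right algebra_simps)
    also have "\<dots> = eps s * ip s (Fi l z) (Fij i j z)"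
      using christoffel_lower[OF z, of l i j] by (simp add: sum_2 christoffel1_def ip_commute)
    finally show ?thesis by simp
  qed
  have o: "ip s (F z) (Fi l z) = 0" "ip s (N z) (Fi l z) = 0" "ip s (Fi l z) (F z) = 0" "ip s (Fi l z) (N z) = 0" for l
    using F_DF[OF z] N_DF[OF z] ip_commute by (metis Fi_def)+
  have NF: "ip s (N z) (F z) = 0" using N_ip(2)[OF z] ip_commute by metis
  note sm = ip.diff_right ip.add_right ip.scaleR_right
  have l: "ip s (Fi l z) R = 0" for l
    using low[of l] unfolding R_def by (simp add: sm o)
  have "R = 0"
  proof (rule tp.orth_zero)
    show "ip s (F z) R = 0"
      unfolding R_def by (simp add: sm o FN N_ip[OF z] ambient_ip[OF F_ambient[OF z]])
    have "ip s (N z) R = 0"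
      unfolding R_def by (simp add: sm o NF N_ip[OF z])
    then show "ip s tp.n R = 0" by (simp add: gnormal_def)
  qed (use l in \<open>auto simp: Fi_def\<close>)
  then show ?thesis by (simp add: R_def)
qed

text \<open>The products of second derivatives in \<open>riemann_sum\<close> are expanded by the
  Gauss formula. Their tangential parts cancel against the Christoffel terms, the normal parts give
  the determinant of the second fundamental form, and the parts along \<open>F\<close> give
  \<open>eps s * det (g z)\<close>.\<close>

lemma gauss_equation:
  assumes z: "z \<in> U" and M: "\<And>v. - D N z v = D F z (M *v v)"
  shows "gauss_curvature_metric (first_form s F) z = det M + eps s"
proof -
  define b where "b i j = ip s (N z) (Fij i j z)" for i j
  define g11 g12 g22 where "g11 = g z $ 1 $ 1" and "g12 = g z $ 1 $ 2" and "g22 = g z $ 2 $ 2"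
  have g21: "g z $ 2 $ 1 = g12" unfolding g12_def g_nth by (simp add: ip_commute)
  have FF: "ip s (F z) (Fij i j z) = - eps s * g z $ i $ j" for i j
  proof -
    have o: "ip s (F z) (Fi l z) = 0" for l using F_DF[OF z] by (simp add: Fi_def)
    show ?thesis
      by (subst second_derivative_expand[OF z])
        (simp add: ip.diff_right ip.add_right ip.scaleR_right o N_ip[OF z] ambient_ip[OF F_ambient[OF z]])
  qed
  have prod: "eps s * ip s (Fij i j z) (Fij k l z) = (\<Sum>m\<in>UNIV. christoffel1 m k l z * \<Gamma> m i j z)
      + b i j * b k l + eps s * (g z $ i $ j * g z $ k $ l)" for i j k l
  proof -
    have "ip s (Fij i j z) (Fij k l z) = \<Gamma> 1 i j z * ip s (Fij k l z) (Fi 1 z) + \<Gamma> 2 i j z * ip s (Fij k l z) (Fi 2 z)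
       + eps s * b i j * b k l - (eps s * g z $ i $ j) * (- eps s * g z $ k $ l)"
      by (subst second_derivative_expand[OF z, of i j])
        (simp add: ip.diff_left ip.add_left ip.scaleR_left FF b_def ip_commute[of s "Fij k l z"])
    then show ?thesis by (simp add: sum_2 christoffel1_def algebra_simps)
  qed
  have bs: "b 2 1 = b 1 2" unfolding b_def Fij_sym[OF z, of 2 1] ..
  have bM: "b i j = eps s * (g z $ 1 $ i * M $ 1 $ j + g z $ 2 $ i * M $ 2 $ j)" for i j
  proof -
    have Mv: "M *v axis j 1 = M $ 1 $ j *\<^sub>R axis 1 1 + M $ 2 $ j *\<^sub>R axis 2 1"
      by (rule matrix_vector_axis_2)
    note L = linear_D[OF diff_F[OF z]]
    have "b i j = ip s (- D N z (axis j 1)) (Fi i z)"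
      unfolding b_def Fij_def Fi_def N_DDF[OF z] by (simp add: ip.minus_left)
    also have "\<dots> = M $ 1 $ j * ip s (Fi 1 z) (Fi i z) + M $ 2 $ j * ip s (Fi 2 z) (Fi i z)"
      unfolding M Mv by (simp add: linear_add[OF L] linear_cmul[OF L] Fi_def ip.add_left ip.scaleR_left)
    finally show ?thesis unfolding g_nth by (simp add: algebra_simps)
  qed
  have "(\<Sum>l\<in>UNIV. g z $ 1 $ l * riemann g l 2 1 2 z) = b 1 1 * b 2 2 - b 1 2 * b 1 2 + eps s * det (g z)"
    unfolding riemann_sum[OF z] right_diff_distrib prod det_2 g21 by (simp add: g11_def g12_def g22_def algebra_simps)
  also have "b 1 1 * b 2 2 - b 1 2 * b 1 2 = b 1 1 * b 2 2 - b 1 2 * b 2 1" using bs by simp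
  also have "\<dots> = (eps s * eps s) * (det (g z) * det M)"
    unfolding bM det_2 g21 by (simp only: g12_def[symmetric]) (simp add: g21 algebra_simps del: eps_sq)
  finally have "(\<Sum>l\<in>UNIV. g z $ 1 $ l * riemann g l 2 1 2 z) = det (g z) * (det M + eps s)"
    by (simp add: algebra_simps)
  then show ?thesis
    unfolding gauss_curvature_metric_def using det_first_form_pos[OF z] by simp
qed

end

section \<open>Charts\<close>

locale surface =
  fixes A :: "'a::{t2_space,second_countable_topology} chart set"
  assumes oriented: "oriented_surface A"
begin

lemma chart_homeo:
  assumes "c \<in> A"
  shows "open (chart_dom c)" "open (chart_img c)" "homeomorphism (chart_dom c) (chart_img c) (snd c) (chart_inv c)"
  using oriented assms by (auto simp: oriented_surface_def)

lemma chart_cover: "\<exists>c\<in>A. q \<in> chart_dom c"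
  using oriented by (auto simp: oriented_surface_def)

lemma chart_inv_dom: "c \<in> A \<Longrightarrow> z \<in> chart_img c \<Longrightarrow> chart_inv c z \<in> chart_dom c"
  and chart_of_inv: "c \<in> A \<Longrightarrow> z \<in> chart_img c \<Longrightarrow> snd c (chart_inv c z) = z"
  and chart_in_img: "c \<in> A \<Longrightarrow> q \<in> chart_dom c \<Longrightarrow> snd c q \<in> chart_img c"
  and chart_inv_of: "c \<in> A \<Longrightarrow> q \<in> chart_dom c \<Longrightarrow> chart_inv c (snd c q) = q"
  using chart_homeo(3)[of c] by (auto simp: homeomorphism_def)

definition overlap :: "'a chart \<Rightarrow> 'a chart \<Rightarrow> (real^2) set" where
  "overlap c d = snd c ` (chart_dom c \<inter> chart_dom d)"

abbreviation trans :: "'a chart \<Rightarrow> 'a chart \<Rightarrow> real^2 \<Rightarrow> real^2" where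
  "trans c d \<equiv> loc c (snd d)"

lemma overlap_iff:
  "c \<in> A \<Longrightarrow> z \<in> overlap c d \<longleftrightarrow> z \<in> chart_img c \<and> chart_inv c z \<in> chart_dom d"
  unfolding overlap_def
  by (auto simp: chart_inv_of chart_in_img)
    (metis IntI chart_inv_dom chart_of_inv image_eqI)

lemma overlap_subset: "c \<in> A \<Longrightarrow> overlap c d \<subseteq> chart_img c"
  by (auto simp: overlap_iff)

lemma open_overlap: assumes "c \<in> A" "d \<in> A" shows "open (overlap c d)"
proof -
  have "overlap c d = chart_img c \<inter> chart_inv c -` chart_dom d"
    by (rule set_eqI) (simp add: overlap_iff[OF assms(1)])
  moreover have "continuous_on (chart_img c) (chart_inv c)"
    using chart_homeo(3)[OF assms(1)] by (simp add: homeomorphism_def)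
  ultimately show ?thesis
    using chart_homeo(1)[OF assms(2)] chart_homeo(2)[OF assms(1)] continuous_open_preimage by metis
qed

lemma in_overlap: "c \<in> A \<Longrightarrow> q \<in> chart_dom c \<Longrightarrow> q \<in> chart_dom d \<Longrightarrow> snd c q \<in> overlap c d"
  by (auto simp: overlap_def)

lemma trans_of: "c \<in> A \<Longrightarrow> q \<in> chart_dom c \<Longrightarrow> trans c d (snd c q) = snd d q"
  by (simp add: loc_def chart_inv_of)

lemma trans_overlap:
  assumes "c \<in> A" "d \<in> A" "z \<in> overlap c d"
  shows "trans c d z \<in> overlap d c" "trans c d z \<in> chart_img d" "chart_inv d (trans c d z) = chart_inv c z"
  using assms overlap_iff[OF assms(1)] overlap_iff[OF assms(2)]
  by (auto simp: loc_def chart_inv_of chart_in_img chart_inv_dom)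

lemma smooth_trans: "c \<in> A \<Longrightarrow> d \<in> A \<Longrightarrow> smooth_on (overlap c d) (trans c d)"
  using oriented by (auto simp: oriented_surface_def overlap_def)

lemma det_trans: "c \<in> A \<Longrightarrow> d \<in> A \<Longrightarrow> z \<in> overlap c d \<Longrightarrow> det (matrix (D (trans c d) z)) > 0"
  using oriented by (auto simp: oriented_surface_def overlap_def)

lemma diff_trans: "c \<in> A \<Longrightarrow> d \<in> A \<Longrightarrow> z \<in> overlap c d \<Longrightarrow> trans c d differentiable (at z)"
  by (rule smooth_on_differentiable[OF smooth_trans])

lemma D_trans_matrix:
  assumes "c \<in> A" "d \<in> A" "z \<in> overlap c d"
  shows "D (trans c d) z v = matrix (D (trans c d) z) *v v"
  using fun_cong[OF matrix_vector_mul(2)[OF linear_D[OF diff_trans[OF assms]]], of v] by simp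

lemma loc_trans:
  assumes "c \<in> A" "d \<in> A" "z \<in> overlap c d"
  shows "loc c f z = loc d f (trans c d z)"
  using trans_overlap(3)[OF assms] by (simp add: loc_def)

lemma D_loc_trans:
  fixes f :: "'a \<Rightarrow> 'v::euclidean_space"
  assumes "c \<in> A" "d \<in> A" "z \<in> overlap c d" "loc d f differentiable (at (trans c d z))"
  shows "D (loc c f) z v = D (loc d f) (trans c d z) (D (trans c d) z v)"
proof -
  have dd: "(\<lambda>z. loc d f (trans c d z)) differentiable (at z)"
    using differentiable_chain_at[OF diff_trans[OF assms(1-3)] assms(4)] by (simp add: o_def)
  note * = D_cong[OF dd open_overlap[OF assms(1,2)] assms(3), of "loc c f"]
  have e: "loc d f (trans c d y) = loc c f y" if "y \<in> overlap c d" for y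
    by (rule loc_trans[OF assms(1,2) that, symmetric])
  have "D (loc c f) z = D (\<lambda>z. loc d f (trans c d z)) z" by (rule *(1)) (rule e)
  then show "D (loc c f) z v = D (loc d f) (trans c d z) (D (trans c d) z v)"
    using D_chain[of "loc d f" "trans c d" z v, OF assms(4) diff_trans[OF assms(1-3)]] by simp
qed

lemma smooth_map_diff: "smooth_map A f \<Longrightarrow> c \<in> A \<Longrightarrow> z \<in> chart_img c \<Longrightarrow> loc c f differentiable (at z)"
  unfolding smooth_map_def using smooth_on_differentiable by blast

lemma D_loc_cols:
  fixes f :: "'a \<Rightarrow> 'v::euclidean_space"
  assumes f: "smooth_map A f" and c: "c \<in> A" and d: "d \<in> A" and z: "z \<in> overlap c d"
  defines "J \<equiv> matrix (D (trans c d) z)"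
  shows "D (loc c f) z (axis j 1) = J $ 1 $ j *\<^sub>R D (loc d f) (trans c d z) (axis 1 1)
    + J $ 2 $ j *\<^sub>R D (loc d f) (trans c d z) (axis 2 1)"
proof -
  have df: "loc d f differentiable (at (trans c d z))"
    by (rule smooth_map_diff[OF f d trans_overlap(2)[OF c d z]])
  have "J *v axis j 1 = J $ 1 $ j *\<^sub>R axis 1 1 + J $ 2 $ j *\<^sub>R axis 2 1"
    by (rule matrix_vector_axis_2)
  moreover note L = linear_D[OF df]
  ultimately show ?thesis
    unfolding D_loc_trans[OF c d z df] D_trans_matrix[OF c d z] J_def[symmetric]
    by (simp add: linear_add[OF L] linear_cmul[OF L])
qed

end

section \<open>Unit normal and curvatures independently of charts\<close>

locale immersed_surface = surface A for A :: "'a::{t2_space,second_countable_topology} chart set" +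
  fixes s :: geometry and \<phi> :: "'a \<Rightarrow> real^4"
  assumes imm: "immersion A (ambient s) \<phi>"
begin

lemma smooth_map_\<phi>: "smooth_map A \<phi>" using imm by (simp add: immersion_def)

lemma patch: assumes "c \<in> A" shows "patch s (chart_img c) (loc c \<phi>)"
proof
  show "open (chart_img c)" by (rule chart_homeo(2)[OF assms])
  show "smooth_on (chart_img c) (loc c \<phi>)" using imm assms by (auto simp: immersion_def smooth_map_def)
  show "loc c \<phi> z \<in> ambient s" for z using imm by (auto simp: immersion_def loc_def)
  show "inj (D (loc c \<phi>) z)" if "z \<in> chart_img c" for z using imm that assms by (auto simp: immersion_def)
qed

lemma D_loc: assumes "c \<in> A" "d \<in> A" "z \<in> overlap c d"
  shows "D (loc c \<phi>) z v = D (loc d \<phi>) (trans c d z) (D (trans c d) z v)"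
  by (rule D_loc_trans[OF assms patch.diff_F[OF patch[OF assms(2)] trans_overlap(2)[OF assms]]])

text \<open>The description of \<open>unit_normal\<close> quantifies over all charts at
  \<open>q\<close>. The normal computed in the chart \<open>c\<close> meets the condition of any
  other chart \<open>d\<close>, because the coordinate change multiplies the determinant by its
  positive Jacobian.\<close>

lemma unit_normal_eq:
  assumes c: "c \<in> A" "q \<in> chart_dom c"
  shows "unit_normal s A \<phi> q = gnormal s (loc c \<phi>) (snd c q)"
proof -
  interpret P: patch s "chart_img c" "loc c \<phi>" by (rule patch[OF c(1)])
  define z where "z = snd c q"
  have z: "z \<in> chart_img c" unfolding z_def by (rule chart_in_img[OF c])
  have q: "loc c \<phi> z = \<phi> q" by (simp add: loc_def z_def chart_inv_of[OF c])
  interpret tp: tangent_plane s "\<phi> q" "D (loc c \<phi>) z (axis 1 1)" "D (loc c \<phi>) z (axis 2 1)"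
    using P.tangent_plane[OF z] unfolding q .
  have n: "gnormal s (loc c \<phi>) z = tp.n" by (simp add: gnormal_def q)
  show ?thesis
    unfolding unit_normal_def z_def[symmetric]
  proof (rule the_equality, intro conjI ballI impI allI)
    show "ip s (gnormal s (loc c \<phi>) z) (gnormal s (loc c \<phi>) z) = eps s" by (rule P.N_ip[OF z])
    show "ip s (gnormal s (loc c \<phi>) z) (\<phi> q) = 0" unfolding n by (rule tp.n_ip)
    fix d assume d: "d \<in> A" "q \<in> chart_dom d"
    have w: "snd d q \<in> overlap d c" by (rule in_overlap[OF d c(2)])
    have t: "trans d c (snd d q) = z" unfolding z_def by (rule trans_of[OF d])
    show "ip s (gnormal s (loc c \<phi>) z) (D (loc d \<phi>) (snd d q) v) = 0" for v
      unfolding D_loc[OF d(1) c(1) w] t by (rule P.N_DF[OF z])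
    have "plk (\<phi> q \<and>\<and> D (loc d \<phi>) (snd d q) (axis 1 1)) (D (loc d \<phi>) (snd d q) (axis 2 1) \<and>\<and> gnormal s (loc c \<phi>) z)
        = det (matrix (D (trans d c) (snd d q))) * sqrt (gram2 s (D (loc c \<phi>) z (axis 1 1)) (D (loc c \<phi>) z (axis 2 1)))"
    proof -
      define a b n where "a = D (loc c \<phi>) z (axis 1 1)" and "b = D (loc c \<phi>) z (axis 2 1)" and "n = gnormal s (loc c \<phi>) z"
      have 1: "plk (\<phi> q \<and>\<and> a) (a \<and>\<and> n) = 0" "plk (\<phi> q \<and>\<and> b) (b \<and>\<and> n) = 0"
        "plk (\<phi> q \<and>\<and> b) (a \<and>\<and> n) = - plk (\<phi> q \<and>\<and> a) (b \<and>\<and> n)"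
        by (simp_all add: plk_def wedge_def algebra_simps)
      have 2: "plk (\<phi> q \<and>\<and> a) (b \<and>\<and> n) = sqrt (gram2 s a b)"
        using tp.plk_n(1) by (simp add: a_def b_def n_def n)
      show ?thesis
        unfolding D_loc_cols[OF smooth_map_\<phi> d(1) c(1) w] t a_def[symmetric] b_def[symmetric] n_def[symmetric]
        by (simp add: wedge.add_left wedge.add_right wedge.scaleR_left wedge.scaleR_right
          plk.add_left plk.add_right plk.scaleR_left plk.scaleR_right 1 2 det_2 algebra_simps)
    qed
    also have "\<dots> > 0" using det_trans[OF d(1) c(1) w] tp.gram2_pos by simp
    finally show "det (vector [\<phi> q, D (loc d \<phi>) (snd d q) (axis 1 1), D (loc d \<phi>) (snd d q) (axis 2 1), gnormal s (loc c \<phi>) z] :: real^4^4) > 0"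
      by (simp add: plk_det)
  next
    fix \<nu> assume *: "ip s \<nu> \<nu> = eps s \<and> ip s \<nu> (\<phi> q) = 0 \<and>
      (\<forall>c\<in>A. q \<in> chart_dom c \<longrightarrow> (\<forall>v. ip s \<nu> (D (loc c \<phi>) (snd c q) v) = 0) \<and>
        det (vector [\<phi> q, D (loc c \<phi>) (snd c q) (axis 1 1), D (loc c \<phi>) (snd c q) (axis 2 1), \<nu>] :: real^4^4) > 0)"
    show "\<nu> = gnormal s (loc c \<phi>) z"
      unfolding n by (rule tp.n_unique) (use * c in \<open>auto simp: z_def plk_det\<close>)
  qed
qed

lemma loc_unit_normal: "c \<in> A \<Longrightarrow> z \<in> chart_img c \<Longrightarrow> loc c (unit_normal s A \<phi>) z = gnormal s (loc c \<phi>) z"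
  using unit_normal_eq[of c "chart_inv c z"] by (simp add: loc_def chart_inv_dom chart_of_inv)

lemma loc_gauss_map:
  "c \<in> A \<Longrightarrow> z \<in> chart_img c \<Longrightarrow> loc c (gauss_map s A \<phi>) z = loc c \<phi> z \<and>\<and> gnormal s (loc c \<phi>) z"
  using loc_unit_normal[of c z] by (simp add: loc_def gauss_map_def)

lemma D_loc_unit_normal: assumes "c \<in> A" "z \<in> chart_img c"
  shows "D (loc c (unit_normal s A \<phi>)) z = D (gnormal s (loc c \<phi>)) z" "loc c (unit_normal s A \<phi>) differentiable (at z)"
  using D_cong[OF patch.diff_N[OF patch] chart_homeo(2), OF assms(1) assms(2) assms, of "loc c (unit_normal s A \<phi>)"]
    loc_unit_normal[OF assms(1)] by auto

lemma D_loc_gauss_map: assumes "c \<in> A" "z \<in> chart_img c"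
  shows "D (loc c (gauss_map s A \<phi>)) z = D (\<lambda>z. loc c \<phi> z \<and>\<and> gnormal s (loc c \<phi>) z) z"
    "loc c (gauss_map s A \<phi>) differentiable (at z)"
  using D_cong[OF smooth_on_differentiable[OF patch.smooth_\<Phi>[OF patch]] chart_homeo(2),
      OF assms(1) assms(2) assms(1,2), of "loc c (gauss_map s A \<phi>)"]
    loc_gauss_map[OF assms(1)] by auto

lemma smooth_gauss_map: "smooth_map A (gauss_map s A \<phi>)"
  unfolding smooth_map_def
proof
  fix c assume c: "c \<in> A"
  show "smooth_on (chart_img c) (loc c (gauss_map s A \<phi>))"
    by (rule smooth_on_cong[OF chart_homeo(2)[OF c] _ patch.smooth_\<Phi>[OF patch[OF c]]])
      (rule loc_gauss_map[OF c, symmetric])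
qed

lemma gauss_map_geodesics: "gauss_map s A \<phi> q \<in> geodesics s"
proof -
  obtain c where c: "c \<in> A" "q \<in> chart_dom c" using chart_cover by blast
  have "loc c (gauss_map s A \<phi>) (snd c q) \<in> geodesics s"
    unfolding loc_gauss_map[OF c(1) chart_in_img[OF c]] by (rule patch.\<Phi>_geodesics[OF patch[OF c(1)] chart_in_img[OF c]])
  then show ?thesis by (simp add: loc_def chart_inv_of[OF c])
qed

abbreviation "shp c q \<equiv> shape_operator (loc c \<phi>) (loc c (unit_normal s A \<phi>)) (snd c q)"

lemma shape_matrix:
  assumes "c \<in> A" "q \<in> chart_dom c"
  shows "- D (gnormal s (loc c \<phi>)) (snd c q) v = D (loc c \<phi>) (snd c q) (matrix (shp c q) *v v)"
proof -
  have z: "snd c q \<in> chart_img c" by (rule chart_in_img[OF assms])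
  obtain M where M: "shape_operator (loc c \<phi>) (gnormal s (loc c \<phi>)) (snd c q) = (\<lambda>v. M *v v)"
    "\<And>v. - D (gnormal s (loc c \<phi>)) (snd c q) v = D (loc c \<phi>) (snd c q) (M *v v)"
    using patch.shape_operator_matrix[OF patch[OF assms(1)] z] by blast
  have "shp c q = (\<lambda>v. M *v v)"
    using M(1) unfolding shape_operator_def D_loc_unit_normal(1)[OF assms(1) z] .
  then show ?thesis using M(2) by simp
qed

text \<open>Both matrices represent the same endomorphism of the tangent plane, in bases related by
  \<open>J\<close>. Hence their traces and determinants agree, which the descriptions of the
  curvatures require.\<close>

lemma shape_conj:
  assumes c: "c \<in> A" "q \<in> chart_dom c" and d: "d \<in> A" "q \<in> chart_dom d"
  defines "J \<equiv> matrix (D (trans c d) (snd c q))"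
  shows "J ** matrix (shp c q) = matrix (shp d q) ** J" "det J \<noteq> 0"
proof -
  define z where "z = snd c q"
  have w: "z \<in> overlap c d" unfolding z_def by (rule in_overlap[OF c d(2)])
  have t: "trans c d z = snd d q" unfolding z_def by (rule trans_of[OF c])
  have zd: "snd d q \<in> chart_img d" by (rule chart_in_img[OF d])
  have zc: "z \<in> chart_img c" unfolding z_def by (rule chart_in_img[OF c])
  show "det J \<noteq> 0" using det_trans[OF c(1) d(1) w] by (simp add: J_def z_def)
  have DN: "D (gnormal s (loc c \<phi>)) z v = D (gnormal s (loc d \<phi>)) (snd d q) (J *v v)" for v
    using D_loc_trans[OF c(1) d(1) w, of "unit_normal s A \<phi>" v] D_loc_unit_normal[OF d(1) zd] D_loc_unit_normal[OF c(1) zc]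
      D_trans_matrix[OF c(1) d(1) w, of v] by (simp add: t[unfolded z_def] J_def z_def)
  have DF: "D (loc c \<phi>) z v = D (loc d \<phi>) (snd d q) (J *v v)" for v
    using D_loc[OF c(1) d(1) w, of v] D_trans_matrix[OF c(1) d(1) w, of v] by (simp add: t[unfolded z_def] J_def z_def)
  have "D (loc d \<phi>) (snd d q) (J *v (matrix (shp c q) *v v)) = D (loc d \<phi>) (snd d q) (matrix (shp d q) *v (J *v v))" for v
    using shape_matrix[OF c, of v] shape_matrix[OF d, of "J *v v"]
    unfolding z_def[symmetric] DN DF by simp
  then have "J *v (matrix (shp c q) *v v) = matrix (shp d q) *v (J *v v)" for v
    using patch.F_inj[OF patch[OF d(1)] zd] by (metis injD)
  then show "J ** matrix (shp c q) = matrix (shp d q) ** J"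
    by (simp add: matrix_eq matrix_vector_mul_assoc)
qed

lemma shape_invariants:
  assumes "c \<in> A" "q \<in> chart_dom c" "d \<in> A" "q \<in> chart_dom d"
  shows "trace (matrix (shp c q)) = trace (matrix (shp d q))" "det (matrix (shp c q)) = det (matrix (shp d q))"
proof -
  define J where "J = matrix (D (trans c d) (snd c q))"
  have J: "J ** matrix (shp c q) = matrix (shp d q) ** J" "det J \<noteq> 0"
    unfolding J_def by (rule shape_conj[OF assms])+
  then obtain K where K: "K ** J = mat 1" "J ** K = mat 1" using invertible_det_nz invertible_def by metis
  have "matrix (shp c q) = K ** (J ** matrix (shp c q))" by (simp add: matrix_mul_assoc K)
  also have "\<dots> = K ** (matrix (shp d q) ** J)" unfolding J ..
  finally have "trace (matrix (shp c q)) = trace ((matrix (shp d q) ** J) ** K)" using trace_mul_sym by metis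
  also have "(matrix (shp d q) ** J) ** K = matrix (shp d q)" by (simp add: matrix_mul_assoc[symmetric] K)
  finally show "trace (matrix (shp c q)) = trace (matrix (shp d q))" .
  have "det J * det (matrix (shp c q)) = det (matrix (shp d q)) * det J"
    using arg_cong[OF J(1), of det] by (simp add: det_mul)
  then show "det (matrix (shp c q)) = det (matrix (shp d q))" using J(2) by simp
qed

lemma mean_curvature_eq:
  assumes "c \<in> A" "q \<in> chart_dom c"
  shows "mean_curvature s A \<phi> q = trace (matrix (shp c q)) / 2"
  unfolding mean_curvature_def
proof (rule the_equality, intro ballI impI)
  fix d assume "d \<in> A" "q \<in> chart_dom d"
  then show "trace (matrix (shp c q)) / 2 = trace (matrix (shp d q)) / 2"
    using shape_invariants(1)[OF assms] by metis
qed (use assms in blast)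

text \<open>Independence of the chart is not checked on the Christoffel formula. The Gauss equation
  turns it into a determinant of the shape operator, which is invariant under conjugation.\<close>

lemma gauss_curvature_eq:
  assumes "c \<in> A" "q \<in> chart_dom c"
  shows "gauss_curvature s A \<phi> q = det (matrix (shp c q)) + eps s"
proof -
  have *: "gauss_curvature_metric (first_form s (loc d \<phi>)) (snd d q) = det (matrix (shp d q)) + eps s"
    if "d \<in> A" "q \<in> chart_dom d" for d
    by (rule patch.gauss_equation[OF patch[OF that(1)] chart_in_img[OF that] shape_matrix[OF that]])
  show ?thesis
    unfolding gauss_curvature_def
  proof (rule the_equality, intro ballI impI)
    fix d assume d: "d \<in> A" "q \<in> chart_dom d"
    show "det (matrix (shp c q)) + eps s = gauss_curvature_metric (first_form s (loc d \<phi>)) (snd d q)"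
      unfolding *[OF d] shape_invariants(2)[OF assms d] ..
  next
    fix k assume "\<forall>c\<in>A. q \<in> chart_dom c \<longrightarrow> k = gauss_curvature_metric (first_form s (loc c \<phi>)) (snd c q)"
    then have "k = gauss_curvature_metric (first_form s (loc c \<phi>)) (snd c q)" using assms by blast
    then show "k = det (matrix (shp c q)) + eps s" unfolding *[OF assms] .
  qed
qed

abbreviation "pulldet c \<psi> z \<equiv> det (\<chi> i j. pullback_G' s (loc c \<psi>) z (axis i 1) (axis j 1) :: real^2^2)"

lemma vol_density_eq:
  assumes "c \<in> A" "q \<in> chart_dom c"
  shows "sqrt \<bar>pulldet c (gauss_map s A \<phi>) (snd c q)\<bar>
    = sqrt (det (first_form s (loc c \<phi>) (snd c q))) *
      (2 * sqrt ((mean_curvature s A \<phi> q)\<^sup>2 - gauss_curvature s A \<phi> q + eps s))"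
    and "0 \<le> (mean_curvature s A \<phi> q)\<^sup>2 - gauss_curvature s A \<phi> q + eps s"
proof -
  define z where "z = snd c q"
  define M where "M = matrix (shp c q)"
  interpret P: patch s "chart_img c" "loc c \<phi>" by (rule patch[OF assms(1)])
  have z: "z \<in> chart_img c" unfolding z_def by (rule chart_in_img[OF assms])
  have M: "- D P.N z v = D (loc c \<phi>) z (M *v v)" for v
    using shape_matrix[OF assms] by (simp add: z_def M_def)
  have disc: "0 \<le> (trace M)\<^sup>2 - 4 * det M" by (rule P.trace_det_shape[OF z M])
  have e: "(mean_curvature s A \<phi> q)\<^sup>2 - gauss_curvature s A \<phi> q + eps s = ((trace M)\<^sup>2 - 4 * det M) / 4"
    unfolding mean_curvature_eq[OF assms] gauss_curvature_eq[OF assms] M_def[symmetric]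
    by (simp add: power_divide field_simps)
  show "0 \<le> (mean_curvature s A \<phi> q)\<^sup>2 - gauss_curvature s A \<phi> q + eps s" unfolding e using disc by simp
  have "pulldet c (gauss_map s A \<phi>) z = - (((trace M)\<^sup>2 - 4 * det M) * det (first_form s (loc c \<phi>) z))"
    using P.det_pullback[OF z M] unfolding pullback_G'_def loc_gauss_map[OF assms(1) z] D_loc_gauss_map(1)[OF assms(1) z] .
  then have "sqrt \<bar>pulldet c (gauss_map s A \<phi>) z\<bar> = sqrt ((trace M)\<^sup>2 - 4 * det M) * sqrt (det (first_form s (loc c \<phi>) z))"
    using disc P.det_first_form_pos[OF z] by (simp add: abs_mult real_sqrt_mult)
  then show "sqrt \<bar>pulldet c (gauss_map s A \<phi>) (snd c q)\<bar>
    = sqrt (det (first_form s (loc c \<phi>) (snd c q))) *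
      (2 * sqrt ((mean_curvature s A \<phi> q)\<^sup>2 - gauss_curvature s A \<phi> q + eps s))"
    unfolding e z_def[symmetric] by (simp add: real_sqrt_divide)
qed

end

section \<open>Measures with given densities\<close>

lemma nn_integral_eq_integral_of_absolutely_integrable:
  fixes k :: "'a::euclidean_space \<Rightarrow> real"
  assumes "k absolutely_integrable_on T" "\<And>x. x \<in> T \<Longrightarrow> 0 \<le> k x"
  shows "(\<integral>\<^sup>+x\<in>T. ennreal (k x) \<partial>lborel) = ennreal (integral T k)"
proof -
  have "(k has_integral integral T k) T"
    using assms(1) by (simp add: absolutely_integrable_on_def integrable_integral)
  from nn_integral_has_integral_lebesgue[OF assms(2) this]
  have "(\<integral>\<^sup>+x. ennreal (indicator T x * k x) \<partial>lborel) = ennreal (integral T k)" by simp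
  moreover have "ennreal (indicator T x * k x) = ennreal (k x) * indicator T x" for x
    by (simp add: indicator_def)
  ultimately show ?thesis by simp
qed

lemma nn_integral_infinite_of_not_absolutely_integrable:
  fixes k :: "'a::euclidean_space \<Rightarrow> real"
  assumes "\<not> k absolutely_integrable_on T" "\<And>x. x \<in> T \<Longrightarrow> 0 \<le> k x"
    and "(\<lambda>x. indicator T x * k x) \<in> borel_measurable borel"
  shows "(\<integral>\<^sup>+x\<in>T. ennreal (k x) \<partial>lborel) = \<infinity>"
proof (rule ccontr)
  assume "\<not> ?thesis"
  moreover have e: "ennreal (indicator T x * k x) = ennreal (k x) * indicator T x" for x
    by (simp add: indicator_def)
  ultimately have "(\<integral>\<^sup>+x. ennreal (indicator T x * k x) \<partial>lborel) < \<infinity>"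
    by (simp add: less_top)
  then have "integrable lborel (\<lambda>x. indicator T x * k x)"
    using assms(2,3) by (intro integrableI_nonneg) (auto simp: indicator_def)
  then have "integrable lebesgue (\<lambda>x. indicator T x * k x)"
    using assms(3) by (subst integrable_completion) auto
  then show False using assms(1) by (simp add: set_integrable_def)
qed

text \<open>The substitution theorem for absolutely integrable functions settles the finite case.
  Being an equivalence, it also shows that integrability fails on both sides together, and then both
  integrals are infinite.\<close>

lemma nn_integral_change_of_variables:
  fixes \<tau> :: "real^2 \<Rightarrow> real^2" and f :: "real^2 \<Rightarrow> real"
  assumes S: "S \<in> sets borel"
    and der: "\<And>x. x \<in> S \<Longrightarrow> (\<tau> has_derivative \<tau>' x) (at x)" and inj: "inj_on \<tau> S"
    and nonneg: "\<And>x. x \<in> S \<Longrightarrow> 0 \<le> f (\<tau> x)"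
    and meas: "(\<lambda>y. indicator (\<tau> ` S) y * f y) \<in> borel_measurable borel"
      "(\<lambda>x. indicator S x * (\<bar>det (matrix (\<tau>' x))\<bar> * f (\<tau> x))) \<in> borel_measurable borel"
  shows "(\<integral>\<^sup>+y\<in>\<tau> ` S. ennreal (f y) \<partial>lborel) = (\<integral>\<^sup>+x\<in>S. ennreal (\<bar>det (matrix (\<tau>' x))\<bar> * f (\<tau> x)) \<partial>lborel)"
proof -
  define h where "h = (\<lambda>x. \<bar>det (matrix (\<tau>' x))\<bar> * f (\<tau> x))"
  have "S \<in> sets lebesgue" using S by simp
  moreover have "(\<tau> has_derivative \<tau>' x) (at x within S)" if "x \<in> S" for x
    using der[OF that] has_derivative_at_withinI by blast
  \<comment> \<open>The substitution theorem takes values in \<open>real^'n\<close>, so the scalar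
    function is read as one with values in \<open>real^1\<close>.\<close>
  ultimately have "(\<lambda>x. \<bar>det (matrix (\<tau>' x))\<bar> *\<^sub>R (vec (f (\<tau> x)) :: real^1)) absolutely_integrable_on S \<and>
      integral S (\<lambda>x. \<bar>det (matrix (\<tau>' x))\<bar> *\<^sub>R (vec (f (\<tau> x)) :: real^1)) = vec b
    \<longleftrightarrow> (\<lambda>x. vec (f x) :: real^1) absolutely_integrable_on (\<tau> ` S) \<and> integral (\<tau> ` S) (\<lambda>x. vec (f x) :: real^1) = vec b" for b
    using has_absolute_integral_change_of_variables[of S \<tau> \<tau>' "\<lambda>x. vec (f x) :: real^1" "vec b"] inj by blast
  then have iff: "h absolutely_integrable_on S \<and> integral S h = b
    \<longleftrightarrow> f absolutely_integrable_on (\<tau> ` S) \<and> integral (\<tau> ` S) f = b" for b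
    by (simp add: absolutely_integrable_on_1_iff integral_on_1_eq h_def vec_eq_iff)
  have hn: "0 \<le> h x" if "x \<in> S" for x using nonneg[OF that] by (simp add: h_def)
  have fn: "0 \<le> f y" if "y \<in> \<tau> ` S" for y using nonneg that by auto
  have "(\<integral>\<^sup>+y\<in>\<tau> ` S. ennreal (f y) \<partial>lborel) = (\<integral>\<^sup>+x\<in>S. ennreal (h x) \<partial>lborel)"
  proof (cases "f absolutely_integrable_on (\<tau> ` S)")
    case True
    then have h: "h absolutely_integrable_on S" "integral S h = integral (\<tau> ` S) f" using iff by blast+
    have "(\<integral>\<^sup>+y\<in>\<tau> ` S. ennreal (f y) \<partial>lborel) = ennreal (integral (\<tau> ` S) f)"
      by (rule nn_integral_eq_integral_of_absolutely_integrable[OF True]) (rule fn)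
    moreover have "(\<integral>\<^sup>+x\<in>S. ennreal (h x) \<partial>lborel) = ennreal (integral S h)"
      by (rule nn_integral_eq_integral_of_absolutely_integrable[OF h(1)]) (rule hn)
    ultimately show ?thesis by (simp only: h(2))
  next
    case False
    then have h: "\<not> h absolutely_integrable_on S" using iff by blast
    have m: "(\<lambda>x. indicator S x * h x) \<in> borel_measurable borel" using meas(2) by (simp add: h_def)
    have "(\<integral>\<^sup>+y\<in>\<tau> ` S. ennreal (f y) \<partial>lborel) = \<infinity>"
      by (rule nn_integral_infinite_of_not_absolutely_integrable[OF False _ meas(1)]) (rule fn)
    moreover have "(\<integral>\<^sup>+x\<in>S. ennreal (h x) \<partial>lborel) = \<infinity>"
      by (rule nn_integral_infinite_of_not_absolutely_integrable[OF h _ m]) (rule hn)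
    ultimately show ?thesis by (simp only:)
  qed
  then show ?thesis by (simp add: h_def)
qed

section \<open>Existence and uniqueness of measures with chart densities\<close>

context surface
begin

definition is_density :: "('a chart \<Rightarrow> real^2 \<Rightarrow> real) \<Rightarrow> bool" where
  "is_density \<rho> \<longleftrightarrow>
    (\<forall>c\<in>A. continuous_on (chart_img c) (\<rho> c) \<and> (\<forall>z\<in>chart_img c. 0 \<le> \<rho> c z)) \<and>
    (\<forall>c\<in>A. \<forall>d\<in>A. \<forall>z\<in>overlap c d. \<rho> c z = \<rho> d (trans c d z) * det (matrix (D (trans c d) z)))"

lemma chart_inv_measurable:
  assumes "c \<in> A" shows "chart_inv c \<in> borel_measurable (restrict_space borel (chart_img c))"
  using chart_homeo(3)[OF assms] by (intro borel_measurable_continuous_on_restrict) (simp add: homeomorphism_def)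

lemma chart_image_eq: "c \<in> A \<Longrightarrow> snd c ` (B \<inter> chart_dom c) = chart_inv c -` B \<inter> chart_img c"
  by (auto simp: chart_inv_of chart_in_img) (metis IntI chart_inv_dom chart_of_inv image_eqI)

lemma chart_image_borel:
  assumes "c \<in> A" "B \<in> sets borel" "B \<subseteq> chart_dom c" shows "snd c ` B \<in> sets borel"
proof -
  have i: "chart_img c \<in> sets borel" using chart_homeo(2)[OF assms(1)] by simp
  have "chart_inv c -` B \<inter> space (restrict_space borel (chart_img c)) \<in> sets (restrict_space borel (chart_img c))"
    by (rule measurable_sets[OF chart_inv_measurable[OF assms(1)] assms(2)])
  then have "chart_inv c -` B \<inter> chart_img c \<in> sets (restrict_space borel (chart_img c))"
    by (simp add: space_restrict_space)
  then have "chart_inv c -` B \<inter> chart_img c \<in> sets borel"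
    using sets_restrict_space_iff[of "chart_img c" borel "chart_inv c -` B \<inter> chart_img c"] i by simp
  moreover have "snd c ` B = snd c ` (B \<inter> chart_dom c)" using assms(3) by (simp add: inf.absorb1)
  ultimately show ?thesis using chart_image_eq[OF assms(1), of B] by simp
qed

lemma density_measurable:
  assumes "is_density \<rho>" "c \<in> A" "S \<in> sets borel" "S \<subseteq> chart_img c"
  shows "(\<lambda>z. indicator S z * \<rho> c z) \<in> borel_measurable borel"
proof -
  have "continuous_on S (\<rho> c)" using assms continuous_on_subset by (fastforce simp: is_density_def)
  from borel_measurable_continuous_on_indicator[OF assms(3) this] show ?thesis by simp
qed

lemma ennreal_indicator_mult: "ennreal r * indicator S z = ennreal (indicator S z * r)"
  by (simp add: indicator_def)

lemma density_measurable_ennreal: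
  assumes "is_density \<rho>" "c \<in> A" "S \<in> sets borel" "S \<subseteq> chart_img c"
  shows "(\<lambda>z. ennreal (\<rho> c z) * indicator S z) \<in> borel_measurable borel"
  unfolding ennreal_indicator_mult using density_measurable[OF assms] by simp

lemma chart_inj: "c \<in> A \<Longrightarrow> B \<subseteq> chart_dom c \<Longrightarrow> inj_on (snd c) B"
  by (rule inj_on_inverseI[of _ "chart_inv c"]) (auto simp: chart_inv_of)

lemma density_overlap:
  assumes \<rho>: "is_density \<rho>" and c: "c \<in> A" and d: "d \<in> A"
    and B: "B \<in> sets borel" "B \<subseteq> chart_dom c" "B \<subseteq> chart_dom d"
  shows "(\<integral>\<^sup>+z\<in>snd d ` B. ennreal (\<rho> d z) \<partial>lborel) = (\<integral>\<^sup>+z\<in>snd c ` B. ennreal (\<rho> c z) \<partial>lborel)"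
proof -
  define S where "S = snd c ` B"
  have S: "S \<in> sets borel" "S \<subseteq> overlap c d" "S \<subseteq> chart_img c"
    using chart_image_borel[OF c B(1,2)] B chart_in_img[OF c] by (auto simp: S_def overlap_def)
  have im: "trans c d ` S = snd d ` B"
    unfolding S_def image_image using B(2) by (intro image_cong refl) (auto intro!: trans_of[OF c])
  have ri: "snd d ` B \<in> sets borel" "snd d ` B \<subseteq> chart_img d"
    using chart_image_borel[OF d B(1,3)] B chart_in_img[OF d] by auto
  have e: "\<rho> c z = \<bar>det (matrix (D (trans c d) z))\<bar> * \<rho> d (trans c d z)" if "z \<in> S" for z
    using \<rho> c d that S(2) det_trans[OF c d, of z] by (auto simp: is_density_def)
  have "(\<integral>\<^sup>+z\<in>trans c d ` S. ennreal (\<rho> d z) \<partial>lborel)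
      = (\<integral>\<^sup>+z\<in>S. ennreal (\<bar>det (matrix (D (trans c d) z))\<bar> * \<rho> d (trans c d z)) \<partial>lborel)"
  proof (rule nn_integral_change_of_variables[OF S(1)])
    show "(trans c d has_derivative D (trans c d) x) (at x)" if "x \<in> S" for x
      using has_derivative_D[OF diff_trans[OF c d]] that S(2) by blast
    show "inj_on (trans c d) S"
    proof (rule inj_on_inverseI[of _ "\<lambda>y. snd c (chart_inv d y)"])
      fix z assume "z \<in> S"
      then have z: "z \<in> overlap c d" using S(2) by blast
      then show "snd c (chart_inv d (trans c d z)) = z"
        unfolding trans_overlap(3)[OF c d z] using chart_of_inv[OF c] overlap_subset[OF c] by blast
    qed
    show "0 \<le> \<rho> d (trans c d x)" if "x \<in> S" for x
      using \<rho> d trans_overlap(2)[OF c d] that S(2) by (auto simp: is_density_def)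
    show "(\<lambda>y. indicator (trans c d ` S) y * \<rho> d y) \<in> borel_measurable borel"
      unfolding im by (rule density_measurable[OF \<rho> d ri])
    have "(\<lambda>x. indicator S x * (\<bar>det (matrix (D (trans c d) x))\<bar> * \<rho> d (trans c d x))) = (\<lambda>x. indicator S x * \<rho> c x)"
      using e by (auto simp: indicator_def)
    then show "(\<lambda>x. indicator S x * (\<bar>det (matrix (D (trans c d) x))\<bar> * \<rho> d (trans c d x))) \<in> borel_measurable borel"
      using density_measurable[OF \<rho> c S(1,3)] by simp
  qed
  also have "\<dots> = (\<integral>\<^sup>+z\<in>S. ennreal (\<rho> c z) \<partial>lborel)"
    by (rule nn_integral_cong) (use e in \<open>auto simp: indicator_def\<close>)
  finally have "(\<integral>\<^sup>+z\<in>trans c d ` S. ennreal (\<rho> d z) \<partial>lborel) = (\<integral>\<^sup>+z\<in>S. ennreal (\<rho> c z) \<partial>lborel)" .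
  from this[unfolded im] show ?thesis unfolding S_def .
qed

text \<open>Second countability gives the Lindelof property, so countably many charts cover the
  surface; the sequence may repeat charts.\<close>

lemma ex_chart_sequence: "\<exists>cs. (\<forall>n::nat. cs n \<in> A) \<and> (\<Union>n. chart_dom (cs n)) = UNIV"
proof -
  obtain F where F: "F \<subseteq> chart_dom ` A" "countable F" "\<Union>F = \<Union>(chart_dom ` A)"
    using Lindelof[of "chart_dom ` A"] chart_homeo(1) by blast
  have U: "\<Union>(chart_dom ` A) = UNIV" using chart_cover by blast
  then have ne: "F \<noteq> {}" using F(3) by auto
  then have r: "range (from_nat_into F) = F" using F(2) by (rule range_from_nat_into)
  have "\<forall>n. \<exists>c. c \<in> A \<and> from_nat_into F n = chart_dom c"
  proof
    fix n
    have "from_nat_into F n \<in> chart_dom ` A" using F(1) from_nat_into[OF ne] by (rule subsetD)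
    then show "\<exists>c. c \<in> A \<and> from_nat_into F n = chart_dom c" by blast
  qed
  from choice[OF this] obtain cs where cs: "\<And>n. cs n \<in> A" "\<And>n. chart_dom (cs n) = from_nat_into F n"
    by auto
  have "(\<Union>n. chart_dom (cs n)) = \<Union>F" unfolding cs(2) using r by simp
  then have "(\<Union>n. chart_dom (cs n)) = UNIV" using F(3) U by simp
  then show ?thesis using cs(1) by (intro exI[of _ cs]) simp
qed

definition "chart_seq = (SOME cs. (\<forall>n::nat. cs n \<in> A) \<and> (\<Union>n. chart_dom (cs n)) = UNIV)"

lemma chart_seq: "chart_seq n \<in> A" "(\<Union>n. chart_dom (chart_seq n)) = UNIV"
  using someI_ex[OF ex_chart_sequence] unfolding chart_seq_def by blast+

text \<open>Disjoint Borel pieces, each inside a single chart: a measure is determined by, and can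
  be assembled from, its restrictions to them.\<close>

definition piece :: "nat \<Rightarrow> 'a set" where
  "piece n = disjointed (\<lambda>n. chart_dom (chart_seq n)) n"

lemma piece:
  "piece n \<in> sets borel" "piece n \<subseteq> chart_dom (chart_seq n)" "disjoint_family piece" "(\<Union>n. piece n) = UNIV"
proof -
  have "range (\<lambda>n. chart_dom (chart_seq n)) \<subseteq> sets borel" using chart_homeo(1)[OF chart_seq(1)] by auto
  then show "piece n \<in> sets borel" unfolding piece_def using sets.range_disjointed_sets by blast
  show "piece n \<subseteq> chart_dom (chart_seq n)" unfolding piece_def by (rule disjointed_subset)
  show "disjoint_family piece" unfolding piece_def[abs_def] by (rule disjoint_family_disjointed)
  show "(\<Union>n. piece n) = UNIV" unfolding piece_def using UN_disjointed_eq chart_seq(2) by metis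
qed

definition represents :: "('a chart \<Rightarrow> real^2 \<Rightarrow> real) \<Rightarrow> 'a measure \<Rightarrow> bool" where
  "represents \<rho> \<mu> \<longleftrightarrow> sets \<mu> = sets borel \<and>
     (\<forall>c\<in>A. \<forall>B\<in>sets borel. B \<subseteq> chart_dom c \<longrightarrow>
        emeasure \<mu> B = (\<integral>\<^sup>+z\<in>snd c ` B. ennreal (\<rho> c z) \<partial>lborel))"

lemma represents_unique:
  assumes "represents \<rho> \<mu>" "represents \<rho> \<nu>" shows "\<mu> = \<nu>"
proof (rule measure_eqI)
  show "sets \<mu> = sets \<nu>" using assms by (simp add: represents_def)
  fix B assume "B \<in> sets \<mu>"
  then have B: "B \<in> sets borel" using assms by (simp add: represents_def)
  have dj: "disjoint_family (\<lambda>n. B \<inter> piece n)" using piece(3) by (auto simp: disjoint_family_on_def)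
  have u: "(\<Union>n. B \<inter> piece n) = B" using piece(4) by auto
  have "emeasure \<mu> (B \<inter> piece n) = emeasure \<nu> (B \<inter> piece n)" for n
  proof -
    have "B \<inter> piece n \<in> sets borel" "B \<inter> piece n \<subseteq> chart_dom (chart_seq n)"
      using B piece(1,2)[of n] by auto
    then show ?thesis using assms chart_seq(1)[of n] unfolding represents_def by metis
  qed
  then have "(\<Sum>n. emeasure \<mu> (B \<inter> piece n)) = (\<Sum>n. emeasure \<nu> (B \<inter> piece n))" by simp
  moreover have "(\<Sum>n. emeasure M (B \<inter> piece n)) = emeasure M B" if "sets M = sets borel" for M
  proof -
    have "range (\<lambda>n. B \<inter> piece n) \<subseteq> sets M" unfolding that using B piece(1) sets.Int by blast
    from suminf_emeasure[OF this dj] show ?thesis unfolding u .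
  qed
  ultimately show "emeasure \<mu> B = emeasure \<nu> B" using assms by (simp add: represents_def)
qed

text \<open>The measure is the sum over the pieces of the chart integrals. That it has the
  prescribed density in every chart of the atlas, not only in those of the sequence, is the
  substitution rule \<open>density_overlap\<close>.\<close>

lemma represents_exists:
  assumes \<rho>: "is_density \<rho>" shows "\<exists>\<mu>. represents \<rho> \<mu>"
proof -
  define I where "I n B = (\<integral>\<^sup>+z\<in>snd (chart_seq n) ` (B \<inter> piece n). ennreal (\<rho> (chart_seq n) z) \<partial>lborel)" for n B
  define \<mu> where "\<mu> = measure_of UNIV (sets borel) (\<lambda>B. \<Sum>n. I n B)"
  have Bn: "B \<inter> piece n \<in> sets borel" "B \<inter> piece n \<subseteq> chart_dom (chart_seq n)" if "B \<in> sets borel" for B n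
    using that piece(1,2)[of n] by auto
  have sum_image: "(\<Sum>i. \<integral>\<^sup>+z\<in>snd c ` (B i). ennreal (\<rho> c z) \<partial>lborel) = (\<integral>\<^sup>+z\<in>snd c ` (\<Union>i. B i). ennreal (\<rho> c z) \<partial>lborel)"
    if c: "c \<in> A" and B: "\<And>i. B i \<in> sets borel" "\<And>i. B i \<subseteq> chart_dom c" and dj: "disjoint_family B" for c and B :: "nat \<Rightarrow> 'a set"
  proof -
    have inj: "inj_on (snd c) (\<Union>i. B i)" using B(2) by (intro chart_inj[OF c]) auto
    have dj': "disjoint_family (\<lambda>i. snd c ` B i)"
      unfolding disjoint_family_on_def
    proof (intro ballI impI)
      fix m n :: nat assume "m \<noteq> n"
      then have "B m \<inter> B n = {}" using dj by (auto simp: disjoint_family_on_def)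
      then show "snd c ` B m \<inter> snd c ` B n = {}"
        using inj_on_image_Int[OF inj, of "B m" "B n"] by auto
    qed
    have "(\<Sum>i. \<integral>\<^sup>+z\<in>snd c ` (B i). ennreal (\<rho> c z) \<partial>lborel) = (\<integral>\<^sup>+z. (\<Sum>i. ennreal (\<rho> c z) * indicator (snd c ` B i) z) \<partial>lborel)"
    proof (rule nn_integral_suminf[symmetric])
      fix i
      have "snd c ` B i \<subseteq> chart_img c" using B(2)[of i] chart_in_img[OF c] by auto
      then show "(\<lambda>z. ennreal (\<rho> c z) * indicator (snd c ` B i) z) \<in> borel_measurable lborel"
        using density_measurable_ennreal[OF \<rho> c chart_image_borel[OF c B(1,2)]] by simp
    qed
    also have "\<dots> = (\<integral>\<^sup>+z\<in>snd c ` (\<Union>i. B i). ennreal (\<rho> c z) \<partial>lborel)"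
      by (rule nn_integral_cong) (simp add: suminf_indicator[OF dj'] image_UN)
    finally show ?thesis .
  qed
  have em: "emeasure \<mu> B = (\<Sum>n. I n B)" if "B \<in> sets borel" for B
    unfolding \<mu>_def
  proof (rule emeasure_measure_of_sigma[OF _ _ _ that])
    show "sigma_algebra UNIV (sets (borel :: 'a measure))" using sets.sigma_algebra_axioms[of borel] by simp
    show "positive (sets borel) (\<lambda>B. \<Sum>n. I n B)" by (simp add: positive_def I_def)
    show "countably_additive (sets borel) (\<lambda>B. \<Sum>n. I n B)"
      unfolding countably_additive_def
    proof (intro allI impI)
      fix B :: "nat \<Rightarrow> 'a set" assume B: "range B \<subseteq> sets borel" "disjoint_family B"
      \<comment> \<open>The two series of non-negative terms are exchanged by reading the inner one
        as an integral over counting measure.\<close>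
      have "(\<Sum>i. \<Sum>n. I n (B i)) = (\<Sum>i. \<integral>\<^sup>+n. I n (B i) \<partial>count_space UNIV)"
        by (simp add: nn_integral_count_space_nat)
      also have "\<dots> = (\<integral>\<^sup>+n. (\<Sum>i. I n (B i)) \<partial>count_space UNIV)"
        by (rule nn_integral_suminf[symmetric]) simp
      also have "\<dots> = (\<Sum>n. \<Sum>i. I n (B i))" by (simp add: nn_integral_count_space_nat)
      also have "\<dots> = (\<Sum>n. I n (\<Union>i. B i))"
      proof (intro suminf_cong)
        fix n show "(\<Sum>i. I n (B i)) = I n (\<Union>i. B i)"
      proof -
        have "disjoint_family (\<lambda>i. B i \<inter> piece n)" using B(2) by (auto simp: disjoint_family_on_def)
        then have "(\<Sum>i. I n (B i)) = (\<integral>\<^sup>+z\<in>snd (chart_seq n) ` (\<Union>i. B i \<inter> piece n). ennreal (\<rho> (chart_seq n) z) \<partial>lborel)"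
          unfolding I_def using B(1) Bn by (intro sum_image chart_seq(1)) auto
        then show ?thesis by (simp add: I_def)
        qed
      qed
      finally show "(\<Sum>i. \<Sum>n. I n (B i)) = (\<Sum>n. I n (\<Union> (range B)))" .
    qed
  qed
  have sets: "sets \<mu> = sets borel"
    unfolding \<mu>_def using sets.sigma_sets_eq[of "borel :: 'a measure"] by simp
  have "represents \<rho> \<mu>"
    unfolding represents_def
  proof (intro conjI sets ballI impI)
    fix c B assume c: "c \<in> A" and B: "B \<in> sets borel" "B \<subseteq> chart_dom c"
    have "I n B = (\<integral>\<^sup>+z\<in>snd c ` (B \<inter> piece n). ennreal (\<rho> c z) \<partial>lborel)" for n
      unfolding I_def by (rule density_overlap[OF \<rho> c chart_seq(1) Bn(1)[OF B(1)] _ Bn(2)[OF B(1)]]) (use B in auto)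
    then have "emeasure \<mu> B = (\<Sum>n. \<integral>\<^sup>+z\<in>snd c ` (B \<inter> piece n). ennreal (\<rho> c z) \<partial>lborel)"
      unfolding em[OF B(1)] by simp
    also have "\<dots> = (\<integral>\<^sup>+z\<in>snd c ` (\<Union>n. B \<inter> piece n). ennreal (\<rho> c z) \<partial>lborel)"
    proof (rule sum_image[OF c Bn(1)[OF B(1)]])
      show "B \<inter> piece i \<subseteq> chart_dom c" for i using B by auto
      show "disjoint_family (\<lambda>n. B \<inter> piece n)" using piece(3) by (auto simp: disjoint_family_on_def)
    qed
    also have "(\<Union>n. B \<inter> piece n) = B" using piece(4) by auto
    finally show "emeasure \<mu> B = (\<integral>\<^sup>+z\<in>snd c ` B. ennreal (\<rho> c z) \<partial>lborel)" .
  qed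
  then show ?thesis by blast
qed

lemma density_measure_represents:
  assumes "is_density \<rho>" shows "represents \<rho> (density_measure A \<rho>)"
proof -
  have "density_measure A \<rho> = (THE \<mu>. represents \<rho> \<mu>)"
    by (simp add: density_measure_def represents_def)
  moreover have "\<exists>!\<mu>. represents \<rho> \<mu>" using represents_exists[OF assms] represents_unique by blast
  ultimately show ?thesis using theI'[of "represents \<rho>"] by simp
qed

lemma density_measure_eqI: "represents \<rho> \<mu> \<Longrightarrow> density_measure A \<rho> = \<mu>"
  unfolding density_measure_def represents_def[symmetric]
  by (rule the_equality) (use represents_unique in auto)

lemma sets_density_measure: "is_density \<rho> \<Longrightarrow> sets (density_measure A \<rho>) = sets borel"
  using density_measure_represents by (simp add: represents_def)

text \<open>Restricted to \<open>B\<close>, the measure is the image under the inverse chart of a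
  measure with density in the plane, so integrals can be transported.\<close>

lemma nn_integral_density_measure:
  assumes \<rho>: "is_density \<rho>" and c: "c \<in> A" and h: "h \<in> borel_measurable borel"
    and B: "B \<in> sets borel" "B \<subseteq> chart_dom c"
  shows "(\<integral>\<^sup>+q\<in>B. h q \<partial>density_measure A \<rho>) = (\<integral>\<^sup>+z\<in>snd c ` B. ennreal (\<rho> c z) * h (chart_inv c z) \<partial>lborel)"
proof -
  define \<mu> where "\<mu> = density_measure A \<rho>"
  have R: "sets \<mu> = sets borel" "\<And>B. B \<in> sets borel \<Longrightarrow> B \<subseteq> chart_dom c \<Longrightarrow>
      emeasure \<mu> B = (\<integral>\<^sup>+z\<in>snd c ` B. ennreal (\<rho> c z) \<partial>lborel)"
    using density_measure_represents[OF \<rho>] c by (auto simp: represents_def \<mu>_def)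
  have hm: "h \<in> borel_measurable \<mu>" using h measurable_cong_sets[OF R(1) refl] by blast
  have img: "snd c ` B \<in> sets borel" "snd c ` B \<subseteq> chart_img c"
    using chart_image_borel[OF c B] chart_in_img[OF c] B(2) by auto
  \<comment> \<open>The inverse chart extended by a constant, hence Borel on the whole plane. The
    density is cut off to the image of \<open>B\<close>, so the value \<open>undefined\<close> does
    not enter.\<close>
  define g where "g z = (if z \<in> chart_img c then chart_inv c z else undefined)" for z
  have gm: "g \<in> borel_measurable borel"
    unfolding g_def
    by (rule measurable_If_restrict_space_iff[THEN iffD2])
       (use chart_homeo(2)[OF c] chart_inv_measurable[OF c] in \<open>auto simp: space_restrict_space\<close>)
  have m1: "(\<lambda>z. ennreal (\<rho> c z) * indicator (snd c ` B) z) \<in> borel_measurable lborel"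
    using density_measurable_ennreal[OF \<rho> c img] by simp
  have eq: "density \<mu> (indicator B) = distr (density lborel (\<lambda>z. ennreal (\<rho> c z) * indicator (snd c ` B) z)) borel g"
  proof (rule measure_eqI)
    show "sets (density \<mu> (indicator B)) = sets (distr (density lborel (\<lambda>z. ennreal (\<rho> c z) * indicator (snd c ` B) z)) borel g)"
      using R(1) by simp
    fix E assume "E \<in> sets (density \<mu> (indicator B))"
    then have E: "E \<in> sets borel" using R(1) by simp
    have gE: "g -` E \<in> sets borel" using measurable_sets[OF gm E] by simp
    have "emeasure (density \<mu> (indicator B)) E = (\<integral>\<^sup>+x. indicator B x * indicator E x \<partial>\<mu>)"
      using E B R(1) by (intro emeasure_density borel_measurable_indicator) auto
    also have "\<dots> = (\<integral>\<^sup>+x. indicator (B \<inter> E) x \<partial>\<mu>)"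
      by (rule nn_integral_cong) (simp add: indicator_def)
    also have "\<dots> = emeasure \<mu> (B \<inter> E)" using E B R(1) by simp
    also have "\<dots> = (\<integral>\<^sup>+z\<in>snd c ` (B \<inter> E). ennreal (\<rho> c z) \<partial>lborel)" using E B by (intro R(2)) auto
    also have "\<dots> = (\<integral>\<^sup>+z. ennreal (\<rho> c z) * indicator (snd c ` B) z * indicator (g -` E) z \<partial>lborel)"
    proof (rule nn_integral_cong)
      fix z :: "real^2"
      have "z \<in> snd c ` (B \<inter> E) \<longleftrightarrow> z \<in> snd c ` B \<and> g z \<in> E"
        using B(2) img(2) chart_inv_of[OF c] chart_in_img[OF c] by (auto simp: g_def)
      then show "ennreal (\<rho> c z) * indicator (snd c ` (B \<inter> E)) z = ennreal (\<rho> c z) * indicator (snd c ` B) z * indicator (g -` E) z"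
        by (simp add: indicator_def)
    qed
    also have "\<dots> = emeasure (density lborel (\<lambda>z. ennreal (\<rho> c z) * indicator (snd c ` B) z)) (g -` E)"
      using gE m1 by (simp add: emeasure_density)
    also have "\<dots> = emeasure (distr (density lborel (\<lambda>z. ennreal (\<rho> c z) * indicator (snd c ` B) z)) borel g) E"
      using E gm by (simp add: emeasure_distr)
    finally show "emeasure (density \<mu> (indicator B)) E = emeasure (distr (density lborel (\<lambda>z. ennreal (\<rho> c z) * indicator (snd c ` B) z)) borel g) E" .
  qed
  have "(\<integral>\<^sup>+q\<in>B. h q \<partial>\<mu>) = (\<integral>\<^sup>+q. h q \<partial>density \<mu> (indicator B))"
    using hm B R(1) by (subst nn_integral_density) (auto simp: mult.commute intro!: borel_measurable_indicator)
  also have "\<dots> = (\<integral>\<^sup>+z. h (g z) \<partial>density lborel (\<lambda>z. ennreal (\<rho> c z) * indicator (snd c ` B) z))"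
    unfolding eq using gm h by (subst nn_integral_distr) auto
  also have "\<dots> = (\<integral>\<^sup>+z. ennreal (\<rho> c z) * indicator (snd c ` B) z * h (g z) \<partial>lborel)"
    using m1 measurable_compose[OF gm h] by (subst nn_integral_density) auto
  also have "\<dots> = (\<integral>\<^sup>+z\<in>snd c ` B. ennreal (\<rho> c z) * h (chart_inv c z) \<partial>lborel)"
    by (rule nn_integral_cong) (use img(2) in \<open>auto simp: indicator_def g_def\<close>)
  finally show ?thesis unfolding \<mu>_def .
qed

text \<open>This is how the volume of the Gauss map becomes an integral against the area of the
  surface.\<close>

lemma density_measure_mult:
  assumes \<rho>: "is_density \<rho>" and h: "h \<in> borel_measurable borel" "\<And>q. 0 \<le> h q"
    and \<rho>': "\<And>c z. c \<in> A \<Longrightarrow> z \<in> chart_img c \<Longrightarrow> \<rho>' c z = \<rho> c z * h (chart_inv c z)"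
  shows "density_measure A \<rho>' = density (density_measure A \<rho>) (\<lambda>q. ennreal (h q))"
proof (rule density_measure_eqI)
  have m: "(\<lambda>q. ennreal (h q)) \<in> borel_measurable borel" using h(1) by simp
  have m': "(\<lambda>q. ennreal (h q)) \<in> borel_measurable (density_measure A \<rho>)"
    using m measurable_cong_sets[OF sets_density_measure[OF \<rho>] refl] by blast
  show "represents \<rho>' (density (density_measure A \<rho>) (\<lambda>q. ennreal (h q)))"
    unfolding represents_def
  proof (intro conjI ballI impI)
    show "sets (density (density_measure A \<rho>) (\<lambda>q. ennreal (h q))) = sets borel" using sets_density_measure[OF \<rho>] by simp
    fix c B assume c: "c \<in> A" and B: "B \<in> sets borel" "B \<subseteq> chart_dom c"
    have "emeasure (density (density_measure A \<rho>) (\<lambda>q. ennreal (h q))) B = (\<integral>\<^sup>+q\<in>B. ennreal (h q) \<partial>density_measure A \<rho>)"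
      using B sets_density_measure[OF \<rho>] m' by (subst emeasure_density) auto
    also have "\<dots> = (\<integral>\<^sup>+z\<in>snd c ` B. ennreal (\<rho> c z) * ennreal (h (chart_inv c z)) \<partial>lborel)"
      by (rule nn_integral_density_measure[OF \<rho> c m B])
    also have "\<dots> = (\<integral>\<^sup>+z\<in>snd c ` B. ennreal (\<rho>' c z) \<partial>lborel)"
    proof (rule nn_integral_cong)
      fix z
      have "ennreal (\<rho> c z) * ennreal (h (chart_inv c z)) = ennreal (\<rho>' c z)" if "z \<in> snd c ` B"
      proof -
        have z: "z \<in> chart_img c" using that B(2) chart_in_img[OF c] by auto
        then show ?thesis using \<rho> c h(2) by (simp add: \<rho>'[OF c z] ennreal_mult'[symmetric] is_density_def mult.commute)
      qed
      then show "ennreal (\<rho> c z) * ennreal (h (chart_inv c z)) * indicator (snd c ` B) z = ennreal (\<rho>' c z) * indicator (snd c ` B) z"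
        by (cases "z \<in> snd c ` B") auto
    qed
    finally show "emeasure (density (density_measure A \<rho>) (\<lambda>q. ennreal (h q))) B = (\<integral>\<^sup>+z\<in>snd c ` B. ennreal (\<rho>' c z) \<partial>lborel)" .
  qed
qed

text \<open>Every point lies in a coordinate ball whose closure stays in the chart image; there the
  continuous density is bounded, and finitely many such balls cover \<open>C\<close>.\<close>

lemma density_measure_compact_finite:
  assumes \<rho>: "is_density \<rho>" and C: "compact C"
  shows "emeasure (density_measure A \<rho>) C < \<infinity>"
proof -
  define \<mu> where "\<mu> = density_measure A \<rho>"
  have R: "sets \<mu> = sets borel" "\<And>c B. c \<in> A \<Longrightarrow> B \<in> sets borel \<Longrightarrow> B \<subseteq> chart_dom c \<Longrightarrow>
      emeasure \<mu> B = (\<integral>\<^sup>+z\<in>snd c ` B. ennreal (\<rho> c z) \<partial>lborel)"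
    using density_measure_represents[OF \<rho>] by (auto simp: represents_def \<mu>_def)
  have "\<exists>U. open U \<and> q \<in> U \<and> emeasure \<mu> U < \<infinity>" for q
  proof -
    obtain c where c: "c \<in> A" "q \<in> chart_dom c" using chart_cover by blast
    obtain r where r: "r > 0" "cball (snd c q) r \<subseteq> chart_img c"
      using chart_homeo(2)[OF c(1)] chart_in_img[OF c] open_contains_cball by blast
    define b where "b = ball (snd c q) r"
    define U where "U = chart_dom c \<inter> snd c -` b"
    have "open U" unfolding U_def b_def
      using chart_homeo[OF c(1)] by (intro continuous_open_preimage) (auto simp: homeomorphism_def)
    moreover have "q \<in> U" using c r by (simp add: U_def b_def)
    moreover have "emeasure \<mu> U < \<infinity>"
    proof -
      have "continuous_on (cball (snd c q) r) (\<rho> c)"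
        using \<rho> c(1) r(2) continuous_on_subset by (fastforce simp: is_density_def)
      then have "compact (\<rho> c ` cball (snd c q) r)" by (rule compact_continuous_image) simp
      then obtain K where K: "\<And>z. z \<in> cball (snd c q) r \<Longrightarrow> \<bar>\<rho> c z\<bar> \<le> K"
        using compact_imp_bounded bounded_real by (metis (no_types, opaque_lifting) image_eqI)
      have "emeasure \<mu> U = (\<integral>\<^sup>+z\<in>snd c ` U. ennreal (\<rho> c z) \<partial>lborel)"
        using \<open>open U\<close> by (intro R(2) c(1)) (auto simp: U_def)
      also have "\<dots> \<le> (\<integral>\<^sup>+z. ennreal K * indicator (cball (snd c q) r) z \<partial>lborel)"
      proof (rule nn_integral_mono)
        fix z
        show "ennreal (\<rho> c z) * indicator (snd c ` U) z \<le> ennreal K * indicator (cball (snd c q) r) z"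
          using K[of z] by (auto simp: indicator_def U_def b_def intro!: ennreal_leI)
      qed
      also have "\<dots> = ennreal K * emeasure lborel (cball (snd c q) r)"
        by (rule nn_integral_cmult_indicator) simp
      also have "\<dots> < \<infinity>"
        using emeasure_compact_finite[of "cball (snd c q) r"] by (simp add: ennreal_mult_less_top)
      finally show ?thesis .
    qed
    ultimately show ?thesis by blast
  qed
  then obtain U where U: "\<And>q. open (U q) \<and> q \<in> U q \<and> emeasure \<mu> (U q) < \<infinity>" by metis
  have "C \<subseteq> (\<Union>q\<in>C. U q)" using U by auto
  from compactE_image[OF C _ this] U obtain F where F: "F \<subseteq> C" "finite F" "C \<subseteq> (\<Union>q\<in>F. U q)"
    by metis
  have "emeasure \<mu> C \<le> emeasure \<mu> (\<Union>q\<in>F. U q)"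
    using F U R(1) by (intro emeasure_mono) auto
  also have "\<dots> \<le> (\<Sum>q\<in>F. emeasure \<mu> (U q))"
    using F U R(1) by (intro emeasure_subadditive_finite) auto
  also have "\<dots> < \<infinity>" using U F(2) by (simp add: less_top)
  finally show ?thesis unfolding \<mu>_def .
qed

lemma continuous_in_charts_measurable:
  fixes h :: "'a \<Rightarrow> real"
  assumes "\<And>c. c \<in> A \<Longrightarrow> continuous_on (chart_img c) (loc c h)"
  shows "continuous_on UNIV h" "h \<in> borel_measurable borel"
proof -
  have "continuous_on (\<Union>c\<in>A. chart_dom c) h"
  proof (rule continuous_on_open_UN)
    fix c assume c: "c \<in> A"
    show "open (chart_dom c)" by (rule chart_homeo(1)[OF c])
    have "continuous_on (chart_dom c) (\<lambda>q. loc c h (snd c q))"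
      using chart_homeo(3)[OF c] by (intro continuous_on_compose2[OF assms[OF c]]) (auto simp: homeomorphism_def)
    then show "continuous_on (chart_dom c) h"
      by (rule continuous_on_eq) (simp add: loc_def chart_inv_of[OF c])
  qed
  moreover have "(\<Union>c\<in>A. chart_dom c) = UNIV" using chart_cover by blast
  ultimately show "continuous_on UNIV h" by simp
  then show "h \<in> borel_measurable borel" by (rule borel_measurable_continuous_onI)
qed

lemma compact_borel: "compact (C::'a set) \<Longrightarrow> C \<in> sets borel"
  by (intro borel_closed compact_imp_closed)

lemma measure_density_eq_integral:
  assumes \<rho>: "is_density \<rho>" and h: "h \<in> borel_measurable borel" "\<And>q. 0 \<le> h q" and C: "C \<in> sets borel"
  shows "measure (density (density_measure A \<rho>) (\<lambda>q. ennreal (h q))) C = (LINT q:C|density_measure A \<rho>. h q)"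
proof -
  note [simp] = sets_density_measure[OF \<rho>]
  have m: "h \<in> borel_measurable (density_measure A \<rho>)"
    using h(1) measurable_cong_sets[OF sets_density_measure[OF \<rho>] refl] by blast
  have CM: "C \<in> sets (density_measure A \<rho>)" using C by simp
  have "measure (density (density_measure A \<rho>) (\<lambda>q. ennreal (h q))) C
     = enn2real (\<integral>\<^sup>+q. ennreal (h q) * indicator C q \<partial>density_measure A \<rho>)"
    unfolding measure_def using m CM by (subst emeasure_density) auto
  also have "\<dots> = enn2real (\<integral>\<^sup>+q. ennreal (indicator C q *\<^sub>R h q) \<partial>density_measure A \<rho>)"
    by (intro arg_cong[where f = enn2real] nn_integral_cong) (simp add: indicator_def)
  also have "\<dots> = (LINT q:C|density_measure A \<rho>. h q)"
    unfolding set_lebesgue_integral_def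
  proof (rule integral_eq_nn_integral[symmetric])
    show "(\<lambda>q. indicat_real C q *\<^sub>R h q) \<in> borel_measurable (density_measure A \<rho>)"
      by (intro borel_measurable_scaleR borel_measurable_indicator CM m)
  qed (simp add: h(2))
  finally show ?thesis .
qed

end

section \<open>Area and volume densities\<close>

text \<open>The Gram determinant of the constant form. In a \<open>2 \<times> 2\<close> determinant
  the sign \<open>eps s\<close> enters squared, so on derivatives this is the determinant of the
  pullback of \<open>G'\<close> in both geometries.\<close>

definition plk_gram :: "real^4^4 \<Rightarrow> real^4^4 \<Rightarrow> real" where
  "plk_gram v w = plk v v * plk w w - plk v w * plk v w"

lemma plk_gram_linear_comb:
  "plk_gram (p *\<^sub>R v + q *\<^sub>R w) (r *\<^sub>R v + t *\<^sub>R w) = (p * t - r * q)\<^sup>2 * plk_gram v w"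
  by (simp add: plk_gram_def plk.add_left plk.add_right plk.scaleR_left plk.scaleR_right
      plk_commute[of w v] power2_eq_square algebra_simps)

lemma plk_gram_indep:
  assumes "plk_gram v w \<noteq> 0" "\<alpha> *\<^sub>R v + \<beta> *\<^sub>R w = 0" shows "\<alpha> = 0 \<and> \<beta> = 0"
proof -
  have "plk_gram (\<alpha> *\<^sub>R v + \<beta> *\<^sub>R w) (r *\<^sub>R v + t *\<^sub>R w) = 0" for r t
    unfolding assms(2) by (simp add: plk_gram_def plk.zero_left)
  from this[of 0 1] this[of 1 0] show ?thesis
    using assms(1) unfolding plk_gram_linear_comb by simp
qed

lemma gram2_linear_comb:
  "gram2 s (p *\<^sub>R v + q *\<^sub>R w) (r *\<^sub>R v + t *\<^sub>R w) = (p * t - r * q)\<^sup>2 * gram2 s v w"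
  by (simp add: gram2_def ip.add_left ip.add_right ip.scaleR_left ip.scaleR_right
      ip_commute[of s w v] power2_eq_square algebra_simps)

definition vol_density :: "geometry \<Rightarrow> ('a \<Rightarrow> real^4^4) \<Rightarrow> 'a chart \<Rightarrow> real^2 \<Rightarrow> real" where
  "vol_density s \<psi> c z = sqrt \<bar>det (\<chi> i j. pullback_G' s (loc c \<psi>) z (axis i 1) (axis j 1) :: real^2^2)\<bar>"

lemma Vol_vol_density: "Vol s A C \<psi> = measure (density_measure A (vol_density s \<psi>)) C"
  by (simp add: Vol_def vol_density_def[abs_def])

context surface
begin

text \<open>Both densities change by the same Jacobian, so their quotient is a function on the
  surface. It reduces comparisons of measures to comparisons of functions against one fixed
  measure.\<close>

lemma density_ratio:
  assumes "is_density \<rho>" "is_density \<rho>'" "\<And>c z. c \<in> A \<Longrightarrow> z \<in> chart_img c \<Longrightarrow> \<rho> c z > 0"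
  shows "\<exists>h. continuous_on UNIV h \<and> h \<in> borel_measurable borel \<and> (\<forall>q. 0 \<le> h q) \<and>
    (\<forall>c\<in>A. \<forall>z\<in>chart_img c. \<rho>' c z = \<rho> c z * h (chart_inv c z))"
proof -
  define ch where "ch q = (SOME c. c \<in> A \<and> q \<in> chart_dom c)" for q
  have ch: "ch q \<in> A" "q \<in> chart_dom (ch q)" for q
    using someI_ex[of "\<lambda>c. c \<in> A \<and> q \<in> chart_dom c"] chart_cover[of q] by (auto simp: ch_def Bex_def)
  define h where "h q = \<rho>' (ch q) (snd (ch q) q) / \<rho> (ch q) (snd (ch q) q)" for q
  have eq: "\<rho>' c z = \<rho> c z * h (chart_inv c z)" if c: "c \<in> A" "z \<in> chart_img c" for c z
  proof -
    define q d where "q = chart_inv c z" and "d = ch q"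
    have d: "d \<in> A" "q \<in> chart_dom d" using ch by (auto simp: d_def)
    have q: "q \<in> chart_dom c" "snd c q = z" using c by (auto simp: q_def chart_inv_dom chart_of_inv)
    have w: "z \<in> overlap c d" using in_overlap[OF c(1) q(1) d(2)] q(2) by simp
    have t: "trans c d z = snd d q" using trans_of[OF c(1) q(1)] q(2) by simp
    have "\<rho> d (snd d q) > 0" using assms(3) d chart_in_img by blast
    moreover have "\<rho> c z = \<rho> d (snd d q) * det (matrix (D (trans c d) z))"
      "\<rho>' c z = \<rho>' d (snd d q) * det (matrix (D (trans c d) z))"
      using assms(1,2) c d w unfolding is_density_def t[symmetric] by blast+
    ultimately show ?thesis unfolding h_def q_def[symmetric] d_def[symmetric] by simp
  qed
  have nonneg: "0 \<le> h q" for q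
  proof -
    have "\<rho> (ch q) (snd (ch q) q) > 0" "\<rho>' (ch q) (snd (ch q) q) \<ge> 0"
      using assms(2,3) ch chart_in_img unfolding is_density_def by blast+
    then show ?thesis by (simp add: h_def)
  qed
  have "continuous_on (chart_img c) (loc c h)" if c: "c \<in> A" for c
  proof -
    have "continuous_on (chart_img c) (\<lambda>z. \<rho>' c z / \<rho> c z)"
      using assms(1,2) assms(3)[OF c] c unfolding is_density_def
      by (intro continuous_on_divide) (auto simp: less_imp_neq[symmetric])
    then show ?thesis
    proof (rule continuous_on_eq)
      fix z assume z: "z \<in> chart_img c"
      show "\<rho>' c z / \<rho> c z = loc c h z" using eq[OF c z] assms(3)[OF c z] by (simp add: loc_def)
    qed
  qed
  from continuous_in_charts_measurable[OF this] show ?thesis using nonneg eq by (intro exI[of _ h]) simp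
qed

text \<open>Both measures are written as multiples of the measure of the positive density
  \<open>\<rho>\<close>. The factors are functions on the surface, so at each point it suffices to
  compare in one chart.\<close>

lemma
  assumes \<rho>: "is_density \<rho>" "\<And>c z. c \<in> A \<Longrightarrow> z \<in> chart_img c \<Longrightarrow> \<rho> c z > 0"
    and \<rho>1: "is_density \<rho>1" and \<rho>2: "is_density \<rho>2"
  shows measure_density_cong: "B \<in> sets borel \<Longrightarrow>
      (\<And>q. q \<in> B \<Longrightarrow> \<exists>c\<in>A. q \<in> chart_dom c \<and> \<rho>1 c (snd c q) = \<rho>2 c (snd c q)) \<Longrightarrow>
      measure (density_measure A \<rho>1) B = measure (density_measure A \<rho>2) B"
    and measure_density_diff: "compact C \<Longrightarrow>
      (\<And>q. q \<in> C \<Longrightarrow> \<exists>c\<in>A. q \<in> chart_dom c \<and> \<bar>\<rho>1 c (snd c q) - \<rho>2 c (snd c q)\<bar> \<le> K * \<rho> c (snd c q)) \<Longrightarrow>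
      \<bar>measure (density_measure A \<rho>1) C - measure (density_measure A \<rho>2) C\<bar> \<le> K * measure (density_measure A \<rho>) C"
proof -
  obtain h1 where h1: "continuous_on UNIV h1" "h1 \<in> borel_measurable borel" "\<And>q. 0 \<le> h1 q"
    "\<And>c z. c \<in> A \<Longrightarrow> z \<in> chart_img c \<Longrightarrow> \<rho>1 c z = \<rho> c z * h1 (chart_inv c z)"
    using density_ratio[OF \<rho>(1) \<rho>1 \<rho>(2)] by auto
  obtain h2 where h2: "continuous_on UNIV h2" "h2 \<in> borel_measurable borel" "\<And>q. 0 \<le> h2 q"
    "\<And>c z. c \<in> A \<Longrightarrow> z \<in> chart_img c \<Longrightarrow> \<rho>2 c z = \<rho> c z * h2 (chart_inv c z)"
    using density_ratio[OF \<rho>(1) \<rho>2 \<rho>(2)] by auto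
  define \<mu> where "\<mu> = density_measure A \<rho>"
  have sets: "sets \<mu> = sets borel" unfolding \<mu>_def by (rule sets_density_measure[OF \<rho>(1)])
  have dm1: "density_measure A \<rho>1 = density (density_measure A \<rho>) (\<lambda>q. ennreal (h1 q))"
    by (rule density_measure_mult[OF \<rho>(1) h1(2,3)]) (rule h1(4))
  have m1: "measure (density_measure A \<rho>1) B = (LINT q:B|\<mu>. h1 q)" if "B \<in> sets borel" for B
    unfolding dm1 \<mu>_def by (rule measure_density_eq_integral[OF \<rho>(1) h1(2,3) that])
  have dm2: "density_measure A \<rho>2 = density (density_measure A \<rho>) (\<lambda>q. ennreal (h2 q))"
    by (rule density_measure_mult[OF \<rho>(1) h2(2,3)]) (rule h2(4))
  have m2: "measure (density_measure A \<rho>2) B = (LINT q:B|\<mu>. h2 q)" if "B \<in> sets borel" for B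
    unfolding dm2 \<mu>_def by (rule measure_density_eq_integral[OF \<rho>(1) h2(2,3) that])
  have at: "\<rho>1 c (snd c q) = \<rho> c (snd c q) * h1 q" "\<rho>2 c (snd c q) = \<rho> c (snd c q) * h2 q" "\<rho> c (snd c q) > 0"
    if "c \<in> A" "q \<in> chart_dom c" for c q
    using h1(4)[OF that(1) chart_in_img[OF that]] h2(4)[OF that(1) chart_in_img[OF that]] \<rho>(2)[OF that(1) chart_in_img[OF that]]
    by (simp_all add: chart_inv_of[OF that])
  show "measure (density_measure A \<rho>1) B = measure (density_measure A \<rho>2) B"
    if B: "B \<in> sets borel" and e: "\<And>q. q \<in> B \<Longrightarrow> \<exists>c\<in>A. q \<in> chart_dom c \<and> \<rho>1 c (snd c q) = \<rho>2 c (snd c q)"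
  proof -
    have "h1 q = h2 q" if q: "q \<in> B" for q
    proof -
      obtain c where c: "c \<in> A" "q \<in> chart_dom c" "\<rho>1 c (snd c q) = \<rho>2 c (snd c q)" using e[OF q] by blast
      then show ?thesis using at[OF c(1,2)] by simp
    qed
    then have "(LINT q:B|\<mu>. h1 q) = (LINT q:B|\<mu>. h2 q)"
      unfolding set_lebesgue_integral_def by (intro Bochner_Integration.integral_cong refl) (simp add: indicator_def)
    then show ?thesis using m1[OF B] m2[OF B] by simp
  qed
  show "\<bar>measure (density_measure A \<rho>1) C - measure (density_measure A \<rho>2) C\<bar> \<le> K * measure (density_measure A \<rho>) C"
    if C: "compact C" and e: "\<And>q. q \<in> C \<Longrightarrow> \<exists>c\<in>A. q \<in> chart_dom c \<and> \<bar>\<rho>1 c (snd c q) - \<rho>2 c (snd c q)\<bar> \<le> K * \<rho> c (snd c q)"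
  proof -
    have Cb: "C \<in> sets borel" by (rule compact_borel[OF C])
    have fin: "emeasure \<mu> C < \<infinity>" unfolding \<mu>_def by (rule density_measure_compact_finite[OF \<rho>(1) C])
    have int: "set_integrable \<mu> C h" if h: "continuous_on UNIV h" "h \<in> borel_measurable borel" for h :: "'a \<Rightarrow> real"
    proof -
      have "compact (h ` C)" using h(1) C continuous_on_subset by (intro compact_continuous_image) auto
      then obtain B where B: "\<And>q. q \<in> C \<Longrightarrow> \<bar>h q\<bar> \<le> B"
        using compact_imp_bounded[of "h ` C"] unfolding bounded_real by blast
      have "h \<in> borel_measurable \<mu>" using h(2) measurable_cong_sets[OF sets refl] by blast
      then show ?thesis unfolding set_integrable_def
        by (intro integrableI_bounded_set_indicator[where B = B]) (use Cb sets fin B in auto)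
    qed
    have le: "\<bar>h1 q - h2 q\<bar> \<le> K" if q: "q \<in> C" for q
    proof -
      obtain c where c: "c \<in> A" "q \<in> chart_dom c" "\<bar>\<rho>1 c (snd c q) - \<rho>2 c (snd c q)\<bar> \<le> K * \<rho> c (snd c q)"
        using e[OF q] by blast
      define r where "r = \<rho> c (snd c q)"
      have r: "r > 0" and "\<bar>r * h1 q - r * h2 q\<bar> \<le> K * r" using c(3) at[OF c(1,2)] by (auto simp: r_def)
      then have "r * \<bar>h1 q - h2 q\<bar> \<le> r * K" by (simp add: right_diff_distrib[symmetric] abs_mult mult.commute)
      then show ?thesis using r by simp
    qed
    have "measure (density_measure A \<rho>1) C - measure (density_measure A \<rho>2) C = (LINT q:C|\<mu>. h1 q - h2 q)"
      unfolding m1[OF Cb] m2[OF Cb] by (rule set_integral_diff(2)[symmetric]) (rule int h1 h2)+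
    also have "\<bar>\<dots>\<bar> \<le> (LINT q:C|\<mu>. \<bar>h1 q - h2 q\<bar>)"
    proof -
      have e: "indicator C q *\<^sub>R \<bar>h1 q - h2 q\<bar> = \<bar>indicator C q *\<^sub>R (h1 q - h2 q)\<bar>" for q by (simp add: indicator_def)
      show ?thesis unfolding set_lebesgue_integral_def e by (rule integral_abs_bound)
    qed
    also have "\<dots> \<le> (LINT q:C|\<mu>. K)"
      by (rule set_integral_mono) (use le in \<open>auto intro!: int continuous_intros h1 h2 borel_measurable_continuous_onI\<close>)
    also have "\<dots> = K * measure \<mu> C" using Cb sets fin by (simp add: set_lebesgue_integral_def mult.commute)
    finally show ?thesis by (simp add: \<mu>_def)
  qed
qed

lemma tangent_loc:
  assumes "smooth_map A \<psi>" "range \<psi> \<subseteq> geodesics s" "c \<in> A" "z \<in> chart_img c"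
  shows "tangent s (loc c \<psi> z) (D (loc c \<psi>) z v)"
proof (rule tangent_deriv[OF chart_homeo(2)[OF assms(3)] assms(4)])
  show "loc c \<psi> y \<in> geodesics s" for y using assms(2) by (auto simp: loc_def)
qed (rule smooth_map_diff[OF assms(1,3,4)])

lemma pullback_plk:
  assumes "smooth_map A \<psi>" "range \<psi> \<subseteq> geodesics s" "c \<in> A" "z \<in> chart_img c"
  shows "pullback_G' s (loc c \<psi>) z v w = eps s * plk (D (loc c \<psi>) z v) (D (loc c \<psi>) z w)"
  unfolding pullback_G'_def by (rule G'_plk) (rule tangent_loc[OF assms])+

lemma vol_density_plk:
  assumes "smooth_map A \<psi>" "range \<psi> \<subseteq> geodesics s" "c \<in> A" "z \<in> chart_img c"
  shows "vol_density s \<psi> c z = sqrt \<bar>plk_gram (D (loc c \<psi>) z (axis 1 1)) (D (loc c \<psi>) z (axis 2 1))\<bar>"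
proof -
  show ?thesis
    unfolding vol_density_def plk_gram_def pullback_plk[OF assms] det_2
    by (simp only: vec_lambda_beta eps_mult_eps plk_commute[of "D (loc c \<psi>) z (axis 2 1)" "D (loc c \<psi>) z (axis 1 1)"])
qed

lemma smooth_D_loc:
  "smooth_map A f \<Longrightarrow> c \<in> A \<Longrightarrow> smooth_on (chart_img c) (\<lambda>z. D (loc c f) z v)"
  unfolding smooth_map_def by (intro smooth_on_D) blast

lemma is_density_vol:
  assumes "smooth_map A \<psi>" "range \<psi> \<subseteq> geodesics s"
  shows "is_density (vol_density s \<psi>)"
  unfolding is_density_def
proof (intro conjI ballI)
  fix c assume c: "c \<in> A"
  have "smooth_on (chart_img c) (\<lambda>z. plk_gram (D (loc c \<psi>) z (axis 1 1)) (D (loc c \<psi>) z (axis 2 1)))"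
    unfolding plk_gram_def
    by (intro smooth_on_diff smooth_on_mult smooth_on_plk smooth_D_loc assms c chart_homeo(2)[OF c])
  from smooth_on_imp_continuous[OF this]
  have "continuous_on (chart_img c) (\<lambda>z. sqrt \<bar>plk_gram (D (loc c \<psi>) z (axis 1 1)) (D (loc c \<psi>) z (axis 2 1))\<bar>)"
    by (intro continuous_intros)
  then show "continuous_on (chart_img c) (vol_density s \<psi> c)"
    by (rule continuous_on_eq) (rule vol_density_plk[OF assms c, symmetric])
  show "0 \<le> vol_density s \<psi> c z" for z by (simp add: vol_density_def)
  fix d z assume d: "d \<in> A" and z: "z \<in> overlap c d"
  define J where "J = matrix (D (trans c d) z)"
  have J: "det J > 0" unfolding J_def by (rule det_trans[OF c d z])
  have zc: "z \<in> chart_img c" using overlap_subset[OF c] z by blast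
  have "plk_gram (D (loc c \<psi>) z (axis 1 1)) (D (loc c \<psi>) z (axis 2 1))
      = (J $ 1 $ 1 * J $ 2 $ 2 - J $ 1 $ 2 * J $ 2 $ 1)\<^sup>2 *
        plk_gram (D (loc d \<psi>) (trans c d z) (axis 1 1)) (D (loc d \<psi>) (trans c d z) (axis 2 1))"
    unfolding D_loc_cols[OF assms(1) c d z] J_def[symmetric] plk_gram_linear_comb ..
  then show "vol_density s \<psi> c z = vol_density s \<psi> d (trans c d z) * det (matrix (D (trans c d) z))"
    unfolding vol_density_plk[OF assms c zc] vol_density_plk[OF assms d trans_overlap(2)[OF c d z]] J_def[symmetric]
    using J by (simp add: det_2 abs_mult real_sqrt_mult)
qed

end

context immersed_surface
begin

lemma is_density_area: "is_density (\<lambda>c z. sqrt (det (first_form s (loc c \<phi>) z)))"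
  unfolding is_density_def
proof (intro conjI ballI)
  fix c assume c: "c \<in> A"
  have "smooth_on (chart_img c) (\<lambda>z. gram2 s (D (loc c \<phi>) z (axis 1 1)) (D (loc c \<phi>) z (axis 2 1)))"
    unfolding gram2_def power2_eq_square
    by (intro smooth_on_diff smooth_on_mult smooth_on_ip smooth_D_loc smooth_map_\<phi> c chart_homeo(2)[OF c])
  from smooth_on_imp_continuous[OF this]
  show "continuous_on (chart_img c) (\<lambda>z. sqrt (det (first_form s (loc c \<phi>) z)))"
    unfolding det_first_form by (intro continuous_intros)
  show "0 \<le> sqrt (det (first_form s (loc c \<phi>) z))" if "z \<in> chart_img c" for z
    using patch.det_first_form_pos[OF patch[OF c] that] by simp
  fix d z assume d: "d \<in> A" and z: "z \<in> overlap c d"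
  define J where "J = matrix (D (trans c d) z)"
  have J: "det J > 0" unfolding J_def by (rule det_trans[OF c d z])
  have "gram2 s (D (loc c \<phi>) z (axis 1 1)) (D (loc c \<phi>) z (axis 2 1))
      = (J $ 1 $ 1 * J $ 2 $ 2 - J $ 1 $ 2 * J $ 2 $ 1)\<^sup>2 *
        gram2 s (D (loc d \<phi>) (trans c d z) (axis 1 1)) (D (loc d \<phi>) (trans c d z) (axis 2 1))"
    unfolding D_loc_cols[OF smooth_map_\<phi> c d z] J_def[symmetric] gram2_linear_comb ..
  then show "sqrt (det (first_form s (loc c \<phi>) z))
      = sqrt (det (first_form s (loc d \<phi>) (trans c d z))) * det (matrix (D (trans c d) z))"
    unfolding det_first_form J_def[symmetric] using J by (simp add: det_2 real_sqrt_mult)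
qed

lemma gauss_map_range: "range (gauss_map s A \<phi>) \<subseteq> geodesics s"
  using gauss_map_geodesics by auto

lemma Vol_eq_W':
  assumes C: "C \<in> sets borel"
  shows "Vol s A C (gauss_map s A \<phi>) = 2 * W' s A C \<phi>"
proof -
  define \<rho> where "\<rho> = (\<lambda>c z. sqrt (det (first_form s (loc c \<phi>) z)))"
  define w where "w q = sqrt ((mean_curvature s A \<phi> q)\<^sup>2 - gauss_curvature s A \<phi> q + eps s)" for q
  have \<rho>: "is_density \<rho>" unfolding \<rho>_def by (rule is_density_area)
  have pos: "\<rho> c z > 0" if "c \<in> A" "z \<in> chart_img c" for c z
    using patch.det_first_form_pos[OF patch[OF that(1)] that(2)] by (simp add: \<rho>_def)
  have eq: "vol_density s (gauss_map s A \<phi>) c z = \<rho> c z * (2 * w (chart_inv c z))" if c: "c \<in> A" and z: "z \<in> chart_img c" for c z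
    using vol_density_eq(1)[OF c chart_inv_dom[OF c z]] by (simp add: vol_density_def \<rho>_def w_def chart_of_inv[OF c z])
  have v: "is_density (vol_density s (gauss_map s A \<phi>))"
    by (rule is_density_vol[OF smooth_gauss_map gauss_map_range])
  \<comment> \<open>The integrand of \<open>W'\<close> is, up to the factor 2, a quotient of two
    continuous densities; its continuity and measurability follow without studying the curvatures as
    functions.\<close>
  have "continuous_on (chart_img c) (loc c (\<lambda>q. 2 * w q))" if c: "c \<in> A" for c
  proof -
    have "continuous_on (chart_img c) (\<lambda>z. vol_density s (gauss_map s A \<phi>) c z / \<rho> c z)"
      using \<rho> v pos[OF c] c unfolding is_density_def by (intro continuous_on_divide) (auto simp: less_imp_neq[symmetric])
    then show ?thesis
    proof (rule continuous_on_eq)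
      fix z assume z: "z \<in> chart_img c"
      show "vol_density s (gauss_map s A \<phi>) c z / \<rho> c z = loc c (\<lambda>q. 2 * w q) z"
        using eq[OF c z] pos[OF c z] by (simp add: loc_def)
    qed
  qed
  then have m: "(\<lambda>q. 2 * w q) \<in> borel_measurable borel" by (rule continuous_in_charts_measurable)
  have nonneg: "0 \<le> 2 * w q" for q
  proof -
    obtain c where "c \<in> A" "q \<in> chart_dom c" using chart_cover by blast
    from vol_density_eq(2)[OF this] show ?thesis by (simp add: w_def)
  qed
  have dm: "density_measure A (vol_density s (gauss_map s A \<phi>)) = density (density_measure A \<rho>) (\<lambda>q. ennreal (2 * w q))"
    by (rule density_measure_mult[OF \<rho> m nonneg]) (rule eq)
  have "Vol s A C (gauss_map s A \<phi>) = (LINT q:C|density_measure A \<rho>. 2 * w q)"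
    unfolding Vol_vol_density dm
    by (rule measure_density_eq_integral[OF \<rho> m nonneg C])
  also have "\<dots> = 2 * (LINT q:C|density_measure A \<rho>. w q)" by simp
  also have "\<dots> = 2 * W' s A C \<phi>" by (simp add: W'_def area_def \<rho>_def w_def)
  finally show ?thesis .
qed

end

section \<open>Hamiltonian normal fields\<close>

context patch
begin

text \<open>A Lagrangian plane is its own \<open>\<Omega>\<close>-orthogonal complement. Explicitly,
  \<open>Y\<close> lies in the tangent plane and so is \<open>- D F z a\<close> for some
  \<open>a\<close>, and the pairings with \<open>D \<Phi> z w\<close> then identify \<open>X\<close>
  with \<open>D N z a\<close>.\<close>

lemma lagrangian_complement:
  assumes z: "z \<in> U" and W: "tangent s (\<Phi> z) W" and "\<And>w. Omega s (\<Phi> z) W (D \<Phi> z w) = 0"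
  obtains a where "W = D \<Phi> z a"
proof -
  interpret tp: tangent_plane s "F z" "D F z (axis 1 1)" "D F z (axis 2 1)" by (rule tangent_plane[OF z])
  have n: "N z = tp.n" by (simp add: gnormal_def)
  obtain X Y where XY: "tangent_repr s (\<Phi> z) W (F z) (N z) X Y"
    using tangent_repr_change[OF W N_frame[OF z] refl] .
  then have o: "X \<in> orth_plane s (F z) (N z)" "Y \<in> orth_plane s (F z) (N z)" and We: "W = F z \<and>\<and> X + N z \<and>\<and> Y"
    by (auto simp: tangent_repr_def)
  obtain \<alpha> \<beta> where "- Y = \<alpha> *\<^sub>R D F z (axis 1 1) + \<beta> *\<^sub>R D F z (axis 2 1)"
    using tp.orth_plane_span[OF orth_plane_uminus[OF o(2)[unfolded n]]] .
  moreover note L = linear_D[OF diff_F[OF z]]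
  ultimately have "- Y = D F z (\<alpha> *\<^sub>R axis 1 1 + \<beta> *\<^sub>R axis 2 1)" by (simp add: linear_add[OF L] linear_cmul[OF L])
  then obtain a where a: "Y = - D F z a" by (metis minus_minus)
  have e: "ip s X (D F z w) = ip s (D N z a) (D F z w)" for w
    using assms(3)[of w] DN_sym[OF z, of w a] unfolding Omega_repr[OF XY repr_\<Phi>[OF z]] a
    by (simp add: ip.minus_left ip.minus_right ip_commute[of s "D F z a"])
  have "X = D N z a"
    using o(1) orth_plane_N(1)[OF z] e unfolding n by (intro tp.tangential_eqI) auto
  then have "W = D \<Phi> z a" unfolding We a D_\<Phi>[OF z] by simp
  then show ?thesis using that by blast
qed

lemma pullback_plk: "z \<in> U \<Longrightarrow> pullback_G' s \<Phi> z v w = eps s * plk (D \<Phi> z v) (D \<Phi> z w)"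
  unfolding pullback_G'_def by (rule G'_plk) (rule tangent_\<Phi>, assumption)+

lemma linear_D\<Phi>: "z \<in> U \<Longrightarrow> linear (D \<Phi> z)"
  by (rule linear_D[OF smooth_on_differentiable[OF smooth_\<Phi>]])

end

locale nondegenerate_point = patch +
  fixes z assumes z: "z \<in> U"
    and nondeg: "\<And>v. v \<noteq> 0 \<Longrightarrow> \<exists>w. pullback_G' s (\<lambda>z. F z \<and>\<and> gnormal s F z) z v w \<noteq> 0"
begin

abbreviation "P \<equiv> pullback_G' s \<Phi> z"

lemma P_eq: "P v w = eps s * plk (D \<Phi> z v) (D \<Phi> z w)" by (rule pullback_plk[OF z])

lemma P_inj: assumes "\<And>w. P a w = P b w" shows "a = b"
proof (rule ccontr)
  assume "a \<noteq> b"
  then obtain w where "P (a - b) w \<noteq> 0" using nondeg[of "a - b"] by auto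
  moreover have "P (a - b) w = P a w - P b w"
    unfolding P_eq by (simp add: linear_diff[OF linear_D\<Phi>[OF z]] plk.diff_left algebra_simps)
  ultimately show False using assms by simp
qed

lemma P_solve: assumes "linear (l :: real^2 \<Rightarrow> real)" obtains a where "\<And>w. P a w = l w"
proof -
  define T :: "real^2 \<Rightarrow> real^2" where "T a = (\<chi> i. P a (axis i 1))" for a
  note L = linear_D\<Phi>[OF z]
  have lT: "linear T"
    by (rule linearI) (simp_all add: T_def P_eq vec_eq_iff linear_add[OF L] linear_cmul[OF L] plk.add_left plk.scaleR_left algebra_simps)
  have lw: "linear (P a)" for a
    by (rule linearI) (simp_all add: P_eq linear_add[OF L] linear_cmul[OF L] plk.add_right plk.scaleR_right algebra_simps)
  have eq: "P a w = m w" if "linear m" "\<And>i. P a (axis i 1) = m (axis i 1)" for a and m :: "real^2 \<Rightarrow> real" and w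
    unfolding linear_real2[OF lw, of a w] linear_real2[OF that(1), of w] that(2) ..
  have "inj T"
  proof (rule injI)
    fix a b assume "T a = T b"
    then have "P a (axis i 1) = P b (axis i 1)" for i by (simp add: T_def vec_eq_iff)
    then show "a = b" using P_inj eq[OF lw] by blast
  qed
  then have "surj T" using linear_injective_imp_surjective[OF lT] by blast
  then obtain a where "(\<chi> i. l (axis i 1)) = T a" by (rule surjE)
  then have "P a (axis i 1) = l (axis i 1)" for i by (simp add: T_def vec_eq_iff)
  from eq[OF assms this] show ?thesis using that by blast
qed

text \<open>The tangential parts of two such decompositions differ by a vector that is
  \<open>G'\<close>-orthogonal to the whole tangent plane, so they agree by non-degeneracy.\<close>

lemma normal_part_eqI:
  assumes V: "tangent s (\<Phi> z) V" and n: "tangent s (\<Phi> z) n" "V = D \<Phi> z a + n" "\<And>b. G' s (\<Phi> z) n (D \<Phi> z b) = 0"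
  shows "normal_part s \<Phi> z V = n"
  unfolding normal_part_def
proof (rule the_equality)
  show "(\<exists>a. V = D \<Phi> z a + n) \<and> (\<forall>b. G' s (\<Phi> z) n (D \<Phi> z b) = 0)" using n by blast
next
  fix m assume "(\<exists>a. V = D \<Phi> z a + m) \<and> (\<forall>b. G' s (\<Phi> z) m (D \<Phi> z b) = 0)"
  then obtain a' where m: "V = D \<Phi> z a' + m" "\<And>b. G' s (\<Phi> z) m (D \<Phi> z b) = 0" by blast
  have "m = V - D \<Phi> z a'" using m(1) by simp
  then have tm: "tangent s (\<Phi> z) m" using tangent_diff[OF V tangent_\<Phi>[OF z]] by simp
  have p: "eps s * plk k (D \<Phi> z b) = 0" if "tangent s (\<Phi> z) k" "G' s (\<Phi> z) k (D \<Phi> z b) = 0" for k b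
    using that G'_plk[OF that(1) tangent_\<Phi>[OF z]] by simp
  have "P a b = P a' b" for b
  proof -
    have d: "D \<Phi> z a - D \<Phi> z a' = m - n" using m(1) n(2) by (simp add: algebra_simps)
    have "P a b - P a' b = eps s * plk (m - n) (D \<Phi> z b)" unfolding P_eq d[symmetric] by (simp add: plk.diff_left algebra_simps)
    also have "\<dots> = 0" using p[OF tm m(2)] p[OF n(1) n(3)] by (simp add: plk.diff_left algebra_simps)
    finally show ?thesis by simp
  qed
  then have "a = a'" by (rule P_inj)
  then show "m = n" using m(1) n(2) by simp
qed

lemma normal_part_exists:
  assumes V: "tangent s (\<Phi> z) V" obtains a where "normal_part s \<Phi> z V = V - D \<Phi> z a"
proof -
  note L = linear_D\<Phi>[OF z]
  have "linear (\<lambda>w. eps s * plk V (D \<Phi> z w))"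
    by (rule linearI) (simp_all add: linear_add[OF L] linear_cmul[OF L] plk.add_right plk.scaleR_right algebra_simps)
  then obtain a where a: "\<And>w. P a w = eps s * plk V (D \<Phi> z w)" using P_solve by blast
  have t: "tangent s (\<Phi> z) (V - D \<Phi> z a)" by (rule tangent_diff[OF V tangent_\<Phi>[OF z]])
  have "normal_part s \<Phi> z V = V - D \<Phi> z a"
    by (rule normal_part_eqI[OF V t, of a])
      (use a in \<open>simp_all add: G'_plk[OF t tangent_\<Phi>[OF z]] P_eq plk.diff_left right_diff_distrib\<close>)
  then show ?thesis using that by blast
qed

lemma gradient_eq:
  assumes "u differentiable (at z)" shows "P (gradient s \<Phi> u z) w = D u z w"
proof -
  obtain a where a: "\<And>w. P a w = D u z w" using P_solve[OF linear_D[OF assms]] by blast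
  have "gradient s \<Phi> u z = a"
    unfolding gradient_def by (rule the_equality) (use a P_inj in auto)
  then show ?thesis using a by simp
qed

text \<open>The right-hand vector \<open>n\<close> is normal, as \<open>G'_JJ'\<close> turns its
  products with the tangent plane into values of \<open>\<Omega>\<close> and the Gauss map is
  Lagrangian; and \<open>\<Omega>(n, d\<Phi>) = - du\<close>. Any other solution of this equation
  differs from \<open>n\<close> by a vector of the tangent plane
  (\<open>lagrangian_complement\<close>), which the normal part does not see.\<close>

lemma hamiltonian_iff:
  assumes V: "tangent s (\<Phi> z) V" and u: "u differentiable (at z)"
  shows "normal_part s \<Phi> z V = JJ' s (\<Phi> z) (D \<Phi> z (gradient s \<Phi> u z)) \<longleftrightarrow>
    (\<forall>w. Omega s (\<Phi> z) V (D \<Phi> z w) = - D u z w)"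
proof -
  define g n where "g = gradient s \<Phi> u z" and "n = JJ' s (\<Phi> z) (D \<Phi> z g)"
  note t = tangent_\<Phi>[OF z]
  have n: "tangent s (\<Phi> z) n" unfolding n_def by (rule tangent_JJ'[OF t])
  have On: "Omega s (\<Phi> z) n (D \<Phi> z w) = - D u z w" for w
    unfolding n_def Omega_JJ'[OF t t] using gradient_eq[OF u, of w] by (simp add: pullback_G'_def g_def)
  have Gn: "G' s (\<Phi> z) n (D \<Phi> z b) = 0" for b
    unfolding n_def G'_JJ'[OF t t] by (rule lagrangian_\<Phi>[OF z])
  have "normal_part s \<Phi> z V = n \<longleftrightarrow> (\<forall>w. Omega s (\<Phi> z) V (D \<Phi> z w) = - D u z w)"
  proof
    assume e: "normal_part s \<Phi> z V = n"
    obtain a where "normal_part s \<Phi> z V = V - D \<Phi> z a" using normal_part_exists[OF V] .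
    then have "n = V - D \<Phi> z a" using e by simp
    then show "\<forall>w. Omega s (\<Phi> z) V (D \<Phi> z w) = - D u z w"
      using On Omega_diff_left[OF V t t] lagrangian_\<Phi>[OF z] by simp
  next
    assume e: "\<forall>w. Omega s (\<Phi> z) V (D \<Phi> z w) = - D u z w"
    have "Omega s (\<Phi> z) (V - n) (D \<Phi> z w) = 0" for w
      unfolding Omega_diff_left[OF V n t] On using e by simp
    then obtain a where "V - n = D \<Phi> z a" using lagrangian_complement[OF z tangent_diff[OF V n]] by blast
    then have "V = D \<Phi> z a + n" by (simp add: algebra_simps)
    then show "normal_part s \<Phi> z V = n" by (rule normal_part_eqI[OF V n _ Gn])
  qed
  then show ?thesis by (simp add: n_def g_def)
qed

end

section \<open>Smooth families\<close>

lemma bounded_linear_embed: "bounded_linear (\<lambda>z::'b::euclidean_space. (0::real, z))" "bounded_linear (\<lambda>t::real. (t, 0::'b))"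
  by (auto intro: bounded_linear_Pair bounded_linear_zero bounded_linear_ident)

lemma smooth_slice:
  fixes g :: "real \<times> 'b::euclidean_space \<Rightarrow> 'v::euclidean_space"
  assumes "open T" "open U" "smooth_on (T \<times> U) g" "t \<in> T"
  shows "smooth_on U (\<lambda>z. g (t, z))"
proof (rule smooth_on_compose[of U "T \<times> U" "\<lambda>z. (t, z)" g])
  have "smooth_on U (\<lambda>z::'b. (t, 0) + (0, z))"
    by (intro smooth_on_add smooth_on_const smooth_on_linear bounded_linear_embed assms)
  then show "smooth_on U (\<lambda>z. (t, z))" by simp
qed (use assms in \<open>auto intro: open_Times\<close>)

lemma has_derivative_slice:
  fixes g :: "real \<times> 'b::euclidean_space \<Rightarrow> 'v::euclidean_space"
  assumes "g differentiable (at (t, z))"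
  shows "((\<lambda>z. g (t, z)) has_derivative (\<lambda>v. D g (t, z) (0, v))) (at z)"
    and "((\<lambda>t. g (t, z)) has_derivative (\<lambda>h. D g (t, z) (h, 0))) (at t)"
proof -
  have 1: "((\<lambda>z. (t, z)) has_derivative (\<lambda>v. (0, v))) (at z)"
    by (auto intro!: derivative_eq_intros)
  show "((\<lambda>z. g (t, z)) has_derivative (\<lambda>v. D g (t, z) (0, v))) (at z)"
    by (rule has_derivative_compose[of "\<lambda>z. (t, z)" "\<lambda>v. (0, v)" z UNIV g "D g (t, z)", OF 1 has_derivative_D[OF assms]])
  have 2: "((\<lambda>t. (t, z)) has_derivative (\<lambda>h. (h, 0))) (at t)"
    by (auto intro!: derivative_eq_intros)
  show "((\<lambda>t. g (t, z)) has_derivative (\<lambda>h. D g (t, z) (h, 0))) (at t)"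
    by (rule has_derivative_compose[of "\<lambda>t. (t, z)" "\<lambda>h. (h, 0)" t UNIV g "D g (t, z)", OF 2 has_derivative_D[OF assms]])
qed

lemma D_slice:
  fixes g :: "real \<times> 'b::euclidean_space \<Rightarrow> 'v::euclidean_space"
  assumes "g differentiable (at (t, z))"
  shows "D (\<lambda>z. g (t, z)) z v = D g (t, z) (0, v)"
  using fun_cong[OF frechet_derivative_at[OF has_derivative_slice(1)[OF assms], symmetric], of v] .

lemma vector_derivative_slice:
  fixes g :: "real \<times> 'b::euclidean_space \<Rightarrow> 'v::euclidean_space"
  assumes "g differentiable (at (t, z))"
  shows "((\<lambda>t. g (t, z)) has_vector_derivative D g (t, z) (1, 0)) (at t)"
proof -
  have "(\<lambda>h. D g (t, z) (h, 0)) = (\<lambda>h. h *\<^sub>R D g (t, z) (1, 0))"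
  proof
    fix h show "D g (t, z) (h, 0) = h *\<^sub>R D g (t, z) (1, 0)"
      using linear_cmul[OF linear_D[OF assms], of h "(1, 0)"] by simp
  qed
  then show ?thesis
    unfolding has_vector_derivative_def by (rule has_derivative_eq_rhs[OF has_derivative_slice(2)[OF assms]])
qed

text \<open>Written in terms of values and derivatives alone, so that maps agreeing in both at a
  point visibly have the same derivative of \<open>plk_gram\<close> there.\<close>

definition plk_gram_deriv :: "real^4^4 \<Rightarrow> real^4^4 \<Rightarrow> real^4^4 \<Rightarrow> real^4^4 \<Rightarrow> real" where
  "plk_gram_deriv v w v' w' = plk v v * (plk w w' + plk w' w) + (plk v v' + plk v' v) * plk w w
     - (plk v w * (plk v w' + plk v' w) + (plk v w' + plk v' w) * plk v w)"

lemma D_plk_gram: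
  assumes "f differentiable (at x)" "g differentiable (at x)"
  shows "D (\<lambda>p. plk_gram (f p) (g p)) x v = plk_gram_deriv (f x) (g x) (D f x v) (D g x v)"
proof -
  note f = has_derivative_D[OF assms(1)] and g = has_derivative_D[OF assms(2)]
  have "((\<lambda>p. plk_gram (f p) (g p)) has_derivative (\<lambda>v. plk_gram_deriv (f x) (g x) (D f x v) (D g x v))) (at x)"
    unfolding plk_gram_def plk_gram_deriv_def
    by (intro has_derivative_diff has_derivative_mult plk.FDERIV f g)
  from fun_cong[OF frechet_derivative_at[OF this, symmetric], of v] show ?thesis .
qed

text \<open>Multiplication by the conjugate: the square root is Lipschitz away from 0, and it is
  enough that one of the two arguments stays away.\<close>

lemma abs_sqrt_diff_le:
  assumes "\<bar>a\<bar> > m" "m > 0"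
  shows "\<bar>sqrt \<bar>a\<bar> - sqrt \<bar>b\<bar>\<bar> \<le> \<bar>a - b\<bar> / sqrt m"
proof -
  have "\<bar>sqrt \<bar>a\<bar> - sqrt \<bar>b\<bar>\<bar> * sqrt m \<le> \<bar>sqrt \<bar>a\<bar> - sqrt \<bar>b\<bar>\<bar> * (sqrt \<bar>a\<bar> + sqrt \<bar>b\<bar>)"
    using assms by (intro mult_left_mono add_increasing2) (auto intro: less_imp_le)
  also have "\<dots> = \<bar>(sqrt \<bar>a\<bar> - sqrt \<bar>b\<bar>) * (sqrt \<bar>a\<bar> + sqrt \<bar>b\<bar>)\<bar>" by (simp add: abs_mult)
  also have "(sqrt \<bar>a\<bar> - sqrt \<bar>b\<bar>) * (sqrt \<bar>a\<bar> + sqrt \<bar>b\<bar>) = \<bar>a\<bar> - \<bar>b\<bar>" by (simp add: algebra_simps)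
  also have "\<bar>\<bar>a\<bar> - \<bar>b\<bar>\<bar> \<le> \<bar>a - b\<bar>" by simp
  finally show ?thesis using assms(2) by (simp add: pos_le_divide_eq)
qed

context surface
begin

definition smooth_family :: "real \<Rightarrow> (real \<Rightarrow> 'a \<Rightarrow> 'v::euclidean_space) \<Rightarrow> bool" where
  "smooth_family \<delta> ft \<longleftrightarrow> \<delta> > 0 \<and> (\<forall>c\<in>A. smooth_on ({-\<delta><..<\<delta>} \<times> chart_img c) (\<lambda>(t, z). loc c (ft t) z))"

abbreviation lift :: "'a chart \<Rightarrow> (real \<Rightarrow> 'a \<Rightarrow> 'v) \<Rightarrow> real \<times> (real^2) \<Rightarrow> 'v" where
  "lift c ft \<equiv> (\<lambda>(t, z). loc c (ft t) z)"

definition velocity :: "(real \<Rightarrow> 'a \<Rightarrow> 'v::euclidean_space) \<Rightarrow> 'a \<Rightarrow> 'v" where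
  "velocity ft q = vector_derivative (\<lambda>t. ft t q) (at 0)"

lemma open_region: "c \<in> A \<Longrightarrow> open ({-\<delta><..<\<delta>::real} \<times> chart_img c)"
  by (intro open_Times chart_homeo) auto

lemma family_diff:
  assumes "smooth_family \<delta> ft" "c \<in> A" "\<bar>t\<bar> < \<delta>" "z \<in> chart_img c"
  shows "lift c ft differentiable (at (t, z))"
proof -
  have "smooth_on ({-\<delta><..<\<delta>} \<times> chart_img c) (lift c ft)" using assms(1,2) by (simp add: smooth_family_def)
  then show ?thesis by (rule smooth_on_differentiable) (use assms in auto)
qed

lemma family_slice:
  assumes "smooth_family \<delta> ft" "\<bar>t\<bar> < \<delta>"
  shows "smooth_map A (ft t)"
    and "c \<in> A \<Longrightarrow> z \<in> chart_img c \<Longrightarrow> D (loc c (ft t)) z v = D (lift c ft) (t, z) (0, v)"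
proof -
  show "smooth_map A (ft t)"
    unfolding smooth_map_def
  proof
    fix c assume c: "c \<in> A"
    have "smooth_on (chart_img c) (\<lambda>z. lift c ft (t, z))"
      by (rule smooth_slice[of "{-\<delta><..<\<delta>}"]) (use assms c chart_homeo(2)[OF c] in \<open>auto simp: smooth_family_def\<close>)
    then show "smooth_on (chart_img c) (loc c (ft t))" by simp
  qed
  show "D (loc c (ft t)) z v = D (lift c ft) (t, z) (0, v)" if "c \<in> A" "z \<in> chart_img c"
    using D_slice[OF family_diff[OF assms(1) that(1) assms(2) that(2)], of v] by simp
qed

lemma family_smooth_D:
  assumes "smooth_family \<delta> ft" "c \<in> A"
  shows "smooth_on ({-\<delta><..<\<delta>} \<times> chart_img c) (\<lambda>p. D (lift c ft) p v)"
  using assms by (intro smooth_on_D) (simp add: smooth_family_def)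

lemma family_velocity:
  assumes "smooth_family \<delta> ft"
  shows "c \<in> A \<Longrightarrow> q \<in> chart_dom c \<Longrightarrow> velocity ft q = D (lift c ft) (0, snd c q) (1, 0)"
    and "c \<in> A \<Longrightarrow> z \<in> chart_img c \<Longrightarrow> loc c (velocity ft) z = D (lift c ft) (0, z) (1, 0)"
    and "smooth_map A (velocity ft)"
proof -
  have \<delta>: "\<delta> > 0" using assms by (simp add: smooth_family_def)
  show 1: "velocity ft q = D (lift c ft) (0, snd c q) (1, 0)" if "c \<in> A" "q \<in> chart_dom c" for c q
  proof -
    have "((\<lambda>t. lift c ft (t, snd c q)) has_vector_derivative D (lift c ft) (0, snd c q) (1, 0)) (at 0)"
      by (rule vector_derivative_slice[OF family_diff[OF assms that(1) _ chart_in_img[OF that]]]) (use \<delta> in simp)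
    then have "((\<lambda>t. ft t q) has_vector_derivative D (lift c ft) (0, snd c q) (1, 0)) (at 0)"
      by (simp add: loc_def chart_inv_of[OF that])
    then show ?thesis unfolding velocity_def by (rule vector_derivative_at)
  qed
  show 2: "loc c (velocity ft) z = D (lift c ft) (0, z) (1, 0)" if "c \<in> A" "z \<in> chart_img c" for c z
    using 1[OF that(1) chart_inv_dom[OF that]] by (simp add: loc_def chart_of_inv[OF that])
  show "smooth_map A (velocity ft)"
    unfolding smooth_map_def
  proof
    fix c assume c: "c \<in> A"
    have "smooth_on (chart_img c) (\<lambda>z. D (lift c ft) (0, z) (1, 0))"
      by (rule smooth_slice[of "{-\<delta><..<\<delta>}" "chart_img c" "\<lambda>p. D (lift c ft) p (1, 0)"])
        (use \<delta> chart_homeo(2)[OF c] family_smooth_D[OF assms c] in auto)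
    then show "smooth_on (chart_img c) (loc c (velocity ft))"
      by (rule smooth_on_cong[OF chart_homeo(2)[OF c], rotated]) (simp add: 2[OF c])
  qed
qed

text \<open>Derivatives in \<open>t\<close> and \<open>z\<close> commute. So families with equal
  velocities also have equal \<open>t\<close>-derivatives of their differentials at
  \<open>t = 0\<close>.\<close>

lemma family_D_velocity:
  assumes ft: "smooth_family \<delta> ft" and c: "c \<in> A" and z: "z \<in> chart_img c"
  shows "D (\<lambda>p. D (lift c ft) p (0, v)) (0, z) (1, 0) = D (loc c (velocity ft)) z v"
proof -
  have \<delta>: "\<delta> > 0" and sm: "smooth_on ({-\<delta><..<\<delta>} \<times> chart_img c) (lift c ft)"
    using ft c by (auto simp: smooth_family_def)
  have m: "(0, z) \<in> {-\<delta><..<\<delta>} \<times> chart_img c" using \<delta> z by simp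
  have "D (\<lambda>p. D (lift c ft) p (0, v)) (0, z) (1, 0) = D (\<lambda>p. D (lift c ft) p (1, 0)) (0, z) (0, v)"
    by (rule D_commute[OF open_region[OF c] sm m])
  also have "\<dots> = D (\<lambda>z. D (lift c ft) (0, z) (1, 0)) z v"
    using D_slice[OF smooth_on_differentiable[OF family_smooth_D[OF ft c] m], of "(1, 0)" v] by simp
  also have "D (\<lambda>z. D (lift c ft) (0, z) (1, 0)) z = D (loc c (velocity ft)) z"
    by (rule D_cong(1)[OF smooth_map_diff[OF family_velocity(3)[OF ft] c z] chart_homeo(2)[OF c] z])
      (simp add: family_velocity(2)[OF ft c])
  finally show ?thesis .
qed

lemma D_loc_local:
  fixes f g :: "'a \<Rightarrow> 'v::euclidean_space"
  assumes "open W" "q \<in> W" "\<And>x. x \<in> W \<Longrightarrow> f x = g x" and c: "c \<in> A" "q \<in> chart_dom c"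
    and f: "smooth_map A f"
  shows "D (loc c g) (snd c q) = D (loc c f) (snd c q)"
proof (rule D_cong(1)[OF smooth_map_diff[OF f c(1) chart_in_img[OF c]]])
  show "open (chart_img c \<inter> chart_inv c -` W)"
    using chart_homeo[OF c(1)] assms(1) by (intro continuous_open_preimage) (auto simp: homeomorphism_def)
  show "snd c q \<in> chart_img c \<inter> chart_inv c -` W" using c assms(2) by (simp add: chart_in_img chart_inv_of)
  show "loc c f y = loc c g y" if "y \<in> chart_img c \<inter> chart_inv c -` W" for y
    using that assms(3) by (simp add: loc_def)
qed

section \<open>Open conditions over compact sets\<close>

lemma chart_box:
  fixes P :: "(real \<times> (real^2)) set"
  assumes "c \<in> A" "q \<in> chart_dom c" "open P" "(0, snd c q) \<in> P"
  shows "\<exists>U \<delta>. open U \<and> q \<in> U \<and> \<delta> > 0 \<and> (\<forall>t q'. \<bar>t\<bar> < \<delta> \<longrightarrow> q' \<in> U \<longrightarrow> q' \<in> chart_dom c \<and> (t, snd c q') \<in> P)"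
proof -
  obtain T Z where TZ: "open T" "open Z" "(0, snd c q) \<in> T \<times> Z" "T \<times> Z \<subseteq> P"
    using open_prod_elim[OF assms(3,4)] by blast
  then obtain r where r: "r > 0" "ball 0 r \<subseteq> T" using openE[of T 0] by auto
  have "open (chart_dom c \<inter> snd c -` Z)"
    using chart_homeo[OF assms(1)] TZ(2) by (intro continuous_open_preimage) (auto simp: homeomorphism_def)
  moreover have "\<forall>t q'. \<bar>t\<bar> < r \<longrightarrow> q' \<in> chart_dom c \<inter> snd c -` Z \<longrightarrow> q' \<in> chart_dom c \<and> (t, snd c q') \<in> P"
  proof (intro allI impI)
    fix t :: real and q' assume "\<bar>t\<bar> < r" "q' \<in> chart_dom c \<inter> snd c -` Z"
    then have "t \<in> T" "snd c q' \<in> Z" "q' \<in> chart_dom c" using r(2) by auto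
    then show "q' \<in> chart_dom c \<and> (t, snd c q') \<in> P" using TZ(4) by blast
  qed
  ultimately show ?thesis using assms(2) TZ(3) r(1)
    by (intro exI[of _ "chart_dom c \<inter> snd c -` Z"] exI[of _ r]) simp
qed

text \<open>The set where \<open>h c\<close> is positive is open in \<open>(t, z)\<close>, and by
  compactness finitely many boxes around points of \<open>C\<close> have a common height. One chart
  per point is enough because the conditions for which this is used do not depend on the
  chart.\<close>

lemma persistence:
  fixes h :: "'a chart \<Rightarrow> real \<times> (real^2) \<Rightarrow> real"
  assumes C: "compact C" and \<delta>: "\<delta> > 0"
    and h: "\<And>c. c \<in> A \<Longrightarrow> continuous_on ({-\<delta><..<\<delta>} \<times> chart_img c) (h c)"
    and h0: "\<And>c q. q \<in> C \<Longrightarrow> c \<in> A \<Longrightarrow> q \<in> chart_dom c \<Longrightarrow> h c (0, snd c q) > 0"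
  shows "\<exists>\<delta>'>0. \<delta>' \<le> \<delta> \<and> (\<forall>t q. \<bar>t\<bar> < \<delta>' \<longrightarrow> q \<in> C \<longrightarrow> (\<exists>c\<in>A. q \<in> chart_dom c \<and> h c (t, snd c q) > 0))"
proof -
  \<comment> \<open>The predicate ignores the constant \<open>K\<close>; only the common radius is
    extracted.\<close>
  have "\<exists>\<delta>'>0. \<exists>K::real. \<forall>t q. \<bar>t\<bar> < \<delta>' \<longrightarrow> q \<in> C \<longrightarrow> (\<exists>c\<in>A. q \<in> chart_dom c \<and> h c (t, snd c q) > 0)"
  proof (rule compact_uniform_bound[OF C])
    fix q assume q: "q \<in> C"
    obtain c where c: "c \<in> A" "q \<in> chart_dom c" using chart_cover by blast
    define P where "P = ({-\<delta><..<\<delta>} \<times> chart_img c) \<inter> h c -` {0<..}"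
    have "open P" unfolding P_def by (rule continuous_open_preimage[OF h[OF c(1)] open_region[OF c(1)]]) auto
    moreover have "(0, snd c q) \<in> P" using h0[OF q c] \<delta> chart_in_img[OF c] by (simp add: P_def)
    ultimately have "\<exists>U \<delta>'. open U \<and> q \<in> U \<and> \<delta>' > 0 \<and>
        (\<forall>t q'. \<bar>t\<bar> < \<delta>' \<longrightarrow> q' \<in> U \<longrightarrow> q' \<in> chart_dom c \<and> (t, snd c q') \<in> P)"
      by (rule chart_box[OF c])
    then obtain U \<delta>' where U: "open U" "q \<in> U" "\<delta>' > 0"
      "\<And>t q'. \<bar>t\<bar> < \<delta>' \<Longrightarrow> q' \<in> U \<Longrightarrow> q' \<in> chart_dom c \<and> (t, snd c q') \<in> P"
      by auto
    have "\<forall>t q'. \<bar>t\<bar> < \<delta>' \<longrightarrow> q' \<in> U \<longrightarrow> (\<exists>c\<in>A. q' \<in> chart_dom c \<and> h c (t, snd c q') > 0)"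
      using U(4) c(1) unfolding P_def by blast
    then show "\<exists>U \<delta>' K. open U \<and> q \<in> U \<and> \<delta>' > 0 \<and>
        (\<forall>t q'. \<bar>t\<bar> < \<delta>' \<longrightarrow> q' \<in> U \<longrightarrow> (\<exists>c\<in>A. q' \<in> chart_dom c \<and> h c (t, snd c q') > 0))"
      using U(1-3) by blast
  qed
  then obtain \<delta>' where d: "\<delta>' > 0" "\<And>t q. \<bar>t\<bar> < \<delta>' \<Longrightarrow> q \<in> C \<Longrightarrow> \<exists>c\<in>A. q \<in> chart_dom c \<and> h c (t, snd c q) > 0"
    by blast
  show ?thesis
    by (rule exI[of _ "min \<delta> \<delta>'"]) (use \<delta> d in auto)
qed

lemma inj_D_loc_change:
  fixes f :: "'a \<Rightarrow> 'v::euclidean_space"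
  assumes f: "smooth_map A f" and c: "c \<in> A" "q \<in> chart_dom c" and d: "d \<in> A" "q \<in> chart_dom d"
    and i: "inj (D (loc d f) (snd d q))"
  shows "inj (D (loc c f) (snd c q))"
proof -
  have w: "snd c q \<in> overlap c d" by (rule in_overlap[OF c d(2)])
  have t: "trans c d (snd c q) = snd d q" by (rule trans_of[OF c])
  have df: "loc d f differentiable (at (trans c d (snd c q)))"
    unfolding t by (rule smooth_map_diff[OF f d(1) chart_in_img[OF d]])
  define J where "J = matrix (D (trans c d) (snd c q))"
  have "det J \<noteq> 0" using det_trans[OF c(1) d(1) w] by (simp add: J_def)
  then have "inj ((*v) J)" using invertible_det_nz inj_matrix_vector_mult by blast
  moreover have "D (loc c f) (snd c q) = (\<lambda>v. D (loc d f) (snd d q) (J *v v))"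
    using D_loc_trans[OF c(1) d(1) w df] D_trans_matrix[OF c(1) d(1) w] by (auto simp: t J_def)
  ultimately show ?thesis using inj_compose[OF i] by (simp add: o_def)
qed

lemma inj_of_columns:
  fixes L :: "real^2 \<Rightarrow> 'v::real_vector"
  assumes "linear L" "\<And>\<alpha> \<beta>. \<alpha> *\<^sub>R L (axis 1 1) + \<beta> *\<^sub>R L (axis 2 1) = 0 \<Longrightarrow> \<alpha> = 0 \<and> \<beta> = 0"
  shows "inj L"
proof (rule linear_injective_0[OF assms(1), THEN iffD2], intro allI impI)
  fix v assume "L v = 0"
  then have "v $ 1 = 0 \<and> v $ 2 = 0" using assms(2) linear_real2[OF assms(1), of v] by metis
  then show "v = 0" by (simp add: vec_eq_iff forall_2)
qed

text \<open>Outside \<open>C\<close> the differential is the initial one, \<open>- C\<close> being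
  open; on \<open>C\<close> positivity of \<open>Q\<close> persists. \<open>Q\<close> is any
  function of the two coordinate derivatives whose positivity implies their independence:
  \<open>gram2\<close> for the immersions, the absolute value of \<open>plk_gram\<close> for the
  Gauss maps.\<close>

lemma inj_persists:
  fixes ft :: "real \<Rightarrow> 'a \<Rightarrow> 'v::euclidean_space" and Q :: "'v \<Rightarrow> 'v \<Rightarrow> real"
  assumes fam: "smooth_family \<delta> ft" and C: "compact C"
    and supp: "\<And>t q. \<bar>t\<bar> < \<delta> \<Longrightarrow> q \<notin> C \<Longrightarrow> ft t q = ft 0 q"
    and cont: "\<And>c. c \<in> A \<Longrightarrow> continuous_on ({-\<delta><..<\<delta>} \<times> chart_img c)
      (\<lambda>p. Q (D (lift c ft) p (0, axis 1 1)) (D (lift c ft) p (0, axis 2 1)))"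
    and Q0: "\<And>c z. c \<in> A \<Longrightarrow> z \<in> chart_img c \<Longrightarrow>
      Q (D (loc c (ft 0)) z (axis 1 1)) (D (loc c (ft 0)) z (axis 2 1)) > 0"
    and indep: "\<And>v w \<alpha> \<beta>. Q v w > 0 \<Longrightarrow> \<alpha> *\<^sub>R v + \<beta> *\<^sub>R w = 0 \<Longrightarrow> \<alpha> = 0 \<and> \<beta> = 0"
  shows "\<exists>\<delta>'>0. \<delta>' \<le> \<delta> \<and> (\<forall>t. \<bar>t\<bar> < \<delta>' \<longrightarrow> (\<forall>c\<in>A. \<forall>z\<in>chart_img c. inj (D (loc c (ft t)) z)))"
proof -
  define h where "h c p = Q (D (lift c ft) p (0, axis 1 1)) (D (lift c ft) p (0, axis 2 1))" for c p
  have \<delta>: "\<delta> > 0" using fam by (simp add: smooth_family_def)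
  then have 0: "\<bar>0\<bar> < \<delta>" by simp
  have h_eq: "h c (t, z) = Q (D (loc c (ft t)) z (axis 1 1)) (D (loc c (ft t)) z (axis 2 1))"
    if "\<bar>t\<bar> < \<delta>" "c \<in> A" "z \<in> chart_img c" for c t z
    using family_slice(2)[OF fam that] by (simp add: h_def)
  have inj_h: "inj (D (loc c (ft t)) z)" if t: "\<bar>t\<bar> < \<delta>" and c: "c \<in> A" and z: "z \<in> chart_img c" and h: "h c (t, z) > 0" for t c z
    by (rule inj_of_columns[OF linear_D[OF smooth_map_diff[OF family_slice(1)[OF fam t] c z]]])
      (rule indep[OF h[unfolded h_eq[OF t c z]]])
  have "\<exists>\<delta>'>0. \<delta>' \<le> \<delta> \<and> (\<forall>t q. \<bar>t\<bar> < \<delta>' \<longrightarrow> q \<in> C \<longrightarrow> (\<exists>c\<in>A. q \<in> chart_dom c \<and> h c (t, snd c q) > 0))"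
  proof (rule persistence[OF C \<delta>])
    fix c assume c: "c \<in> A"
    show "continuous_on ({-\<delta><..<\<delta>} \<times> chart_img c) (h c)" unfolding h_def by (rule cont[OF c])
    fix q assume q: "q \<in> chart_dom c"
    show "h c (0, snd c q) > 0" unfolding h_eq[OF 0 c chart_in_img[OF c q]] by (rule Q0[OF c chart_in_img[OF c q]])
  qed
  then obtain \<delta>' where \<delta>': "\<delta>' > 0" "\<delta>' \<le> \<delta>"
    and pos: "\<And>t q. \<bar>t\<bar> < \<delta>' \<Longrightarrow> q \<in> C \<Longrightarrow> \<exists>c\<in>A. q \<in> chart_dom c \<and> h c (t, snd c q) > 0" by auto
  have oC: "open (- C)" using compact_imp_closed[OF C] by auto
  have "inj (D (loc c (ft t)) z)" if t': "\<bar>t\<bar> < \<delta>'" and c: "c \<in> A" and z: "z \<in> chart_img c" for t c z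
  proof -
    have t: "\<bar>t\<bar> < \<delta>" using t' \<delta>' by simp
    define q where "q = chart_inv c z"
    have q: "q \<in> chart_dom c" "snd c q = z" using c z by (auto simp: q_def chart_inv_dom chart_of_inv)
    show ?thesis
    proof (cases "q \<in> C")
      case True
      then obtain d where d: "d \<in> A" "q \<in> chart_dom d" "h d (t, snd d q) > 0" using pos[OF t'] by blast
      show ?thesis
        using inj_D_loc_change[OF family_slice(1)[OF fam t] c q(1) d(1,2) inj_h[OF t d(1) chart_in_img[OF d(1,2)] d(3)]]
        by (simp add: q(2))
    next
      case False
      have "D (loc c (ft t)) (snd c q) = D (loc c (ft 0)) (snd c q)"
        by (rule D_loc_local[OF oC _ _ c q(1) family_slice(1)[OF fam 0]]) (use False supp[OF t] in auto)
      moreover have "inj (D (loc c (ft 0)) z)"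
        by (rule inj_h[OF 0 c z]) (use Q0[OF c z] h_eq[OF 0 c z] in simp)
      ultimately show ?thesis by (simp add: q(2))
    qed
  qed
  then show ?thesis using \<delta>' by blast
qed

text \<open>Spatial derivatives of equal initial maps and of equal velocities agree, so
  \<open>p\<close> and \<open>p'\<close> agree to first order at \<open>t = 0\<close>, and
  \<open>taylor_quadratic\<close> applies. The bound is relative to the initial density, which makes
  it independent of the chart and usable in \<open>measure_density_diff\<close>.\<close>

lemma family_difference:
  fixes \<psi> \<psi>' :: "real \<Rightarrow> 'a \<Rightarrow> real^4^4"
  assumes \<psi>: "smooth_family \<delta> \<psi>" "\<And>t. \<bar>t\<bar> < \<delta> \<Longrightarrow> range (\<psi> t) \<subseteq> geodesics s"
    and \<psi>': "smooth_family \<delta> \<psi>'" "\<And>t. \<bar>t\<bar> < \<delta> \<Longrightarrow> range (\<psi>' t) \<subseteq> geodesics s"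
    and init: "\<psi> 0 = \<psi>' 0" "velocity \<psi> = velocity \<psi>'"
    and nondeg: "\<And>c z. c \<in> A \<Longrightarrow> z \<in> chart_img c \<Longrightarrow> vol_density s (\<psi> 0) c z > 0"
    and C: "compact C"
  shows "\<exists>\<delta>'>0. \<exists>K. \<forall>t q. \<bar>t\<bar> < \<delta>' \<longrightarrow> q \<in> C \<longrightarrow> (\<exists>c\<in>A. q \<in> chart_dom c \<and>
    \<bar>vol_density s (\<psi> t) c (snd c q) - vol_density s (\<psi>' t) c (snd c q)\<bar> \<le> K * t\<^sup>2 * vol_density s (\<psi> 0) c (snd c q))"
proof (rule compact_uniform_bound[OF C])
  have \<delta>: "\<delta> > 0" using \<psi>(1) by (simp add: smooth_family_def)
  fix q assume "q \<in> C"
  obtain c where c: "c \<in> A" "q \<in> chart_dom c" using chart_cover by blast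
  define z0 where "z0 = snd c q"
  have z0: "z0 \<in> chart_img c" unfolding z0_def by (rule chart_in_img[OF c])
  define S where "S = {-\<delta><..<\<delta>} \<times> chart_img c"
  have oS: "open S" unfolding S_def by (rule open_region[OF c(1)])
  define X X' where "X v = (\<lambda>p. D (lift c \<psi>) p (0, v))" and "X' v = (\<lambda>p. D (lift c \<psi>') p (0, v))" for v
  have sX: "smooth_on S (X v)" "smooth_on S (X' v)" for v
    unfolding X_def X'_def S_def by (rule family_smooth_D[OF \<psi>(1) c(1)] family_smooth_D[OF \<psi>'(1) c(1)])+
  define p p' where "p = (\<lambda>x. plk_gram (X (axis 1 1) x) (X (axis 2 1) x))" and "p' = (\<lambda>x. plk_gram (X' (axis 1 1) x) (X' (axis 2 1) x))"
  have sp: "smooth_on S p" "smooth_on S p'"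
    unfolding p_def p'_def plk_gram_def by (intro smooth_on_diff smooth_on_mult smooth_on_plk oS sX)+
  have vp: "vol_density s (\<psi> t) c z = sqrt \<bar>p (t, z)\<bar>" "vol_density s (\<psi>' t) c z = sqrt \<bar>p' (t, z)\<bar>"
    if "\<bar>t\<bar> < \<delta>" "z \<in> chart_img c" for t z
    unfolding p_def p'_def X_def X'_def
      vol_density_plk[OF family_slice(1)[OF \<psi>(1) that(1)] \<psi>(2)[OF that(1)] c(1) that(2)]
      vol_density_plk[OF family_slice(1)[OF \<psi>'(1) that(1)] \<psi>'(2)[OF that(1)] c(1) that(2)]
      family_slice(2)[OF \<psi>(1) that(1) c(1) that(2)] family_slice(2)[OF \<psi>'(1) that(1) c(1) that(2)] by simp_all
  have X0: "X v (0, z) = X' v (0, z)" if "z \<in> chart_img c" for v z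
    using family_slice(2)[OF \<psi>(1) _ c(1) that, of 0 v] family_slice(2)[OF \<psi>'(1) _ c(1) that, of 0 v] \<delta> init(1)
    by (simp add: X_def X'_def)
  have DX0: "D (X v) (0, z) (1, 0) = D (X' v) (0, z) (1, 0)" if "z \<in> chart_img c" for v z
    unfolding X_def X'_def family_D_velocity[OF \<psi>(1) c(1) that] family_D_velocity[OF \<psi>'(1) c(1) that] init(2) ..
  have "\<exists>M. \<forall>\<^sub>F x in nhds (0, z0). \<bar>p x - p' x\<bar> \<le> M * (fst x)\<^sup>2"
  proof (rule taylor_quadratic[OF \<delta> chart_homeo(2)[OF c(1)] _ z0])
    show "smooth_on ({-\<delta><..<\<delta>} \<times> chart_img c) (\<lambda>x. p x - p' x)"
      using smooth_on_diff[OF oS sp] by (simp add: S_def)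
    show "p (0, z) - p' (0, z) = 0" if "z \<in> chart_img c" for z
      using X0[OF that] by (simp add: p_def p'_def)
    show "D (\<lambda>x. p x - p' x) (0, z) (1, 0) = 0" if z: "z \<in> chart_img c" for z
    proof -
      have m: "(0, z) \<in> S" using \<delta> z by (simp add: S_def)
      note d = smooth_on_differentiable[OF _ m]
      have "D (\<lambda>x. p x + (- 1) * p' x) (0, z) (1, 0) = D p (0, z) (1, 0) + D (\<lambda>x. (- 1) * p' x) (0, z) (1, 0)"
        by (rule D_add[OF d d]) (intro sp smooth_on_mult smooth_on_const oS)+
      also have "D (\<lambda>x. (- 1) * p' x) (0, z) (1, 0) = (- 1) * D p' (0, z) (1, 0)"
        by (rule D_linear_compose[OF bounded_linear_mult_right d[OF sp(2)]])
      also have "D p (0, z) (1, 0) = D p' (0, z) (1, 0)"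
        unfolding p_def p'_def D_plk_gram[OF d[OF sX(1)] d[OF sX(1)]] D_plk_gram[OF d[OF sX(2)] d[OF sX(2)]]
          X0[OF z] DX0[OF z] ..
      finally show ?thesis by simp
    qed
  qed
  then obtain M where "\<forall>\<^sub>F x in nhds (0, z0). \<bar>p x - p' x\<bar> \<le> M * (fst x)\<^sup>2" by blast
  then obtain Q where Q: "open Q" "(0, z0) \<in> Q" "\<And>x. x \<in> Q \<Longrightarrow> \<bar>p x - p' x\<bar> \<le> M * (fst x)\<^sup>2"
    unfolding eventually_nhds by blast
  have p0: "\<bar>p (0, z0)\<bar> > 0" using nondeg[OF c(1) z0] vp(1)[OF _ z0, of 0] \<delta> by simp
  \<comment> \<open>Half the central value, so that \<open>\<bar>p\<bar> > m\<close> is an open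
    condition satisfied at the centre.\<close>
  define m where "m = \<bar>p (0, z0)\<bar> / 2"
  have m: "m > 0" "\<bar>p (0, z0)\<bar> > m" using p0 by (auto simp: m_def)
  define P where "P = Q \<inter> (S \<inter> (\<lambda>x. \<bar>p x\<bar>) -` {m<..})"
  have "continuous_on S (\<lambda>x. \<bar>p x\<bar>)" by (intro continuous_intros smooth_on_imp_continuous[OF sp(1)])
  then have "open (S \<inter> (\<lambda>x. \<bar>p x\<bar>) -` {m<..})" using oS by (rule continuous_open_preimage) auto
  then have "open P" unfolding P_def using Q(1) by auto
  moreover have "(0, snd c q) \<in> P" using Q(2) m \<delta> z0 by (simp add: P_def S_def z0_def)
  ultimately have "\<exists>U \<delta>1. open U \<and> q \<in> U \<and> \<delta>1 > 0 \<and>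
      (\<forall>t q'. \<bar>t\<bar> < \<delta>1 \<longrightarrow> q' \<in> U \<longrightarrow> q' \<in> chart_dom c \<and> (t, snd c q') \<in> P)"
    by (rule chart_box[OF c])
  then obtain U \<delta>1 where U: "open U" "q \<in> U" "\<delta>1 > 0"
    "\<And>t q'. \<bar>t\<bar> < \<delta>1 \<Longrightarrow> q' \<in> U \<Longrightarrow> q' \<in> chart_dom c \<and> (t, snd c q') \<in> P"
    by auto
  have "\<bar>vol_density s (\<psi> t) c (snd c q') - vol_density s (\<psi>' t) c (snd c q')\<bar> \<le> \<bar>M\<bar> / m * t\<^sup>2 * vol_density s (\<psi> 0) c (snd c q')"
    if t: "\<bar>t\<bar> < \<delta>1" and q': "q' \<in> U" for t q'
  proof -
    define z where "z = snd c q'"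
    have mem: "(t, z) \<in> P" "(0, z) \<in> P" using U(4)[OF t q'] U(4)[OF _ q', of 0] U(3) by (auto simp: z_def)
    then have td: "\<bar>t\<bar> < \<delta>" and z: "z \<in> chart_img c" by (auto simp: P_def S_def)
    have pm: "\<bar>p (t, z)\<bar> > m" "\<bar>p (0, z)\<bar> > m" using mem by (auto simp: P_def)
    have "\<bar>vol_density s (\<psi> t) c z - vol_density s (\<psi>' t) c z\<bar> \<le> \<bar>p (t, z) - p' (t, z)\<bar> / sqrt m"
      unfolding vp[OF td z] by (rule abs_sqrt_diff_le[OF pm(1) m(1)])
    also have "\<dots> \<le> \<bar>M\<bar> * t\<^sup>2 / sqrt m"
    proof (rule divide_right_mono)
      have "\<bar>p (t, z) - p' (t, z)\<bar> \<le> M * t\<^sup>2" using Q(3)[of "(t, z)"] mem(1) by (simp add: P_def)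
      also have "\<dots> \<le> \<bar>M\<bar> * t\<^sup>2" by (intro mult_right_mono) auto
      finally show "\<bar>p (t, z) - p' (t, z)\<bar> \<le> \<bar>M\<bar> * t\<^sup>2" .
    qed (use m in simp)
    \<comment> \<open>One factor \<open>sqrt m\<close> is kept in the numerator since it is at most
      the initial density; this produces the relative bound.\<close>
    also have "\<dots> = \<bar>M\<bar> / m * t\<^sup>2 * sqrt m"
    proof -
      have "1 / sqrt m = sqrt m / m" using m(1) by (simp add: field_simps)
      then show ?thesis by (metis (no_types, opaque_lifting) times_divide_eq_left times_divide_eq_right mult.commute mult_1)
    qed
    also have "\<dots> \<le> \<bar>M\<bar> / m * t\<^sup>2 * vol_density s (\<psi> 0) c z"
      using vp(1)[OF _ z, of 0] \<delta> pm(2) m(1) by (intro mult_left_mono) (auto intro: less_imp_le)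
    finally show ?thesis by (simp add: z_def)
  qed
  then have "\<forall>t q'. \<bar>t\<bar> < \<delta>1 \<longrightarrow> q' \<in> U \<longrightarrow> (\<exists>c\<in>A. q' \<in> chart_dom c \<and>
    \<bar>vol_density s (\<psi> t) c (snd c q') - vol_density s (\<psi>' t) c (snd c q')\<bar> \<le> (\<bar>M\<bar> / m) * t\<^sup>2 * vol_density s (\<psi> 0) c (snd c q'))"
    using U(4) c(1) by blast
  then show "\<exists>U \<delta>1 K. open U \<and> q \<in> U \<and> \<delta>1 > 0 \<and> (\<forall>t q'. \<bar>t\<bar> < \<delta>1 \<longrightarrow> q' \<in> U \<longrightarrow> (\<exists>c\<in>A. q' \<in> chart_dom c \<and>
    \<bar>vol_density s (\<psi> t) c (snd c q') - vol_density s (\<psi>' t) c (snd c q')\<bar> \<le> K * t\<^sup>2 * vol_density s (\<psi> 0) c (snd c q')))"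
    using U(1-3) by blast
next
  fix K K' t q
  assume KK: "(K::real) \<le> K'" and "\<exists>c\<in>A. q \<in> chart_dom c \<and>
    \<bar>vol_density s (\<psi> t) c (snd c q) - vol_density s (\<psi>' t) c (snd c q)\<bar> \<le> K * t\<^sup>2 * vol_density s (\<psi> 0) c (snd c q)"
  then obtain c where c: "c \<in> A" "q \<in> chart_dom c"
    "\<bar>vol_density s (\<psi> t) c (snd c q) - vol_density s (\<psi>' t) c (snd c q)\<bar> \<le> K * t\<^sup>2 * vol_density s (\<psi> 0) c (snd c q)" by blast
  have "0 \<le> vol_density s (\<psi> 0) c (snd c q)" by (simp add: vol_density_def)
  then have "K * t\<^sup>2 * vol_density s (\<psi> 0) c (snd c q) \<le> K' * t\<^sup>2 * vol_density s (\<psi> 0) c (snd c q)"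
    using KK by (intro mult_right_mono) auto
  then show "\<exists>c\<in>A. q \<in> chart_dom c \<and>
    \<bar>vol_density s (\<psi> t) c (snd c q) - vol_density s (\<psi>' t) c (snd c q)\<bar> \<le> K' * t\<^sup>2 * vol_density s (\<psi> 0) c (snd c q)"
    using c by (meson order_trans)
qed

end

section \<open>Gauss maps of families of immersions\<close>

lemma quadratic_bound_derivative:
  fixes e :: "real \<Rightarrow> real"
  assumes "\<delta> > 0" "\<And>t. \<bar>t\<bar> < \<delta> \<Longrightarrow> \<bar>e t\<bar> \<le> K * t\<^sup>2"
  shows "(e has_real_derivative 0) (at 0)"
proof -
  have e0: "e 0 = 0" using assms(2)[of 0] assms(1) by simp
  have "((\<lambda>h. (e h - e 0) / h) \<longlongrightarrow> 0) (at 0)"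
  proof (rule Lim_null_comparison)
    have "\<forall>\<^sub>F h in at 0. h \<in> {-\<delta><..<\<delta>} - {0}"
      using assms(1) by (intro eventually_at_in_open) auto
    then show "\<forall>\<^sub>F h in at 0. norm ((e h - e 0) / h) \<le> K * \<bar>h\<bar>"
    proof eventually_elim
      case (elim h)
      then have "\<bar>h\<bar> < \<delta>" by auto
      from assms(2)[OF this] have "\<bar>e h\<bar> \<le> K * \<bar>h\<bar> * \<bar>h\<bar>" by (simp add: power2_eq_square mult.assoc)
      then show ?case using elim by (simp add: e0 pos_divide_le_eq)
    qed
    show "((\<lambda>h. K * \<bar>h\<bar>) \<longlongrightarrow> 0) (at (0::real))" by (auto intro!: tendsto_eq_intros)
  qed
  then show ?thesis by (simp add: has_field_derivative_iff)
qed

lemma gram2_indep: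
  assumes "gram2 s v w \<noteq> 0" "\<alpha> *\<^sub>R v + \<beta> *\<^sub>R w = 0" shows "\<alpha> = 0 \<and> \<beta> = 0"
proof -
  have "gram2 s (\<alpha> *\<^sub>R v + \<beta> *\<^sub>R w) (r *\<^sub>R v + t *\<^sub>R w) = 0" for r t
    unfolding assms(2) by (simp add: gram2_def ip.zero_left)
  from this[of 0 1] this[of 1 0] show ?thesis
    using assms(1) unfolding gram2_linear_comb by simp
qed

lemma ambient_iff: "x \<in> ambient s \<longleftrightarrow> ip s x x = 1 \<and> (s = Hyperbolic \<longrightarrow> x $ 4 > 0)"
  by (cases s) auto

lemma pullback_cong: "F z = F' z \<Longrightarrow> D F z = D F' z \<Longrightarrow> pullback_G' s F z = pullback_G' s F' z"
  by (intro ext) (simp add: pullback_G'_def)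

lemma gradient_cong: "F z = F' z \<Longrightarrow> D F z = D F' z \<Longrightarrow> gradient s F u z = gradient s F' u z"
  using pullback_cong[of F z F' s] by (simp add: gradient_def)

lemma normal_part_cong: "F z = F' z \<Longrightarrow> D F z = D F' z \<Longrightarrow> normal_part s F z = normal_part s F' z"
  by (intro ext) (simp add: normal_part_def)

context surface
begin

lemma smooth_family_mono:
  assumes "smooth_family \<delta> ft" "0 < \<delta>'" "\<delta>' \<le> \<delta>" shows "smooth_family \<delta>' ft"
  unfolding smooth_family_def
proof (intro conjI ballI assms(2))
  fix c assume "c \<in> A"
  then have "smooth_on ({-\<delta><..<\<delta>} \<times> chart_img c) (lift c ft)" using assms(1) by (simp add: smooth_family_def)
  then show "smooth_on ({-\<delta>'<..<\<delta>'} \<times> chart_img c) (lift c ft)"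
    by (rule smooth_on_subset) (use assms(3) in \<open>intro Sigma_mono, auto\<close>)
qed

lemma immersed_surfaceI: "immersion A (ambient s) \<phi> \<Longrightarrow> immersed_surface A s \<phi>"
  by (simp add: immersed_surface_def immersed_surface_axioms_def surface_axioms)

lemma velocity_zero:
  assumes "\<delta> > 0" "\<And>t. \<bar>t\<bar> < \<delta> \<Longrightarrow> ft t q = ft 0 q" shows "velocity ft q = 0"
proof -
  have "((\<lambda>t. ft t q) has_derivative (\<lambda>h. 0)) (at 0)"
  proof (rule has_derivative_transform_within_open[OF has_derivative_const])
    show "open {-\<delta><..<\<delta>}" "0 \<in> {-\<delta><..<\<delta>}" using assms(1) by auto
    show "ft 0 q = ft t q" if "t \<in> {-\<delta><..<\<delta>}" for t using assms(2)[of t] that by (simp add: abs_less_iff)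
  qed
  then have "((\<lambda>t. ft t q) has_vector_derivative 0) (at 0)" by (simp add: has_vector_derivative_def)
  then show ?thesis unfolding velocity_def by (rule vector_derivative_at)
qed

lemma gauss_map_local:
  assumes "immersion A (ambient s) \<phi>" "immersion A (ambient s) \<psi>" "open W" "q \<in> W" "\<And>x. x \<in> W \<Longrightarrow> \<phi> x = \<psi> x"
  shows "gauss_map s A \<psi> q = gauss_map s A \<phi> q"
proof -
  obtain c where c: "c \<in> A" "q \<in> chart_dom c" using chart_cover by blast
  have "D (loc c \<psi>) (snd c q) = D (loc c \<phi>) (snd c q)"
    by (rule D_loc_local[OF assms(3,4,5) c]) (use assms(1) in \<open>auto simp: immersion_def\<close>)
  then have "unit_normal s A \<psi> q = unit_normal s A \<phi> q"
    unfolding immersed_surface.unit_normal_eq[OF immersed_surfaceI[OF assms(1)] c] immersed_surface.unit_normal_eq[OF immersed_surfaceI[OF assms(2)] c]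
    using assms(4,5) by (simp add: gnormal_def loc_def chart_inv_of[OF c])
  then show ?thesis using assms(4,5) by (simp add: gauss_map_def)
qed

end

section \<open>Gauss maps along a family and their velocity\<close>

locale immersed_family = surface A for A :: "'a::{t2_space,second_countable_topology} chart set" +
  fixes s :: geometry and \<delta> :: real and \<phi>t :: "real \<Rightarrow> 'a \<Rightarrow> real^4"
  assumes fam: "smooth_family \<delta> \<phi>t"
    and imms: "\<And>t. \<bar>t\<bar> < \<delta> \<Longrightarrow> immersion A (ambient s) (\<phi>t t)"
begin

abbreviation "\<Phi>t \<equiv> \<lambda>t. gauss_map s A (\<phi>t t)"

lemma \<delta>_pos: "\<delta> > 0" using fam by (simp add: smooth_family_def)

lemma imm_at: "\<bar>t\<bar> < \<delta> \<Longrightarrow> immersed_surface A s (\<phi>t t)" using imms immersed_surfaceI by blast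

lemma patch_at: "\<bar>t\<bar> < \<delta> \<Longrightarrow> c \<in> A \<Longrightarrow> patch s (chart_img c) (loc c (\<phi>t t))"
  using immersed_surface.patch[OF imm_at] .

text \<open>The unit normal as a single function of \<open>(t, z)\<close>: joint smoothness is
  visible in the formula \<open>lnormal\<close>, not in the description
  \<open>unit_normal\<close>.\<close>

definition family_normal :: "'a chart \<Rightarrow> real \<times> (real^2) \<Rightarrow> real^4" where
  "family_normal c p = lnormal s (lift c \<phi>t p) (D (lift c \<phi>t) p (0, axis 1 1)) (D (lift c \<phi>t) p (0, axis 2 1))"

lemma family_normal_eq: "\<bar>t\<bar> < \<delta> \<Longrightarrow> c \<in> A \<Longrightarrow> z \<in> chart_img c \<Longrightarrow> family_normal c (t, z) = gnormal s (loc c (\<phi>t t)) z"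
  by (simp add: family_normal_def gnormal_def family_slice(2)[OF fam])

lemma smooth_lift: "c \<in> A \<Longrightarrow> smooth_on ({-\<delta><..<\<delta>} \<times> chart_img c) (lift c \<phi>t)"
  using fam by (simp add: smooth_family_def)

lemma smooth_family_normal: assumes c: "c \<in> A" shows "smooth_on ({-\<delta><..<\<delta>} \<times> chart_img c) (family_normal c)"
  unfolding family_normal_def[abs_def]
proof (rule smooth_on_lnormal[OF open_region[OF c] smooth_lift[OF c] family_smooth_D[OF fam c] family_smooth_D[OF fam c]])
  fix p assume p: "p \<in> {-\<delta><..<\<delta>} \<times> chart_img c"
  obtain t z where tz: "p = (t, z)" by (cases p)
  have t: "\<bar>t\<bar> < \<delta>" and z: "z \<in> chart_img c" using p tz by auto
  show "0 < gram2 s (D (lift c \<phi>t) p (0, axis 1 1)) (D (lift c \<phi>t) p (0, axis 2 1))"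
    using patch.gram2_pos[OF patch_at[OF t c] z] family_slice(2)[OF fam t c z] by (simp add: tz)
qed

lemma lift_gauss:
  "\<bar>t\<bar> < \<delta> \<Longrightarrow> c \<in> A \<Longrightarrow> z \<in> chart_img c \<Longrightarrow> loc c (\<Phi>t t) z = lift c \<phi>t (t, z) \<and>\<and> family_normal c (t, z)"
  using immersed_surface.loc_gauss_map[OF imm_at] family_normal_eq by simp

lemma gauss_family: "smooth_family \<delta> \<Phi>t"
  unfolding smooth_family_def
proof (intro conjI \<delta>_pos ballI)
  fix c assume c: "c \<in> A"
  have "smooth_on ({-\<delta><..<\<delta>} \<times> chart_img c) (\<lambda>p. lift c \<phi>t p \<and>\<and> family_normal c p)"
    by (intro smooth_on_wedge open_region[OF c] smooth_lift[OF c] smooth_family_normal[OF c])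
  then show "smooth_on ({-\<delta><..<\<delta>} \<times> chart_img c) (\<lambda>(t, z). loc c (\<Phi>t t) z)"
    by (rule smooth_on_cong[OF open_region[OF c], rotated]) (use lift_gauss[OF _ c] in \<open>auto simp: abs_less_iff\<close>)
qed

text \<open>The \<open>t\<close>-derivative of the normal is never computed. Differentiating the
  relations between the immersion, its derivatives and the normal gives all the products that enter
  \<open>\<Omega>\<close>. The tangential velocity appears in the second component, while the
  pairing with \<open>d\<Phi>\<close> sees only the normal velocity.\<close>

lemma velocity_gauss:
  assumes c: "c \<in> A" and z: "z \<in> chart_img c"
  defines "F \<equiv> loc c (\<phi>t 0)" and "N \<equiv> gnormal s (loc c (\<phi>t 0))" and "f \<equiv> loc c (velocity \<phi>t)"
  shows "\<exists>X.
    tangent_repr s (F z \<and>\<and> N z) (loc c (velocity \<Phi>t) z) (F z) (N z) X (- (f z - (eps s * ip s (f z) (N z)) *\<^sub>R N z)) \<and>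
    (\<forall>w. Omega s (F z \<and>\<and> N z) (loc c (velocity \<Phi>t) z) (D (\<lambda>z. F z \<and>\<and> N z) z w)
        = - D (\<lambda>z. - ip s (f z) (N z)) z w)"
proof -
  define R where "R = {-\<delta><..<\<delta>} \<times> chart_img c"
  define L where "L = lift c \<phi>t"
  define n where "n = family_normal c"
  define p0 where "p0 = (0::real, z)"
  have 0: "\<bar>0\<bar> < \<delta>" using \<delta>_pos by simp
  interpret P: patch s "chart_img c" F unfolding F_def by (rule patch_at[OF 0 c])
  have N: "N = gnormal s F" by (simp add: N_def F_def)
  have oR: "open R" unfolding R_def by (rule open_region[OF c])
  have p0: "p0 \<in> R" using \<delta>_pos z by (simp add: R_def p0_def)
  have L0: "L p0 = F z" by (simp add: L_def p0_def F_def)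
  have n0: "n p0 = N z" unfolding n_def p0_def N_def by (rule family_normal_eq[OF 0 c z])
  have dL: "L differentiable (at p0)" and dn: "n differentiable (at p0)"
    using smooth_on_differentiable[OF smooth_lift[OF c]] smooth_on_differentiable[OF smooth_family_normal[OF c]] p0
    by (simp_all add: L_def n_def R_def)
  define x where "x = D L p0 (1, 0)"
  define y where "y = D n p0 (1, 0)"
  have fz: "f z = x" unfolding f_def x_def L_def p0_def by (rule family_velocity(2)[OF fam c z])
  have at: "ip s (L p) (L p) = 1" "ip s (L p) (n p) = 0" "ip s (n p) (n p) = eps s" "ip s (n p) (D L p (0, w)) = 0"
    if "p \<in> R" for p w
  proof -
    obtain t z' where tz: "p = (t, z')" by (cases p)
    have t: "\<bar>t\<bar> < \<delta>" and z': "z' \<in> chart_img c" using that tz by (auto simp: R_def)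
    interpret Q: patch s "chart_img c" "loc c (\<phi>t t)" by (rule patch_at[OF t c])
    have n: "n p = gnormal s (loc c (\<phi>t t)) z'" using family_normal_eq[OF t c z'] by (simp add: n_def tz)
    have L: "L p = loc c (\<phi>t t) z'" by (simp add: L_def tz)
    have DL: "D L p (0, w) = D (loc c (\<phi>t t)) z' w" using family_slice(2)[OF fam t c z'] by (simp add: L_def tz)
    show "ip s (L p) (L p) = 1" "ip s (L p) (n p) = 0" "ip s (n p) (n p) = eps s" "ip s (n p) (D L p (0, w)) = 0"
      unfolding n L DL using Q.N_ip[OF z'] Q.N_DF[OF z'] ambient_ip[OF Q.F_ambient[OF z']] by auto
  qed
  note bil = differentiable_bilinear[OF ip.bounded_bilinear_axioms]
  have Fx: "ip s (F z) x = 0"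
  proof -
    have "D (\<lambda>p. ip s (L p) (L p)) p0 (1, 0) = 0"
      by (rule D_locally_const[OF oR p0 _ bil[OF dL dL]]) (rule at(1))
    then show ?thesis unfolding D_ip[OF dL dL] x_def[symmetric] L0 by (simp add: ip_commute[of s x "F z"])
  qed
  have Ny: "ip s (N z) y = 0"
  proof -
    have "D (\<lambda>p. ip s (n p) (n p)) p0 (1, 0) = 0"
      by (rule D_locally_const[OF oR p0 _ bil[OF dn dn]]) (rule at(3))
    then show ?thesis unfolding D_ip[OF dn dn] y_def[symmetric] n0 by (simp add: ip_commute[of s y "N z"])
  qed
  have Fy: "ip s (F z) y = - ip s x (N z)"
  proof -
    have "D (\<lambda>p. ip s (L p) (n p)) p0 (1, 0) = 0"
      by (rule D_locally_const[OF oR p0 _ bil[OF dL dn]]) (rule at(2))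
    then show ?thesis unfolding D_ip[OF dL dn] y_def[symmetric] x_def[symmetric] n0 L0 by simp
  qed
  \<comment> \<open>The \<open>t\<close>-derivative of the orthogonality of the normal and
    \<open>D L p (0, w)\<close>; by commuting derivatives the latter has \<open>t\<close>-derivative
    \<open>D f z w\<close>.\<close>
  have yF: "ip s y (D F z w) = - ip s (N z) (D f z w)" for w
  proof -
    have d: "(\<lambda>p. D L p (0, w)) differentiable (at p0)"
      using smooth_on_differentiable[OF family_smooth_D[OF fam c]] p0 by (simp add: L_def R_def)
    have "D (\<lambda>p. ip s (n p) (D L p (0, w))) p0 (1, 0) = 0"
      by (rule D_locally_const[OF oR p0 _ bil[OF dn d]]) (rule at(4))
    moreover have "D (\<lambda>p. D L p (0, w)) p0 (1, 0) = D f z w"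
      unfolding L_def p0_def f_def by (rule family_D_velocity[OF fam c z])
    moreover have "D L p0 (0, w) = D F z w"
      unfolding L_def p0_def F_def by (rule family_slice(2)[OF fam 0 c z, symmetric])
    ultimately show ?thesis unfolding D_ip[OF dn d] y_def[symmetric] n0 by simp
  qed
  have V: "loc c (velocity \<Phi>t) z = F z \<and>\<and> y + x \<and>\<and> N z"
  proof -
    have d: "(\<lambda>p. L p \<and>\<and> n p) differentiable (at p0)"
      by (rule differentiable_bilinear[OF wedge.bounded_bilinear_axioms dL dn])
    have "D (lift c \<Phi>t) p0 = D (\<lambda>p. L p \<and>\<and> n p) p0"
    proof (rule D_cong(1)[OF d oR p0])
      fix p assume "p \<in> R"
      then show "L p \<and>\<and> n p = lift c \<Phi>t p"
        using lift_gauss[OF _ c] by (cases p) (auto simp: R_def L_def n_def abs_less_iff)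
    qed
    then show ?thesis
      using family_velocity(2)[OF gauss_family c z] D_bilinear[OF wedge.bounded_bilinear_axioms dL dn, of "(1, 0)"]
      by (simp add: p0_def[symmetric] x_def y_def L0 n0)
  qed
  \<comment> \<open>Adding a multiple of \<open>F z\<close> to \<open>y\<close> and removing the
    normal part of \<open>x\<close> leaves the bivector unchanged, as
    \<open>F z \<and>\<and> F z\<close> and \<open>N z \<and>\<and> N z\<close> vanish, and brings
    both components into the orthogonal plane.\<close>
  define k where "k = ip s x (N z)"
  define X Y where "X = y + k *\<^sub>R F z" and "Y = - (x - (eps s * k) *\<^sub>R N z)"
  have FN: "ip s (F z) (N z) = 0" "ip s (N z) (F z) = 0" "ip s (N z) (N z) = eps s" "ip s (F z) (F z) = 1"
    using P.N_ip[OF z] ambient_ip[OF P.F_ambient[OF z]] ip_commute[of s "N z" "F z"] unfolding N by auto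
  have Nx: "ip s (N z) x = k" unfolding k_def by (rule ip_commute)
  have r: "tangent_repr s (F z \<and>\<and> N z) (loc c (velocity \<Phi>t) z) (F z) (N z) X Y"
    unfolding tangent_repr_def
  proof (intro conjI refl)
    show "geodesic_frame s (F z) (N z)" unfolding N by (rule P.N_frame[OF z])
    show "X \<in> orth_plane s (F z) (N z)"
      by (simp add: orth_plane_def X_def ip.add_right ip.scaleR_right Fy Ny FN k_def)
    show "Y \<in> orth_plane s (F z) (N z)"
      by (simp add: orth_plane_def Y_def ip.diff_right ip.minus_right ip.scaleR_right Fx Nx FN)
    show "loc c (velocity \<Phi>t) z = F z \<and>\<and> X + N z \<and>\<and> Y"
      unfolding V X_def Y_def using wedge_commute[of x "N z"]
      by (simp add: wedge.add_right wedge.diff_right wedge.minus_right wedge.scaleR_right)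
  qed
  have df: "f differentiable (at z)"
    unfolding f_def by (rule smooth_map_diff[OF family_velocity(3)[OF fam] c z])
  have dN: "N differentiable (at z)" unfolding N by (rule P.diff_N[OF z])
  have "Omega s (F z \<and>\<and> N z) (loc c (velocity \<Phi>t) z) (D (\<lambda>z. F z \<and>\<and> N z) z w) = - D (\<lambda>z. - ip s (f z) (N z)) z w" for w
  proof -
    have "D (\<lambda>z. - ip s (f z) (N z)) z w = - D (\<lambda>z. ip s (f z) (N z)) z w"
      by (rule D_linear_compose[OF bounded_linear_minus[OF bounded_linear_ident] bil[OF df dN]])
    then have D: "D (\<lambda>z. - ip s (f z) (N z)) z w = - (ip s x (D N z w) + ip s (D f z w) (N z))"
      unfolding D_ip[OF df dN] fz .
    have NDN: "ip s (N z) (D N z w) = 0" unfolding N by (rule P.N_DN[OF z])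
    have FDF: "ip s (F z) (D F z w) = 0" by (rule P.F_DF[OF z])
    have "Omega s (F z \<and>\<and> N z) (loc c (velocity \<Phi>t) z) (D (\<lambda>z. F z \<and>\<and> N z) z w)
        = ip s X (- D F z w) - ip s Y (D N z w)"
      using Omega_repr[OF r P.repr_\<Phi>[OF z, folded N]] .
    also have "\<dots> = ip s (N z) (D f z w) + ip s x (D N z w)"
      by (simp add: X_def Y_def ip.add_left ip.minus_right ip.minus_left ip.diff_left ip.scaleR_left yF NDN FDF)
    finally show ?thesis unfolding D by (simp add: ip_commute[of s "N z"])
  qed
  then show ?thesis using r unfolding Y_def fz k_def by (intro exI[of _ X]) simp
qed

end

section \<open>Hamiltonian variations\<close>

locale nondegenerate_gauss_map = immersed_surface +
  assumes gauss_imm: "immersion A (geodesics s) (gauss_map s A \<phi>)"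
    and gauss_nondeg: "nondegenerate s A (gauss_map s A \<phi>)"
begin

abbreviation "\<Phi> \<equiv> gauss_map s A \<phi>"
abbreviation "\<Phi>c c \<equiv> \<lambda>z. loc c \<phi> z \<and>\<and> gnormal s (loc c \<phi>) z"

lemma loc_\<Phi>: "c \<in> A \<Longrightarrow> z \<in> chart_img c \<Longrightarrow> loc c \<Phi> z = \<Phi>c c z \<and> D (loc c \<Phi>) z = D (\<Phi>c c) z"
  using loc_gauss_map D_loc_gauss_map(1) by blast

lemma nondegenerate_point: assumes c: "c \<in> A" and z: "z \<in> chart_img c"
  shows "nondegenerate_point s (chart_img c) (loc c \<phi>) z"
proof -
  have "pullback_G' s (loc c \<Phi>) z = pullback_G' s (\<Phi>c c) z"
    by (rule pullback_cong) (use loc_\<Phi>[OF c z] in auto)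
  then have "\<exists>w. pullback_G' s (\<Phi>c c) z v w \<noteq> 0" if "v \<noteq> 0" for v
    using gauss_nondeg c z that unfolding nondegenerate_def by metis
  then show ?thesis
    using patch[OF c] z by (simp add: nondegenerate_point_def nondegenerate_point_axioms_def)
qed

text \<open>A kernel vector of the matrix of the pulled back metric would be orthogonal to every
  direction, against non-degeneracy.\<close>

lemma vol_density_pos: assumes c: "c \<in> A" and z: "z \<in> chart_img c" shows "vol_density s \<Phi> c z > 0"
proof -
  define M :: "real^2^2" where "M = (\<chi> i j. pullback_G' s (loc c \<Phi>) z (axis i 1) (axis j 1))"
  note P = pullback_plk[OF smooth_gauss_map gauss_map_range c z]
  note L = linear_D[OF smooth_map_diff[OF smooth_gauss_map c z]]
  have "det M \<noteq> 0"
  proof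
    assume "det M = 0"
    then obtain v where v: "v \<noteq> 0" "M *v v = 0" using matrix_left_invertible_ker[of M] invertible_left_inverse[of M] invertible_det_nz[of M] by blast
    have "pullback_G' s (loc c \<Phi>) z v (axis i 1) = 0" for i
    proof -
      have "(M *v v) $ i = pullback_G' s (loc c \<Phi>) z v (axis i 1)"
        unfolding M_def matrix_vector_mult_def P linear_real2[OF L, of v]
        by (simp add: sum_2 plk.add_left plk.scaleR_left plk.add_right plk.scaleR_right plk_commute[of _ "D (loc c \<Phi>) z (axis i 1)"] algebra_simps)
      then show ?thesis using v(2) by simp
    qed
    then have "pullback_G' s (loc c \<Phi>) z v w = 0" for w
      unfolding P linear_real2[OF L, of w] by (simp add: plk.add_right plk.scaleR_right)
    then show False using gauss_nondeg c z v(1) unfolding nondegenerate_def by blast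
  qed
  then show ?thesis by (simp add: vol_density_def M_def)
qed

lemma lagrangian_gauss_map: "lagrangian s A \<Phi>"
  unfolding lagrangian_def
proof (intro ballI allI)
  fix c z v w assume c: "c \<in> A" and z: "z \<in> chart_img c"
  show "Omega s (loc c \<Phi> z) (D (loc c \<Phi>) z v) (D (loc c \<Phi>) z w) = 0"
    using patch.lagrangian_\<Phi>[OF patch[OF c] z] loc_\<Phi>[OF c z] by simp
qed

lemma hamiltonian_at:
  assumes c: "c \<in> A" and z: "z \<in> chart_img c" and V: "tangent s (\<Phi>c c z) V" and u: "u differentiable (at z)"
  shows "normal_part s (loc c \<Phi>) z V = JJ' s (loc c \<Phi> z) (D (loc c \<Phi>) z (gradient s (loc c \<Phi>) u z)) \<longleftrightarrow>
    (\<forall>w. Omega s (\<Phi>c c z) V (D (\<Phi>c c) z w) = - D u z w)"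
proof -
  have e: "loc c \<Phi> z = \<Phi>c c z" "D (loc c \<Phi>) z = D (\<Phi>c c) z" using loc_\<Phi>[OF c z] by auto
  show ?thesis
    unfolding normal_part_cong[of "loc c \<Phi>" z "\<Phi>c c", OF e] gradient_cong[of "loc c \<Phi>" z "\<Phi>c c", OF e] e
    by (rule nondegenerate_point.hamiltonian_iff[OF nondegenerate_point[OF c z] V u])
qed

end

text \<open>A variation of the Gauss map must consist of immersions. Non-degeneracy at
  \<open>t = 0\<close> makes \<open>plk_gram\<close> non-zero; on \<open>C\<close> this persists for
  small \<open>t\<close> and forces injective differentials.\<close>

lemma (in immersed_family) gauss_map_immersions:
  assumes n: "nondegenerate_gauss_map A s (\<phi>t 0)" and C: "compact C"
    and supp: "\<And>t q. \<bar>t\<bar> < \<delta> \<Longrightarrow> q \<notin> C \<Longrightarrow> \<phi>t t q = \<phi>t 0 q"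
  shows "\<exists>\<delta>'>0. \<delta>' \<le> \<delta> \<and> (\<forall>t. \<bar>t\<bar> < \<delta>' \<longrightarrow> immersion A (geodesics s) (\<Phi>t t))"
    and "\<And>t q. \<bar>t\<bar> < \<delta> \<Longrightarrow> q \<notin> C \<Longrightarrow> \<Phi>t t q = \<Phi>t 0 q"
proof -
  interpret n: nondegenerate_gauss_map A s "\<phi>t 0" by (rule n)
  have 0: "\<bar>0\<bar> < \<delta>" using \<delta>_pos by simp
  have oC: "open (- C)" using compact_imp_closed[OF C] by auto
  show loc: "\<Phi>t t q = \<Phi>t 0 q" if t: "\<bar>t\<bar> < \<delta>" and q: "q \<notin> C" for t q
    by (rule gauss_map_local[OF imms[OF 0] imms[OF t] oC]) (use q supp[OF t] in auto)
  have "\<exists>\<delta>'>0. \<delta>' \<le> \<delta> \<and> (\<forall>t. \<bar>t\<bar> < \<delta>' \<longrightarrow> (\<forall>c\<in>A. \<forall>z\<in>chart_img c. inj (D (loc c (\<Phi>t t)) z)))"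
  proof (rule inj_persists[OF gauss_family C loc, of "\<lambda>v w. \<bar>plk_gram v w\<bar>"])
    fix c assume c: "c \<in> A"
    have "smooth_on ({-\<delta><..<\<delta>} \<times> chart_img c) (\<lambda>p. plk_gram (D (lift c \<Phi>t) p (0, axis 1 1)) (D (lift c \<Phi>t) p (0, axis 2 1)))"
      unfolding plk_gram_def
      by (intro smooth_on_diff smooth_on_mult smooth_on_plk open_region[OF c] family_smooth_D[OF gauss_family c])
    from smooth_on_imp_continuous[OF this]
    show "continuous_on ({-\<delta><..<\<delta>} \<times> chart_img c) (\<lambda>p. \<bar>plk_gram (D (lift c \<Phi>t) p (0, axis 1 1)) (D (lift c \<Phi>t) p (0, axis 2 1))\<bar>)"
      by (intro continuous_intros)
    show "\<bar>plk_gram (D (loc c (\<Phi>t 0)) z (axis 1 1)) (D (loc c (\<Phi>t 0)) z (axis 2 1))\<bar> > 0" if z: "z \<in> chart_img c" for z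
      using n.vol_density_pos[OF c z] unfolding vol_density_plk[OF n.smooth_gauss_map n.gauss_map_range c z] by simp
  next
    show "\<alpha> = 0 \<and> \<beta> = 0" if "\<bar>plk_gram v w\<bar> > 0" "\<alpha> *\<^sub>R v + \<beta> *\<^sub>R w = 0" for v w \<alpha> \<beta>
      by (rule plk_gram_indep[OF _ that(2)]) (use that(1) in simp)
  qed
  then obtain \<delta>' where \<delta>': "\<delta>' > 0" "\<delta>' \<le> \<delta>"
    and inj: "\<And>t c z. \<bar>t\<bar> < \<delta>' \<Longrightarrow> c \<in> A \<Longrightarrow> z \<in> chart_img c \<Longrightarrow> inj (D (loc c (\<Phi>t t)) z)" by blast
  have "immersion A (geodesics s) (\<Phi>t t)" if t': "\<bar>t\<bar> < \<delta>'" for t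
  proof -
    have t: "\<bar>t\<bar> < \<delta>" using t' \<delta>' by simp
    show ?thesis
      using immersed_surface.gauss_map_range[OF imm_at[OF t]] immersed_surface.smooth_gauss_map[OF imm_at[OF t]] inj[OF t']
      by (simp add: immersion_def)
  qed
  then show "\<exists>\<delta>'>0. \<delta>' \<le> \<delta> \<and> (\<forall>t. \<bar>t\<bar> < \<delta>' \<longrightarrow> immersion A (geodesics s) (\<Phi>t t))"
    using \<delta>' by blast
qed

context surface
begin

lemma variationD:
  assumes "variation A M f ft C"
  obtains \<delta> where "compact C" "ft 0 = f" "smooth_family \<delta> ft" "\<And>t. \<bar>t\<bar> < \<delta> \<Longrightarrow> immersion A M (ft t)"
    "\<And>t q. \<bar>t\<bar> < \<delta> \<Longrightarrow> q \<notin> C \<Longrightarrow> ft t q = ft 0 q"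
proof -
  obtain \<delta> where \<delta>: "\<delta> > 0" "\<forall>c\<in>A. smooth_on ({-\<delta><..<\<delta>} \<times> chart_img c) (\<lambda>(t, z). loc c (ft t) z)"
    "\<forall>t\<in>{-\<delta><..<\<delta>}. immersion A M (ft t) \<and> (\<forall>q. q \<notin> C \<longrightarrow> ft t q = f q)" and c: "compact C" "ft 0 = f"
    using assms unfolding variation_def by blast
  have "smooth_family \<delta> ft" using \<delta> by (simp add: smooth_family_def)
  moreover have "immersion A M (ft t)" "q \<notin> C \<Longrightarrow> ft t q = ft 0 q" if "\<bar>t\<bar> < \<delta>" for t q
    using \<delta>(3) that c(2) by (auto simp: abs_less_iff)
  ultimately show ?thesis using that c by blast
qed

lemma variationI:
  assumes "compact C" "ft 0 = f" "smooth_family \<delta> ft" "\<And>t. \<bar>t\<bar> < \<delta> \<Longrightarrow> immersion A M (ft t)"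
    "\<And>t q. \<bar>t\<bar> < \<delta> \<Longrightarrow> q \<notin> C \<Longrightarrow> ft t q = ft 0 q"
  shows "variation A M f ft C"
proof -
  have \<delta>: "\<delta> > 0" "\<forall>c\<in>A. smooth_on ({-\<delta><..<\<delta>} \<times> chart_img c) (lift c ft)"
    using assms(3) by (auto simp: smooth_family_def)
  have "\<forall>t\<in>{-\<delta><..<\<delta>}. immersion A M (ft t) \<and> (\<forall>q. q \<notin> C \<longrightarrow> ft t q = f q)"
  proof
    fix t assume "t \<in> {-\<delta><..<\<delta>}"
    then have "\<bar>t\<bar> < \<delta>" by (simp add: abs_less_iff)
    then show "immersion A M (ft t) \<and> (\<forall>q. q \<notin> C \<longrightarrow> ft t q = f q)" using assms(2,4,5) by simp
  qed
  then show ?thesis unfolding variation_def using assms(1,2) \<delta> by blast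
qed

end

section \<open>The two implications\<close>

context nondegenerate_gauss_map
begin

lemma hamiltonian_minimal_imp_critical:
  assumes H: "hamiltonian_minimal s A \<Phi>" shows "critical_W' s A \<phi>"
  unfolding critical_W'_def
proof (intro allI impI)
  fix \<phi>t C assume var: "variation A (ambient s) \<phi> \<phi>t C"
  obtain \<delta> where C: "compact C" and \<phi>0: "\<phi>t 0 = \<phi>" and fam: "smooth_family \<delta> \<phi>t"
    and imms: "\<And>t. \<bar>t\<bar> < \<delta> \<Longrightarrow> immersion A (ambient s) (\<phi>t t)"
    and supp: "\<And>t q. \<bar>t\<bar> < \<delta> \<Longrightarrow> q \<notin> C \<Longrightarrow> \<phi>t t q = \<phi>t 0 q"
    using variationD[OF var] by metis
  interpret fam: immersed_family A s \<delta> \<phi>t by unfold_locales (use fam imms in auto)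
  have n0: "nondegenerate_gauss_map A s (\<phi>t 0)" unfolding \<phi>0 by unfold_locales
  note gi = fam.gauss_map_immersions[OF n0 C supp]
  obtain \<delta>' where \<delta>': "\<delta>' > 0" "\<delta>' \<le> \<delta>" "\<And>t. \<bar>t\<bar> < \<delta>' \<Longrightarrow> immersion A (geodesics s) (fam.\<Phi>t t)"
    using gi(1) by blast
  have var\<Phi>: "variation A (geodesics s) \<Phi> fam.\<Phi>t C"
    by (rule variationI[OF C _ smooth_family_mono[OF fam.gauss_family \<delta>'(1,2)] \<delta>'(3)])
      (use gi(2) \<delta>'(2) in \<open>auto simp: \<phi>0\<close>)
  \<comment> \<open>The potential supplied by \<open>velocity_gauss\<close>. It vanishes outside
    \<open>C\<close>, where the family does not move.\<close>
  define u where "u q = - ip s (velocity \<phi>t q) (unit_normal s A \<phi> q)" for q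
  have loc_u: "loc c u z = - ip s (loc c (velocity \<phi>t) z) (gnormal s (loc c \<phi>) z)" if "c \<in> A" "z \<in> chart_img c" for c z
    using loc_unit_normal[OF that] by (simp add: u_def loc_def)
  have smu: "smooth_map A u"
    unfolding smooth_map_def
  proof
    fix c assume c: "c \<in> A"
    interpret P: patch s "chart_img c" "loc c \<phi>" by (rule patch[OF c])
    have "smooth_on (chart_img c) (\<lambda>z. - ip s (loc c (velocity \<phi>t) z) (gnormal s (loc c \<phi>) z))"
      using family_velocity(3)[OF fam] c
      by (intro smooth_on_minus smooth_on_ip P.open_U P.smooth_N) (simp add: smooth_map_def)
    then show "smooth_on (chart_img c) (loc c u)"
      by (rule smooth_on_cong[OF P.open_U, rotated]) (rule loc_u[OF c, symmetric])
  qed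
  have u0: "u q = 0" if "q \<notin> C" for q
  proof -
    have "velocity \<phi>t q = 0" by (rule velocity_zero[OF fam.\<delta>_pos]) (rule supp[OF _ that])
    then show ?thesis by (simp add: u_def ip.zero_left)
  qed
  have "hamiltonian_field s A \<Phi> (velocity fam.\<Phi>t)"
    unfolding hamiltonian_field_def
  proof (intro exI[of _ u] conjI smu ballI)
    show "\<exists>K. compact K \<and> (\<forall>q. q \<notin> K \<longrightarrow> u q = 0)" using C u0 by blast
    fix c z assume c: "c \<in> A" and z: "z \<in> chart_img c"
    define V where "V = loc c (velocity fam.\<Phi>t) z"
    obtain X where X: "tangent_repr s (\<Phi>c c z) V (loc c \<phi> z) (gnormal s (loc c \<phi>) z) X
        (- (loc c (velocity \<phi>t) z - (eps s * ip s (loc c (velocity \<phi>t) z) (gnormal s (loc c \<phi>) z)) *\<^sub>R gnormal s (loc c \<phi>) z)) \<and>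
      (\<forall>w. Omega s (\<Phi>c c z) V (D (\<Phi>c c) z w) = - D (\<lambda>z. - ip s (loc c (velocity \<phi>t) z) (gnormal s (loc c \<phi>) z)) z w)"
      using fam.velocity_gauss[OF c z] unfolding \<phi>0 V_def ..
    have du: "loc c u differentiable (at z)" by (rule smooth_map_diff[OF smu c z])
    have "D (\<lambda>z. - ip s (loc c (velocity \<phi>t) z) (gnormal s (loc c \<phi>) z)) z = D (loc c u) z"
      by (rule D_cong(1)[OF du chart_homeo(2)[OF c] z]) (rule loc_u[OF c])
    then have "\<forall>w. Omega s (\<Phi>c c z) V (D (\<Phi>c c) z w) = - D (loc c u) z w" using X[THEN conjunct2] by simp
    moreover have "tangent s (\<Phi>c c z) V" using X[THEN conjunct1] unfolding tangent_def by blast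
    ultimately show "normal_part s (loc c \<Phi>) z (loc c (velocity fam.\<Phi>t) z) =
        JJ' s (loc c \<Phi> z) (D (loc c \<Phi>) z (gradient s (loc c \<Phi>) (loc c u) z))"
      using hamiltonian_at[OF c z _ du, of V] by (simp add: V_def)
  qed
  then have hf: "hamiltonian_field s A \<Phi> (\<lambda>q. vector_derivative (\<lambda>t. fam.\<Phi>t t q) (at 0))"
    unfolding velocity_def[abs_def] .
  have "((\<lambda>t. Vol s A C (fam.\<Phi>t t)) has_real_derivative 0) (at 0)"
    using H var\<Phi> hf unfolding hamiltonian_minimal_def by blast
  then have "((\<lambda>t. (1/2) * Vol s A C (fam.\<Phi>t t)) has_real_derivative (1/2) * 0) (at 0)"
    by (rule DERIV_cmult)
  then have "((\<lambda>t. (1/2) * Vol s A C (fam.\<Phi>t t)) has_real_derivative 0) (at 0)" by simp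
  then show "((\<lambda>t. W' s A C (\<phi>t t)) has_real_derivative 0) (at 0)"
  proof (rule has_field_derivative_transform_within_open[of _ _ _ "{-\<delta><..<\<delta>}"])
    fix t assume "t \<in> {-\<delta><..<\<delta>}"
    then have "\<bar>t\<bar> < \<delta>" by (simp add: abs_less_iff)
    from immersed_surface.Vol_eq_W'[OF fam.imm_at[OF this] compact_borel[OF C]]
    show "(1/2) * Vol s A C (fam.\<Phi>t t) = W' s A C (\<phi>t t)" by simp
  qed (use fam.\<delta>_pos in auto)
qed

text \<open>The straight motion \<open>\<phi> + t \<xi>\<close> is scaled back to the quadric. As
  \<open>\<xi>\<close> is orthogonal to \<open>\<phi>\<close>, the squared length is
  \<open>1 + t^2 * ip s (\<xi> q) (\<xi> q)\<close>, so the scaling has no first-order effect on the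
  velocity. In the hyperbolic case this expression can become negative and the connected component
  can be left, hence the restriction to small \<open>t\<close>, uniform by compactness.\<close>

lemma family_through:
  fixes \<xi> :: "'a \<Rightarrow> real^4"
  assumes sm: "smooth_map A \<xi>" and tang: "\<And>q. ip s (\<phi> q) (\<xi> q) = 0"
    and C: "compact C" and supp: "\<And>q. q \<notin> C \<Longrightarrow> \<xi> q = 0"
  obtains \<phi>t where "variation A (ambient s) \<phi> \<phi>t C" "velocity \<phi>t = \<xi>"
proof -
  define r where "r t q = 1 + t\<^sup>2 * ip s (\<xi> q) (\<xi> q)" for t q
  define \<phi>t where "\<phi>t t q = (1 / sqrt (r t q)) *\<^sub>R (\<phi> q + t *\<^sub>R \<xi> q)" for t q
  have \<phi>0: "\<phi>t 0 = \<phi>" by (simp add: \<phi>t_def r_def fun_eq_iff)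
  have out: "\<phi>t t q = \<phi> q" "r t q = 1" if "q \<notin> C" for t q
    using supp[OF that] by (auto simp: \<phi>t_def r_def ip.zero_left)
  have lift_snd: "smooth_on ({-d<..<d} \<times> chart_img c) (\<lambda>p. loc c g (snd p))"
    if "smooth_map A g" "c \<in> A" for g :: "'a \<Rightarrow> real^4" and c and d :: real
    by (rule smooth_on_compose[of _ "chart_img c" snd])
      (use that open_region[OF that(2)] chart_homeo(2)[OF that(2)] in \<open>auto simp: smooth_map_def intro: smooth_on_linear bounded_linear_snd\<close>)
  have lift_fst: "smooth_on ({-d<..<d} \<times> chart_img c) (fst :: real \<times> (real^2) \<Rightarrow> real)" for c and d :: real
    by (rule smooth_on_linear[OF bounded_linear_fst])
  have smr: "smooth_on ({-d<..<d} \<times> chart_img c) (\<lambda>p. 1 + (fst p)\<^sup>2 * ip s (loc c \<xi> (snd p)) (loc c \<xi> (snd p)))"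
    if c: "c \<in> A" for c and d :: real
    unfolding power2_eq_square
    by (intro smooth_on_add smooth_on_const smooth_on_mult smooth_on_ip lift_fst lift_snd sm c open_region[OF c])
  \<comment> \<open>The minimum lets one application of \<open>persistence\<close> preserve both
    conditions: a positive radicand and, in the hyperbolic case, a positive fourth
    coordinate.\<close>
  define h where "h c p = min (1 + (fst p)\<^sup>2 * ip s (loc c \<xi> (snd p)) (loc c \<xi> (snd p)))
      (if s = Hyperbolic then (loc c \<phi> (snd p) + fst p *\<^sub>R loc c \<xi> (snd p)) $ 4 else 1)" for c p
  have sm4: "smooth_on ({-d<..<d} \<times> chart_img c) (\<lambda>p. loc c \<phi> (snd p) + fst p *\<^sub>R loc c \<xi> (snd p))"
    if c: "c \<in> A" for c and d :: real
    by (intro smooth_on_add smooth_on_scaleR lift_fst lift_snd sm smooth_map_\<phi> c open_region[OF c])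
  have amb: "\<phi> q \<in> ambient s" for q using imm by (auto simp: immersion_def)
  have h_eq: "h c (t, snd c q) = min (r t q) (if s = Hyperbolic then (\<phi> q + t *\<^sub>R \<xi> q) $ 4 else 1)"
    if "c \<in> A" "q \<in> chart_dom c" for c t q
    by (simp add: h_def r_def loc_def chart_inv_of[OF that])
  have "\<exists>\<delta>1>0. \<delta>1 \<le> 1 \<and> (\<forall>t q. \<bar>t\<bar> < \<delta>1 \<longrightarrow> q \<in> C \<longrightarrow> (\<exists>c\<in>A. q \<in> chart_dom c \<and> h c (t, snd c q) > 0))"
  proof (rule persistence[OF C])
    fix c assume c: "c \<in> A"
    have "continuous_on ({-1<..<1} \<times> chart_img c) (\<lambda>p. (loc c \<phi> (snd p) + fst p *\<^sub>R loc c \<xi> (snd p)) $ 4)"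
      by (intro smooth_on_imp_continuous smooth_on_nth open_region[OF c] sm4[OF c])
    then show "continuous_on ({-1<..<1} \<times> chart_img c) (h c)"
      unfolding h_def using smooth_on_imp_continuous[OF smr[OF c]]
      by (cases s) (auto intro!: continuous_on_min)
    fix q assume q: "q \<in> chart_dom c"
    show "h c (0, snd c q) > 0" unfolding h_eq[OF c q] using amb[of q] by (auto simp: r_def ambient_iff)
  qed simp
  then obtain \<delta>1 where \<delta>1: "\<delta>1 > 0"
    and pos1: "\<And>t q. \<bar>t\<bar> < \<delta>1 \<Longrightarrow> q \<in> C \<Longrightarrow> \<exists>c\<in>A. q \<in> chart_dom c \<and> h c (t, snd c q) > 0" by auto
  have pos: "r t q > 0" "s = Hyperbolic \<Longrightarrow> (\<phi> q + t *\<^sub>R \<xi> q) $ 4 > 0" if t: "\<bar>t\<bar> < \<delta>1" for t q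
  proof -
    have "r t q > 0 \<and> (s = Hyperbolic \<longrightarrow> (\<phi> q + t *\<^sub>R \<xi> q) $ 4 > 0)"
    proof (cases "q \<in> C")
      case True
      then obtain c where c: "c \<in> A" "q \<in> chart_dom c" and hp: "h c (t, snd c q) > 0" using pos1[OF t] by blast
      show ?thesis using hp unfolding h_eq[OF c] by (auto split: if_splits)
    next
      case False
      then show ?thesis using out(2)[OF False] supp[OF False] amb[of q] by (auto simp: ambient_iff)
    qed
    then show "r t q > 0" "s = Hyperbolic \<Longrightarrow> (\<phi> q + t *\<^sub>R \<xi> q) $ 4 > 0" by auto
  qed
  have rng: "range (\<phi>t t) \<subseteq> ambient s" if t: "\<bar>t\<bar> < \<delta>1" for t
  proof
    fix x assume "x \<in> range (\<phi>t t)"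
    then obtain q where x: "x = \<phi>t t q" by blast
    have "ip s (\<phi> q + t *\<^sub>R \<xi> q) (\<phi> q + t *\<^sub>R \<xi> q) = r t q"
      using tang[of q] ip_commute[of s "\<xi> q" "\<phi> q"] ambient_ip[OF amb[of q]]
      by (simp add: ip.add_left ip.add_right ip.scaleR_left ip.scaleR_right r_def power2_eq_square)
    then have "ip s x x = (1 / sqrt (r t q)) * ((1 / sqrt (r t q)) * r t q)"
      unfolding x \<phi>t_def ip.scaleR_left ip.scaleR_right by simp
    also have "\<dots> = 1" using pos(1)[OF t, of q] by simp
    finally show "x \<in> ambient s"
      using pos[OF t, of q] unfolding ambient_iff x \<phi>t_def by simp
  qed
  have fam: "smooth_family \<delta>1 \<phi>t"
    unfolding smooth_family_def
  proof (intro conjI \<delta>1 ballI)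
    fix c assume c: "c \<in> A"
    have "smooth_on ({-\<delta>1<..<\<delta>1} \<times> chart_img c) (\<lambda>p. (1 / sqrt (1 + (fst p)\<^sup>2 * ip s (loc c \<xi> (snd p)) (loc c \<xi> (snd p))))
        *\<^sub>R (loc c \<phi> (snd p) + fst p *\<^sub>R loc c \<xi> (snd p)))"
    proof (intro smooth_on_scaleR smooth_on_divide smooth_on_sqrt smooth_on_const smr sm4 c open_region[OF c])
      fix p assume "p \<in> {-\<delta>1<..<\<delta>1} \<times> chart_img c"
      then have "\<bar>fst p\<bar> < \<delta>1" by (auto simp: abs_less_iff)
      from pos(1)[OF this, of "chart_inv c (snd p)"]
      show p: "0 < 1 + (fst p)\<^sup>2 * ip s (loc c \<xi> (snd p)) (loc c \<xi> (snd p))" by (simp add: r_def loc_def)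
      then show "sqrt (1 + (fst p)\<^sup>2 * ip s (loc c \<xi> (snd p)) (loc c \<xi> (snd p))) \<noteq> 0" by simp
    qed
    then show "smooth_on ({-\<delta>1<..<\<delta>1} \<times> chart_img c) (lift c \<phi>t)"
      by (rule smooth_on_cong[OF open_region[OF c], rotated]) (auto simp: \<phi>t_def r_def loc_def)
  qed
  have "\<exists>\<delta>2>0. \<delta>2 \<le> \<delta>1 \<and> (\<forall>t. \<bar>t\<bar> < \<delta>2 \<longrightarrow> (\<forall>c\<in>A. \<forall>z\<in>chart_img c. inj (D (loc c (\<phi>t t)) z)))"
  proof (rule inj_persists[OF fam C, of "gram2 s"])
    show "\<phi>t t q = \<phi>t 0 q" if "q \<notin> C" for t q using out(1)[OF that] by simp
    fix c assume c: "c \<in> A"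
    show "continuous_on ({-\<delta>1<..<\<delta>1} \<times> chart_img c) (\<lambda>p. gram2 s (D (lift c \<phi>t) p (0, axis 1 1)) (D (lift c \<phi>t) p (0, axis 2 1)))"
      unfolding gram2_def power2_eq_square
      by (intro smooth_on_imp_continuous smooth_on_diff smooth_on_mult smooth_on_ip open_region[OF c] family_smooth_D[OF fam c])
    show "gram2 s (D (loc c (\<phi>t 0)) z (axis 1 1)) (D (loc c (\<phi>t 0)) z (axis 2 1)) > 0" if z: "z \<in> chart_img c" for z
      unfolding \<phi>0 by (rule patch.gram2_pos[OF patch[OF c] z])
  next
    show "\<alpha> = 0 \<and> \<beta> = 0" if "gram2 s v w > 0" "\<alpha> *\<^sub>R v + \<beta> *\<^sub>R w = 0" for v w \<alpha> \<beta>
      by (rule gram2_indep[where s = s, OF _ that(2)]) (use that(1) in simp)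
  qed
  then obtain \<delta>2 where \<delta>2: "\<delta>2 > 0" "\<delta>2 \<le> \<delta>1"
    and inj: "\<And>t c z. \<bar>t\<bar> < \<delta>2 \<Longrightarrow> c \<in> A \<Longrightarrow> z \<in> chart_img c \<Longrightarrow> inj (D (loc c (\<phi>t t)) z)" by blast
  have imms: "immersion A (ambient s) (\<phi>t t)" if t': "\<bar>t\<bar> < \<delta>2" for t
  proof -
    have t: "\<bar>t\<bar> < \<delta>1" using t' \<delta>2 by simp
    show ?thesis using rng[OF t] family_slice(1)[OF fam t] inj[OF t'] by (simp add: immersion_def)
  qed
  have "variation A (ambient s) \<phi> \<phi>t C"
    by (rule variationI[OF C \<phi>0 smooth_family_mono[OF fam \<delta>2] imms]) (use out(1) in auto)
  moreover have "velocity \<phi>t = \<xi>"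
  proof
    fix q
    define k where "k = ip s (\<xi> q) (\<xi> q)"
    have "((\<lambda>t. (1 / sqrt (1 + t\<^sup>2 * k)) *\<^sub>R (\<phi> q + t *\<^sub>R \<xi> q)) has_vector_derivative \<xi> q) (at 0)"
      by (auto intro!: derivative_eq_intros simp: has_vector_derivative_def)
    then show "velocity \<phi>t q = \<xi> q"
      unfolding velocity_def \<phi>t_def r_def k_def by (rule vector_derivative_at)
  qed
  ultimately show ?thesis using that by blast
qed

lemma critical_imp_hamiltonian_minimal:
  assumes crit: "critical_W' s A \<phi>" shows "hamiltonian_minimal s A \<Phi>"
  unfolding hamiltonian_minimal_def
proof (intro conjI gauss_imm lagrangian_gauss_map gauss_nondeg allI impI)
  fix \<Psi> C assume var: "variation A (geodesics s) \<Phi> \<Psi> C"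
    and "hamiltonian_field s A \<Phi> (\<lambda>q. vector_derivative (\<lambda>t. \<Psi> t q) (at 0))"
  then have "hamiltonian_field s A \<Phi> (velocity \<Psi>)" unfolding velocity_def[abs_def] by simp
  then obtain u K where smu: "smooth_map A u" and K: "compact K" "\<And>q. q \<notin> K \<Longrightarrow> u q = (0::real)"
    and ham: "\<And>c z. c \<in> A \<Longrightarrow> z \<in> chart_img c \<Longrightarrow> normal_part s (loc c \<Phi>) z (loc c (velocity \<Psi>) z) =
           JJ' s (loc c \<Phi> z) (D (loc c \<Phi>) z (gradient s (loc c \<Phi>) (loc c u) z))"
    unfolding hamiltonian_field_def by blast
  obtain \<delta> where C: "compact C" and \<Psi>0: "\<Psi> 0 = \<Phi>" and fam\<Psi>: "smooth_family \<delta> \<Psi>"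
    and imm\<Psi>: "\<And>t. \<bar>t\<bar> < \<delta> \<Longrightarrow> immersion A (geodesics s) (\<Psi> t)"
    and supp\<Psi>: "\<And>t q. \<bar>t\<bar> < \<delta> \<Longrightarrow> q \<notin> C \<Longrightarrow> \<Psi> t q = \<Psi> 0 q"
    using variationD[OF var] by metis
  have \<delta>: "\<delta> > 0" using fam\<Psi> by (simp add: smooth_family_def)
  \<comment> \<open>Outside \<open>C\<close> the potential is only locally constant, so its support
    \<open>K\<close> need not lie in \<open>C\<close>; the field \<open>\<xi>\<close> below vanishes
    outside the union.\<close>
  define C' where "C' = C \<union> K"
  have C': "compact C'" unfolding C'_def using C K(1) by (rule compact_Un)
  define N where "N = unit_normal s A \<phi>"
  define V where "V = velocity \<Psi>"
  have V0: "V q = 0" if "q \<notin> C" for q unfolding V_def by (rule velocity_zero[OF \<delta>]) (rule supp\<Psi>[OF _ that])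
  have tanV: "tangent s (\<Phi>c c z) (loc c V z)" if c: "c \<in> A" and z: "z \<in> chart_img c" for c z
  proof -
    have p0: "(0, z) \<in> {-\<delta><..<\<delta>} \<times> chart_img c" using \<delta> z by simp
    have "tangent s (lift c \<Psi> (0, z)) (D (lift c \<Psi>) (0, z) (1, 0))"
    proof (rule tangent_deriv[OF open_region[OF c] p0 _ family_diff[OF fam\<Psi> c _ z]])
      show "lift c \<Psi> y \<in> geodesics s" if "y \<in> {-\<delta><..<\<delta>} \<times> chart_img c" for y
        using imm\<Psi>[of "fst y"] that by (cases y) (auto simp: immersion_def loc_def abs_less_iff)
    qed (use \<delta> in simp)
    then show ?thesis unfolding V_def family_velocity(2)[OF fam\<Psi> c z] using \<Psi>0 loc_\<Phi>[OF c z] by simp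
  qed
  have OmV: "Omega s (\<Phi>c c z) (loc c V z) (D (\<Phi>c c) z w) = - D (loc c u) z w" if c: "c \<in> A" and z: "z \<in> chart_img c" for c z w
    using hamiltonian_at[OF c z tanV[OF c z] smooth_map_diff[OF smu c z]] ham[OF c z] by (simp add: V_def)
  \<comment> \<open>For \<open>V = \<phi> \<and>\<and> X + N \<and>\<and> Y\<close> the contraction
    with \<open>N\<close> is \<open>- eps s *\<^sub>R Y\<close>, so
    \<open>\<xi> = - eps s u N - Y\<close>. By \<open>velocity_gauss\<close> a family with this
    velocity has potential \<open>u\<close> and second component \<open>Y\<close>. Writing
    \<open>Y\<close> as a contraction shows smoothness without a choice of components.\<close>
  define \<xi> where "\<xi> q = (- eps s * u q) *\<^sub>R N q + eps s *\<^sub>R contr s (V q) (N q)" for q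
  have smN: "smooth_on (chart_img c) (loc c N)" if c: "c \<in> A" for c
    by (rule smooth_on_cong[OF chart_homeo(2)[OF c] _ patch.smooth_N[OF patch[OF c]]])
      (simp add: N_def loc_unit_normal[OF c])
  have sm\<xi>: "smooth_map A \<xi>"
    unfolding smooth_map_def
  proof
    fix c assume c: "c \<in> A"
    have "smooth_on (chart_img c) (\<lambda>z. (- eps s * loc c u z) *\<^sub>R loc c N z + eps s *\<^sub>R contr s (loc c V z) (loc c N z))"
      using smu family_velocity(3)[OF fam\<Psi>] c unfolding V_def smooth_map_def
      by (intro smooth_on_add smooth_on_scaleR smooth_on_mult smooth_on_const smooth_on_contr smN[OF c] chart_homeo(2)[OF c]) auto
    moreover have "(\<lambda>z. (- eps s * loc c u z) *\<^sub>R loc c N z + eps s *\<^sub>R contr s (loc c V z) (loc c N z)) = loc c \<xi>"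
      by (simp add: fun_eq_iff loc_def \<xi>_def)
    ultimately show "smooth_on (chart_img c) (loc c \<xi>)" by simp
  qed
  have \<xi>_loc: "loc c \<xi> z = (- eps s * loc c u z) *\<^sub>R gnormal s (loc c \<phi>) z - Y"
    if c: "c \<in> A" and z: "z \<in> chart_img c" and XY: "tangent_repr s (\<Phi>c c z) (loc c V z) (loc c \<phi> z) (gnormal s (loc c \<phi>) z) X Y"
    for c z X Y
  proof -
    define F n where "F = loc c \<phi> z" and "n = gnormal s (loc c \<phi>) z"
    have o: "geodesic_frame s F n" "X \<in> orth_plane s F n" "Y \<in> orth_plane s F n" "loc c V z = F \<and>\<and> X + n \<and>\<and> Y"
      using XY by (auto simp: tangent_repr_def F_def n_def)
    have "contr s (loc c V z) n = - eps s *\<^sub>R Y"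
      unfolding o(4) by (simp add: contr.add_left contr_wedge geodesic_frame_ip[OF o(1)] orth_plane_ip[OF o(2)] orth_plane_ip[OF o(3)])
    then have "eps s *\<^sub>R contr s (loc c V z) n = - Y" by simp
    moreover have "loc c \<xi> z = (- eps s * loc c u z) *\<^sub>R n + eps s *\<^sub>R contr s (loc c V z) n"
      using loc_unit_normal[OF c z] by (simp add: \<xi>_def N_def n_def loc_def)
    ultimately show ?thesis by (simp add: n_def)
  qed
  have reprV: "\<exists>X Y. tangent_repr s (\<Phi>c c z) (loc c V z) (loc c \<phi> z) (gnormal s (loc c \<phi>) z) X Y"
    if c: "c \<in> A" and z: "z \<in> chart_img c" for c z
    using tangent_repr_change[OF tanV[OF c z] patch.N_frame[OF patch[OF c] z] refl] by metis
  have tang\<xi>: "ip s (\<phi> q) (\<xi> q) = 0" for q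
  proof -
    obtain c where c: "c \<in> A" "q \<in> chart_dom c" using chart_cover by blast
    define z where "z = snd c q"
    have z: "z \<in> chart_img c" unfolding z_def by (rule chart_in_img[OF c])
    obtain X Y where XY: "tangent_repr s (\<Phi>c c z) (loc c V z) (loc c \<phi> z) (gnormal s (loc c \<phi>) z) X Y"
      using reprV[OF c(1) z] by blast
    then have Y: "Y \<in> orth_plane s (loc c \<phi> z) (gnormal s (loc c \<phi>) z)" by (auto simp: tangent_repr_def)
    have "ip s (loc c \<phi> z) (loc c \<xi> z) = 0"
      unfolding \<xi>_loc[OF c(1) z XY] by (simp add: ip.diff_right ip.minus_right ip.scaleR_right orth_plane_ip[OF Y] patch.N_ip[OF patch[OF c(1)] z])
    then show ?thesis by (simp add: loc_def z_def chart_inv_of[OF c])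
  qed
  have \<xi>0: "\<xi> q = 0" if "q \<notin> C'" for q
    using that V0[of q] K(2)[of q] by (simp add: C'_def \<xi>_def contr.zero_left)
  obtain \<phi>t where var\<phi>: "variation A (ambient s) \<phi> \<phi>t C'" and vel: "velocity \<phi>t = \<xi>"
    using family_through[OF sm\<xi> tang\<xi> C' \<xi>0] by blast
  obtain \<delta>1 where \<phi>0: "\<phi>t 0 = \<phi>" and fam: "smooth_family \<delta>1 \<phi>t"
    and imms: "\<And>t. \<bar>t\<bar> < \<delta>1 \<Longrightarrow> immersion A (ambient s) (\<phi>t t)"
    using variationD[OF var\<phi>] by metis
  interpret fam: immersed_family A s \<delta>1 \<phi>t by unfold_locales (use fam imms in auto)
  \<comment> \<open>The components \<open>Y\<close> agree by the choice of \<open>\<xi>\<close>. The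
    pairings with \<open>d\<Phi>\<close> are both \<open>- du\<close>, which then forces the
    components \<open>X\<close> to agree, since \<open>d\<phi>\<close> spans the plane.\<close>
  have velG: "velocity \<Psi> = velocity fam.\<Phi>t"
  proof
    fix q
    obtain c where c: "c \<in> A" "q \<in> chart_dom c" using chart_cover by blast
    define z where "z = snd c q"
    have z: "z \<in> chart_img c" unfolding z_def by (rule chart_in_img[OF c])
    interpret P: patch s "chart_img c" "loc c \<phi>" by (rule patch[OF c(1)])
    interpret tp: tangent_plane s "loc c \<phi> z" "D (loc c \<phi>) z (axis 1 1)" "D (loc c \<phi>) z (axis 2 1)" by (rule P.tangent_plane[OF z])
    define F n where "F = loc c \<phi> z" and "n = gnormal s (loc c \<phi>) z"
    define V' where "V' = loc c (velocity fam.\<Phi>t) z"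
    obtain X Y where XY: "tangent_repr s (\<Phi>c c z) (loc c V z) F n X Y"
      using reprV[OF c(1) z] unfolding F_def n_def by blast
    obtain X' where X': "tangent_repr s (\<Phi>c c z) V' F n X' (- (loc c \<xi> z - (eps s * ip s (loc c \<xi> z) n) *\<^sub>R n)) \<and>
      (\<forall>w. Omega s (\<Phi>c c z) V' (D (\<Phi>c c) z w) = - D (\<lambda>z. - ip s (loc c \<xi> z) (gnormal s (loc c \<phi>) z)) z w)"
      using fam.velocity_gauss[OF c(1) z] unfolding \<phi>0 vel V'_def F_def n_def ..
    note XY' = X'[THEN conjunct1] and O = X'[THEN conjunct2, rule_format]
    have ux: "- ip s (loc c \<xi> y) (gnormal s (loc c \<phi>) y) = loc c u y" if y: "y \<in> chart_img c" for y
    proof -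
      obtain X Y where XY: "tangent_repr s (\<Phi>c c y) (loc c V y) (loc c \<phi> y) (gnormal s (loc c \<phi>) y) X Y"
        using reprV[OF c(1) y] by blast
      then have Y: "Y \<in> orth_plane s (loc c \<phi> y) (gnormal s (loc c \<phi>) y)" by (auto simp: tangent_repr_def)
      show ?thesis unfolding \<xi>_loc[OF c(1) y XY]
        by (simp add: ip.diff_left ip.minus_left ip.scaleR_left orth_plane_ip[OF Y] P.N_ip[OF y])
    qed
    have "D (\<lambda>z. - ip s (loc c \<xi> z) (gnormal s (loc c \<phi>) z)) z = D (loc c u) z"
      by (rule D_cong(1)[OF smooth_map_diff[OF smu c(1) z] P.open_U z]) (rule ux[symmetric])
    then have Oeq: "Omega s (\<Phi>c c z) V' (D (\<Phi>c c) z w) = Omega s (\<Phi>c c z) (loc c V z) (D (\<Phi>c c) z w)" for w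
      using O OmV[OF c(1) z] by simp
    have Y': "- (loc c \<xi> z - (eps s * ip s (loc c \<xi> z) n) *\<^sub>R n) = Y"
    proof -
      have "ip s (loc c \<xi> z) n = - loc c u z" using ux[OF z] by (simp add: n_def)
      then show ?thesis using \<xi>_loc[OF c(1) z XY[unfolded F_def n_def]] by (simp add: n_def)
    qed
    have r: "tangent_repr s (\<Phi>c c z) (D (\<Phi>c c) z w) F n (D (gnormal s (loc c \<phi>)) z w) (- D (loc c \<phi>) z w)" for w
      unfolding F_def n_def by (rule P.repr_\<Phi>[OF z])
    have ipX: "ip s X' (D (loc c \<phi>) z w) = ip s X (D (loc c \<phi>) z w)" for w
      using Oeq[of w] unfolding Omega_repr[OF XY' r] Omega_repr[OF XY r] Y' by (simp add: ip.minus_right)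
    have n': "n = tp.n" by (simp add: n_def gnormal_def)
    have "X' \<in> orth_plane s F n" "X \<in> orth_plane s F n" using XY XY' by (auto simp: tangent_repr_def)
    then have "X' = X" using ipX unfolding n' F_def by (intro tp.tangential_eqI) auto
    then have "V' = loc c V z" using XY XY' unfolding Y' by (simp add: tangent_repr_def)
    then show "velocity \<Psi> q = velocity fam.\<Phi>t q" by (simp add: V'_def V_def loc_def z_def chart_inv_of[OF c])
  qed
  define d where "d = min \<delta> \<delta>1"
  have d: "d > 0" "d \<le> \<delta>" "d \<le> \<delta>1" using \<delta> fam.\<delta>_pos by (auto simp: d_def)
  have rng\<Psi>: "range (\<Psi> t) \<subseteq> geodesics s" if "\<bar>t\<bar> < d" for t using imm\<Psi>[of t] that d by (simp add: immersion_def)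
  have rngG: "range (fam.\<Phi>t t) \<subseteq> geodesics s" if "\<bar>t\<bar> < d" for t
    using immersed_surface.gauss_map_range[OF fam.imm_at] that d by simp
  have init: "\<Psi> 0 = fam.\<Phi>t 0" using \<Psi>0 \<phi>0 by simp
  have "\<exists>\<delta>'>0. \<exists>K. \<forall>t q. \<bar>t\<bar> < \<delta>' \<longrightarrow> q \<in> C' \<longrightarrow> (\<exists>c\<in>A. q \<in> chart_dom c \<and>
    \<bar>vol_density s (\<Psi> t) c (snd c q) - vol_density s (fam.\<Phi>t t) c (snd c q)\<bar> \<le> K * t\<^sup>2 * vol_density s (\<Psi> 0) c (snd c q))"
    by (rule family_difference[OF smooth_family_mono[OF fam\<Psi> d(1,2)] rng\<Psi> smooth_family_mono[OF fam.gauss_family d(1,3)] rngG init velG _ C'])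
      (use vol_density_pos \<Psi>0 in auto)
  then obtain d2 L where d2: "d2 > 0" and L: "\<And>t q. \<bar>t\<bar> < d2 \<Longrightarrow> q \<in> C' \<Longrightarrow> \<exists>c\<in>A. q \<in> chart_dom c \<and>
    \<bar>vol_density s (\<Psi> t) c (snd c q) - vol_density s (fam.\<Phi>t t) c (snd c q)\<bar> \<le> (L * t\<^sup>2) * vol_density s \<Phi> c (snd c q)"
    unfolding \<Psi>0 by blast
  have dens\<Phi>: "is_density (vol_density s \<Phi>)" by (rule is_density_vol[OF smooth_gauss_map gauss_map_range])
  have dens\<Psi>: "is_density (vol_density s (\<Psi> t))" if "\<bar>t\<bar> < d" for t
    by (rule is_density_vol[OF family_slice(1)[OF fam\<Psi>] rng\<Psi>[OF that]]) (use that d in simp)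
  have densG: "is_density (vol_density s (fam.\<Phi>t t))" if "\<bar>t\<bar> < d" for t
    by (rule is_density_vol[OF family_slice(1)[OF fam.gauss_family] rngG[OF that]]) (use that d in simp)
  \<comment> \<open>Only the difference of the volumes is estimated. Differentiability of the volume
    of \<open>\<Psi>\<close> is not presupposed: it is inherited from that of \<open>W'\<close>,
    which is part of criticality.\<close>
  define e where "e t = Vol s A C' (\<Psi> t) - Vol s A C' (fam.\<Phi>t t)" for t
  have "(e has_real_derivative 0) (at 0)"
  proof (rule quadratic_bound_derivative[of "min d d2"])
    fix t assume t: "\<bar>t\<bar> < min d d2"
    have "\<bar>e t\<bar> \<le> (L * t\<^sup>2) * measure (density_measure A (vol_density s \<Phi>)) C'"
      unfolding e_def Vol_vol_density
      by (rule measure_density_diff[OF dens\<Phi> vol_density_pos dens\<Psi> densG C']) (use t L in auto)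
    then show "\<bar>e t\<bar> \<le> (L * measure (density_measure A (vol_density s \<Phi>)) C') * t\<^sup>2" by (simp add: mult_ac)
  qed (use d d2 in simp)
  moreover have "((\<lambda>t. 2 * W' s A C' (\<phi>t t)) has_real_derivative 2 * 0) (at 0)"
    using crit var\<phi> unfolding critical_W'_def by (intro DERIV_cmult) blast
  ultimately have "((\<lambda>t. e t + 2 * W' s A C' (\<phi>t t)) has_real_derivative 0 + 2 * 0) (at 0)"
    by (rule DERIV_add)
  then have "((\<lambda>t. e t + 2 * W' s A C' (\<phi>t t) - Vol s A (C' - C) \<Phi>) has_real_derivative 0 + 2 * 0 - 0) (at 0)"
    by (intro DERIV_diff DERIV_const)
  then have "((\<lambda>t. e t + 2 * W' s A C' (\<phi>t t) - Vol s A (C' - C) \<Phi>) has_real_derivative 0) (at 0)" by simp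
  then show "((\<lambda>t. Vol s A C (\<Psi> t)) has_real_derivative 0) (at 0)"
  proof (rule has_field_derivative_transform_within_open[of _ _ _ "{-d<..<d}"])
    fix t assume "t \<in> {-d<..<d}"
    then have t: "\<bar>t\<bar> < d" by (simp add: abs_less_iff)
    have bC: "C \<in> sets borel" "C' \<in> sets borel" using compact_borel C C' by auto
    have oC: "open (- C)" using compact_imp_closed[OF C] by auto
    have "Vol s A C' (fam.\<Phi>t t) = 2 * W' s A C' (\<phi>t t)"
      by (rule immersed_surface.Vol_eq_W'[OF fam.imm_at bC(2)]) (use t d in simp)
    \<comment> \<open>On the open complement of \<open>C\<close> the family \<open>\<Psi>\<close> is
      stationary together with its differentials, so enlarging \<open>C\<close> to \<open>C'\<close>
      adds a constant to the volume.\<close>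
    moreover have "Vol s A (C' - C) (\<Psi> t) = Vol s A (C' - C) \<Phi>"
      unfolding Vol_vol_density
    proof (rule measure_density_cong[OF dens\<Phi> vol_density_pos dens\<Psi>[OF t] dens\<Phi>])
      show "C' - C \<in> sets borel" using bC by auto
      fix q assume "q \<in> C' - C"
      then have q: "q \<notin> C" by simp
      obtain c where c: "c \<in> A" "q \<in> chart_dom c" using chart_cover by blast
      have "D (loc c (\<Psi> t)) (snd c q) = D (loc c \<Phi>) (snd c q)"
        by (rule D_loc_local[OF oC _ _ c smooth_gauss_map]) (use q supp\<Psi>[of t] t d \<Psi>0 in auto)
      then have "vol_density s (\<Psi> t) c (snd c q) = vol_density s \<Phi> c (snd c q)"
        using vol_density_plk[OF family_slice(1)[OF fam\<Psi>] rng\<Psi>[OF t] c(1) chart_in_img[OF c]] t d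
          vol_density_plk[OF smooth_gauss_map gauss_map_range c(1) chart_in_img[OF c]] by simp
      then show "\<exists>c\<in>A. q \<in> chart_dom c \<and> vol_density s (\<Psi> t) c (snd c q) = vol_density s \<Phi> c (snd c q)"
        using c by blast
    qed
    moreover have "Vol s A (C' - C) (\<Psi> t) = Vol s A C' (\<Psi> t) - Vol s A C (\<Psi> t)"
      unfolding Vol_vol_density
      by (rule measure_Diff)
        (use density_measure_compact_finite[OF dens\<Psi>[OF t] C'] bC sets_density_measure[OF dens\<Psi>[OF t]] in \<open>auto simp: C'_def\<close>)
    ultimately show "e t + 2 * W' s A C' (\<phi>t t) - Vol s A (C' - C) \<Phi> = Vol s A C (\<Psi> t)" by (simp add: e_def)
  qed (use d in auto)
qed

end

theorem corollary3p5:
  fixes s :: geometry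
    and A :: "'a::{t2_space,second_countable_topology} chart set"
    and \<phi> :: "'a \<Rightarrow> real^4"
  assumes "oriented_surface A"
    and "immersion A (ambient s) \<phi>"
    and "immersion A (geodesics s) (gauss_map s A \<phi>)"
    and "nondegenerate s A (gauss_map s A \<phi>)"
  shows "hamiltonian_minimal s A (gauss_map s A \<phi>) \<longleftrightarrow> critical_W' s A \<phi>"
proof -
  interpret nondegenerate_gauss_map A s \<phi> by unfold_locales (use assms in auto)
  show ?thesis
    using hamiltonian_minimal_imp_critical critical_imp_hamiltonian_minimal by blast
qed

end
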